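(* Let $k$ be an algebraically closed field, and let $(A,R)$ be a triangular semisimple and cosemisimple Hopf algebra over $k$ with Drinfeld element $1$, written as $(A,R)=(k[G]^J,J_{21}^{-1}J)$, where $G$ is a finite group whose order is not divisible by the characteristic of $k$, $H\subseteq G$ is a subgroup and $J\in k[H]\otimes k[H]$ is a minimal twist for $k[H]$. Let $Z$ be a double coset of $H$ in $G$, let $g\in Z$, and let $K_g:=H\cap gHg^{-1}$. Let $(A^* )_Z:=\bigoplus_{z\in Z}k\delta_z$, a subalgebra (direct factor) of $A^*$, and let $W:=W_1\otimes W_2$ be the projective representation of $K_g$ defined in the context. Let $(\hat K_g,\tilde\pi_W)$ be any linearization of the projective representation $W$ of $K_g$, let $\zeta$ be the kernel of the projection $\hat K_g\to K_g$, and let $\chi:\zeta\to k^*$ be the character by which $\zeta$ acts in $W$. Then there exists a one-to-one correspondence between: (1) isomorphism classes of irreducible representations of the algebra $(A^* )_Z$, and (2) isomorphism classes of irreducible representations of $\hat K_g$ with $\zeta$ acting by $\chi$. Moreover, if a representation $Y$ of $(A^* )_Z$ corresponds to a representation $X$ of $\hat K_g$, then $$\dim(Y)=\frac{|H|}{|K_g|}\dim(X).$$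
   Context: Triangular: $R\in A\otimes A$ is invertible with $(\Delta\otimes \mathrm{Id})(R)=R_{13}R_{23}$, $(\mathrm{Id}\otimes\Delta)(R)=R_{13}R_{12}$, $\Delta^{cop}(a)R=R\Delta(a)$, $R^{-1}=R_{21}$. The Drinfeld element of $(A,R)$ with $R=\sum_i a_i\otimes b_i$ is $u=\sum_i S(b_i)a_i$. A twist for a Hopf algebra $B$ is an invertible $J\in B\otimes B$ with $(\Delta\otimes \mathrm{Id})(J)(J\otimes 1)=(\mathrm{Id}\otimes\Delta)(J)(1\otimes J)$ and $(\varepsilon\otimes \mathrm{Id})(J)=(\mathrm{Id}\otimes\varepsilon)(J)=1$; $B^J$ is $B$ as an algebra with coproduct $\Delta^J(a)=J^{-1}\Delta(a)J$. A twist $J$ for $k[H]$ is minimal if the left and right components (tensorands) of $J_{21}^{-1}J$ span $k[H]$. Every triangular semisimple and cosemisimple Hopf algebra over $k$ with Drinfeld element $1$ has the form $(k[G]^J,J_{21}^{-1}J)$ with $G,H,J$ as in the claim. $A^*$ has the basis $\{\delta_x\mid x\in G\}$ dual to the basis $G$ of $A=k[G]$ (as a vector space), and for each double coset $Z$ of $H$ in $G$ the subspace $(A^* )_Z$ is a subalgebra, with $A^*=\bigoplus_Z (A^* )_Z$ as algebras. The projective representations $V_1,V_2$ of $H$: let $A_1$ be the coalgebra $k[H]$ with coproduct $a\mapsto\Delta(a)J$ and counit $\varepsilon$, and $A_2$ the coalgebra $k[H]$ with coproduct $a\mapsto J^{-1}\Delta(a)$ and counit $\varepsilon$. In terms of the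 dual basis $\{\delta_y\mid y\in H\}$, $H$ acts by algebra automorphisms on $(A_1)^*$ via $\rho_1(h)\delta_y=\delta_{hy}$ and on $(A_2)^*$ via $\rho_2(h)\delta_y=\delta_{yh^{-1}}$. The algebras $(A_1)^*,(A_2)^*$ are simple, isomorphic to the matrix algebra $M_{|H|^{1/2}}(k)$. Let $V_i$ be the simple module over $(A_i)^*$; the action $\rho_i$ of $H$ by automorphisms of $(A_i)^*\cong \mathrm{End}_k(V_i)$ defines a homomorphism $H\to \mathrm{PGL}(V_i)$, which makes $V_i$ a projective representation of $H$. Define $\theta_1,\theta_2:K_g\to H$ by $\theta_1(a)=g^{-1}ag$, $\theta_2(a)=a$, and let $W_i$ be the pullback of the projective representation $V_i$ to $K_g$ along $\theta_i$, $i=1,2$. A linearization of a projective representation $W$ of a group $K$ is a central extension $\hat K$ of $K$ by a central subgroup $\zeta$ together with a linear representation $\tilde\pi_W:\hat K\to \mathrm{GL}(W)$ which descends to the given homomorphism $K\to \mathrm{PGL}(W)$. *)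

theory Defs
  imports "HOL-Algebra.Coset" "Jordan_Normal_Form.VS_Connect"
begin

section \<open>Finite-dimensional algebras and coalgebras with a basis\<close>

text \<open>
  The vector space \<open>k\<^sup>B\<close> with basis \<open>B\<close> consists of the functions to \<open>k\<close> that vanish
  outside \<open>B\<close>; the basis vector of \<open>b\<close> is \<open>kd b\<close>. The tensor product of \<open>k\<^sup>B\<close> and \<open>k\<^sup>C\<close> is
  \<open>k\<^sup>B\<^sup>\<times>\<^sup>C\<close>, and \<open>B\<close> also labels the dual basis of the dual space. Multiplication and
  comultiplication are given by structure constants: \<open>mcoeff A b c\<close> is the product of the basis
  vectors of \<open>b\<close> and \<open>c\<close>, and \<open>ccoeff A b\<close> is the coproduct of the basis vector of \<open>b\<close>.
\<close>

record ('b, 'k) algd =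
  bas :: "'b set"
  mcoeff :: "'b \<Rightarrow> 'b \<Rightarrow> 'b \<Rightarrow> 'k"
  unity :: "'b \<Rightarrow> 'k"

record ('b, 'k) bialgd = "('b, 'k) algd" +
  ccoeff :: "'b \<Rightarrow> 'b \<times> 'b \<Rightarrow> 'k"
  cou :: "'b \<Rightarrow> 'k"

definition kd :: "'b \<Rightarrow> 'b \<Rightarrow> 'k::field" where
  "kd b = (\<lambda>x. if x = b then 1 else 0)"

definition elts :: "('b, 'k::field, 'z) algd_scheme \<Rightarrow> ('b \<Rightarrow> 'k) set" where
  "elts A = {f. \<forall>x. x \<notin> bas A \<longrightarrow> f x = 0}"

definition amul :: "('b, 'k::field, 'z) algd_scheme \<Rightarrow> ('b \<Rightarrow> 'k) \<Rightarrow> ('b \<Rightarrow> 'k) \<Rightarrow> 'b \<Rightarrow> 'k" where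
  "amul A f h = (\<lambda>x. \<Sum>b\<in>bas A. \<Sum>c\<in>bas A. f b * h c * mcoeff A b c x)"

definition is_ainv :: "('b, 'k::field, 'z) algd_scheme \<Rightarrow> ('b \<Rightarrow> 'k) \<Rightarrow> ('b \<Rightarrow> 'k) \<Rightarrow> bool" where
  "is_ainv A f h \<longleftrightarrow> f \<in> elts A \<and> h \<in> elts A \<and> amul A f h = unity A \<and> amul A h f = unity A"

definition ainv :: "('b, 'k::field, 'z) algd_scheme \<Rightarrow> ('b \<Rightarrow> 'k) \<Rightarrow> 'b \<Rightarrow> 'k" where
  "ainv A f = (THE h. is_ainv A f h)"

definition fd_algebra :: "('b, 'k::field, 'z) algd_scheme \<Rightarrow> bool" where
  "fd_algebra A \<longleftrightarrow>
     finite (bas A) \<and> unity A \<in> elts A \<and>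
     (\<forall>b\<in>bas A. \<forall>c\<in>bas A. mcoeff A b c \<in> elts A) \<and>
     (\<forall>f\<in>elts A. \<forall>h\<in>elts A. \<forall>l\<in>elts A. amul A (amul A f h) l = amul A f (amul A h l)) \<and>
     (\<forall>f\<in>elts A. amul A (unity A) f = f \<and> amul A f (unity A) = f)"

definition tens_alg ::
  "('b, 'k::field, 'y) algd_scheme \<Rightarrow> ('c, 'k, 'z) algd_scheme \<Rightarrow> ('b \<times> 'c, 'k) algd" where
  "tens_alg A B =
     \<lparr>bas = bas A \<times> bas B,
      mcoeff = (\<lambda>(b, b') (c, c') (x, x'). mcoeff A b c x * mcoeff B b' c' x'),
      unity = (\<lambda>(x, x'). unity A x * unity B x')\<rparr>"

abbreviation sq_alg :: "('b, 'k::field, 'z) algd_scheme \<Rightarrow> ('b \<times> 'b, 'k) algd" where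
  "sq_alg A \<equiv> tens_alg A A"

abbreviation cube_alg :: "('b, 'k::field, 'z) algd_scheme \<Rightarrow> ('b \<times> 'b \<times> 'b, 'k) algd" where
  "cube_alg A \<equiv> tens_alg A (tens_alg A A)"

definition flip :: "('b \<times> 'b \<Rightarrow> 'k) \<Rightarrow> 'b \<times> 'b \<Rightarrow> 'k" where
  "flip t = (\<lambda>(x, y). t (y, x))"

definition leg12 :: "('b, 'k::field, 'z) algd_scheme \<Rightarrow> ('b \<times> 'b \<Rightarrow> 'k) \<Rightarrow> 'b \<times> 'b \<times> 'b \<Rightarrow> 'k" where
  "leg12 A t = (\<lambda>(x, y, z). t (x, y) * unity A z)"

definition leg13 :: "('b, 'k::field, 'z) algd_scheme \<Rightarrow> ('b \<times> 'b \<Rightarrow> 'k) \<Rightarrow> 'b \<times> 'b \<times> 'b \<Rightarrow> 'k" where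
  "leg13 A t = (\<lambda>(x, y, z). t (x, z) * unity A y)"

definition leg23 :: "('b, 'k::field, 'z) algd_scheme \<Rightarrow> ('b \<times> 'b \<Rightarrow> 'k) \<Rightarrow> 'b \<times> 'b \<times> 'b \<Rightarrow> 'k" where
  "leg23 A t = (\<lambda>(x, y, z). unity A x * t (y, z))"

definition comul :: "('b, 'k::field, 'z) bialgd_scheme \<Rightarrow> ('b \<Rightarrow> 'k) \<Rightarrow> 'b \<times> 'b \<Rightarrow> 'k" where
  "comul A f = (\<lambda>p. \<Sum>b\<in>bas A. f b * ccoeff A b p)"

definition counit :: "('b, 'k::field, 'z) bialgd_scheme \<Rightarrow> ('b \<Rightarrow> 'k) \<Rightarrow> 'k" where
  "counit A f = (\<Sum>b\<in>bas A. f b * cou A b)"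

text \<open>\<open>\<Delta> \<otimes> Id\<close>, \<open>Id \<otimes> \<Delta>\<close>, \<open>\<epsilon> \<otimes> Id\<close> and \<open>Id \<otimes> \<epsilon>\<close> on \<open>A \<otimes> A\<close>.\<close>

definition comul_l :: "('b, 'k::field, 'z) bialgd_scheme \<Rightarrow> ('b \<times> 'b \<Rightarrow> 'k) \<Rightarrow> 'b \<times> 'b \<times> 'b \<Rightarrow> 'k" where
  "comul_l A t = (\<lambda>(x, y, z). \<Sum>b\<in>bas A. t (b, z) * ccoeff A b (x, y))"

definition comul_r :: "('b, 'k::field, 'z) bialgd_scheme \<Rightarrow> ('b \<times> 'b \<Rightarrow> 'k) \<Rightarrow> 'b \<times> 'b \<times> 'b \<Rightarrow> 'k" where
  "comul_r A t = (\<lambda>(x, y, z). \<Sum>b\<in>bas A. t (x, b) * ccoeff A b (y, z))"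

definition counit_l :: "('b, 'k::field, 'z) bialgd_scheme \<Rightarrow> ('b \<times> 'b \<Rightarrow> 'k) \<Rightarrow> 'b \<Rightarrow> 'k" where
  "counit_l A t = (\<lambda>y. \<Sum>b\<in>bas A. cou A b * t (b, y))"

definition counit_r :: "('b, 'k::field, 'z) bialgd_scheme \<Rightarrow> ('b \<times> 'b \<Rightarrow> 'k) \<Rightarrow> 'b \<Rightarrow> 'k" where
  "counit_r A t = (\<lambda>x. \<Sum>b\<in>bas A. t (x, b) * cou A b)"

text \<open>The algebra structure on \<open>A\<^sup>*\<close>, where \<open>A\<close> is regarded as a coalgebra.\<close>

definition dual_alg :: "('b, 'k::field, 'z) bialgd_scheme \<Rightarrow> ('b, 'k) algd" where
  "dual_alg A =
     \<lparr>bas = bas A,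
      mcoeff = (\<lambda>b c x. if x \<in> bas A then ccoeff A x (b, c) else 0),
      unity = (\<lambda>x. if x \<in> bas A then cou A x else 0)\<rparr>"

section \<open>Triangular Hopf algebras\<close>

definition fd_coalgebra :: "('b, 'k::field, 'z) bialgd_scheme \<Rightarrow> bool" where
  "fd_coalgebra A \<longleftrightarrow>
     finite (bas A) \<and>
     (\<forall>b\<in>bas A. ccoeff A b \<in> elts (sq_alg A)) \<and>
     (\<forall>f\<in>elts A. comul_l A (comul A f) = comul_r A (comul A f) \<and>
        counit_l A (comul A f) = f \<and> counit_r A (comul A f) = f)"

definition fd_bialgebra :: "('b, 'k::field, 'z) bialgd_scheme \<Rightarrow> bool" where
  "fd_bialgebra A \<longleftrightarrow>
     fd_algebra A \<and> fd_coalgebra A \<and>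
     (\<forall>f\<in>elts A. \<forall>h\<in>elts A. comul A (amul A f h) = amul (sq_alg A) (comul A f) (comul A h) \<and>
        counit A (amul A f h) = counit A f * counit A h) \<and>
     comul A (unity A) = unity (sq_alg A) \<and> counit A (unity A) = 1"

text \<open>\<open>S b\<close> is the value of the antipode at the basis vector of \<open>b\<close>; the values outside the basis
  are fixed so that the antipode is unique.\<close>

definition is_antipode :: "('b, 'k::field, 'z) bialgd_scheme \<Rightarrow> ('b \<Rightarrow> 'b \<Rightarrow> 'k) \<Rightarrow> bool" where
  "is_antipode A S \<longleftrightarrow>
     (\<forall>b. S b \<in> elts A) \<and> (\<forall>b. b \<notin> bas A \<longrightarrow> S b = (\<lambda>x. 0)) \<and>
     (\<forall>b\<in>bas A.
        (\<lambda>x. \<Sum>c\<in>bas A. \<Sum>d\<in>bas A. ccoeff A b (c, d) * amul A (S c) (kd d) x)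
          = (\<lambda>x. cou A b * unity A x) \<and>
        (\<lambda>x. \<Sum>c\<in>bas A. \<Sum>d\<in>bas A. ccoeff A b (c, d) * amul A (kd c) (S d) x)
          = (\<lambda>x. cou A b * unity A x))"

definition hopf_algebra :: "('b, 'k::field, 'z) bialgd_scheme \<Rightarrow> bool" where
  "hopf_algebra A \<longleftrightarrow> fd_bialgebra A \<and> (\<exists>S. is_antipode A S)"

definition antipode :: "('b, 'k::field, 'z) bialgd_scheme \<Rightarrow> 'b \<Rightarrow> 'b \<Rightarrow> 'k" where
  "antipode A = (THE S. is_antipode A S)"

definition triangular :: "('b, 'k::field, 'z) bialgd_scheme \<Rightarrow> ('b \<times> 'b \<Rightarrow> 'k) \<Rightarrow> bool" where
  "triangular A R \<longleftrightarrow>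
     is_ainv (sq_alg A) R (flip R) \<and>
     comul_l A R = amul (cube_alg A) (leg13 A R) (leg23 A R) \<and>
     comul_r A R = amul (cube_alg A) (leg13 A R) (leg12 A R) \<and>
     (\<forall>f\<in>elts A. amul (sq_alg A) (flip (comul A f)) R = amul (sq_alg A) R (comul A f))"

definition drinfeld_element ::
  "('b, 'k::field, 'z) bialgd_scheme \<Rightarrow> ('b \<times> 'b \<Rightarrow> 'k) \<Rightarrow> 'b \<Rightarrow> 'k" where
  "drinfeld_element A R =
     (\<lambda>x. \<Sum>b\<in>bas A. \<Sum>c\<in>bas A. R (b, c) * amul A (antipode A c) (kd b) x)"

text \<open>An algebra is semisimple iff each left ideal has a complementary left ideal.\<close>

definition left_ideal :: "('b, 'k::field, 'z) algd_scheme \<Rightarrow> ('b \<Rightarrow> 'k) set \<Rightarrow> bool" where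
  "left_ideal A I \<longleftrightarrow>
     I \<subseteq> elts A \<and> (\<lambda>x. 0) \<in> I \<and>
     (\<forall>f\<in>I. \<forall>h\<in>I. (\<lambda>x. f x + h x) \<in> I) \<and>
     (\<forall>c. \<forall>f\<in>I. (\<lambda>x. c * f x) \<in> I) \<and>
     (\<forall>a\<in>elts A. \<forall>f\<in>I. amul A a f \<in> I)"

definition semisimple_alg :: "('b, 'k::field, 'z) algd_scheme \<Rightarrow> bool" where
  "semisimple_alg A \<longleftrightarrow>
     (\<forall>I. left_ideal A I \<longrightarrow>
        (\<exists>I'. left_ideal A I' \<and> I \<inter> I' = {\<lambda>x. 0} \<and>
           {\<lambda>x. f x + h x | f h. f \<in> I \<and> h \<in> I'} = elts A))"

definition cosemisimple :: "('b, 'k::field, 'z) bialgd_scheme \<Rightarrow> bool" where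
  "cosemisimple A \<longleftrightarrow> semisimple_alg (dual_alg A)"

section \<open>Group algebras and twists\<close>

definition grp_alg :: "('g, 'm) monoid_scheme \<Rightarrow> ('g, 'k::field) bialgd" where
  "grp_alg G =
     \<lparr>bas = carrier G,
      mcoeff = (\<lambda>x y. kd (x \<otimes>\<^bsub>G\<^esub> y)),
      unity = kd \<one>\<^bsub>G\<^esub>,
      ccoeff = (\<lambda>x. kd (x, x)),
      cou = (\<lambda>x. 1)\<rparr>"

definition is_twist :: "('b, 'k::field, 'z) bialgd_scheme \<Rightarrow> ('b \<times> 'b \<Rightarrow> 'k) \<Rightarrow> bool" where
  "is_twist B J \<longleftrightarrow>
     (\<exists>J'. is_ainv (sq_alg B) J J') \<and>
     amul (cube_alg B) (comul_l B J) (leg12 B J) = amul (cube_alg B) (comul_r B J) (leg23 B J) \<and>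
     counit_l B J = unity B \<and> counit_r B J = unity B"

definition twisted :: "('b, 'k::field) bialgd \<Rightarrow> ('b \<times> 'b \<Rightarrow> 'k) \<Rightarrow> ('b, 'k) bialgd" where
  "twisted B J =
     B\<lparr>ccoeff := (\<lambda>b. amul (sq_alg B) (amul (sq_alg B) (ainv (sq_alg B) J) (ccoeff B b)) J)\<rparr>"

definition twist_R :: "('b, 'k::field, 'z) bialgd_scheme \<Rightarrow> ('b \<times> 'b \<Rightarrow> 'k) \<Rightarrow> 'b \<times> 'b \<Rightarrow> 'k" where
  "twist_R B J = amul (sq_alg B) (ainv (sq_alg B) (flip J)) J"

text \<open>The span of the left tensorands of \<open>t\<close> is the set of all \<open>(Id \<otimes> \<phi>)(t)\<close> with \<open>\<phi>\<close> a linear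
  form, which is given by its values on the basis; similarly on the right.\<close>

definition left_tensorands :: "('b, 'k::field, 'z) algd_scheme \<Rightarrow> ('b \<times> 'b \<Rightarrow> 'k) \<Rightarrow> ('b \<Rightarrow> 'k) set" where
  "left_tensorands B t = {\<lambda>x. \<Sum>y\<in>bas B. t (x, y) * \<phi> y | \<phi>. True}"

definition right_tensorands :: "('b, 'k::field, 'z) algd_scheme \<Rightarrow> ('b \<times> 'b \<Rightarrow> 'k) \<Rightarrow> ('b \<Rightarrow> 'k) set" where
  "right_tensorands B t = {\<lambda>y. \<Sum>x\<in>bas B. \<phi> x * t (x, y) | \<phi>. True}"

definition minimal_twist :: "('b, 'k::field, 'z) bialgd_scheme \<Rightarrow> ('b \<times> 'b \<Rightarrow> 'k) \<Rightarrow> bool" where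
  "minimal_twist B J \<longleftrightarrow>
     is_twist B J \<and>
     left_tensorands B (twist_R B J) = elts B \<and> right_tensorands B (twist_R B J) = elts B"

text \<open>The coalgebras \<open>A\<^sub>1\<close> and \<open>A\<^sub>2\<close> for \<open>B = k[H]\<close>. Only the coalgebra part of the result is meaningful.\<close>

definition coalg1 :: "('b, 'k::field) bialgd \<Rightarrow> ('b \<times> 'b \<Rightarrow> 'k) \<Rightarrow> ('b, 'k) bialgd" where
  "coalg1 B J = B\<lparr>ccoeff := (\<lambda>b. amul (sq_alg B) (ccoeff B b) J)\<rparr>"

definition coalg2 :: "('b, 'k::field) bialgd \<Rightarrow> ('b \<times> 'b \<Rightarrow> 'k) \<Rightarrow> ('b, 'k) bialgd" where
  "coalg2 B J = B\<lparr>ccoeff := (\<lambda>b. amul (sq_alg B) (ainv (sq_alg B) J) (ccoeff B b))\<rparr>"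

text \<open>The direct factor spanned by the basis vectors in \<open>Z\<close>; its unit is the corresponding
  component of the unit.\<close>

definition factor_alg :: "('b, 'k::field) algd \<Rightarrow> 'b set \<Rightarrow> ('b, 'k) algd" where
  "factor_alg D Z = D\<lparr>bas := Z, unity := (\<lambda>x. if x \<in> Z then unity D x else 0)\<rparr>"

text \<open>The linear maps with \<open>\<delta>\<^sub>y \<mapsto> \<delta>\<^sub>h\<^sub>y\<close> and \<open>\<delta>\<^sub>y \<mapsto> \<delta>\<^bsub>yh\<inverse>\<^esub>\<close>.\<close>

definition rho1 :: "('g, 'm) monoid_scheme \<Rightarrow> 'g \<Rightarrow> ('g \<Rightarrow> 'k::field) \<Rightarrow> 'g \<Rightarrow> 'k" where
  "rho1 H h f = (\<lambda>x. \<Sum>y\<in>carrier H. f y * kd (h \<otimes>\<^bsub>H\<^esub> y) x)"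

definition rho2 :: "('g, 'm) monoid_scheme \<Rightarrow> 'g \<Rightarrow> ('g \<Rightarrow> 'k::field) \<Rightarrow> 'g \<Rightarrow> 'k" where
  "rho2 H h f = (\<lambda>x. \<Sum>y\<in>carrier H. f y * kd (y \<otimes>\<^bsub>H\<^esub> inv\<^bsub>H\<^esub> h) x)"

section \<open>Matrix representations\<close>

text \<open>A representation of a set \<open>S\<close> (an algebra or a group) is a pair of its dimension \<open>n\<close> and a
  map from \<open>S\<close> to the matrices of size \<open>n\<close>; values outside \<open>S\<close> are irrelevant. Irreducible
  representations of a finite-dimensional algebra are finite-dimensional, and so are those of a
  central extension of a finite group in which the central kernel acts by scalars.\<close>

type_synonym ('x, 'k) mrep = "nat \<times> ('x \<Rightarrow> 'k mat)"

definition irreducible_on :: "'x set \<Rightarrow> ('x, 'k::field) mrep \<Rightarrow> bool" where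
  "irreducible_on S V \<longleftrightarrow>
     fst V > 0 \<and>
     (\<forall>U. subspace class_ring U (module_vec TYPE('k) (fst V)) \<longrightarrow>
        (\<forall>x\<in>S. \<forall>v\<in>U. snd V x *\<^sub>v v \<in> U) \<longrightarrow>
        U = {0\<^sub>v (fst V)} \<or> U = carrier_vec (fst V))"

definition alg_rep :: "('b, 'k::field, 'z) algd_scheme \<Rightarrow> ('b \<Rightarrow> 'k, 'k) mrep \<Rightarrow> bool" where
  "alg_rep D V \<longleftrightarrow>
     (let n = fst V; \<pi> = snd V in
       (\<forall>f\<in>elts D. \<pi> f \<in> carrier_mat n n) \<and>
       (\<forall>f\<in>elts D. \<forall>h\<in>elts D. \<pi> (\<lambda>x. f x + h x) = \<pi> f + \<pi> h) \<and>
       (\<forall>c. \<forall>f\<in>elts D. \<pi> (\<lambda>x. c * f x) = c \<cdot>\<^sub>m \<pi> f) \<and>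
       (\<forall>f\<in>elts D. \<forall>h\<in>elts D. \<pi> (amul D f h) = \<pi> f * \<pi> h) \<and>
       \<pi> (unity D) = 1\<^sub>m n)"

definition alg_irreps :: "('b, 'k::field, 'z) algd_scheme \<Rightarrow> ('b \<Rightarrow> 'k, 'k) mrep set" where
  "alg_irreps D = {V. alg_rep D V \<and> irreducible_on (elts D) V}"

definition GLn :: "nat \<Rightarrow> 'k::field mat monoid" where
  "GLn n = units_of (ring_mat TYPE('k) n ())"

definition scalars :: "nat \<Rightarrow> 'k::field mat set" where
  "scalars n = {c \<cdot>\<^sub>m 1\<^sub>m n | c. c \<noteq> 0}"

definition PGLn :: "nat \<Rightarrow> 'k::field mat set monoid" where
  "PGLn n = GLn n Mod scalars n"

text \<open>Irreducible representations of \<open>E\<close> with \<open>\<zeta>\<close> acting by \<open>\<chi>\<close>.\<close>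

definition grp_irreps ::
  "('e, 'l) monoid_scheme \<Rightarrow> 'e set \<Rightarrow> ('e \<Rightarrow> 'k::field) \<Rightarrow> ('e, 'k) mrep set" where
  "grp_irreps E \<zeta> \<chi> =
     {V. snd V \<in> hom E (GLn (fst V)) \<and> irreducible_on (carrier E) V \<and>
         (\<forall>z\<in>\<zeta>. snd V z = \<chi> z \<cdot>\<^sub>m 1\<^sub>m (fst V))}"

definition rep_iso :: "'x set \<Rightarrow> ('x, 'k::field) mrep \<Rightarrow> ('x, 'k) mrep \<Rightarrow> bool" where
  "rep_iso S V W \<longleftrightarrow>
     fst V = fst W \<and> (\<exists>P\<in>carrier (GLn (fst V)). \<forall>x\<in>S. P * snd V x = snd W x * P)"

definition iso_classes :: "'x set \<Rightarrow> ('x, 'k::field) mrep set \<Rightarrow> ('x, 'k) mrep set set" where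
  "iso_classes S C = C // {(V, W). V \<in> C \<and> W \<in> C \<and> rep_iso S V W}"

section \<open>Projective representations\<close>

text \<open>Since \<open>PGL\<close> is a quotient of \<open>GL\<close>, a projective representation of \<open>K\<close> of dimension \<open>n\<close>, a
  homomorphism from \<open>K\<close> to \<open>PGLn n\<close>, maps each element of \<open>K\<close> to the set of its lifts to \<open>GLn n\<close>.\<close>

definition proj_rep :: "('a, 'l) monoid_scheme \<Rightarrow> nat \<Rightarrow> ('a \<Rightarrow> 'k::field mat set) \<Rightarrow> bool" where
  "proj_rep K n P \<longleftrightarrow> P \<in> hom K (PGLn n)"

text \<open>For a simple module \<open>V\<close> over a matrix algebra \<open>D\<close> and an action \<open>\<rho>\<close> by automorphisms of \<open>D\<close>:
  the element of the projective group of \<open>V\<close> whose conjugation action is \<open>\<rho> h\<close>.\<close>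

definition induced_proj ::
  "('b, 'k::field) algd \<Rightarrow> ('a \<Rightarrow> ('b \<Rightarrow> 'k) \<Rightarrow> 'b \<Rightarrow> 'k) \<Rightarrow> ('b \<Rightarrow> 'k, 'k) mrep \<Rightarrow>
     'a \<Rightarrow> 'k mat set" where
  "induced_proj D \<rho> V h =
     {T \<in> carrier (GLn (fst V)).
        \<forall>f\<in>elts D. T * snd V f * inv\<^bsub>GLn (fst V)\<^esub> T = snd V (\<rho> h f)}"

definition kron :: "'k::field mat \<Rightarrow> 'k mat \<Rightarrow> 'k mat" where
  "kron S T =
     mat (dim_row S * dim_row T) (dim_col S * dim_col T)
       (\<lambda>(i, j). S $$ (i div dim_row T, j div dim_col T) * T $$ (i mod dim_row T, j mod dim_col T))"

text \<open>The class of \<open>S \<otimes> T\<close>, for lifts \<open>S\<close> and \<open>T\<close>; the set on the right is a full coset of the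
  scalars because \<open>P a\<close> is one.\<close>

definition proj_tensor ::
  "('a \<Rightarrow> 'k::field mat set) \<Rightarrow> ('a \<Rightarrow> 'k mat set) \<Rightarrow> 'a \<Rightarrow> 'k mat set" where
  "proj_tensor P Q a = {kron S T | S T. S \<in> P a \<and> T \<in> Q a}"

definition linearization ::
  "('a, 'l) monoid_scheme \<Rightarrow> nat \<Rightarrow> ('a \<Rightarrow> 'k::field mat set) \<Rightarrow>
     ('e, 'm) monoid_scheme \<Rightarrow> ('e \<Rightarrow> 'a) \<Rightarrow> ('e \<Rightarrow> 'k mat) \<Rightarrow> bool" where
  "linearization K n P E p \<pi> \<longleftrightarrow>
     proj_rep K n P \<and> group E \<and> p \<in> epi E K \<and>
     (\<forall>z\<in>kernel E K p. \<forall>x\<in>carrier E. z \<otimes>\<^bsub>E\<^esub> x = x \<otimes>\<^bsub>E\<^esub> z) \<and>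
     \<pi> \<in> hom E (GLn n) \<and>
     (\<forall>x\<in>carrier E. scalars n #>\<^bsub>GLn n\<^esub> \<pi> x = P (p x))"

end

theory Submission
  imports Defs "Jordan_Normal_Form.Char_Poly"
begin

text \<open>
  Since \<open>\<Delta>\<^sup>J(tgs) = (J\<^sup>-\<^sup>1 \<Delta>(t)) \<Delta>(g) (\<Delta>(s) J)\<close> for \<open>s\<close> and \<open>t\<close> in \<open>H\<close>, the map
  \<open>f \<mapsto> \<Sum>\<^sub>s\<^sub>,\<^sub>t f(tgs) \<delta>\<^sub>s \<otimes> \<delta>\<^sub>t\<close> embeds \<open>(A\<^sup>*)\<^sub>Z\<close> as an algebra into
  \<open>(A\<^sub>1)\<^sup>* \<otimes> (A\<^sub>2)\<^sup>* = End(V\<^sub>1 \<otimes> V\<^sub>2)\<close>. Its image consists of the functions of \<open>(s, t)\<close> that are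
  invariant under the action of \<open>K\<^sub>g\<close>, and that action is conjugation by \<open>W\<close>; so \<open>(A\<^sup>*)\<^sub>Z\<close> is the
  commutant of \<open>W\<close>. Its irreducible representations are therefore the multiplicity spaces of the
  irreducible constituents \<open>X\<close> of \<open>W\<close>.

  Write \<open>d\<^sub>X\<close> and \<open>m\<^sub>X\<close> for dimension and multiplicity. Then \<open>\<Sum> m\<^sub>X\<^sup>2 = dim (A\<^sup>*)\<^sub>Z = |H|\<^sup>2 / |K\<^sub>g|\<close>,
  \<open>\<Sum> d\<^sub>X\<^sup>2 \<le> |K\<^sub>g|\<close> over any set of pairwise inequivalent \<open>X\<close>, and \<open>\<Sum> m\<^sub>X d\<^sub>X = dim W = |H|\<close>. So equality
  holds in the Cauchy-Schwarz inequality, which gives \<open>m\<^sub>X = (|H| / |K\<^sub>g|) d\<^sub>X\<close> and shows that every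
  admissible irreducible representation occurs in \<open>W\<close>.

  The simplicity of \<open>(A\<^sub>i)\<^sup>*\<close>, in the form that \<open>V\<^sub>i\<close> identifies it with all matrices, follows from
  its center being trivial, which is the nondegeneracy of \<open>J\<^sub>2\<^sub>1\<^sup>-\<^sup>1 J\<close>, together with the
  Casimir element of its nondegenerate trace form.
\<close>

section \<open>Schur's lemma for matrices\<close>

text \<open>The field may have positive characteristic, where a trace determines a dimension only
  modulo the characteristic. So the inequalities between dimensions (for n^2, for the sums of
  squares, for the commutant) come from pairs of dual families through
  \<open>card_le_of_dual_families\<close>, with the orthogonality relations supplying the duals.
  Neither side of the correspondence is constructed from the other: a decomposition of W gives one
  list of constituents, whose multiplicity spaces represent the classes on the algebra side, and the
  counting shows afterwards that the list itself represents all classes on the group side. The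
  extension of K_g may be infinite. Averages therefore run over K_g through an arbitrary choice of
  preimages, which is harmless because the kernel acts by the same character on both sides of the
  averaged matrix. The second coalgebra is treated as an instance of the first: a \<mapsto> J^{-1}
  \<Delta>(a) is the first construction for the opposite group and the twist J^{-1}.\<close>

lemma card_le_of_dual_families:
  fixes s t :: "'i \<Rightarrow> 'z \<Rightarrow> 'k::field"
  assumes fin: "finite I" "finite Z"
    and dual: "\<And>i j. i \<in> I \<Longrightarrow> j \<in> I \<Longrightarrow> (\<Sum>z\<in>Z. s i z * t j z) = (if i = j then 1 else 0)"
  shows "card I \<le> card Z"
proof (rule ccontr)
  assume "\<not> card I \<le> card Z"
  define d e where "d = card I" and "e = card Z"
  have de: "e < d" using \<open>\<not> card I \<le> card Z\<close> by (simp add: d_def e_def)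
  obtain f where f: "bij_betw f {0..<d} I"
    using ex_bij_betw_nat_finite[OF fin(1)] d_def by auto
  obtain g where g: "bij_betw g {0..<e} Z"
    using ex_bij_betw_nat_finite[OF fin(2)] e_def by auto
  \<comment> \<open>Zero columns in S and zero rows in T make both matrices square, so S T = 1
    forces T S = 1; but the last row of T is zero.\<close>
  define S where "S = mat d d (\<lambda>(i, c). if c < e then s (f i) (g c) else 0)"
  define T where "T = mat d d (\<lambda>(c, i). if c < e then t (f i) (g c) else 0)"
  have S: "S \<in> carrier_mat d d" and T: "T \<in> carrier_mat d d"
    by (auto simp: S_def T_def)
  have "S * T = 1\<^sub>m d"
  proof (rule eq_matI)
    fix i j assume "i < dim_row (1\<^sub>m d)" "j < dim_col (1\<^sub>m d)"
    then have ij: "i < d" "j < d" by auto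
    have "(S * T) $$ (i, j) = (\<Sum>c\<in>{0..<d}. if c < e then s (f i) (g c) * t (f j) (g c) else 0)"
      using ij by (auto simp: S_def T_def scalar_prod_def intro!: sum.cong)
    also have "\<dots> = (\<Sum>c\<in>{0..<e}. s (f i) (g c) * t (f j) (g c))"
      using de by (intro sum.mono_neutral_cong_right) auto
    also have "\<dots> = (\<Sum>z\<in>Z. s (f i) z * t (f j) z)"
      using sum.reindex_bij_betw[OF g, of "\<lambda>z. s (f i) z * t (f j) z"] .
    also have "\<dots> = (if f i = f j then 1 else 0)"
      using dual f ij by (auto simp: bij_betw_def)
    also have "\<dots> = (if i = j then 1 else 0)"
      using f ij by (auto simp: bij_betw_def inj_on_def)
    finally show "(S * T) $$ (i, j) = 1\<^sub>m d $$ (i, j)" using ij by simp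
  qed (auto simp: S_def T_def)
  then have TS: "T * S = 1\<^sub>m d"
    using mat_mult_left_right_inverse[OF S T] by simp
  have "(T * S) $$ (d - 1, d - 1) = 0"
    using de by (auto simp: S_def T_def scalar_prod_def)
  then show False using TS de by auto
qed

lemma mat_mult_index:
  assumes "A \<in> carrier_mat r n" "B \<in> carrier_mat n m" "i < r" "j < m"
  shows "(A * B) $$ (i, j) = (\<Sum>c<n. A $$ (i, c) * B $$ (c, j))"
  using assms by (simp add: scalar_prod_def atLeast0LessThan)

lemma mat_left_inverse_le:
  fixes X Y :: "'k::field mat"
  assumes "X \<in> carrier_mat a b" "Y \<in> carrier_mat b a" "X * Y = 1\<^sub>m a"
  shows "a \<le> b"
proof -
  have "card {..<a} \<le> card {..<b}"
  proof (rule card_le_of_dual_families[where s = "\<lambda>i c. X $$ (i, c)" and t = "\<lambda>j c. Y $$ (c, j)"])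
    fix i j assume ij: "i \<in> {..<a}" "j \<in> {..<a}"
    have "(\<Sum>z<b. X $$ (i, z) * Y $$ (z, j)) = (X * Y) $$ (i, j)"
      using ij mat_mult_index[OF assms(1,2)] by simp
    then show "(\<Sum>z<b. X $$ (i, z) * Y $$ (z, j)) = (if i = j then 1 else 0)"
      using ij assms(3) by simp
  qed auto
  then show ?thesis by simp
qed

section \<open>Subspaces of k^n as ranges of split embeddings\<close>

lemma closed_sum_vec:
  fixes U :: "'k::field vec set"
  assumes U: "U \<subseteq> carrier_vec n" "0\<^sub>v n \<in> U"
    and add: "\<And>v w. v \<in> U \<Longrightarrow> w \<in> U \<Longrightarrow> v + w \<in> U"
    and smult: "\<And>c v. v \<in> U \<Longrightarrow> c \<cdot>\<^sub>v v \<in> U"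
    and I: "finite I" and u: "\<And>i. i \<in> I \<Longrightarrow> u i \<in> U"
  shows "vec n (\<lambda>c. \<Sum>i\<in>I. a i * u i $ c) \<in> U"
  using I u
proof (induction I)
  case empty
  have "vec n (\<lambda>c. 0) = (0\<^sub>v n :: 'k vec)" by auto
  then show ?case using U by simp
next
  case (insert d I)
  have ud: "u d \<in> carrier_vec n" using insert.prems U by auto
  have "vec n (\<lambda>c. \<Sum>i\<in>insert d I. a i * u i $ c) = a d \<cdot>\<^sub>v u d + vec n (\<lambda>c. \<Sum>i\<in>I. a i * u i $ c)"
    using ud insert.hyps by (intro eq_vecI) auto
  then show ?case using add[OF smult insert.IH] insert.prems by simp
qed

text \<open>Take as many vectors of U as possible that admit dual functionals on k^n; there are at
  most n of them. They span U, since a vector of U outside their span could be added together with a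
  suitable functional. The vectors are the columns of T and the functionals the rows of S.\<close>

lemma subspace_split:
  fixes U :: "'k::field vec set"
  assumes U: "U \<subseteq> carrier_vec n" "0\<^sub>v n \<in> U"
    and add: "\<And>v w. v \<in> U \<Longrightarrow> w \<in> U \<Longrightarrow> v + w \<in> U"
    and smult: "\<And>c v. v \<in> U \<Longrightarrow> c \<cdot>\<^sub>v v \<in> U"
  obtains d T S where "T \<in> carrier_mat n d" "S \<in> carrier_mat d n" "S * T = 1\<^sub>m d"
    "U = {T *\<^sub>v v | v. v \<in> carrier_vec d}"
proof -
  define good where "good = (\<lambda>d (u :: nat \<Rightarrow> 'k vec) (r :: nat \<Rightarrow> nat \<Rightarrow> 'k).
     (\<forall>i<d. u i \<in> U) \<and> (\<forall>i<d. \<forall>j<d. (\<Sum>c<n. r i c * u j $ c) = (if i = j then 1 else 0)))"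
  have bound: "d \<le> n" if ex: "\<exists>u r. good d u r" for d
  proof -
    obtain u r where "good d u r" using ex by (elim exE)
    then have "card {..<d} \<le> card {..<n}"
      by (intro card_le_of_dual_families[where s = r and t = "\<lambda>j c. u j $ c"]) (auto simp: good_def)
    then show ?thesis by simp
  qed
  have ex0: "\<exists>u r. good 0 u r" by (simp add: good_def)
  define d where "d = (GREATEST d. \<exists>u r. good d u r)"
  have "\<exists>u r. good d u r" unfolding d_def
    using GreatestI_nat[of "\<lambda>d. \<exists>u r. good d u r" 0 n] ex0 bound by blast
  then obtain u r where ur: "good d u r" by (elim exE) (rule that)
  have max: "\<not> (\<exists>u r. good (Suc d) u r)"
    using Greatest_le_nat[of "\<lambda>d. \<exists>u r. good d u r" "Suc d" n] bound unfolding d_def[symmetric] by auto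
  have uU: "u i \<in> U" if "i < d" for i using ur that by (simp add: good_def)
  have ru: "(\<Sum>c<n. r i c * u j $ c) = (if i = j then 1 else 0)" if "i < d" "j < d" for i j
    using ur that by (simp add: good_def)
  define T where "T = mat n d (\<lambda>(c, i). u i $ c)"
  define S where "S = mat d n (\<lambda>(i, c). r i c)"
  have Tv: "T *\<^sub>v v = vec n (\<lambda>c. \<Sum>i<d. v $ i * u i $ c)" if "v \<in> carrier_vec d" for v
    using that by (intro eq_vecI)
      (auto simp: T_def scalar_prod_def atLeast0LessThan mult.commute intro!: sum.cong)
  have ST: "S * T = 1\<^sub>m d"
    by (rule eq_matI) (auto simp: S_def T_def scalar_prod_def atLeast0LessThan ru)
  have "w \<in> {T *\<^sub>v v | v. v \<in> carrier_vec d}" if w: "w \<in> U" for w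
  proof -
    define a where "a i = (\<Sum>c<n. r i c * w $ c)" for i
    define p where "p = vec n (\<lambda>c. \<Sum>i<d. a i * u i $ c)"
    \<comment> \<open>The part of \<open>w\<close> that the chosen vectors do not capture. All
      \<open>r i\<close> vanish on it, so the old functionals can be kept when it is added.\<close>
    define w' where "w' = w + (-1) \<cdot>\<^sub>v p"
    have wn: "w \<in> carrier_vec n" using w U by auto
    have pU: "p \<in> U" unfolding p_def using uU by (intro closed_sum_vec[OF U add smult]) auto
    have w'U: "w' \<in> U" unfolding w'_def by (intro add smult w pU)
    have w'c: "w' $ c = w $ c - (\<Sum>i<d. a i * u i $ c)" if "c < n" for c
      using that wn by (simp add: w'_def p_def)
    have rp: "(\<Sum>c<n. r i c * w' $ c) = 0" if i: "i < d" for i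
    proof -
      have "(\<Sum>c<n. r i c * w' $ c) = a i - (\<Sum>c<n. \<Sum>j<d. a j * (r i c * u j $ c))"
        by (simp add: w'c a_def right_diff_distrib sum_subtractf sum_distrib_left mult_ac)
      also have "(\<Sum>c<n. \<Sum>j<d. a j * (r i c * u j $ c)) = (\<Sum>j<d. a j * (\<Sum>c<n. r i c * u j $ c))"
        by (subst sum.swap) (simp add: sum_distrib_left)
      also have "\<dots> = (\<Sum>j<d. if j = i then a j else 0)"
        using i by (intro sum.cong) (auto simp: ru)
      also have "\<dots> = a i" using i by simp
      finally show ?thesis by simp
    qed
    have "w' $ c = 0" if c: "c < n" for c
    proof (rule ccontr)
      assume ne: "w' $ c \<noteq> 0"
      \<comment> \<open>The coordinate functional at c, corrected so as to vanish on all
        \<open>u i\<close> and scaled to take the value 1 on \<open>w'\<close>.\<close>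
      define q where "q e = (inverse (w' $ c)) * ((if e = c then 1 else 0) - (\<Sum>i<d. u i $ c * r i e))" for e
      have qv: "(\<Sum>e<n. q e * v $ e) = inverse (w' $ c) * (v $ c - (\<Sum>i<d. u i $ c * (\<Sum>e<n. r i e * v $ e)))"
        for v
      proof -
        have "(\<Sum>e<n. q e * v $ e) = inverse (w' $ c) *
            (\<Sum>e<n. (if e = c then v $ e else 0) - (\<Sum>i<d. u i $ c * (r i e * v $ e)))"
          unfolding sum_distrib_left
          by (intro sum.cong) (auto simp: q_def algebra_simps sum_distrib_left sum_distrib_right)
        also have "(\<Sum>e<n. (if e = c then v $ e else 0) - (\<Sum>i<d. u i $ c * (r i e * v $ e)))
            = v $ c - (\<Sum>e<n. \<Sum>i<d. u i $ c * (r i e * v $ e))"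
          using c by (simp add: sum_subtractf)
        also have "(\<Sum>e<n. \<Sum>i<d. u i $ c * (r i e * v $ e)) = (\<Sum>i<d. u i $ c * (\<Sum>e<n. r i e * v $ e))"
          by (subst sum.swap) (simp add: sum_distrib_left)
        finally show ?thesis .
      qed
      have qw: "(\<Sum>e<n. q e * w' $ e) = 1" using ne by (simp add: qv rp)
      have qu: "(\<Sum>e<n. q e * u j $ e) = 0" if "j < d" for j
      proof -
        have "(\<Sum>i<d. u i $ c * (\<Sum>e<n. r i e * u j $ e)) = (\<Sum>i<d. if i = j then u i $ c else 0)"
          using that by (intro sum.cong) (auto simp: ru)
        then show ?thesis using that by (simp add: qv)
      qed
      have "good (Suc d) (u(d := w')) (r(d := q))"
        unfolding good_def using uU w'U qw qu rp ru by (auto simp: less_Suc_eq)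
      then show False using max by blast
    qed
    then have "w = T *\<^sub>v vec d a"
      using wn by (intro eq_vecI) (auto simp: Tv w'c)
    then show ?thesis by auto
  qed
  moreover have "T *\<^sub>v v \<in> U" if "v \<in> carrier_vec d" for v
    unfolding Tv[OF that] using uU by (intro closed_sum_vec[OF U add smult]) auto
  ultimately have "U = {T *\<^sub>v v | v. v \<in> carrier_vec d}" by blast
  then show ?thesis using that[of T d S] ST by (auto simp: T_def S_def)
qed

lemma subspace_vecI:
  fixes U :: "'k::field vec set"
  assumes "U \<subseteq> carrier_vec n" "0\<^sub>v n \<in> U"
    and "\<And>v w. v \<in> U \<Longrightarrow> w \<in> U \<Longrightarrow> v + w \<in> U"
    and "\<And>c v. v \<in> U \<Longrightarrow> c \<cdot>\<^sub>v v \<in> U"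
  shows "VectorSpace.subspace class_ring U (module_vec TYPE('k) n)"
  using assms vec_vs[of n] vec_module[of n]
  by (auto simp: VectorSpace.subspace_def submodule_def module_vec_simps)

lemma subspace_vecD:
  fixes U :: "'k::field vec set"
  assumes "VectorSpace.subspace class_ring U (module_vec TYPE('k) n)"
  shows "U \<subseteq> carrier_vec n" "0\<^sub>v n \<in> U"
    and "\<And>v w. v \<in> U \<Longrightarrow> w \<in> U \<Longrightarrow> v + w \<in> U"
    and "\<And>c v. v \<in> U \<Longrightarrow> c \<cdot>\<^sub>v v \<in> U"
  using assms by (auto simp: VectorSpace.subspace_def submodule_def module_vec_simps)

section \<open>Invariant subspaces and intertwiners\<close>

lemma mat_mult_unit_vec:
  assumes "A \<in> carrier_mat m n" "i < m" "j < n"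
  shows "(A *\<^sub>v unit_vec n j) $ i = (A $$ (i, j) :: 'k::semiring_1)"
proof -
  have "(\<Sum>c = 0..<n. A $$ (i, c) * unit_vec n j $ c) = (\<Sum>c = 0..<n. if c = j then A $$ (i, c) else 0)"
    using assms by (intro sum.cong) auto
  then show ?thesis using assms by (simp add: scalar_prod_def)
qed

lemma irreducible_onD:
  fixes U :: "'k::field vec set"
  assumes "irreducible_on S (n, A)" "U \<subseteq> carrier_vec n" "0\<^sub>v n \<in> U"
    and "\<And>v w. v \<in> U \<Longrightarrow> w \<in> U \<Longrightarrow> v + w \<in> U"
    and "\<And>c v. v \<in> U \<Longrightarrow> c \<cdot>\<^sub>v v \<in> U"
    and "\<And>x v. x \<in> S \<Longrightarrow> v \<in> U \<Longrightarrow> A x *\<^sub>v v \<in> U"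
  shows "U = {0\<^sub>v n} \<or> U = carrier_vec n"
  using assms(1,6) subspace_vecI[OF assms(2-5)] by (auto simp: irreducible_on_def)

text \<open>Kernel and image of an intertwiner are invariant, so a nonzero one is bijective. Its
  inverse is built column by column from preimages of the unit vectors, and the equality of the two
  sizes is then read off from the two one-sided inverses.\<close>

lemma schur_intertwiner:
  fixes P :: "'k::field mat"
  assumes irr: "irreducible_on S (n, A)" "irreducible_on S (m, B)"
    and A: "\<And>x. x \<in> S \<Longrightarrow> A x \<in> carrier_mat n n" and B: "\<And>x. x \<in> S \<Longrightarrow> B x \<in> carrier_mat m m"
    and P: "P \<in> carrier_mat m n" and int: "\<And>x. x \<in> S \<Longrightarrow> P * A x = B x * P"
    and nz: "P \<noteq> 0\<^sub>m m n"
  shows "m = n \<and> (\<exists>Q\<in>carrier_mat n n. P * Q = 1\<^sub>m n \<and> Q * P = 1\<^sub>m n)"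
proof -
  let ?K = "{v \<in> carrier_vec n. P *\<^sub>v v = 0\<^sub>v m}"
  let ?I = "{P *\<^sub>v v | v. v \<in> carrier_vec n}"
  have "?K = {0\<^sub>v n} \<or> ?K = carrier_vec n"
  proof (rule irreducible_onD[OF irr(1)])
    fix x v assume x: "x \<in> S" and v: "v \<in> ?K"
    have vn: "v \<in> carrier_vec n" using v by simp
    have "P *\<^sub>v (A x *\<^sub>v v) = (P * A x) *\<^sub>v v"
      by (rule assoc_mult_mat_vec[OF P A[OF x] vn, symmetric])
    also have "\<dots> = B x *\<^sub>v (P *\<^sub>v v)"
      unfolding int[OF x] by (rule assoc_mult_mat_vec[OF B[OF x] P vn])
    also have "\<dots> = 0\<^sub>v m" using v B[OF x] by (auto intro: eq_vecI)
    finally show "A x *\<^sub>v v \<in> ?K" using A[OF x] v by auto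
  next
    fix v w assume "v \<in> ?K" "w \<in> ?K"
    then show "v + w \<in> ?K" by (simp add: mult_add_distrib_mat_vec[OF P])
  next
    fix c v assume "v \<in> ?K"
    then show "c \<cdot>\<^sub>v v \<in> ?K" using P by (auto simp: mult_mat_vec[of _ m n] intro!: eq_vecI)
  next
    show "0\<^sub>v n \<in> ?K" using P by auto
  qed auto
  moreover have "?K \<noteq> carrier_vec n"
  proof
    assume K: "?K = carrier_vec n"
    have "P = 0\<^sub>m m n"
    proof (rule eq_matI)
      fix i j assume "i < dim_row (0\<^sub>m m n)" "j < dim_col (0\<^sub>m m n)"
      then have ij: "i < m" "j < n" by auto
      have "unit_vec n j \<in> ?K" unfolding K by simp
      then have "P *\<^sub>v unit_vec n j = 0\<^sub>v m" by simp
      then have "(P *\<^sub>v unit_vec n j) $ i = 0" using ij by simp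
      then show "P $$ (i, j) = 0\<^sub>m m n $$ (i, j)" using ij mat_mult_unit_vec[OF P ij] by simp
    qed (use P in auto)
    then show False using nz by simp
  qed
  ultimately have K: "?K = {0\<^sub>v n}" by blast
  have "?I = {0\<^sub>v m} \<or> ?I = carrier_vec m"
  proof (rule irreducible_onD[OF irr(2)])
    have "P *\<^sub>v 0\<^sub>v n = 0\<^sub>v m" using P by (auto intro!: eq_vecI)
    then show "0\<^sub>v m \<in> ?I" using zero_carrier_vec[of n] by (metis (mono_tags, lifting) mem_Collect_eq)
  next
    fix v w assume "v \<in> ?I" "w \<in> ?I"
    then obtain v' w' where "v' \<in> carrier_vec n" "w' \<in> carrier_vec n" "v = P *\<^sub>v v'" "w = P *\<^sub>v w'" by auto
    then have "v + w = P *\<^sub>v (v' + w')" "v' + w' \<in> carrier_vec n"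
      by (auto simp: mult_add_distrib_mat_vec[OF P])
    then show "v + w \<in> ?I" by blast
  next
    fix c v assume "v \<in> ?I"
    then obtain v' where "v' \<in> carrier_vec n" "v = P *\<^sub>v v'" by auto
    then have "c \<cdot>\<^sub>v v = P *\<^sub>v (c \<cdot>\<^sub>v v')" "c \<cdot>\<^sub>v v' \<in> carrier_vec n"
      using P by (auto simp: mult_mat_vec[of _ m n])
    then show "c \<cdot>\<^sub>v v \<in> ?I" by blast
  next
    fix x v assume x: "x \<in> S" and "v \<in> ?I"
    then obtain v' where v': "v' \<in> carrier_vec n" "v = P *\<^sub>v v'" by auto
    have "B x *\<^sub>v v = (B x * P) *\<^sub>v v'"
      unfolding v'(2) by (rule assoc_mult_mat_vec[OF B[OF x] P v'(1), symmetric])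
    also have "\<dots> = P *\<^sub>v (A x *\<^sub>v v')"
      unfolding int[OF x, symmetric] by (rule assoc_mult_mat_vec[OF P A[OF x] v'(1)])
    finally show "B x *\<^sub>v v \<in> ?I" using A[OF x] v' by auto
  qed (use P in auto)
  moreover have "?I \<noteq> {0\<^sub>v m}"
  proof
    assume "?I = {0\<^sub>v m}"
    then have "\<forall>v\<in>carrier_vec n. P *\<^sub>v v = 0\<^sub>v m" by auto
    then have "?K = carrier_vec n" by auto
    then show False using \<open>?K \<noteq> carrier_vec n\<close> by simp
  qed
  ultimately have I: "?I = carrier_vec m" by blast
  have "\<exists>v. v \<in> carrier_vec n \<and> P *\<^sub>v v = unit_vec m i" if "i < m" for i
  proof -
    have "unit_vec m i \<in> ?I" unfolding I by simp
    then obtain v where "v \<in> carrier_vec n" "unit_vec m i = P *\<^sub>v v" by blast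
    then show ?thesis by (intro exI[of _ v]) simp
  qed
  then obtain q where q: "\<And>i. i < m \<Longrightarrow> q i \<in> carrier_vec n" "\<And>i. i < m \<Longrightarrow> P *\<^sub>v q i = unit_vec m i"
    by metis
  define Q where "Q = mat n m (\<lambda>(c, i). q i $ c)"
  have Q: "Q \<in> carrier_mat n m" by (simp add: Q_def)
  have cQ: "col Q i = q i" if "i < m" for i using that q(1)[OF that] by (auto simp: Q_def)
  have PQ: "P * Q = 1\<^sub>m m"
  proof (rule eq_matI)
    fix i j assume "i < dim_row (1\<^sub>m m)" "j < dim_col (1\<^sub>m m)"
    then have ij: "i < m" "j < m" by auto
    have "(P * Q) $$ (i, j) = (P *\<^sub>v q j) $ i" using ij P Q cQ by simp
    then show "(P * Q) $$ (i, j) = 1\<^sub>m m $$ (i, j)" using ij q by simp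
  qed (use P Q in auto)
  \<comment> \<open>From P Q = 1 follows P (Q P v) = P v, and injectivity of P gives Q P v = v
    before the matrices are known to be square.\<close>
  have QP: "Q * P = 1\<^sub>m n"
  proof -
    have "v = (Q * P) *\<^sub>v v" if v: "v \<in> carrier_vec n" for v
    proof -
      have "P *\<^sub>v ((Q * P) *\<^sub>v v) = ((P * Q) * P) *\<^sub>v v" using P Q v
        by (metis assoc_mult_mat assoc_mult_mat_vec mult_carrier_mat)
      also have "\<dots> = P *\<^sub>v v" using PQ P by simp
      finally have e: "P *\<^sub>v ((Q * P) *\<^sub>v v) = P *\<^sub>v v" .
      have "(Q * P) *\<^sub>v v \<in> carrier_vec n"
        using Q P v by (intro mult_mat_vec_carrier[of _ n n]) auto
      then have "P *\<^sub>v (v - (Q * P) *\<^sub>v v) = P *\<^sub>v v - P *\<^sub>v v"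
        using mult_minus_distrib_mat_vec[OF P v] e by metis
      also have "\<dots> = 0\<^sub>v m" using P by (auto intro!: eq_vecI)
      finally have "P *\<^sub>v (v - (Q * P) *\<^sub>v v) = 0\<^sub>v m" .
      moreover have "v - (Q * P) *\<^sub>v v \<in> carrier_vec n"
        using Q P v by (intro minus_carrier_vec mult_mat_vec_carrier[of _ n n]) auto
      ultimately have z: "v - (Q * P) *\<^sub>v v = 0\<^sub>v n" using K by blast
      show ?thesis
      proof (rule eq_vecI)
        fix i assume "i < dim_vec ((Q * P) *\<^sub>v v)"
        then have i: "i < n" using Q by simp
        have "(v - (Q * P) *\<^sub>v v) $ i = 0" unfolding z using i by simp
        then show "v $ i = ((Q * P) *\<^sub>v v) $ i"
          using i Q v by (simp del: assoc_mult_mat_vec)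
      qed (use Q v in auto)
    qed
    note this[symmetric]
    then have *: "(Q * P) *\<^sub>v unit_vec n j = unit_vec n j" if "j < n" for j by simp
    show ?thesis
    proof (rule eq_matI)
      fix i j assume "i < dim_row (1\<^sub>m n)" "j < dim_col (1\<^sub>m n)"
      then have ij: "i < n" "j < n" by auto
      have QPc: "Q * P \<in> carrier_mat n n" using Q P by simp
      have "(Q * P) $$ (i, j) = ((Q * P) *\<^sub>v unit_vec n j) $ i"
        using mat_mult_unit_vec[OF QPc ij] by simp
      also have "\<dots> = 1\<^sub>m n $$ (i, j)" using *[OF ij(2)] ij by simp
      finally show "(Q * P) $$ (i, j) = 1\<^sub>m n $$ (i, j)" .
    qed (use P Q in auto)
  qed
  have "m = n" using mat_left_inverse_le[OF P Q PQ] mat_left_inverse_le[OF Q P QP] by simp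
  then show ?thesis using Q PQ QP by blast
qed

text \<open>The characteristic polynomial has a root because the field is algebraically closed and n
  > 0; the eigenspace is invariant and nonzero, hence the whole space.\<close>

lemma schur_scalar:
  fixes P :: "'k::alg_closed_field mat"
  assumes irr: "irreducible_on S (n, A)"
    and A: "\<And>x. x \<in> S \<Longrightarrow> A x \<in> carrier_mat n n"
    and P: "P \<in> carrier_mat n n" and int: "\<And>x. x \<in> S \<Longrightarrow> P * A x = A x * P"
  shows "\<exists>c. P = c \<cdot>\<^sub>m 1\<^sub>m n"
proof -
  have n: "n > 0" using irr by (simp add: irreducible_on_def)
  obtain c where "poly (char_poly P) c = 0"
    using alg_closed_imp_poly_has_root[of "char_poly P"] degree_monic_char_poly[OF P] n by auto
  then obtain v where v: "v \<in> carrier_vec n" "v \<noteq> 0\<^sub>v n" "P *\<^sub>v v = c \<cdot>\<^sub>v v"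
    using eigenvalue_root_char_poly[OF P, of c] P by (auto simp: eigenvalue_def eigenvector_def)
  let ?K = "{w \<in> carrier_vec n. P *\<^sub>v w = c \<cdot>\<^sub>v w}"
  have "?K = {0\<^sub>v n} \<or> ?K = carrier_vec n"
  proof (rule irreducible_onD[OF irr])
    fix x w assume x: "x \<in> S" and w: "w \<in> ?K"
    have wn: "w \<in> carrier_vec n" using w by simp
    have "P *\<^sub>v (A x *\<^sub>v w) = (P * A x) *\<^sub>v w"
      by (rule assoc_mult_mat_vec[OF P A[OF x] wn, symmetric])
    also have "\<dots> = A x *\<^sub>v (P *\<^sub>v w)"
      unfolding int[OF x] by (rule assoc_mult_mat_vec[OF A[OF x] P wn])
    also have "\<dots> = c \<cdot>\<^sub>v (A x *\<^sub>v w)" using w A[OF x] by (simp add: mult_mat_vec)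
    finally show "A x *\<^sub>v w \<in> ?K" using A[OF x] w by auto
  next
    fix v w assume "v \<in> ?K" "w \<in> ?K"
    then show "v + w \<in> ?K"
      by (simp add: mult_add_distrib_mat_vec[OF P] smult_add_distrib_vec[of _ n])
  next
    fix d v assume "v \<in> ?K"
    then show "d \<cdot>\<^sub>v v \<in> ?K"
      using P by (simp add: mult_mat_vec[of _ n n] smult_smult_assoc mult.commute)
  next
    show "0\<^sub>v n \<in> ?K" using P by auto
  qed auto
  then have K: "?K = carrier_vec n" using v by blast
  have "P = c \<cdot>\<^sub>m 1\<^sub>m n"
  proof (rule eq_matI)
    fix i j assume "i < dim_row (c \<cdot>\<^sub>m 1\<^sub>m n)" "j < dim_col (c \<cdot>\<^sub>m 1\<^sub>m n)"
    then have ij: "i < n" "j < n" by auto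
    have "unit_vec n j \<in> ?K" unfolding K by simp
    then have "P *\<^sub>v unit_vec n j = c \<cdot>\<^sub>v unit_vec n j" by simp
    then have "(P *\<^sub>v unit_vec n j) $ i = (c \<cdot>\<^sub>v unit_vec n j) $ i" by simp
    then show "P $$ (i, j) = (c \<cdot>\<^sub>m 1\<^sub>m n) $$ (i, j)" using ij mat_mult_unit_vec[OF P ij] by simp
  qed (use P in auto)
  then show ?thesis ..
qed

section \<open>Simple algebras with a nondegenerate trace form\<close>

lemma sum_delta_mult:
  fixes f :: "'a \<Rightarrow> 'k::semiring_1"
  assumes "finite B" "a \<in> B"
  shows "(\<Sum>s\<in>B. (if a = s then 1 else 0) * f s) = f a"
proof -
  have "(\<Sum>s\<in>B. (if a = s then 1 else 0) * f s) = (\<Sum>s\<in>B. if s = a then f s else 0)"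
    by (intro sum.cong) auto
  then show ?thesis using assms by simp
qed

lemma sum_sum_swap3:
  "(\<Sum>z\<in>C. \<Sum>y\<in>A. \<Sum>s\<in>B. f z y s) = (\<Sum>y\<in>A. \<Sum>s\<in>B. \<Sum>z\<in>C. f z y s)"
  by (subst sum.swap) (intro sum.cong refl sum.swap)

text \<open>The algebra with structure constants \<open>m\<close> and unit \<open>\<Sum>b\<in>B. b\<close>. The trace of right
  multiplication is the linear form \<open>\<lambda>\<close> with value \<open>1\<close> on the basis, and \<open>\<Phi>\<close> is the inverse
  matrix of the form \<open>\<lambda>(bc)\<close>; so \<open>\<Sum> \<Phi> s y (y \<otimes> s)\<close> is a Casimir element.\<close>

locale frobenius_algebra =
  fixes B :: "'b set" and m :: "'b \<Rightarrow> 'b \<Rightarrow> 'b \<Rightarrow> 'k::alg_closed_field" and \<Phi> :: "'b \<Rightarrow> 'b \<Rightarrow> 'k"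
  assumes fin: "finite B"
    and assoc: "\<And>b c d y. b \<in> B \<Longrightarrow> c \<in> B \<Longrightarrow> d \<in> B \<Longrightarrow> y \<in> B \<Longrightarrow>
      (\<Sum>x\<in>B. m b c x * m x d y) = (\<Sum>x\<in>B. m c d x * m b x y)"
    and unit_right: "\<And>b x. b \<in> B \<Longrightarrow> x \<in> B \<Longrightarrow> (\<Sum>c\<in>B. m b c x) = (if x = b then 1 else 0)"
    and trace_one: "\<And>b. b \<in> B \<Longrightarrow> (\<Sum>y\<in>B. m y b y) = 1"
    and form_Phi: "\<And>u v. u \<in> B \<Longrightarrow> v \<in> B \<Longrightarrow>
      (\<Sum>s\<in>B. (\<Sum>x\<in>B. m u s x) * \<Phi> s v) = (if u = v then 1 else 0)"
    and center: "\<And>z. (\<And>c x. c \<in> B \<Longrightarrow> x \<in> B \<Longrightarrow>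
      (\<Sum>b\<in>B. z b * m b c x) = (\<Sum>b\<in>B. z b * m c b x)) \<Longrightarrow> \<exists>l. \<forall>b\<in>B. z b = l"
    and card_ne: "of_nat (card B) \<noteq> (0::'k)"
begin

section \<open>The symmetric trace form and its Casimir element\<close>

definition form :: "'b \<Rightarrow> 'b \<Rightarrow> 'k" where "form b c = (\<Sum>x\<in>B. m b c x)"

text \<open>By \<open>trace_one\<close>, \<open>form b c\<close> is the trace of right
  multiplication by bc, which is the composite of right multiplication by b and by c; the trace of a
  composite does not depend on the order.\<close>

lemma form_sym: assumes "b \<in> B" "c \<in> B" shows "form b c = form c b"
proof -
  have *: "form b c = (\<Sum>y\<in>B. \<Sum>x\<in>B. m y b x * m x c y)" if "b \<in> B" "c \<in> B" for b c
  proof -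
    have "form b c = (\<Sum>x\<in>B. m b c x * (\<Sum>y\<in>B. m y x y))"
      by (simp add: form_def trace_one)
    also have "\<dots> = (\<Sum>y\<in>B. \<Sum>x\<in>B. m b c x * m y x y)"
      unfolding sum_distrib_left by (rule sum.swap)
    also have "\<dots> = (\<Sum>y\<in>B. \<Sum>x\<in>B. m y b x * m x c y)"
      using that by (intro sum.cong refl assoc[symmetric]) auto
    finally show ?thesis .
  qed
  have "form b c = (\<Sum>x\<in>B. \<Sum>y\<in>B. m y b x * m x c y)"
    unfolding *[OF assms] by (rule sum.swap)
  also have "\<dots> = form c b" unfolding *[OF assms(2,1)] by (simp add: mult.commute)
  finally show ?thesis .
qed

lemma form_Phi': "u \<in> B \<Longrightarrow> v \<in> B \<Longrightarrow> (\<Sum>s\<in>B. form u s * \<Phi> s v) = (if u = v then 1 else 0)"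
  using form_Phi by (simp add: form_def)

lemma Phi_form: assumes "u \<in> B" "v \<in> B"
  shows "(\<Sum>s\<in>B. \<Phi> s u * form s v) = (if u = v then 1 else 0)"
proof -
  have "(\<Sum>s\<in>B. \<Phi> s u * form s v) = (\<Sum>s\<in>B. form v s * \<Phi> s u)"
    using assms by (intro sum.cong refl) (simp add: form_sym mult.commute)
  then show ?thesis using form_Phi'[OF assms(2,1)] by auto
qed

text \<open>\<open>\<Phi>\<close> recovers the coordinates of an element from its pairings.
  Identities between elements are proved below by pairing both sides with every basis
  vector.\<close>

lemma form_cancel:
  assumes eq: "\<And>v. v \<in> B \<Longrightarrow> (\<Sum>s\<in>B. form v s * f s) = (\<Sum>s\<in>B. form v s * g s)" and u: "u \<in> B"
  shows "f u = g u"
proof -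
  have *: "f u = (\<Sum>v\<in>B. \<Phi> v u * (\<Sum>s\<in>B. form v s * f s))" for f
  proof -
    have "(\<Sum>v\<in>B. \<Phi> v u * (\<Sum>s\<in>B. form v s * f s)) = (\<Sum>s\<in>B. \<Sum>v\<in>B. \<Phi> v u * form v s * f s)"
      unfolding sum_distrib_left by (subst sum.swap) (simp add: mult.assoc)
    also have "\<dots> = (\<Sum>s\<in>B. (if u = s then 1 else 0) * f s)"
      using u by (intro sum.cong refl) (simp add: Phi_form flip: sum_distrib_right)
    finally show ?thesis using u fin by (simp add: sum_delta_mult)
  qed
  show ?thesis unfolding *[of f] *[of g] using eq by (intro sum.cong refl) auto
qed

text \<open>The value \<lambda>(bcd) of the trace form on a triple product.\<close>

definition form3 :: "'b \<Rightarrow> 'b \<Rightarrow> 'b \<Rightarrow> 'k" where "form3 b c d = (\<Sum>x\<in>B. m b c x * form x d)"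

lemma form3_alt: assumes "b \<in> B" "c \<in> B" "d \<in> B"
  shows "form3 b c d = (\<Sum>x\<in>B. m c d x * form b x)"
proof -
  have "form3 b c d = (\<Sum>y\<in>B. \<Sum>x\<in>B. m b c x * m x d y)"
    unfolding form3_def form_def sum_distrib_left by (rule sum.swap)
  also have "\<dots> = (\<Sum>y\<in>B. \<Sum>x\<in>B. m c d x * m b x y)"
    using assms by (intro sum.cong refl assoc) auto
  also have "\<dots> = (\<Sum>x\<in>B. m c d x * form b x)"
    unfolding form_def sum_distrib_left by (rule sum.swap)
  finally show ?thesis .
qed

lemma form3_cyclic: assumes "b \<in> B" "c \<in> B" "d \<in> B" shows "form3 b c d = form3 c d b"
proof -
  have "form3 b c d = (\<Sum>x\<in>B. m c d x * form x b)"
    unfolding form3_alt[OF assms] using assms by (intro sum.cong refl) (simp add: form_sym)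
  then show ?thesis by (simp add: form3_def)
qed

text \<open>In terms of the Casimir element this is \<Sum> \<Phi> s y (xy \<otimes> s) = \<Sum>
  \<Phi> s y (y \<otimes> sx), compared at z \<otimes> s. Pairing the second factor with v turns
  both sides into xv: on the left because \<open>\<Phi>\<close> inverts the form, on the right after
  the cyclic rotation of \<lambda>(vwx) into \<lambda>(xvw).\<close>

lemma casimir: assumes x: "x \<in> B" and s: "s \<in> B" and z: "z \<in> B"
  shows "(\<Sum>y\<in>B. \<Phi> s y * m x y z) = (\<Sum>w\<in>B. \<Phi> w z * m w x s)"
proof (rule form_cancel[OF _ s])
  fix v assume v: "v \<in> B"
  have "(\<Sum>s\<in>B. form v s * (\<Sum>y\<in>B. \<Phi> s y * m x y z)) = (\<Sum>y\<in>B. (\<Sum>s\<in>B. form v s * \<Phi> s y) * m x y z)"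
    unfolding sum_distrib_left sum_distrib_right by (subst sum.swap) (simp add: mult.assoc)
  also have "\<dots> = (\<Sum>y\<in>B. if v = y then m x y z else 0)"
    using v by (intro sum.cong refl) (simp add: form_Phi')
  also have "\<dots> = m x v z" using v fin by simp
  finally have l: "(\<Sum>s\<in>B. form v s * (\<Sum>y\<in>B. \<Phi> s y * m x y z)) = m x v z" .
  have "(\<Sum>s\<in>B. form v s * (\<Sum>w\<in>B. \<Phi> w z * m w x s)) = (\<Sum>w\<in>B. \<Phi> w z * (\<Sum>s\<in>B. m w x s * form v s))"
    unfolding sum_distrib_left by (subst sum.swap) (simp add: mult_ac)
  also have "\<dots> = (\<Sum>w\<in>B. \<Phi> w z * form3 v w x)"
    using v x by (intro sum.cong refl) (simp add: form3_alt)
  also have "\<dots> = (\<Sum>w\<in>B. \<Phi> w z * (\<Sum>u\<in>B. m x v u * form u w))"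
    using v x by (intro sum.cong refl) (simp add: form3_cyclic[of x v, symmetric] form3_def[symmetric])
  also have "\<dots> = (\<Sum>u\<in>B. m x v u * (\<Sum>w\<in>B. form u w * \<Phi> w z))"
    unfolding sum_distrib_left by (subst sum.swap) (simp add: mult_ac)
  also have "\<dots> = (\<Sum>u\<in>B. if u = z then m x v u else 0)"
    using z by (intro sum.cong refl) (simp add: form_Phi')
  also have "\<dots> = m x v z" using z fin by simp
  finally show "(\<Sum>s\<in>B. form v s * (\<Sum>y\<in>B. \<Phi> s y * m x y z)) =
      (\<Sum>s\<in>B. form v s * (\<Sum>w\<in>B. \<Phi> w z * m w x s))"
    using l by simp
qed

text \<open>The invariance of the Casimir element with an arbitrary expression F in its two factors.
  In this form x can be carried from one side of a sandwich between the factors to the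
  other.\<close>

lemma casimir_move: assumes x: "x \<in> B"
  shows "(\<Sum>y\<in>B. \<Sum>s\<in>B. \<Phi> s y * (\<Sum>z\<in>B. m x y z * F z s)) =
    (\<Sum>y\<in>B. \<Sum>s\<in>B. \<Phi> s y * (\<Sum>w\<in>B. m s x w * F y w))"
proof -
  have "(\<Sum>y\<in>B. \<Sum>s\<in>B. \<Phi> s y * (\<Sum>z\<in>B. m x y z * F z s))
      = (\<Sum>s\<in>B. \<Sum>y\<in>B. \<Sum>z\<in>B. \<Phi> s y * m x y z * F z s)"
    unfolding sum_distrib_left by (subst sum.swap) (simp add: mult.assoc)
  also have "\<dots> = (\<Sum>s\<in>B. \<Sum>z\<in>B. (\<Sum>y\<in>B. \<Phi> s y * m x y z) * F z s)"
    unfolding sum_distrib_right by (intro sum.cong refl sum.swap)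
  also have "\<dots> = (\<Sum>s\<in>B. \<Sum>z\<in>B. (\<Sum>w\<in>B. \<Phi> w z * m w x s) * F z s)"
    using x by (intro sum.cong refl) (simp add: casimir)
  also have "\<dots> = (\<Sum>z\<in>B. \<Sum>s\<in>B. \<Sum>w\<in>B. \<Phi> w z * m w x s * F z s)"
    unfolding sum_distrib_right by (rule sum.swap)
  also have "\<dots> = (\<Sum>z\<in>B. \<Sum>w\<in>B. \<Sum>s\<in>B. \<Phi> w z * m w x s * F z s)"
    by (intro sum.cong refl sum.swap)
  also have "\<dots> = (\<Sum>y\<in>B. \<Sum>s\<in>B. \<Phi> s y * (\<Sum>w\<in>B. m s x w * F y w))"
    by (simp add: sum_distrib_left mult.assoc)
  finally show ?thesis .
qed

text \<open>The product s y of the Casimir factors is the unit, whose coordinates are all 1. Paired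
  with v, it becomes by cyclicity the sum of \<Phi> s y \<lambda>(yvs), which is the trace of right
  multiplication by v, namely 1; the unit paired with v gives \<lambda>(v) = 1 too. The
  normalization is exact because the form is the trace form of the regular representation.\<close>

lemma casimir_one: assumes x: "x \<in> B" shows "(\<Sum>y\<in>B. \<Sum>s\<in>B. \<Phi> s y * m s y x) = 1"
proof (rule form_cancel[where g = "\<lambda>x. 1", OF _ x])
  fix v assume v: "v \<in> B"
  have "(\<Sum>x\<in>B. form v x * (\<Sum>y\<in>B. \<Sum>s\<in>B. \<Phi> s y * m s y x))
      = (\<Sum>x\<in>B. \<Sum>y\<in>B. \<Sum>s\<in>B. \<Phi> s y * (m s y x * form v x))"
    by (simp add: sum_distrib_left mult_ac)
  also have "\<dots> = (\<Sum>y\<in>B. \<Sum>x\<in>B. \<Sum>s\<in>B. \<Phi> s y * (m s y x * form v x))"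
    by (rule sum.swap)
  also have "\<dots> = (\<Sum>y\<in>B. \<Sum>s\<in>B. \<Sum>x\<in>B. \<Phi> s y * (m s y x * form v x))"
    by (intro sum.cong refl sum.swap)
  also have "\<dots> = (\<Sum>y\<in>B. \<Sum>s\<in>B. \<Phi> s y * form3 v s y)"
    using v by (intro sum.cong refl) (simp add: form3_alt sum_distrib_left)
  also have "\<dots> = (\<Sum>y\<in>B. \<Sum>s\<in>B. \<Phi> s y * form3 y v s)"
    using v by (intro sum.cong refl) (simp add: form3_cyclic[of _ v])
  also have "\<dots> = (\<Sum>y\<in>B. \<Sum>u\<in>B. \<Sum>s\<in>B. m y v u * (form u s * \<Phi> s y))"
    unfolding form3_def sum_distrib_left by (rule sum.cong[OF refl], subst sum.swap) (simp add: mult_ac)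
  also have "\<dots> = (\<Sum>y\<in>B. \<Sum>u\<in>B. if u = y then m y v u else 0)"
    by (intro sum.cong refl) (simp add: form_Phi' flip: sum_distrib_left)
  also have "\<dots> = 1" using v fin by (simp add: trace_one)
  also have "1 = (\<Sum>x\<in>B. form v x * 1)"
    unfolding form_def mult_1_right using v fin by (subst sum.swap) (simp add: unit_right)
  finally show "(\<Sum>x\<in>B. form v x * (\<Sum>y\<in>B. \<Sum>s\<in>B. \<Phi> s y * m s y x)) = (\<Sum>x\<in>B. form v x * 1)" .
qed

lemma casimir_sum: "(\<Sum>y\<in>B. \<Sum>s\<in>B. \<Phi> s y * (\<Sum>x\<in>B. m s y x * F x)) = (\<Sum>x\<in>B. F x)"
proof -
  have "(\<Sum>y\<in>B. \<Sum>s\<in>B. \<Phi> s y * (\<Sum>x\<in>B. m s y x * F x))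
      = (\<Sum>y\<in>B. \<Sum>x\<in>B. \<Sum>s\<in>B. \<Phi> s y * m s y x * F x)"
    unfolding sum_distrib_left by (rule sum.cong[OF refl], subst sum.swap) (simp add: mult.assoc)
  also have "\<dots> = (\<Sum>x\<in>B. (\<Sum>y\<in>B. \<Sum>s\<in>B. \<Phi> s y * m s y x) * F x)"
    unfolding sum_distrib_right by (rule sum.swap)
  also have "\<dots> = (\<Sum>x\<in>B. F x)" by (intro sum.cong refl) (simp add: casimir_one)
  finally show ?thesis .
qed

text \<open>The coordinate at z of the product y b s, where b is sandwiched between the Casimir
  factors y and s.\<close>

definition mul3 :: "'b \<Rightarrow> 'b \<Rightarrow> 'b \<Rightarrow> 'b \<Rightarrow> 'k" where
  "mul3 b y s z = (\<Sum>v\<in>B. m y b v * m v s z)"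

lemma mul3_right: assumes "b \<in> B" "y \<in> B" "s \<in> B" "c \<in> B" "x \<in> B"
  shows "(\<Sum>z\<in>B. mul3 b y s z * m z c x) = (\<Sum>q\<in>B. m s c q * mul3 b y q x)"
proof -
  have "(\<Sum>z\<in>B. mul3 b y s z * m z c x) = (\<Sum>v\<in>B. m y b v * (\<Sum>z\<in>B. m v s z * m z c x))"
    unfolding mul3_def sum_distrib_left sum_distrib_right by (subst sum.swap) (simp add: mult.assoc)
  also have "\<dots> = (\<Sum>v\<in>B. m y b v * (\<Sum>q\<in>B. m s c q * m v q x))"
    using assms by (intro sum.cong refl arg_cong2[where f = times] assoc) auto
  also have "\<dots> = (\<Sum>q\<in>B. m s c q * mul3 b y q x)"
    unfolding mul3_def sum_distrib_left sum_distrib_right by (subst sum.swap) (simp add: mult_ac)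
  finally show ?thesis .
qed

lemma mul3_left: assumes "b \<in> B" "y \<in> B" "s \<in> B" "c \<in> B" "x \<in> B"
  shows "(\<Sum>z\<in>B. mul3 b y s z * m c z x) = (\<Sum>q\<in>B. m c y q * mul3 b q s x)"
proof -
  have "(\<Sum>z\<in>B. mul3 b y s z * m c z x) = (\<Sum>v\<in>B. m y b v * (\<Sum>z\<in>B. m v s z * m c z x))"
    unfolding mul3_def sum_distrib_left sum_distrib_right by (subst sum.swap) (simp add: mult.assoc)
  also have "\<dots> = (\<Sum>v\<in>B. m y b v * (\<Sum>w\<in>B. m c v w * m w s x))"
    using assms by (intro sum.cong refl arg_cong2[where f = times] assoc[symmetric]) auto
  also have "\<dots> = (\<Sum>w\<in>B. (\<Sum>v\<in>B. m y b v * m c v w) * m w s x)"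
    unfolding sum_distrib_left sum_distrib_right by (subst sum.swap) (simp add: mult.assoc)
  also have "\<dots> = (\<Sum>w\<in>B. (\<Sum>q\<in>B. m c y q * m q b w) * m w s x)"
    using assms by (intro sum.cong refl arg_cong2[where f = times] assoc[symmetric]) auto
  also have "\<dots> = (\<Sum>q\<in>B. m c y q * mul3 b q s x)"
    unfolding mul3_def sum_distrib_left sum_distrib_right by (subst sum.swap) (simp add: mult.assoc)
  finally show ?thesis .
qed

text \<open>Sandwiching b between the Casimir factors gives a central element by
  \<open>casimir_move\<close>, hence a multiple l of the unit. Its value under \<lambda> is |B| l,
  and it is also the trace of right multiplication by b, which is 1.\<close>

lemma casimir_average: assumes b: "b \<in> B" and z: "z \<in> B"
  shows "(\<Sum>y\<in>B. \<Sum>s\<in>B. \<Phi> s y * mul3 b y s z) = 1 / of_nat (card B)"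
proof -
  define E where "E z = (\<Sum>y\<in>B. \<Sum>s\<in>B. \<Phi> s y * mul3 b y s z)" for z
  have pull: "(\<Sum>z\<in>B. E z * g z) = (\<Sum>y\<in>B. \<Sum>s\<in>B. \<Phi> s y * (\<Sum>z\<in>B. mul3 b y s z * g z))" for g
  proof -
    have "(\<Sum>z\<in>B. E z * g z) = (\<Sum>z\<in>B. \<Sum>y\<in>B. \<Sum>s\<in>B. \<Phi> s y * (mul3 b y s z * g z))"
      unfolding E_def by (simp add: sum_distrib_right mult.assoc)
    also have "\<dots> = (\<Sum>y\<in>B. \<Sum>z\<in>B. \<Sum>s\<in>B. \<Phi> s y * (mul3 b y s z * g z))" by (rule sum.swap)
    also have "\<dots> = (\<Sum>y\<in>B. \<Sum>s\<in>B. \<Sum>z\<in>B. \<Phi> s y * (mul3 b y s z * g z))"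
      by (intro sum.cong refl sum.swap)
    finally show ?thesis by (simp add: sum_distrib_left)
  qed
  have "\<exists>l. \<forall>z\<in>B. E z = l"
  proof (rule center)
    fix c x assume c: "c \<in> B" and x: "x \<in> B"
    have "(\<Sum>z\<in>B. E z * m z c x) = (\<Sum>y\<in>B. \<Sum>s\<in>B. \<Phi> s y * (\<Sum>q\<in>B. m s c q * mul3 b y q x))"
      unfolding pull using b c x by (intro sum.cong refl) (simp add: mul3_right)
    also have "\<dots> = (\<Sum>y\<in>B. \<Sum>s\<in>B. \<Phi> s y * (\<Sum>q\<in>B. m c y q * mul3 b q s x))"
      by (rule casimir_move[OF c, symmetric])
    also have "\<dots> = (\<Sum>z\<in>B. E z * m c z x)"
      unfolding pull using b c x by (intro sum.cong refl) (simp add: mul3_left)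
    finally show "(\<Sum>z\<in>B. E z * m z c x) = (\<Sum>z\<in>B. E z * m c z x)" .
  qed
  then obtain l where l: "\<And>z. z \<in> B \<Longrightarrow> E z = l" by blast
  have "of_nat (card B) * l = (\<Sum>z\<in>B. E z * 1)" by (simp add: l)
  also have "\<dots> = (\<Sum>y\<in>B. \<Sum>s\<in>B. \<Phi> s y * (\<Sum>v\<in>B. m y b v * form v s))"
  proof -
    have "(\<Sum>z\<in>B. mul3 b y s z) = (\<Sum>v\<in>B. m y b v * form v s)" for y s
      unfolding mul3_def form_def sum_distrib_left by (rule sum.swap)
    then show ?thesis using pull[of "\<lambda>_. 1"] by simp
  qed
  also have "\<dots> = (\<Sum>y\<in>B. \<Sum>v\<in>B. m y b v * (\<Sum>s\<in>B. form v s * \<Phi> s y))"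
    unfolding sum_distrib_left by (rule sum.cong[OF refl], subst sum.swap) (simp add: mult_ac)
  also have "\<dots> = (\<Sum>y\<in>B. \<Sum>v\<in>B. if v = y then m y b v else 0)"
    by (intro sum.cong refl) (simp add: form_Phi')
  also have "\<dots> = 1" using b fin by (simp add: trace_one)
  finally show ?thesis using l[OF z] card_ne by (simp add: E_def field_simps)
qed

text \<open>Matrix units sandwiched between the Casimir factors are scalar by Schur's lemma, and
  \<open>casimir_sum\<close> evaluates the scalars through traces; this makes the matrix
  coefficients of P linearly independent. Conversely, \<open>casimir_average\<close> gives every P b
  the trace n/|B|, so the trace form of P is proportional to the nondegenerate form and the matrices
  P b are linearly independent. The two counts give n^2 = |B|, and one Q witnesses both.\<close>

lemma irreducible_dual_basis:
  fixes P :: "'b \<Rightarrow> 'k mat" and n :: nat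
  assumes P: "\<And>b. b \<in> B \<Longrightarrow> P b \<in> carrier_mat n n"
    and mult: "\<And>b c i j. b \<in> B \<Longrightarrow> c \<in> B \<Longrightarrow> i < n \<Longrightarrow> j < n \<Longrightarrow>
      (P b * P c) $$ (i, j) = (\<Sum>x\<in>B. m b c x * P x $$ (i, j))"
    and one: "\<And>i j. i < n \<Longrightarrow> j < n \<Longrightarrow> (\<Sum>b\<in>B. P b $$ (i, j)) = (if i = j then 1 else 0)"
    and irr: "irreducible_on B (n, P)"
  shows "n * n = card B"
    and "\<exists>Q. (\<forall>s\<in>B. \<forall>s'\<in>B. (\<Sum>(i, j)\<in>{..<n} \<times> {..<n}. P s $$ (i, j) * Q s' i j) = (if s = s' then 1 else 0)) \<and>
      (\<forall>i<n. \<forall>j<n. \<forall>i'<n. \<forall>j'<n. (\<Sum>s\<in>B. P s $$ (i, j) * Q s i' j') = (if i = i' \<and> j = j' then 1 else 0))"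
proof -
  have npos: "n > 0" using irr by (simp add: irreducible_on_def)
  define p where "p b i j = P b $$ (i, j)" for b i j
  have pm: "(\<Sum>k<n. p b i k * p c k j) = (\<Sum>x\<in>B. m b c x * p x i j)"
    if "b \<in> B" "c \<in> B" "i < n" "j < n" for b c i j
    using mult[OF that] P[OF that(1)] P[OF that(2)] that
    by (simp add: p_def scalar_prod_def atLeast0LessThan)
  \<comment> \<open>\<open>C q r\<close> is the matrix \<Sum> \<Phi> s y P(y) E P(s), where E is the
    matrix unit at (q, r).\<close>
  define C where "C q r i j = (\<Sum>y\<in>B. \<Sum>s\<in>B. \<Phi> s y * (p y i q * p s r j))" for q r i j
  have "\<exists>l. \<forall>i<n. \<forall>j<n. C q r i j = (if i = j then l else 0)" if q: "q < n" and r: "r < n" for q r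
  proof -
    let ?M = "mat n n (\<lambda>(i, j). C q r i j)"
    have "\<exists>l. ?M = l \<cdot>\<^sub>m 1\<^sub>m n"
    proof (rule schur_scalar[OF irr P])
      fix x assume x: "x \<in> B"
      show "?M * P x = P x * ?M"
      proof (rule eq_matI)
        fix i j assume "i < dim_row (P x * ?M)" "j < dim_col (P x * ?M)"
        then have ij: "i < n" "j < n" using P[OF x] by auto
        have "(?M * P x) $$ (i, j) = (\<Sum>k<n. C q r i k * p x k j)"
          using ij P[OF x] by (simp add: p_def scalar_prod_def atLeast0LessThan)
        also have "\<dots> = (\<Sum>k<n. \<Sum>y\<in>B. \<Sum>s\<in>B. \<Phi> s y * (p y i q * (p s r k * p x k j)))"
          by (simp add: C_def sum_distrib_right mult.assoc)
        also have "\<dots> = (\<Sum>y\<in>B. \<Sum>s\<in>B. \<Phi> s y * (p y i q * (\<Sum>k<n. p s r k * p x k j)))"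
          by (subst sum_sum_swap3) (simp add: sum_distrib_left)
        also have "\<dots> = (\<Sum>y\<in>B. \<Sum>s\<in>B. \<Phi> s y * (\<Sum>w\<in>B. m s x w * (p y i q * p w r j)))"
          using x ij r by (intro sum.cong refl) (simp add: pm sum_distrib_left mult_ac)
        also have "\<dots> = (\<Sum>y\<in>B. \<Sum>s\<in>B. \<Phi> s y * (\<Sum>z\<in>B. m x y z * (p z i q * p s r j)))"
          by (rule casimir_move[OF x, symmetric])
        also have "\<dots> = (\<Sum>y\<in>B. \<Sum>s\<in>B. \<Phi> s y * ((\<Sum>k<n. p x i k * p y k q) * p s r j))"
          using x ij q by (intro sum.cong refl) (subst pm, auto simp: sum_distrib_left sum_distrib_right mult_ac)
        also have "\<dots> = (\<Sum>y\<in>B. \<Sum>s\<in>B. \<Sum>k<n. p x i k * (\<Phi> s y * (p y k q * p s r j)))"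
          by (simp add: sum_distrib_left sum_distrib_right mult_ac)
        also have "\<dots> = (\<Sum>k<n. p x i k * C q r k j)"
          by (subst sum_sum_swap3[symmetric]) (simp add: C_def sum_distrib_left)
        also have "\<dots> = (P x * ?M) $$ (i, j)"
          using ij P[OF x] by (simp add: p_def scalar_prod_def atLeast0LessThan)
        finally show "(?M * P x) $$ (i, j) = (P x * ?M) $$ (i, j)" .
      qed (use P[OF x] in auto)
    qed auto
    then obtain l where l: "?M = l \<cdot>\<^sub>m 1\<^sub>m n" by blast
    have "C q r i j = (if i = j then l else 0)" if "i < n" "j < n" for i j
    proof -
      have "C q r i j = ?M $$ (i, j)" using that by simp
      also have "\<dots> = (if i = j then l else 0)" unfolding l using that by simp
      finally show ?thesis .
    qed
    then show ?thesis by blast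
  qed
  then obtain l where l: "\<And>q r i j. q < n \<Longrightarrow> r < n \<Longrightarrow> i < n \<Longrightarrow> j < n \<Longrightarrow>
      C q r i j = (if i = j then l q r else 0)" by metis
  have nl: "of_nat n * l q r = (if r = q then 1 else 0)" if "q < n" "r < n" for q r
  proof -
    have "of_nat n * l q r = (\<Sum>i<n. C q r i i)" using that by (simp add: l)
    also have "\<dots> = (\<Sum>y\<in>B. \<Sum>s\<in>B. \<Phi> s y * (\<Sum>i<n. p s r i * p y i q))"
      unfolding C_def by (subst sum_sum_swap3) (simp add: sum_distrib_left mult_ac)
    also have "\<dots> = (\<Sum>y\<in>B. \<Sum>s\<in>B. \<Phi> s y * (\<Sum>x\<in>B. m s y x * p x r q))"
      using that by (intro sum.cong refl) (simp add: pm)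
    also have "\<dots> = (if r = q then 1 else 0)"
      unfolding casimir_sum using one[OF that(2,1)] by (simp add: p_def)
    finally show ?thesis .
  qed
  \<comment> \<open>The case q = r exhibits an inverse of n in the field, whatever the
    characteristic.\<close>
  have n_ne: "of_nat n \<noteq> (0::'k)" using nl[of 0 0] npos by auto
  have orth: "of_nat n * C q r i j = (if i = j \<and> r = q then 1 else 0)"
    if "q < n" "r < n" "i < n" "j < n" for q r i j
    using nl[of q r] l[of q r i j] that by auto
  have trace: "(\<Sum>i<n. p b i i) = of_nat n / of_nat (card B)" if b: "b \<in> B" for b
  proof -
    have mul3_p: "(\<Sum>z\<in>B. mul3 b y s z * p z i j) = (\<Sum>h<n. \<Sum>k<n. p b k h * (p s h j * p y i k))"
      if "y \<in> B" "s \<in> B" "i < n" "j < n" for y s i j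
    proof -
      have "(\<Sum>z\<in>B. mul3 b y s z * p z i j) = (\<Sum>v\<in>B. m y b v * (\<Sum>z\<in>B. m v s z * p z i j))"
        unfolding mul3_def sum_distrib_left sum_distrib_right by (subst sum.swap) (simp add: mult.assoc)
      also have "\<dots> = (\<Sum>v\<in>B. m y b v * (\<Sum>h<n. p v i h * p s h j))"
        using that by (intro sum.cong refl) (simp add: pm)
      also have "\<dots> = (\<Sum>h<n. (\<Sum>v\<in>B. m y b v * p v i h) * p s h j)"
        unfolding sum_distrib_left sum_distrib_right by (subst sum.swap) (simp add: mult.assoc)
      also have "\<dots> = (\<Sum>h<n. (\<Sum>k<n. p y i k * p b k h) * p s h j)"
        using that b by (intro sum.cong refl) (simp add: pm)
      also have "\<dots> = (\<Sum>h<n. \<Sum>k<n. p b k h * (p s h j * p y i k))"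
        by (simp add: sum_distrib_left sum_distrib_right mult_ac)
      finally show ?thesis .
    qed
    \<comment> \<open>The trace of the sandwiched b is evaluated twice. By
      \<open>casimir_average\<close> it is n/|B|, because the P z sum to the identity. By cyclicity
      of the trace it is the trace of the product of P b with \<Sum> \<Phi> s y P(s) P(y), and the
      latter matrix is the identity by \<open>casimir_sum\<close>.\<close>
    have "(\<Sum>y\<in>B. \<Sum>s\<in>B. \<Phi> s y * (\<Sum>i<n. \<Sum>z\<in>B. mul3 b y s z * p z i i)) =
        (\<Sum>z\<in>B. (\<Sum>y\<in>B. \<Sum>s\<in>B. \<Phi> s y * mul3 b y s z) * (\<Sum>i<n. p z i i))"
    proof -
      have "(\<Sum>z\<in>B. (\<Sum>y\<in>B. \<Sum>s\<in>B. \<Phi> s y * mul3 b y s z) * (\<Sum>i<n. p z i i))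
          = (\<Sum>z\<in>B. \<Sum>y\<in>B. \<Sum>s\<in>B. \<Phi> s y * (mul3 b y s z * (\<Sum>i<n. p z i i)))"
        by (simp only: sum_distrib_right mult.assoc)
      also have "\<dots> = (\<Sum>z\<in>B. \<Sum>y\<in>B. \<Sum>s\<in>B. \<Phi> s y * (\<Sum>i<n. mul3 b y s z * p z i i))"
        by (simp only: sum_distrib_left)
      also have "\<dots> = (\<Sum>y\<in>B. \<Sum>s\<in>B. \<Sum>z\<in>B. \<Phi> s y * (\<Sum>i<n. mul3 b y s z * p z i i))"
        by (rule sum_sum_swap3)
      also have "\<dots> = (\<Sum>y\<in>B. \<Sum>s\<in>B. \<Phi> s y * (\<Sum>z\<in>B. \<Sum>i<n. mul3 b y s z * p z i i))"
        by (simp add: sum_distrib_left)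
      also have "\<dots> = (\<Sum>y\<in>B. \<Sum>s\<in>B. \<Phi> s y * (\<Sum>i<n. \<Sum>z\<in>B. mul3 b y s z * p z i i))"
        by (intro sum.cong refl arg_cong2[where f = times] sum.swap)
      finally show ?thesis ..
    qed
    also have "\<dots> = (\<Sum>z\<in>B. 1 / of_nat (card B) * (\<Sum>i<n. p z i i))"
      using b by (intro sum.cong refl) (simp add: casimir_average)
    also have "\<dots> = 1 / of_nat (card B) * (\<Sum>i<n. \<Sum>z\<in>B. p z i i)"
      by (subst sum.swap) (simp add: sum_distrib_left)
    also have "\<dots> = of_nat n / of_nat (card B)" by (simp add: p_def one)
    finally have 1: "(\<Sum>y\<in>B. \<Sum>s\<in>B. \<Phi> s y * (\<Sum>i<n. \<Sum>z\<in>B. mul3 b y s z * p z i i))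
      = of_nat n / of_nat (card B)" .
    have "(\<Sum>y\<in>B. \<Sum>s\<in>B. \<Phi> s y * (\<Sum>i<n. \<Sum>z\<in>B. mul3 b y s z * p z i i))
        = (\<Sum>y\<in>B. \<Sum>s\<in>B. \<Phi> s y * (\<Sum>h<n. \<Sum>k<n. p b k h * (\<Sum>x\<in>B. m s y x * p x h k)))"
    proof (rule sum.cong[OF refl], rule sum.cong[OF refl], rule arg_cong2[where f = times, OF refl])
      fix y s assume ys: "y \<in> B" "s \<in> B"
      have "(\<Sum>i<n. \<Sum>z\<in>B. mul3 b y s z * p z i i)
          = (\<Sum>i<n. \<Sum>h<n. \<Sum>k<n. p b k h * (p s h i * p y i k))"
        using ys by (intro sum.cong refl) (simp add: mul3_p)
      also have "\<dots> = (\<Sum>h<n. \<Sum>k<n. p b k h * (\<Sum>i<n. p s h i * p y i k))"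
        by (subst sum_sum_swap3) (simp add: sum_distrib_left)
      also have "\<dots> = (\<Sum>h<n. \<Sum>k<n. p b k h * (\<Sum>x\<in>B. m s y x * p x h k))"
        using ys by (intro sum.cong refl) (simp add: pm)
      finally show "(\<Sum>i<n. \<Sum>z\<in>B. mul3 b y s z * p z i i) =
        (\<Sum>h<n. \<Sum>k<n. p b k h * (\<Sum>x\<in>B. m s y x * p x h k))" .
    qed
    also have "\<dots> = (\<Sum>y\<in>B. \<Sum>s\<in>B. \<Phi> s y * (\<Sum>x\<in>B. m s y x * (\<Sum>h<n. \<Sum>k<n. p b k h * p x h k)))"
    proof (rule sum.cong[OF refl], rule sum.cong[OF refl], rule arg_cong2[where f = times, OF refl])
      fix y s assume "y \<in> B" "s \<in> B"
      have "(\<Sum>x\<in>B. m s y x * (\<Sum>h<n. \<Sum>k<n. p b k h * p x h k))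
         = (\<Sum>x\<in>B. \<Sum>h<n. \<Sum>k<n. p b k h * (m s y x * p x h k))"
        by (simp add: sum_distrib_left mult_ac)
      also have "\<dots> = (\<Sum>h<n. \<Sum>k<n. p b k h * (\<Sum>x\<in>B. m s y x * p x h k))"
        by (subst sum_sum_swap3) (simp add: sum_distrib_left)
      finally show "(\<Sum>h<n. \<Sum>k<n. p b k h * (\<Sum>x\<in>B. m s y x * p x h k)) =
        (\<Sum>x\<in>B. m s y x * (\<Sum>h<n. \<Sum>k<n. p b k h * p x h k))" ..
    qed
    also have "\<dots> = (\<Sum>x\<in>B. \<Sum>h<n. \<Sum>k<n. p b k h * p x h k)" by (rule casimir_sum)
    also have "\<dots> = (\<Sum>h<n. \<Sum>k<n. p b k h * (\<Sum>x\<in>B. p x h k))"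
      by (subst sum_sum_swap3) (simp add: sum_distrib_left)
    also have "\<dots> = (\<Sum>h<n. \<Sum>k<n. if k = h then p b k h else 0)"
      by (intro sum.cong refl) (simp add: p_def one)
    also have "\<dots> = (\<Sum>h<n. p b h h)" by simp
    finally show ?thesis using 1 by simp
  qed
  \<comment> \<open>The factor n normalizes the pairing in \<open>dual2\<close>. The indices of p
    are transposed, so that summing over i and j in \<open>dual1\<close> gives the trace of a
    product.\<close>
  define Q where "Q b i j = of_nat n * (\<Sum>s\<in>B. \<Phi> s b * p s j i)" for b i j
  have dual2: "(\<Sum>s\<in>B. P s $$ (i, j) * Q s i' j') = (if i = i' \<and> j = j' then 1 else 0)"
    if "i < n" "j < n" "i' < n" "j' < n" for i j i' j'
  proof -
    have "(\<Sum>s\<in>B. P s $$ (i, j) * Q s i' j') = of_nat n * C j j' i i'"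
      unfolding p_def[symmetric] Q_def C_def by (simp add: sum_distrib_left mult_ac)
    then show ?thesis using orth[of j j' i i'] that by auto
  qed
  have dual1: "(\<Sum>(i, j)\<in>{..<n} \<times> {..<n}. P s $$ (i, j) * Q s' i j)
      = (if s = s' then of_nat n * (of_nat n / of_nat (card B)) else 0)" if "s \<in> B" "s' \<in> B" for s s'
  proof -
    have "(\<Sum>(i, j)\<in>{..<n} \<times> {..<n}. P s $$ (i, j) * Q s' i j)
        = (\<Sum>i<n. \<Sum>j<n. \<Sum>r\<in>B. of_nat n * \<Phi> r s' * (p s i j * p r j i))"
      unfolding p_def[symmetric] Q_def
      by (simp add: sum.cartesian_product[symmetric] sum_distrib_left mult_ac)
    also have "\<dots> = (\<Sum>r\<in>B. of_nat n * \<Phi> r s' * (\<Sum>i<n. \<Sum>j<n. p s i j * p r j i))"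
      by (subst sum_sum_swap3[symmetric]) (simp add: sum_distrib_left)
    also have "\<dots> = (\<Sum>r\<in>B. of_nat n * \<Phi> r s' * (\<Sum>i<n. \<Sum>x\<in>B. m s r x * p x i i))"
      using that by (intro sum.cong refl) (simp add: pm)
    also have "\<dots> = (\<Sum>r\<in>B. of_nat n * \<Phi> r s' * (\<Sum>x\<in>B. m s r x * (of_nat n / of_nat (card B))))"
      by (subst sum.swap) (intro sum.cong refl, simp add: trace flip: sum_distrib_left)
    also have "\<dots> = of_nat n * (of_nat n / of_nat (card B)) * (\<Sum>r\<in>B. form s r * \<Phi> r s')"
      unfolding form_def by (simp add: sum_distrib_left sum_distrib_right mult_ac)
    also have "\<dots> = (if s = s' then of_nat n * (of_nat n / of_nat (card B)) else 0)"
      using that by (simp add: form_Phi')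
    finally show ?thesis .
  qed
  \<comment> \<open>At this point n^2/|B| is only known as a nonzero element of the field, which
    suffices for the second count; afterwards n^2 = |B| turns it into 1.\<close>
  define e where "e = of_nat n * (of_nat n / of_nat (card B) :: 'k)"
  have e_ne: "e \<noteq> 0" using n_ne card_ne by (simp add: e_def)
  have dual1_e: "(\<Sum>z\<in>{..<n} \<times> {..<n}. (case z of (i, j) \<Rightarrow> P s $$ (i, j)) * (case z of (i, j) \<Rightarrow> Q s' i j / e))
      = (if s = s' then 1 else 0)" if "s \<in> B" "s' \<in> B" for s s'
  proof -
    have "(\<Sum>z\<in>{..<n} \<times> {..<n}. (case z of (i, j) \<Rightarrow> P s $$ (i, j)) * (case z of (i, j) \<Rightarrow> Q s' i j / e))
        = (\<Sum>(i, j)\<in>{..<n} \<times> {..<n}. P s $$ (i, j) * Q s' i j) / e"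
      unfolding sum_divide_distrib by (intro sum.cong) auto
    then show ?thesis using dual1[OF that] e_ne by (simp add: e_def)
  qed
  have "card B \<le> card ({..<n} \<times> {..<n})"
    by (rule card_le_of_dual_families[where s = "\<lambda>s (i, j). P s $$ (i, j)" and t = "\<lambda>s (i, j). Q s i j / e"])
      (use fin dual1_e in auto)
  moreover have "card ({..<n} \<times> {..<n}) \<le> card B"
    by (rule card_le_of_dual_families[where s = "\<lambda>(i, j) s. P s $$ (i, j)" and t = "\<lambda>(i, j) s. Q s i j"])
      (use fin dual2 in \<open>auto split: if_splits\<close>)
  ultimately show nn: "n * n = card B" by (simp add: card_cartesian_product)
  have "e = 1" unfolding e_def using n_ne by (simp flip: nn)
  then show "\<exists>Q. (\<forall>s\<in>B. \<forall>s'\<in>B. (\<Sum>(i, j)\<in>{..<n} \<times> {..<n}. P s $$ (i, j) * Q s' i j) = (if s = s' then 1 else 0)) \<and>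
      (\<forall>i<n. \<forall>j<n. \<forall>i'<n. \<forall>j'<n. (\<Sum>s\<in>B. P s $$ (i, j) * Q s i' j') = (if i = i' \<and> j = j' then 1 else 0))"
    using dual1 dual2 unfolding e_def by (intro exI[of _ Q]) simp
qed

end

section \<open>Twists of group algebras\<close>

context group
begin

lemma sum_mult_left:
  assumes "x \<in> carrier G"
  shows "(\<Sum>a\<in>carrier G. f (x \<otimes> a)) = (\<Sum>a\<in>carrier G. f a)"
  by (rule sum.reindex_bij_witness[where i = "\<lambda>a. inv x \<otimes> a" and j = "\<lambda>a. x \<otimes> a"])
    (use assms in \<open>auto simp: m_assoc[symmetric]\<close>)

lemma sum_mult_right:
  assumes "x \<in> carrier G"
  shows "(\<Sum>a\<in>carrier G. f (a \<otimes> x)) = (\<Sum>a\<in>carrier G. f a)"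
  by (rule sum.reindex_bij_witness[where i = "\<lambda>a. a \<otimes> inv x" and j = "\<lambda>a. a \<otimes> x"])
    (use assms in \<open>auto simp: m_assoc\<close>)

lemma sum_inv: "(\<Sum>a\<in>carrier G. f (inv a)) = (\<Sum>a\<in>carrier G. f a)"
  by (rule sum.reindex_bij_witness[where i = "\<lambda>a. inv a" and j = "\<lambda>a. inv a"]) auto

lemma sum_inv_mult_right:
  assumes "x \<in> carrier G"
  shows "(\<Sum>a\<in>carrier G. f (inv a \<otimes> x)) = (\<Sum>a\<in>carrier G. f a)"
  using sum_inv[of "\<lambda>a. f (a \<otimes> x)"] sum_mult_right[OF assms] by simp

lemma cancel_inv_mult: "x \<in> carrier G \<Longrightarrow> y \<in> carrier G \<Longrightarrow> inv x \<otimes> (x \<otimes> y) = y"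
  "x \<in> carrier G \<Longrightarrow> y \<in> carrier G \<Longrightarrow> x \<otimes> (inv x \<otimes> y) = y"
  by (simp_all add: m_assoc[symmetric])

lemma inv_mult_eq_one: "x \<in> carrier G \<Longrightarrow> y \<in> carrier G \<Longrightarrow> inv x \<otimes> y = \<one> \<longleftrightarrow> x = y"
  by (metis inv_closed inv_equality inv_inv l_inv)

end

text \<open>The twist axioms and minimality, written out in coefficients. The inner double sum of
  \<open>nondegenerate\<close> is the coefficient of J_21^{-1} J at (a, y); that this matrix has no
  left kernel is the dual form of its left tensorands spanning everything.\<close>

locale group_twist = group M for M :: "('g, 'm) monoid_scheme" (structure) +
  fixes J J' :: "'g \<times> 'g \<Rightarrow> 'k::alg_closed_field"
  assumes fin: "finite (carrier M)"
    and cocycle: "\<And>b c d. b \<in> carrier M \<Longrightarrow> c \<in> carrier M \<Longrightarrow> d \<in> carrier M \<Longrightarrow>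
      (\<Sum>a\<in>carrier M. J (a, d) * J (inv a \<otimes> b, inv a \<otimes> c)) =
      (\<Sum>a\<in>carrier M. J (b, a) * J (inv a \<otimes> c, inv a \<otimes> d))"
    and inverse_right: "\<And>b c. b \<in> carrier M \<Longrightarrow> c \<in> carrier M \<Longrightarrow>
      (\<Sum>p\<in>carrier M. \<Sum>q\<in>carrier M. J (p, q) * J' (inv p \<otimes> b, inv q \<otimes> c)) =
      (if b = \<one> \<and> c = \<one> then 1 else 0)"
    and inverse_left: "\<And>b c. b \<in> carrier M \<Longrightarrow> c \<in> carrier M \<Longrightarrow>
      (\<Sum>p\<in>carrier M. \<Sum>q\<in>carrier M. J' (p, q) * J (inv p \<otimes> b, inv q \<otimes> c)) =
      (if b = \<one> \<and> c = \<one> then 1 else 0)"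
    and counit_left: "\<And>c. c \<in> carrier M \<Longrightarrow> (\<Sum>b\<in>carrier M. J (b, c)) = (if c = \<one> then 1 else 0)"
    and counit_right: "\<And>b. b \<in> carrier M \<Longrightarrow> (\<Sum>c\<in>carrier M. J (b, c)) = (if b = \<one> then 1 else 0)"
    and nondegenerate: "\<And>\<phi> a. (\<And>y. y \<in> carrier M \<Longrightarrow> (\<Sum>a\<in>carrier M. \<phi> a *
        (\<Sum>p\<in>carrier M. \<Sum>q\<in>carrier M. J' (q, p) * J (inv p \<otimes> a, inv q \<otimes> y))) = 0) \<Longrightarrow>
      a \<in> carrier M \<Longrightarrow> \<phi> a = 0"
    and card_nonzero: "of_nat (card (carrier M)) \<noteq> (0::'k)"
begin

text \<open>The value at x of the product of \<delta>_b and \<delta>_c, that is, the coefficient at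
  (b, c) of \<Delta>(x) J.\<close>

definition tmult :: "'g \<Rightarrow> 'g \<Rightarrow> 'g \<Rightarrow> 'k" where
  "tmult b c x = J (inv x \<otimes> b, inv x \<otimes> c)"

text \<open>The inverse matrix of the trace form, as \<open>tdual_form\<close> shows. It depends
  only on v^{-1} s, and sums J^{-1} over the pairs (a, b) with b a^{-1} = v^{-1} s.\<close>

definition tdual :: "'g \<Rightarrow> 'g \<Rightarrow> 'k" where
  "tdual s v = (\<Sum>a\<in>carrier M. J' (a, inv v \<otimes> s \<otimes> a))"

text \<open>The substitution x = y a turns the two sides into the two sides of
  \<open>cocycle\<close> for y^{-1} b, y^{-1} c and y^{-1} d.\<close>

lemma tmult_assoc:
  assumes "b \<in> carrier M" "c \<in> carrier M" "d \<in> carrier M" "y \<in> carrier M"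
  shows "(\<Sum>x\<in>carrier M. tmult b c x * tmult x d y) = (\<Sum>x\<in>carrier M. tmult c d x * tmult b x y)"
proof -
  have "(\<Sum>x\<in>carrier M. tmult b c x * tmult x d y) =
      (\<Sum>a\<in>carrier M. tmult b c (y \<otimes> a) * tmult (y \<otimes> a) d y)"
    using sum_mult_left[OF assms(4)] by (rule sym)
  also have "\<dots> = (\<Sum>a\<in>carrier M. J (a, inv y \<otimes> d) * J (inv a \<otimes> (inv y \<otimes> b), inv a \<otimes> (inv y \<otimes> c)))"
    using assms by (intro sum.cong refl)
      (simp add: tmult_def inv_mult_group m_assoc cancel_inv_mult mult.commute)
  also have "\<dots> = (\<Sum>a\<in>carrier M. J (inv y \<otimes> b, a) * J (inv a \<otimes> (inv y \<otimes> c), inv a \<otimes> (inv y \<otimes> d)))"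
    using assms by (intro cocycle) auto
  also have "\<dots> = (\<Sum>a\<in>carrier M. tmult c d (y \<otimes> a) * tmult b (y \<otimes> a) y)"
    using assms by (intro sum.cong refl)
      (simp add: tmult_def inv_mult_group m_assoc cancel_inv_mult mult.commute)
  also have "\<dots> = (\<Sum>x\<in>carrier M. tmult c d x * tmult b x y)"
    by (rule sum_mult_left[OF assms(4)])
  finally show ?thesis .
qed

lemma tmult_unit_right:
  assumes "b \<in> carrier M" "x \<in> carrier M"
  shows "(\<Sum>c\<in>carrier M. tmult b c x) = (if x = b then 1 else 0)"
  using assms sum_mult_left[of "inv x" "\<lambda>c. J (inv x \<otimes> b, c)"]
  by (simp add: tmult_def counit_right inv_mult_eq_one)

lemma tmult_unit_left:
  assumes "c \<in> carrier M" "x \<in> carrier M"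
  shows "(\<Sum>b\<in>carrier M. tmult b c x) = (if x = c then 1 else 0)"
  using assms sum_mult_left[of "inv x" "\<lambda>b. J (b, inv x \<otimes> c)"]
  by (simp add: tmult_def counit_left inv_mult_eq_one)

text \<open>The summand is J(1, y^{-1} b), so the sum is the right counit condition at the
  identity.\<close>

lemma tmult_trace:
  assumes "b \<in> carrier M"
  shows "(\<Sum>y\<in>carrier M. tmult y b y) = 1"
  using assms sum_inv_mult_right[of b "\<lambda>c. J (\<one>, c)"] by (simp add: tmult_def counit_right)

text \<open>This is why left translations, the action \<open>rho1\<close>, are automorphisms of the
  algebra.\<close>

lemma tmult_translate:
  assumes "h \<in> carrier M" "b \<in> carrier M" "c \<in> carrier M" "x \<in> carrier M"
  shows "tmult (h \<otimes> b) (h \<otimes> c) x = tmult b c (inv h \<otimes> x)"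
  using assms by (simp add: tmult_def inv_mult_group m_assoc)

text \<open>The substitution s = h^{-1} z r, v = z q leaves the convolution of J with J^{-1} at (p,
  w p), summed over p, where w = z^{-1} h^{-1} z. It is nonzero only for p = w = 1, that is, for h =
  1.\<close>

lemma tdual_translate:
  assumes h: "h \<in> carrier M" and z: "z \<in> carrier M"
  shows "(\<Sum>s\<in>carrier M. \<Sum>v\<in>carrier M. tdual s v * tmult (h \<otimes> s) v z) = (if h = \<one> then 1 else 0)"
proof -
  define w where "w = inv z \<otimes> inv h \<otimes> z"
  have w: "w \<in> carrier M" using h z by (simp add: w_def)
  have w1: "w = \<one> \<longleftrightarrow> h = \<one>"
  proof
    assume "w = \<one>"
    then have "z \<otimes> w \<otimes> inv z = \<one>" using z by simp
    moreover have "z \<otimes> w \<otimes> inv z = inv h"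
      using h z unfolding w_def by (simp add: m_assoc) (simp add: m_assoc[symmetric])
    ultimately show "h = \<one>" using h by (metis inv_inv inv_one)
  qed (use z in \<open>simp add: w_def\<close>)
  have td: "tdual (inv h \<otimes> (z \<otimes> r)) (z \<otimes> q) =
      (\<Sum>p\<in>carrier M. J' (inv r \<otimes> p, inv q \<otimes> (w \<otimes> p)))"
    if rq: "r \<in> carrier M" "q \<in> carrier M" for r q
  proof -
    have "tdual (inv h \<otimes> (z \<otimes> r)) (z \<otimes> q) =
      (\<Sum>p\<in>carrier M. J' (inv r \<otimes> p, inv (z \<otimes> q) \<otimes> (inv h \<otimes> (z \<otimes> r)) \<otimes> (inv r \<otimes> p)))"
      unfolding tdual_def using rq by (intro sum_mult_left[symmetric]) auto
    also have "\<dots> = (\<Sum>p\<in>carrier M. J' (inv r \<otimes> p, inv q \<otimes> (w \<otimes> p)))"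
      using rq h z by (intro sum.cong refl) (simp add: w_def inv_mult_group m_assoc cancel_inv_mult)
    finally show ?thesis .
  qed
  have "(\<Sum>s\<in>carrier M. \<Sum>v\<in>carrier M. tdual s v * tmult (h \<otimes> s) v z)
      = (\<Sum>s\<in>carrier M. \<Sum>q\<in>carrier M. tdual s (z \<otimes> q) * tmult (h \<otimes> s) (z \<otimes> q) z)"
    by (intro sum.cong refl sum_mult_left[symmetric] z)
  also have "\<dots> = (\<Sum>r\<in>carrier M. \<Sum>q\<in>carrier M. tdual (inv h \<otimes> (z \<otimes> r)) (z \<otimes> q) *
      tmult (h \<otimes> (inv h \<otimes> (z \<otimes> r))) (z \<otimes> q) z)"
    using h z sum_mult_left[of "inv h \<otimes> z", symmetric] by (simp add: m_assoc)
  also have "\<dots> = (\<Sum>r\<in>carrier M. \<Sum>q\<in>carrier M. \<Sum>p\<in>carrier M.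
      J (r, q) * J' (inv r \<otimes> p, inv q \<otimes> (w \<otimes> p)))"
    using h z by (intro sum.cong refl)
      (simp add: td tmult_def m_assoc cancel_inv_mult sum_distrib_left mult.commute)
  also have "\<dots> = (\<Sum>p\<in>carrier M. \<Sum>r\<in>carrier M. \<Sum>q\<in>carrier M.
      J (r, q) * J' (inv r \<otimes> p, inv q \<otimes> (w \<otimes> p)))"
    by (rule sum_sum_swap3[symmetric])
  also have "\<dots> = (\<Sum>p\<in>carrier M. if p = \<one> then (if w = \<one> then 1 else 0) else 0)"
    using w by (intro sum.cong refl) (auto simp: inverse_right)
  also have "\<dots> = (if h = \<one> then 1 else 0)" using fin w1 by simp
  finally show ?thesis .
qed

text \<open>The sum \<open>?S\<close> of \<open>tdual s v\<close> times ((hu)(hs))v over h, s and v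
  is computed twice. Translation by h is multiplicative, so summing over h turns (hu)(hs) into
  \<lambda>(us) times the unit, which leaves the wanted pairing. Reassociated as (hu)((hs)v), the
  sum over s and v vanishes by \<open>tdual_translate\<close> unless h = 1, and then only u
  remains.\<close>

lemma tdual_form:
  assumes u: "u \<in> carrier M" and z: "z \<in> carrier M"
  shows "(\<Sum>s\<in>carrier M. (\<Sum>x\<in>carrier M. tmult u s x) * tdual s z) = (if u = z then 1 else 0)"
proof -
  let ?S = "\<Sum>h\<in>carrier M. \<Sum>s\<in>carrier M. \<Sum>v\<in>carrier M. tdual s v *
    (\<Sum>x\<in>carrier M. tmult (h \<otimes> u) (h \<otimes> s) x * tmult x v z)"
  have "?S = (\<Sum>s\<in>carrier M. \<Sum>v\<in>carrier M. \<Sum>h\<in>carrier M. tdual s v *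
    (\<Sum>x\<in>carrier M. tmult (h \<otimes> u) (h \<otimes> s) x * tmult x v z))"
    by (rule sum_sum_swap3)
  also have "\<dots> = (\<Sum>s\<in>carrier M. \<Sum>v\<in>carrier M. tdual s v *
      (\<Sum>x\<in>carrier M. (\<Sum>h\<in>carrier M. tmult u s (inv h \<otimes> x)) * tmult x v z))"
  proof (rule sum.cong[OF refl], rule sum.cong[OF refl])
    fix s v assume s: "s \<in> carrier M" and v: "v \<in> carrier M"
    have "(\<Sum>h\<in>carrier M. tdual s v * (\<Sum>x\<in>carrier M. tmult (h \<otimes> u) (h \<otimes> s) x * tmult x v z))
        = tdual s v * (\<Sum>h\<in>carrier M. \<Sum>x\<in>carrier M. tmult u s (inv h \<otimes> x) * tmult x v z)"
      using s u by (simp add: sum_distrib_left tmult_translate)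
    also have "\<dots> = tdual s v * (\<Sum>x\<in>carrier M. \<Sum>h\<in>carrier M. tmult u s (inv h \<otimes> x) * tmult x v z)"
      by (subst sum.swap) rule
    finally show "(\<Sum>h\<in>carrier M. tdual s v * (\<Sum>x\<in>carrier M. tmult (h \<otimes> u) (h \<otimes> s) x * tmult x v z))
        = tdual s v * (\<Sum>x\<in>carrier M. (\<Sum>h\<in>carrier M. tmult u s (inv h \<otimes> x)) * tmult x v z)"
      by (simp add: sum_distrib_right)
  qed
  also have "\<dots> = (\<Sum>s\<in>carrier M. \<Sum>v\<in>carrier M. tdual s v *
      ((\<Sum>x\<in>carrier M. tmult u s x) * (\<Sum>x\<in>carrier M. tmult x v z)))"
    by (intro sum.cong refl arg_cong2[where f = times]) (simp add: sum_inv_mult_right sum_distrib_left)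
  also have "\<dots> = (\<Sum>s\<in>carrier M. \<Sum>v\<in>carrier M.
      if v = z then (\<Sum>x\<in>carrier M. tmult u s x) * tdual s v else 0)"
    using z by (intro sum.cong refl) (auto simp: tmult_unit_left mult.commute)
  also have "\<dots> = (\<Sum>s\<in>carrier M. (\<Sum>x\<in>carrier M. tmult u s x) * tdual s z)"
    using fin z by simp
  finally have 1: "?S = (\<Sum>s\<in>carrier M. (\<Sum>x\<in>carrier M. tmult u s x) * tdual s z)" .
  have "?S = (\<Sum>h\<in>carrier M. if h = \<one> then (if u = z then 1 else 0) else 0)"
  proof (rule sum.cong[OF refl])
    fix h assume h: "h \<in> carrier M"
    have "(\<Sum>s\<in>carrier M. \<Sum>v\<in>carrier M. tdual s v *
        (\<Sum>x\<in>carrier M. tmult (h \<otimes> u) (h \<otimes> s) x * tmult x v z))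
      = (\<Sum>s\<in>carrier M. \<Sum>v\<in>carrier M. tdual s v *
        (\<Sum>x\<in>carrier M. tmult (h \<otimes> s) v x * tmult (h \<otimes> u) x z))"
      using h u z by (intro sum.cong refl arg_cong2[where f = times] tmult_assoc) auto
    also have "\<dots> = (\<Sum>s\<in>carrier M. \<Sum>v\<in>carrier M. \<Sum>x\<in>carrier M.
        tdual s v * tmult (h \<otimes> s) v x * tmult (h \<otimes> u) x z)"
      by (simp add: sum_distrib_left mult.assoc)
    also have "\<dots> = (\<Sum>x\<in>carrier M. (\<Sum>s\<in>carrier M. \<Sum>v\<in>carrier M.
        tdual s v * tmult (h \<otimes> s) v x) * tmult (h \<otimes> u) x z)"
      by (subst sum_sum_swap3[symmetric]) (simp add: sum_distrib_right)
    also have "\<dots> = (\<Sum>x\<in>carrier M. (if h = \<one> then 1 else 0) * tmult (h \<otimes> u) x z)"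
      using h by (intro sum.cong refl) (simp add: tdual_translate)
    also have "\<dots> = (if h = \<one> then (if u = z then 1 else 0) else 0)"
      using u z by (simp add: tmult_unit_right)
    finally show "(\<Sum>s\<in>carrier M. \<Sum>v\<in>carrier M. tdual s v *
        (\<Sum>x\<in>carrier M. tmult (h \<otimes> u) (h \<otimes> s) x * tmult x v z))
      = (if h = \<one> then (if u = z then 1 else 0) else 0)" .
  qed
  also have "\<dots> = (if u = z then 1 else 0)" using fin by simp
  finally show ?thesis using 1 by simp
qed

text \<open>Centrality allows the arguments of J to be exchanged under the sum with z, so J_21^{-1}
  meets J_21 instead of J and only the value at the identity survives. The constant function with
  value \<open>z \<one>\<close> satisfies the same equation, and nondegeneracy of J_21^{-1} J
  identifies the two.\<close>

lemma central_constant: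
  assumes central: "\<And>c x. c \<in> carrier M \<Longrightarrow> x \<in> carrier M \<Longrightarrow>
    (\<Sum>b\<in>carrier M. z b * tmult b c x) = (\<Sum>b\<in>carrier M. z b * tmult c b x)"
    and a: "a \<in> carrier M"
  shows "z a = z \<one>"
proof -
  let ?R = "\<lambda>a y. \<Sum>p\<in>carrier M. \<Sum>q\<in>carrier M. J' (q, p) * J (inv p \<otimes> a, inv q \<otimes> y)"
  have *: "(\<Sum>a\<in>carrier M. z a * ?R a y) = (if y = \<one> then z \<one> else 0)"
    if central: "\<And>c x. c \<in> carrier M \<Longrightarrow> x \<in> carrier M \<Longrightarrow>
      (\<Sum>b\<in>carrier M. z b * tmult b c x) = (\<Sum>b\<in>carrier M. z b * tmult c b x)"
    and y: "y \<in> carrier M" for z y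
  proof -
    have swap: "(\<Sum>a\<in>carrier M. z a * J (inv p \<otimes> a, inv q \<otimes> y)) = (\<Sum>a\<in>carrier M. z a * J (inv q \<otimes> y, inv p \<otimes> a))"
      if "p \<in> carrier M" "q \<in> carrier M" for p q
      \<comment> \<open>With x = p and c = p q^{-1} y, the product of \<delta>_a and \<delta>_c at x
        is J(p^{-1} a, q^{-1} y), so the arguments of J are arbitrary translates.\<close>
      using central[of "p \<otimes> inv q \<otimes> y" p] that y by (simp add: tmult_def m_assoc cancel_inv_mult)
    have "(\<Sum>a\<in>carrier M. z a * ?R a y) = (\<Sum>a\<in>carrier M. \<Sum>p\<in>carrier M. \<Sum>q\<in>carrier M.
        J' (q, p) * (z a * J (inv p \<otimes> a, inv q \<otimes> y)))"
      by (simp add: sum_distrib_left mult.left_commute)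
    also have "\<dots> = (\<Sum>p\<in>carrier M. \<Sum>q\<in>carrier M.
        J' (q, p) * (\<Sum>a\<in>carrier M. z a * J (inv p \<otimes> a, inv q \<otimes> y)))"
      by (subst sum_sum_swap3) (simp add: sum_distrib_left)
    also have "\<dots> = (\<Sum>p\<in>carrier M. \<Sum>q\<in>carrier M.
        J' (q, p) * (\<Sum>a\<in>carrier M. z a * J (inv q \<otimes> y, inv p \<otimes> a)))"
      by (intro sum.cong refl) (simp add: swap)
    also have "\<dots> = (\<Sum>q\<in>carrier M. \<Sum>p\<in>carrier M.
        J' (q, p) * (\<Sum>a\<in>carrier M. z a * J (inv q \<otimes> y, inv p \<otimes> a)))"
      by (rule sum.swap)
    also have "\<dots> = (\<Sum>a\<in>carrier M. z a * (\<Sum>q\<in>carrier M. \<Sum>p\<in>carrier M.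
        J' (q, p) * J (inv q \<otimes> y, inv p \<otimes> a)))"
      unfolding sum_distrib_left by (subst sum_sum_swap3[symmetric]) (simp add: mult.left_commute)
    also have "\<dots> = (\<Sum>a\<in>carrier M. if a = \<one> then (if y = \<one> then z \<one> else 0) else 0)"
      using y by (intro sum.cong refl) (auto simp: inverse_left)
    finally show ?thesis using fin by simp
  qed
  have "z a - z \<one> = 0"
  proof (rule nondegenerate[OF _ a])
    fix y assume y: "y \<in> carrier M"
    have "(\<Sum>a\<in>carrier M. z \<one> * ?R a y) = (if y = \<one> then z \<one> else 0)"
    proof (rule *[OF _ y])
      fix c x assume "c \<in> carrier M" "x \<in> carrier M"
      then show "(\<Sum>b\<in>carrier M. z \<one> * tmult b c x) = (\<Sum>b\<in>carrier M. z \<one> * tmult c b x)"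
        by (simp add: tmult_unit_left tmult_unit_right flip: sum_distrib_left)
    qed
    then show "(\<Sum>a\<in>carrier M. (z a - z \<one>) * ?R a y) = 0"
      using *[OF central y] by (simp add: left_diff_distrib sum_subtractf)
  qed
  then show ?thesis by simp
qed

sublocale twisted: frobenius_algebra "carrier M" tmult tdual
proof
  fix z assume "\<And>c x. c \<in> carrier M \<Longrightarrow> x \<in> carrier M \<Longrightarrow>
    (\<Sum>b\<in>carrier M. z b * tmult b c x) = (\<Sum>b\<in>carrier M. z b * tmult c b x)"
  from central_constant[OF this] show "\<exists>l. \<forall>b\<in>carrier M. z b = l" by blast
qed (simp_all add: fin tmult_assoc tmult_unit_right tmult_trace tdual_form card_nonzero)

end

section \<open>Group algebras and their tensor powers as convolution algebras\<close>

lemma amul_cong: "bas A = bas B \<Longrightarrow> mcoeff A = mcoeff B \<Longrightarrow> amul A = amul B"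
  by (intro ext) (simp add: amul_def)

lemma kd_pair: "kd (a, b) (x, y) = kd a x * (kd b y :: 'k::field)"
  by (simp add: kd_def)

lemma kd_pair': "kd p (x, y) = kd (fst p) x * (kd (snd p) y :: 'k::field)"
  by (cases p) (simp add: kd_pair)

lemma sum_kd_mult:
  fixes f :: "'a \<Rightarrow> 'k::field"
  assumes "finite C"
  shows "(\<Sum>b\<in>C. f b * kd b x) = (if x \<in> C then f x else 0)"
    and "(\<Sum>b\<in>C. kd x b * f b) = (if x \<in> C then f x else 0)"
proof -
  have "(\<Sum>b\<in>C. f b * kd b x) = (\<Sum>b\<in>C. if b = x then f b else 0)"
    by (intro sum.cong) (auto simp: kd_def)
  then show "(\<Sum>b\<in>C. f b * kd b x) = (if x \<in> C then f x else 0)" using assms by simp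
  have "(\<Sum>b\<in>C. kd x b * f b) = (\<Sum>b\<in>C. if b = x then f b else 0)"
    by (intro sum.cong) (auto simp: kd_def)
  then show "(\<Sum>b\<in>C. kd x b * f b) = (if x \<in> C then f x else 0)" using assms by simp
qed

text \<open>A tensor power of a group algebra is the group algebra of a direct power. The records
  have different types, so the identification is made separately for multiplication, unit and
  elements.\<close>

lemma amul_sq_grp_alg: "amul (sq_alg (grp_alg M)) = amul (grp_alg (M \<times>\<times> M))"
  by (rule amul_cong) (auto simp: tens_alg_def grp_alg_def kd_pair fun_eq_iff)

lemma amul_cube_grp_alg: "amul (cube_alg (grp_alg M)) = amul (grp_alg (M \<times>\<times> (M \<times>\<times> M)))"
  by (rule amul_cong) (auto simp: tens_alg_def grp_alg_def kd_pair fun_eq_iff)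

lemma unity_sq_grp_alg: "unity (sq_alg (grp_alg M)) = kd \<one>\<^bsub>M \<times>\<times> M\<^esub>"
  by (auto simp: tens_alg_def grp_alg_def kd_pair fun_eq_iff)

lemma elts_sq_grp_alg: "elts (sq_alg (grp_alg M)) = elts (grp_alg (M \<times>\<times> M))"
  by (auto simp: elts_def tens_alg_def grp_alg_def)

lemma kd_elts: "b \<in> bas A \<Longrightarrow> kd b \<in> elts A"
  by (auto simp: elts_def kd_def)

lemma elts_grp_alg: "elts (grp_alg M) = {f. \<forall>x. x \<notin> carrier M \<longrightarrow> f x = 0}"
  by (simp add: elts_def grp_alg_def)

context group
begin

lemma amul_grp_alg:
  assumes fin: "finite (carrier G)"
  shows "amul (grp_alg G) u v x =
    (if x \<in> carrier G then (\<Sum>b\<in>carrier G. u b * (v (inv b \<otimes> x) :: 'k::field)) else 0)"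
proof (cases "x \<in> carrier G")
  case True
  have "amul (grp_alg G) u v x = (\<Sum>b\<in>carrier G. \<Sum>c\<in>carrier G. if c = inv b \<otimes> x then u b * v c else 0)"
    unfolding amul_def grp_alg_def
  proof (simp, intro sum.cong refl)
    fix b c assume bc: "b \<in> carrier G" "c \<in> carrier G"
    have "x = b \<otimes> c \<longleftrightarrow> c = inv b \<otimes> x" using bc True by (metis inv_solve_left)
    then show "u b * v c * kd (b \<otimes> c) x = (if c = inv b \<otimes> x then u b * v c else 0)"
      by (simp add: kd_def)
  qed
  then show ?thesis using True fin by simp
next
  case False
  then have "kd (b \<otimes> c) x = (0::'k)" if "b \<in> carrier G" "c \<in> carrier G" for b c
    using that by (auto simp: kd_def)
  then show ?thesis using False by (simp add: amul_def grp_alg_def)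
qed

lemma amul_grp_alg_right:
  assumes fin: "finite (carrier G)" and x: "x \<in> carrier G"
  shows "amul (grp_alg G) u v x = (\<Sum>b\<in>carrier G. u (x \<otimes> inv b) * (v b :: 'k::field))"
proof -
  have "(\<Sum>b\<in>carrier G. u b * v (inv b \<otimes> x)) = (\<Sum>b\<in>carrier G. u (inv b) * v (b \<otimes> x))"
    by (subst sum_inv[symmetric]) simp
  also have "\<dots> = (\<Sum>b\<in>carrier G. u (inv (b \<otimes> inv x)) * v (b \<otimes> inv x \<otimes> x))"
    using sum_mult_right[of "inv x" "\<lambda>b. u (inv b) * v (b \<otimes> x)"] x by simp
  also have "\<dots> = (\<Sum>b\<in>carrier G. u (x \<otimes> inv b) * v b)"
    using x by (intro sum.cong refl) (simp add: inv_mult_group m_assoc)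
  finally show ?thesis using x by (simp add: amul_grp_alg[OF fin])
qed

lemma amul_grp_alg_assoc:
  assumes fin: "finite (carrier G)"
  shows "amul (grp_alg G) (amul (grp_alg G) u v) w = amul (grp_alg G) u (amul (grp_alg G) v (w :: 'a \<Rightarrow> 'k::field))"
proof
  fix x
  show "amul (grp_alg G) (amul (grp_alg G) u v) w x = amul (grp_alg G) u (amul (grp_alg G) v w) x"
  proof (cases "x \<in> carrier G")
    case x: True
    have "amul (grp_alg G) (amul (grp_alg G) u v) w x =
        (\<Sum>b\<in>carrier G. \<Sum>a\<in>carrier G. u a * (v (inv a \<otimes> b) * w (inv b \<otimes> x)))"
      using x by (simp add: amul_grp_alg[OF fin] sum_distrib_right mult.assoc)
    also have "\<dots> = (\<Sum>a\<in>carrier G. \<Sum>b\<in>carrier G. u a * (v (inv a \<otimes> b) * w (inv b \<otimes> x)))"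
      by (rule sum.swap)
    also have "\<dots> = (\<Sum>a\<in>carrier G. \<Sum>b\<in>carrier G. u a * (v b * w (inv b \<otimes> (inv a \<otimes> x))))"
    proof (rule sum.cong[OF refl])
      fix a assume a: "a \<in> carrier G"
      have "(\<Sum>b\<in>carrier G. u a * (v (inv a \<otimes> b) * w (inv b \<otimes> x))) =
          (\<Sum>b\<in>carrier G. u a * (v (inv a \<otimes> (a \<otimes> b)) * w (inv (a \<otimes> b) \<otimes> x)))"
        by (rule sum_mult_left[OF a, symmetric])
      also have "\<dots> = (\<Sum>b\<in>carrier G. u a * (v b * w (inv b \<otimes> (inv a \<otimes> x))))"
        using a x by (intro sum.cong refl) (simp add: cancel_inv_mult inv_mult_group m_assoc)
      finally show "(\<Sum>b\<in>carrier G. u a * (v (inv a \<otimes> b) * w (inv b \<otimes> x))) =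
        (\<Sum>b\<in>carrier G. u a * (v b * w (inv b \<otimes> (inv a \<otimes> x))))" .
    qed
    also have "\<dots> = amul (grp_alg G) u (amul (grp_alg G) v w) x"
      using x by (simp add: amul_grp_alg[OF fin] sum_distrib_left)
    finally show ?thesis .
  qed (simp add: amul_grp_alg[OF fin])
qed

lemma amul_grp_alg_unit:
  assumes fin: "finite (carrier G)" and u: "(u :: 'a \<Rightarrow> 'k::field) \<in> elts (grp_alg G)"
  shows "amul (grp_alg G) (kd \<one>) u = u" "amul (grp_alg G) u (kd \<one>) = u"
proof -
  show "amul (grp_alg G) (kd \<one>) u = u"
  proof
    fix x show "amul (grp_alg G) (kd \<one>) u x = u x"
      using u by (cases "x \<in> carrier G") (auto simp: amul_grp_alg[OF fin] sum_kd_mult[OF fin] elts_grp_alg)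
  qed
  show "amul (grp_alg G) u (kd \<one>) = u"
  proof
    fix x show "amul (grp_alg G) u (kd \<one>) x = u x"
    proof (cases "x \<in> carrier G")
      case x: True
      have "(\<Sum>b\<in>carrier G. u b * kd \<one> (inv b \<otimes> x)) = (\<Sum>b\<in>carrier G. u b * kd b x)"
        using x by (intro sum.cong refl) (auto simp: kd_def inv_mult_eq_one)
      then show ?thesis using x by (simp add: amul_grp_alg[OF fin] sum_kd_mult[OF fin])
    qed (use u in \<open>auto simp: amul_grp_alg[OF fin] elts_grp_alg\<close>)
  qed
qed

end

text \<open>The linear map of group algebras induced by \<theta>. The operations \<Delta> \<otimes>
  Id, Id \<otimes> \<Delta> and the insertion of a trivial leg are all of this kind, so one argument
  shows that they are multiplicative and preserve inverses.\<close>

definition pushforward :: "('a, 'm) monoid_scheme \<Rightarrow> ('a \<Rightarrow> 'c) \<Rightarrow> ('a \<Rightarrow> 'k::field) \<Rightarrow> 'c \<Rightarrow> 'k" where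
  "pushforward N \<theta> u = (\<lambda>y. \<Sum>x\<in>carrier N. u x * kd (\<theta> x) y)"

lemma pushforward_amul:
  fixes u v :: "'a \<Rightarrow> 'k::field"
  assumes N: "group N" "finite (carrier N)" and C: "group C" "finite (carrier C)"
    and \<theta>: "\<theta> \<in> hom N C"
  shows "pushforward N \<theta> (amul (grp_alg N) u v) = amul (grp_alg C) (pushforward N \<theta> u) (pushforward N \<theta> v)"
proof
  fix y
  have \<theta>c: "\<theta> x \<in> carrier C" if "x \<in> carrier N" for x using \<theta> that by (auto simp: hom_def)
  have "pushforward N \<theta> (amul (grp_alg N) u v) y =
      (\<Sum>z\<in>carrier N. \<Sum>x\<in>carrier N. \<Sum>x'\<in>carrier N. u x * v x' * (kd (x \<otimes>\<^bsub>N\<^esub> x') z * kd (\<theta> z) y))"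
    by (simp add: pushforward_def amul_def grp_alg_def sum_distrib_right mult.assoc)
  also have "\<dots> = (\<Sum>x\<in>carrier N. \<Sum>x'\<in>carrier N. u x * v x' * (\<Sum>z\<in>carrier N. kd (x \<otimes>\<^bsub>N\<^esub> x') z * kd (\<theta> z) y))"
    by (subst sum_sum_swap3) (simp add: sum_distrib_left)
  also have "\<dots> = (\<Sum>x\<in>carrier N. \<Sum>x'\<in>carrier N. u x * v x' * kd (\<theta> x \<otimes>\<^bsub>C\<^esub> \<theta> x') y)"
    using \<theta> N by (intro sum.cong refl)
      (simp add: sum_kd_mult[OF N(2)] hom_mult[OF \<theta>] monoid.m_closed group.is_monoid)
  finally have l: "pushforward N \<theta> (amul (grp_alg N) u v) y =
      (\<Sum>x\<in>carrier N. \<Sum>x'\<in>carrier N. u x * v x' * kd (\<theta> x \<otimes>\<^bsub>C\<^esub> \<theta> x') y)" .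
  have "amul (grp_alg C) (pushforward N \<theta> u) (pushforward N \<theta> v) y =
      (\<Sum>p\<in>carrier C. \<Sum>q\<in>carrier C. \<Sum>x\<in>carrier N. u x * kd (\<theta> x) p * (\<Sum>x'\<in>carrier N. v x' * kd (\<theta> x') q) * kd (p \<otimes>\<^bsub>C\<^esub> q) y)"
    by (simp add: pushforward_def amul_def grp_alg_def sum_distrib_right)
  also have "\<dots> = (\<Sum>x\<in>carrier N. \<Sum>p\<in>carrier C. \<Sum>q\<in>carrier C. u x * kd (\<theta> x) p * (\<Sum>x'\<in>carrier N. v x' * kd (\<theta> x') q) * kd (p \<otimes>\<^bsub>C\<^esub> q) y)"
    by (rule sum_sum_swap3[symmetric])
  also have "\<dots> = (\<Sum>x\<in>carrier N. u x * (\<Sum>q\<in>carrier C. (\<Sum>x'\<in>carrier N. v x' * kd (\<theta> x') q) * kd (\<theta> x \<otimes>\<^bsub>C\<^esub> q) y))"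
  proof (rule sum.cong[OF refl])
    fix x assume x: "x \<in> carrier N"
    let ?g = "\<lambda>p. \<Sum>q\<in>carrier C. u x * (\<Sum>x'\<in>carrier N. v x' * kd (\<theta> x') q) * kd (p \<otimes>\<^bsub>C\<^esub> q) y"
    have "(\<Sum>p\<in>carrier C. \<Sum>q\<in>carrier C. u x * kd (\<theta> x) p * (\<Sum>x'\<in>carrier N. v x' * kd (\<theta> x') q) * kd (p \<otimes>\<^bsub>C\<^esub> q) y)
      = (\<Sum>p\<in>carrier C. kd (\<theta> x) p * ?g p)"
      by (rule sum.cong[OF refl]) (simp only: sum_distrib_left mult_ac)
    also have "\<dots> = ?g (\<theta> x)" using \<theta>c[OF x] by (simp add: sum_kd_mult[OF C(2)])
    also have "\<dots> = u x * (\<Sum>q\<in>carrier C. (\<Sum>x'\<in>carrier N. v x' * kd (\<theta> x') q) * kd (\<theta> x \<otimes>\<^bsub>C\<^esub> q) y)"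
      by (subst sum_distrib_left) (simp only: mult.assoc)
    finally show "(\<Sum>p\<in>carrier C. \<Sum>q\<in>carrier C. u x * kd (\<theta> x) p * (\<Sum>x'\<in>carrier N. v x' * kd (\<theta> x') q) * kd (p \<otimes>\<^bsub>C\<^esub> q) y)
      = u x * (\<Sum>q\<in>carrier C. (\<Sum>x'\<in>carrier N. v x' * kd (\<theta> x') q) * kd (\<theta> x \<otimes>\<^bsub>C\<^esub> q) y)" .
  qed
  also have "\<dots> = (\<Sum>x\<in>carrier N. u x * (\<Sum>x'\<in>carrier N. v x' * kd (\<theta> x \<otimes>\<^bsub>C\<^esub> \<theta> x') y))"
  proof (rule sum.cong[OF refl], rule arg_cong2[where f = times, OF refl])
    fix x assume x: "x \<in> carrier N"
    have "(\<Sum>q\<in>carrier C. (\<Sum>x'\<in>carrier N. v x' * kd (\<theta> x') q) * kd (\<theta> x \<otimes>\<^bsub>C\<^esub> q) y)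
       = (\<Sum>x'\<in>carrier N. v x' * (\<Sum>q\<in>carrier C. kd (\<theta> x') q * kd (\<theta> x \<otimes>\<^bsub>C\<^esub> q) y))"
      unfolding sum_distrib_left sum_distrib_right by (subst sum.swap) (simp add: mult.assoc)
    also have "\<dots> = (\<Sum>x'\<in>carrier N. v x' * kd (\<theta> x \<otimes>\<^bsub>C\<^esub> \<theta> x') y)"
      using \<theta>c by (intro sum.cong refl) (simp add: sum_kd_mult[OF C(2)])
    finally show "(\<Sum>q\<in>carrier C. (\<Sum>x'\<in>carrier N. v x' * kd (\<theta> x') q) * kd (\<theta> x \<otimes>\<^bsub>C\<^esub> q) y)
      = (\<Sum>x'\<in>carrier N. v x' * kd (\<theta> x \<otimes>\<^bsub>C\<^esub> \<theta> x') y)" .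
  qed
  finally show "pushforward N \<theta> (amul (grp_alg N) u v) y =
      amul (grp_alg C) (pushforward N \<theta> u) (pushforward N \<theta> v) y"
    using l by (simp add: sum_distrib_left mult.assoc)
qed

lemma pushforward_unit:
  assumes "group N" "finite (carrier N)" "group C" "\<theta> \<in> hom N C"
  shows "pushforward N \<theta> (kd \<one>\<^bsub>N\<^esub>) = (kd \<one>\<^bsub>C\<^esub> :: _ \<Rightarrow> 'k::field)"
  using assms by (auto simp: pushforward_def sum_kd_mult hom_one group.is_monoid monoid.one_closed)

lemma pushforward_elts:
  assumes "\<theta> \<in> hom N C"
  shows "pushforward N \<theta> u \<in> elts (grp_alg C)"
  using assms by (auto simp: pushforward_def elts_grp_alg hom_def kd_def intro!: sum.neutral)

section \<open>Coproducts and legs as maps induced by group homomorphisms\<close>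

context group
begin

lemma comul_l_pushforward:
  assumes fin: "finite (carrier G)" and t: "(t :: _ \<Rightarrow> 'k::field) \<in> elts (sq_alg (grp_alg G))"
  shows "comul_l (grp_alg G) t = pushforward (G \<times>\<times> G) (\<lambda>(x, z). (x, x, z)) t"
proof
  fix w :: "'a \<times> 'a \<times> 'a" obtain x y z where w: "w = (x, y, z)" by (cases w) auto
  have t0: "t (b, z) = 0" if "z \<notin> carrier G" for b
    using t that by (auto simp: elts_def tens_alg_def grp_alg_def)
  have "pushforward (G \<times>\<times> G) (\<lambda>(x, z). (x, x, z)) t w =
      (\<Sum>b\<in>carrier G. \<Sum>r\<in>carrier G. t (b, r) * kd (b, b) (x, y) * kd r z)"
    by (simp add: pushforward_def w sum.cartesian_product kd_pair' split_beta mult.assoc)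
  also have "\<dots> = (\<Sum>b\<in>carrier G. t (b, z) * kd (b, b) (x, y))"
    by (intro sum.cong refl) (simp add: sum_kd_mult[OF fin] t0)
  finally show "comul_l (grp_alg G) t w = pushforward (G \<times>\<times> G) (\<lambda>(x, z). (x, x, z)) t w"
    by (simp add: comul_l_def w grp_alg_def)
qed

lemma comul_r_pushforward:
  assumes fin: "finite (carrier G)" and t: "(t :: _ \<Rightarrow> 'k::field) \<in> elts (sq_alg (grp_alg G))"
  shows "comul_r (grp_alg G) t = pushforward (G \<times>\<times> G) (\<lambda>(x, z). (x, z, z)) t"
proof
  fix w :: "'a \<times> 'a \<times> 'a" obtain x y z where w: "w = (x, y, z)" by (cases w) auto
  have t0: "t (x, b) = 0" if "x \<notin> carrier G" for b
    using t that by (auto simp: elts_def tens_alg_def grp_alg_def)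
  have "pushforward (G \<times>\<times> G) (\<lambda>(x, z). (x, z, z)) t w =
      (\<Sum>r\<in>carrier G. \<Sum>b\<in>carrier G. t (r, b) * kd (b, b) (y, z) * kd r x)"
    by (simp add: pushforward_def w sum.cartesian_product kd_pair' split_beta mult_ac)
  also have "\<dots> = (\<Sum>b\<in>carrier G. \<Sum>r\<in>carrier G. t (r, b) * kd (b, b) (y, z) * kd r x)"
    by (rule sum.swap)
  also have "\<dots> = (\<Sum>b\<in>carrier G. t (x, b) * kd (b, b) (y, z))"
    by (intro sum.cong refl) (simp add: sum_kd_mult[OF fin] t0)
  finally show "comul_r (grp_alg G) t w = pushforward (G \<times>\<times> G) (\<lambda>(x, z). (x, z, z)) t w"
    by (simp add: comul_r_def w grp_alg_def)
qed

lemma leg12_pushforward: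
  assumes fin: "finite (carrier G)" and t: "(t :: _ \<Rightarrow> 'k::field) \<in> elts (sq_alg (grp_alg G))"
  shows "leg12 (grp_alg G) t = pushforward (G \<times>\<times> G) (\<lambda>(x, z). (x, z, \<one>)) t"
proof
  fix w :: "'a \<times> 'a \<times> 'a" obtain x y z where w: "w = (x, y, z)" by (cases w) auto
  have "pushforward (G \<times>\<times> G) (\<lambda>(x, z). (x, z, \<one>)) t w =
      (\<Sum>p\<in>carrier G \<times> carrier G. (t p * kd \<one> z) * kd p (x, y))"
    by (simp add: pushforward_def w kd_pair' split_beta mult_ac)
  also have "\<dots> = t (x, y) * kd \<one> z"
    using fin t by (auto simp: sum_kd_mult elts_def tens_alg_def grp_alg_def)
  finally show "leg12 (grp_alg G) t w = pushforward (G \<times>\<times> G) (\<lambda>(x, z). (x, z, \<one>)) t w"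
    by (simp add: leg12_def w grp_alg_def)
qed

lemma leg23_pushforward:
  assumes fin: "finite (carrier G)" and t: "(t :: _ \<Rightarrow> 'k::field) \<in> elts (sq_alg (grp_alg G))"
  shows "leg23 (grp_alg G) t = pushforward (G \<times>\<times> G) (\<lambda>(x, z). (\<one>, x, z)) t"
proof
  fix w :: "'a \<times> 'a \<times> 'a" obtain x y z where w: "w = (x, y, z)" by (cases w) auto
  have "pushforward (G \<times>\<times> G) (\<lambda>(x, z). (\<one>, x, z)) t w =
      (\<Sum>p\<in>carrier G \<times> carrier G. (t p * kd \<one> x) * kd p (y, z))"
    by (simp add: pushforward_def w kd_pair' split_beta mult_ac)
  also have "\<dots> = t (y, z) * kd \<one> x"
    using fin t by (auto simp: sum_kd_mult elts_def tens_alg_def grp_alg_def)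
  finally show "leg23 (grp_alg G) t w = pushforward (G \<times>\<times> G) (\<lambda>(x, z). (\<one>, x, z)) t w"
    by (simp add: leg23_def w grp_alg_def mult.commute)
qed

end

lemma grp_alg_simps:
  "bas (grp_alg M) = carrier M" "mcoeff (grp_alg M) x y = kd (x \<otimes>\<^bsub>M\<^esub> y)"
  "unity (grp_alg M) = kd \<one>\<^bsub>M\<^esub>" "ccoeff (grp_alg M) x = kd (x, x)" "cou (grp_alg M) x = 1"
  by (simp_all add: grp_alg_def)

context group
begin

lemma grp_alg_inverse_unique:
  assumes fin: "finite (carrier G)"
    and elts: "(v :: 'a \<Rightarrow> 'k::field) \<in> elts (grp_alg G)" "w \<in> elts (grp_alg G)"
    and inv: "amul (grp_alg G) u v = kd \<one>" "amul (grp_alg G) w u = kd \<one>"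
  shows "w = v"
proof -
  have "w = amul (grp_alg G) w (amul (grp_alg G) u v)"
    using inv amul_grp_alg_unit[OF fin elts(2)] by simp
  also have "\<dots> = v"
    unfolding amul_grp_alg_assoc[OF fin, symmetric] inv(2) by (rule amul_grp_alg_unit[OF fin elts(1)])
  finally show ?thesis .
qed

text \<open>The convolution is expanded once along its left and once along its right factor; the
  second form is the one that matches the opposite group.\<close>

lemma amul_sq_grp_alg_eval:
  assumes fin: "finite (carrier G)" and xy: "x \<in> carrier G" "y \<in> carrier G"
  shows "amul (sq_alg (grp_alg G)) u v (x, y) =
      (\<Sum>p\<in>carrier G. \<Sum>q\<in>carrier G. u (p, q) * (v (inv p \<otimes> x, inv q \<otimes> y) :: 'k::field))"
    and "amul (sq_alg (grp_alg G)) u v (x, y) =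
      (\<Sum>p\<in>carrier G. \<Sum>q\<in>carrier G. u (x \<otimes> inv p, y \<otimes> inv q) * v (p, q))"
proof -
  interpret N: group "G \<times>\<times> G" by (intro DirProd_group is_group)
  have finN: "finite (carrier (G \<times>\<times> G))" using fin by simp
  have xyN: "(x, y) \<in> carrier (G \<times>\<times> G)" using xy by simp
  show "amul (sq_alg (grp_alg G)) u v (x, y) =
      (\<Sum>p\<in>carrier G. \<Sum>q\<in>carrier G. u (p, q) * v (inv p \<otimes> x, inv q \<otimes> y))"
    unfolding amul_sq_grp_alg N.amul_grp_alg[OF finN] sum.cartesian_product
    using xy by (auto simp: inv_DirProd[OF is_group is_group] intro!: sum.cong)
  show "amul (sq_alg (grp_alg G)) u v (x, y) =
      (\<Sum>p\<in>carrier G. \<Sum>q\<in>carrier G. u (x \<otimes> inv p, y \<otimes> inv q) * v (p, q))"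
    unfolding amul_sq_grp_alg N.amul_grp_alg_right[OF finN xyN] sum.cartesian_product
    using xy by (auto simp: inv_DirProd[OF is_group is_group] intro!: sum.cong)
qed

lemma amul_cube_grp_alg_eval:
  assumes fin: "finite (carrier G)" and xyz: "x \<in> carrier G" "y \<in> carrier G" "z \<in> carrier G"
  shows "amul (cube_alg (grp_alg G)) u v (x, y, z) =
      (\<Sum>p\<in>carrier G. \<Sum>q\<in>carrier G. \<Sum>r\<in>carrier G. u (p, q, r) * (v (inv p \<otimes> x, inv q \<otimes> y, inv r \<otimes> z) :: 'k::field))"
    and "amul (cube_alg (grp_alg G)) u v (x, y, z) =
      (\<Sum>p\<in>carrier G. \<Sum>q\<in>carrier G. \<Sum>r\<in>carrier G. u (x \<otimes> inv p, y \<otimes> inv q, z \<otimes> inv r) * v (p, q, r))"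
proof -
  interpret N: group "G \<times>\<times> G" by (intro DirProd_group is_group)
  interpret C: group "G \<times>\<times> (G \<times>\<times> G)" by (intro DirProd_group is_group)
  have finC: "finite (carrier (G \<times>\<times> (G \<times>\<times> G)))" using fin by simp
  have C: "(x, y, z) \<in> carrier (G \<times>\<times> (G \<times>\<times> G))" using xyz by simp
  show "amul (cube_alg (grp_alg G)) u v (x, y, z) =
      (\<Sum>p\<in>carrier G. \<Sum>q\<in>carrier G. \<Sum>r\<in>carrier G. u (p, q, r) * v (inv p \<otimes> x, inv q \<otimes> y, inv r \<otimes> z))"
    unfolding amul_cube_grp_alg C.amul_grp_alg[OF finC] sum.cartesian_product
    using xyz by (auto simp: inv_DirProd[OF is_group is_group] inv_DirProd[OF is_group N.is_group] intro!: sum.cong)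
  show "amul (cube_alg (grp_alg G)) u v (x, y, z) =
      (\<Sum>p\<in>carrier G. \<Sum>q\<in>carrier G. \<Sum>r\<in>carrier G. u (x \<otimes> inv p, y \<otimes> inv q, z \<otimes> inv r) * v (p, q, r))"
    unfolding amul_cube_grp_alg C.amul_grp_alg_right[OF finC C] sum.cartesian_product
    using xyz by (auto simp: inv_DirProd[OF is_group is_group] inv_DirProd[OF is_group N.is_group] intro!: sum.cong)
qed

lemma comul_l_eval:
  assumes "finite (carrier G)" "p \<in> carrier G"
  shows "comul_l (grp_alg G) t (p, q, r) = t (p, r) * (kd p q :: 'k::field)"
proof -
  have "comul_l (grp_alg G) t (p, q, r) = (\<Sum>b\<in>carrier G. (t (b, r) * kd b q) * kd b p)"
    by (simp add: comul_l_def grp_alg_simps kd_pair mult_ac)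
  then show ?thesis using assms by (simp add: sum_kd_mult)
qed

lemma comul_r_eval:
  assumes "finite (carrier G)" "q \<in> carrier G"
  shows "comul_r (grp_alg G) t (p, q, r) = t (p, q) * (kd q r :: 'k::field)"
proof -
  have "comul_r (grp_alg G) t (p, q, r) = (\<Sum>b\<in>carrier G. (t (p, b) * kd b r) * kd b q)"
    by (simp add: comul_r_def grp_alg_simps kd_pair mult_ac)
  then show ?thesis using assms by (simp add: sum_kd_mult)
qed

lemma kd_one_inv: "p \<in> carrier G \<Longrightarrow> x \<in> carrier G \<Longrightarrow> kd \<one> (inv p \<otimes> x) = kd x p"
  by (auto simp: kd_def inv_mult_eq_one)

lemma kd_one_inv':
  assumes "p \<in> carrier G" "x \<in> carrier G"
  shows "kd \<one> (x \<otimes> inv p) = kd x p"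
proof -
  have "x \<otimes> inv p = \<one> \<longleftrightarrow> p = x"
    using assms by (metis inv_solve_right' l_one one_closed)
  then show ?thesis by (simp add: kd_def)
qed

lemma comul_l_leg12_eval:
  fixes t u :: "'a \<times> 'a \<Rightarrow> 'k::field"
  assumes fin: "finite (carrier G)" and xyz: "x \<in> carrier G" "y \<in> carrier G" "z \<in> carrier G"
  shows "amul (cube_alg (grp_alg G)) (comul_l (grp_alg G) t) (leg12 (grp_alg G) u) (x, y, z) =
      (\<Sum>p\<in>carrier G. t (p, z) * u (inv p \<otimes> x, inv p \<otimes> y))"
    and "amul (cube_alg (grp_alg G)) (leg12 (grp_alg G) u) (comul_l (grp_alg G) t) (x, y, z) =
      (\<Sum>p\<in>carrier G. t (p, z) * u (x \<otimes> inv p, y \<otimes> inv p))"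
proof -
  have "amul (cube_alg (grp_alg G)) (comul_l (grp_alg G) t) (leg12 (grp_alg G) u) (x, y, z) =
      (\<Sum>p\<in>carrier G. \<Sum>q\<in>carrier G. \<Sum>r\<in>carrier G. kd z r * (t (p, r) * (kd p q * u (inv p \<otimes> x, inv q \<otimes> y))))"
    unfolding amul_cube_grp_alg_eval(1)[OF fin xyz]
    using xyz by (intro sum.cong refl)
      (simp add: comul_l_eval[OF fin] leg12_def grp_alg_simps kd_one_inv mult_ac)
  also have "\<dots> = (\<Sum>p\<in>carrier G. \<Sum>q\<in>carrier G. kd p q * (t (p, z) * u (inv p \<otimes> x, inv q \<otimes> y)))"
    using xyz by (intro sum.cong refl) (subst sum_kd_mult(2)[OF fin], auto simp: mult_ac)
  also have "\<dots> = (\<Sum>p\<in>carrier G. t (p, z) * u (inv p \<otimes> x, inv p \<otimes> y))"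
    by (intro sum.cong refl) (simp add: sum_kd_mult[OF fin])
  finally show "amul (cube_alg (grp_alg G)) (comul_l (grp_alg G) t) (leg12 (grp_alg G) u) (x, y, z) =
      (\<Sum>p\<in>carrier G. t (p, z) * u (inv p \<otimes> x, inv p \<otimes> y))" .
  have "amul (cube_alg (grp_alg G)) (leg12 (grp_alg G) u) (comul_l (grp_alg G) t) (x, y, z) =
      (\<Sum>p\<in>carrier G. \<Sum>q\<in>carrier G. \<Sum>r\<in>carrier G. kd z r * (t (p, r) * (kd p q * u (x \<otimes> inv p, y \<otimes> inv q))))"
    unfolding amul_cube_grp_alg_eval(2)[OF fin xyz]
    using xyz by (intro sum.cong refl)
      (simp add: comul_l_eval[OF fin] leg12_def grp_alg_simps kd_one_inv' mult_ac)
  also have "\<dots> = (\<Sum>p\<in>carrier G. \<Sum>q\<in>carrier G. kd p q * (t (p, z) * u (x \<otimes> inv p, y \<otimes> inv q)))"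
    using xyz by (intro sum.cong refl) (subst sum_kd_mult(2)[OF fin], auto simp: mult_ac)
  also have "\<dots> = (\<Sum>p\<in>carrier G. t (p, z) * u (x \<otimes> inv p, y \<otimes> inv p))"
    by (intro sum.cong refl) (simp add: sum_kd_mult[OF fin])
  finally show "amul (cube_alg (grp_alg G)) (leg12 (grp_alg G) u) (comul_l (grp_alg G) t) (x, y, z) =
      (\<Sum>p\<in>carrier G. t (p, z) * u (x \<otimes> inv p, y \<otimes> inv p))" .
qed

lemma comul_r_leg23_eval:
  fixes t u :: "'a \<times> 'a \<Rightarrow> 'k::field"
  assumes fin: "finite (carrier G)" and xyz: "x \<in> carrier G" "y \<in> carrier G" "z \<in> carrier G"
  shows "amul (cube_alg (grp_alg G)) (comul_r (grp_alg G) t) (leg23 (grp_alg G) u) (x, y, z) =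
      (\<Sum>p\<in>carrier G. t (x, p) * u (inv p \<otimes> y, inv p \<otimes> z))"
    and "amul (cube_alg (grp_alg G)) (leg23 (grp_alg G) u) (comul_r (grp_alg G) t) (x, y, z) =
      (\<Sum>p\<in>carrier G. t (x, p) * u (y \<otimes> inv p, z \<otimes> inv p))"
proof -
  have "amul (cube_alg (grp_alg G)) (comul_r (grp_alg G) t) (leg23 (grp_alg G) u) (x, y, z) =
      (\<Sum>p\<in>carrier G. \<Sum>q\<in>carrier G. \<Sum>r\<in>carrier G. kd q r * (kd x p * (t (p, q) * u (inv q \<otimes> y, inv r \<otimes> z))))"
    unfolding amul_cube_grp_alg_eval(1)[OF fin xyz]
    using xyz by (intro sum.cong refl)
      (simp add: comul_r_eval[OF fin] leg23_def grp_alg_simps kd_one_inv mult_ac)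
  also have "\<dots> = (\<Sum>p\<in>carrier G. kd x p * (\<Sum>q\<in>carrier G. t (p, q) * u (inv q \<otimes> y, inv q \<otimes> z)))"
    using xyz by (intro sum.cong refl) (simp add: sum_kd_mult[OF fin] sum_distrib_left)
  also have "\<dots> = (\<Sum>p\<in>carrier G. t (x, p) * u (inv p \<otimes> y, inv p \<otimes> z))"
    using xyz by (simp add: sum_kd_mult[OF fin])
  finally show "amul (cube_alg (grp_alg G)) (comul_r (grp_alg G) t) (leg23 (grp_alg G) u) (x, y, z) =
      (\<Sum>p\<in>carrier G. t (x, p) * u (inv p \<otimes> y, inv p \<otimes> z))" .
  have "amul (cube_alg (grp_alg G)) (leg23 (grp_alg G) u) (comul_r (grp_alg G) t) (x, y, z) =
      (\<Sum>p\<in>carrier G. \<Sum>q\<in>carrier G. \<Sum>r\<in>carrier G. kd q r * (kd x p * (t (p, q) * u (y \<otimes> inv q, z \<otimes> inv r))))"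
    unfolding amul_cube_grp_alg_eval(2)[OF fin xyz]
    using xyz by (intro sum.cong refl)
      (simp add: comul_r_eval[OF fin] leg23_def grp_alg_simps kd_one_inv' mult_ac)
  also have "\<dots> = (\<Sum>p\<in>carrier G. kd x p * (\<Sum>q\<in>carrier G. t (p, q) * u (y \<otimes> inv q, z \<otimes> inv q)))"
    using xyz by (intro sum.cong refl) (simp add: sum_kd_mult[OF fin] sum_distrib_left)
  also have "\<dots> = (\<Sum>p\<in>carrier G. t (x, p) * u (y \<otimes> inv p, z \<otimes> inv p))"
    using xyz by (simp add: sum_kd_mult[OF fin])
  finally show "amul (cube_alg (grp_alg G)) (leg23 (grp_alg G) u) (comul_r (grp_alg G) t) (x, y, z) =
      (\<Sum>p\<in>carrier G. t (x, p) * u (y \<otimes> inv p, z \<otimes> inv p))" .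
qed

text \<open>Inverting both sides of the twist equation reverses the order of the factors. Each
  factor is the image of J under a map induced by a group homomorphism, so its inverse is the image
  of the inverse of J.\<close>

lemma inverse_cocycle:
  fixes J J' :: "'a \<times> 'a \<Rightarrow> 'k::field"
  assumes fin: "finite (carrier G)" and ainv: "is_ainv (sq_alg (grp_alg G)) J J'"
    and coc: "amul (cube_alg (grp_alg G)) (comul_l (grp_alg G) J) (leg12 (grp_alg G) J) =
      amul (cube_alg (grp_alg G)) (comul_r (grp_alg G) J) (leg23 (grp_alg G) J)"
  shows "amul (cube_alg (grp_alg G)) (leg12 (grp_alg G) J') (comul_l (grp_alg G) J') =
    amul (cube_alg (grp_alg G)) (leg23 (grp_alg G) J') (comul_r (grp_alg G) J')"
proof -
  let ?N = "G \<times>\<times> G" and ?C = "G \<times>\<times> (G \<times>\<times> G)"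
  interpret N: group ?N by (intro DirProd_group is_group)
  interpret C: group ?C by (intro DirProd_group is_group)
  have finN: "finite (carrier ?N)" and finC: "finite (carrier ?C)" using fin by auto
  have J: "J \<in> elts (sq_alg (grp_alg G))" "J' \<in> elts (sq_alg (grp_alg G))"
    and JJ': "amul (grp_alg ?N) J J' = kd \<one>\<^bsub>?N\<^esub>" "amul (grp_alg ?N) J' J = kd \<one>\<^bsub>?N\<^esub>"
    using ainv by (simp_all add: is_ainv_def amul_sq_grp_alg unity_sq_grp_alg)
  have push: "amul (grp_alg ?C) (pushforward ?N \<theta> J) (pushforward ?N \<theta> J') = kd \<one>\<^bsub>?C\<^esub>"
    "amul (grp_alg ?C) (pushforward ?N \<theta> J') (pushforward ?N \<theta> J) = kd \<one>\<^bsub>?C\<^esub>"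
    if \<theta>: "\<theta> \<in> hom ?N ?C" for \<theta>
    using pushforward_amul[OF N.is_group finN C.is_group finC \<theta>, of J J']
      pushforward_amul[OF N.is_group finN C.is_group finC \<theta>, of J' J]
      pushforward_unit[OF N.is_group finN C.is_group \<theta>, where 'k = 'k] JJ' by simp_all
  have hom: "(\<lambda>(x, z). (x, x, z)) \<in> hom ?N ?C" "(\<lambda>(x, z). (x, z, z)) \<in> hom ?N ?C"
    "(\<lambda>(x, z). (x, z, \<one>)) \<in> hom ?N ?C" "(\<lambda>(x, z). (\<one>, x, z)) \<in> hom ?N ?C"
    by (auto simp: hom_def)
  note pf = comul_l_pushforward[OF fin] comul_r_pushforward[OF fin] leg12_pushforward[OF fin]
    leg23_pushforward[OF fin]
  define m where "m = (amul (grp_alg ?C) :: (_ \<Rightarrow> 'k) \<Rightarrow> _)"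
  define l l' r r' e e' f f' where defs:
    "l = comul_l (grp_alg G) J" "l' = comul_l (grp_alg G) J'"
    "r = comul_r (grp_alg G) J" "r' = comul_r (grp_alg G) J'"
    "e = leg12 (grp_alg G) J" "e' = leg12 (grp_alg G) J'"
    "f = leg23 (grp_alg G) J" "f' = leg23 (grp_alg G) J'"
  have el: "l' \<in> elts (grp_alg ?C)" "r' \<in> elts (grp_alg ?C)"
    unfolding defs pf[OF J(2)] by (intro pushforward_elts hom)+
  have inv: "m l' l = kd \<one>\<^bsub>?C\<^esub>" "m r r' = kd \<one>\<^bsub>?C\<^esub>" "m e' e = kd \<one>\<^bsub>?C\<^esub>" "m f f' = kd \<one>\<^bsub>?C\<^esub>"
    unfolding defs pf[OF J(1)] pf[OF J(2)] m_def by (intro push hom)+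
  have assoc: "m (m u v) w = m u (m v w)" for u v w
    unfolding m_def by (rule C.amul_grp_alg_assoc[OF finC])
  have unit: "m (kd \<one>\<^bsub>?C\<^esub>) u = u" "m u (kd \<one>\<^bsub>?C\<^esub>) = u" if "u \<in> elts (grp_alg ?C)" for u
    unfolding m_def by (intro C.amul_grp_alg_unit[OF finC that])+
  have coc: "m l e = m r f"
    using coc unfolding defs m_def amul_cube_grp_alg by simp
  \<comment> \<open>The product r f f' r' = 1 is inserted, and r f = l e then cancels against e'
    l'.\<close>
  have "m e' l' = m e' (m l' (m r (m (m f f') r')))"
    using inv unit el by simp
  also have "\<dots> = m e' (m (m l' (m r f)) (m f' r'))" by (simp add: assoc)
  also have "\<dots> = m (m e' (m (m l' l) e)) (m f' r')" by (simp add: assoc flip: coc)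
  also have "\<dots> = m f' r'"
  proof -
    have "e \<in> elts (grp_alg ?C)"
      unfolding defs pf[OF J(1)] by (intro pushforward_elts hom)
    moreover have "m f' r' \<in> elts (grp_alg ?C)"
      by (simp add: m_def elts_grp_alg C.amul_grp_alg[OF finC])
    ultimately show ?thesis using inv unit by simp
  qed
  finally show ?thesis unfolding defs m_def amul_cube_grp_alg .
qed

lemma amul_flip:
  fixes u v :: "'a \<times> 'a \<Rightarrow> 'k::field"
  assumes fin: "finite (carrier G)"
  shows "amul (sq_alg (grp_alg G)) (flip u) (flip v) = flip (amul (sq_alg (grp_alg G)) u v)"
proof
  interpret N: group "G \<times>\<times> G" by (intro DirProd_group is_group)
  have finN: "finite (carrier (G \<times>\<times> G))" using fin by simp
  fix p :: "'a \<times> 'a" obtain x y where p: "p = (x, y)" by (cases p) auto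
  show "amul (sq_alg (grp_alg G)) (flip u) (flip v) p = flip (amul (sq_alg (grp_alg G)) u v) p"
  proof (cases "x \<in> carrier G \<and> y \<in> carrier G")
    case True
    then show ?thesis
      unfolding p by (simp add: flip_def amul_sq_grp_alg_eval(1)[OF fin]) (rule sum.swap)
  next
    case False
    then show ?thesis
      unfolding p amul_sq_grp_alg by (auto simp: flip_def N.amul_grp_alg[OF finN])
  qed
qed

lemma ainv_sq_grp_alg:
  fixes J J' :: "'a \<times> 'a \<Rightarrow> 'k::field"
  assumes fin: "finite (carrier G)" and ainv: "is_ainv (sq_alg (grp_alg G)) J J'"
  shows "ainv (sq_alg (grp_alg G)) J = J'"
proof -
  interpret N: group "G \<times>\<times> G" by (intro DirProd_group is_group)
  have finN: "finite (carrier (G \<times>\<times> G))" using fin by simp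
  show ?thesis unfolding ainv_def
  proof (rule the_equality, rule ainv)
    fix h assume "is_ainv (sq_alg (grp_alg G)) J h"
    then show "h = J'"
      using ainv N.grp_alg_inverse_unique[OF finN, of J' h J]
      unfolding is_ainv_def amul_sq_grp_alg unity_sq_grp_alg elts_sq_grp_alg by simp
  qed
qed

lemma is_ainv_flip:
  fixes J J' :: "'a \<times> 'a \<Rightarrow> 'k::field"
  assumes fin: "finite (carrier G)" and ainv: "is_ainv (sq_alg (grp_alg G)) J J'"
  shows "is_ainv (sq_alg (grp_alg G)) (flip J) (flip J')"
proof -
  have "flip (unity (sq_alg (grp_alg G))) = (unity (sq_alg (grp_alg G)) :: 'a \<times> 'a \<Rightarrow> 'k)"
    by (auto simp: flip_def tens_alg_def fun_eq_iff mult.commute)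
  moreover have "flip u \<in> elts (sq_alg (grp_alg G))" if "u \<in> elts (sq_alg (grp_alg G))" for u :: "'a \<times> 'a \<Rightarrow> 'k"
    using that by (auto simp: flip_def elts_def tens_alg_def)
  ultimately show ?thesis using ainv unfolding is_ainv_def amul_flip[OF fin] by simp
qed

end

text \<open>With the multiplication reversed, the arguments \<open>inv x \<otimes> b\<close> in
  \<open>tmult\<close> become \<open>b \<otimes> inv x\<close>, which is the shape of the dual of
  the coalgebra \<open>a \<mapsto> J\<^sup>-\<^sup>1 \<Delta>(a)\<close>.\<close>

definition opposite :: "('g, 'm) monoid_scheme \<Rightarrow> ('g, 'm) monoid_scheme" where
  "opposite M = M\<lparr>mult := (\<lambda>x y. y \<otimes>\<^bsub>M\<^esub> x)\<rparr>"

lemma opposite_simps [simp]: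
  "carrier (opposite M) = carrier M" "x \<otimes>\<^bsub>opposite M\<^esub> y = y \<otimes>\<^bsub>M\<^esub> x" "\<one>\<^bsub>opposite M\<^esub> = \<one>\<^bsub>M\<^esub>"
  by (simp_all add: opposite_def)

lemma (in group) opposite_group: "group (opposite G)"
  by (rule groupI) (auto simp: m_assoc intro: r_inv_ex)

lemma (in group) inv_opposite: "x \<in> carrier G \<Longrightarrow> inv\<^bsub>opposite G\<^esub> x = inv x"
  using group.inv_equality[OF opposite_group, of "inv x" x] by simp

section \<open>From a minimal twist to coefficient identities\<close>

context group
begin

lemma minimal_twist_inverse:
  fixes J :: "'a \<times> 'a \<Rightarrow> 'k::field"
  assumes fin: "finite (carrier G)" and J: "minimal_twist (grp_alg G) J"
  shows "is_ainv (sq_alg (grp_alg G)) J (ainv (sq_alg (grp_alg G)) J)"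
proof -
  obtain J' where "is_ainv (sq_alg (grp_alg G)) J J'"
    using J by (auto simp: minimal_twist_def is_twist_def)
  then show ?thesis using ainv_sq_grp_alg[OF fin, of J J'] by simp
qed

text \<open>Over the opposite group the inverse of J satisfies the cocycle condition by
  \<open>inverse_cocycle\<close>, and its counterpart of J_21^{-1} J has the transposed coefficient
  matrix. So the left tensorands in \<open>minimal_twist\<close> serve the first claim and the right
  tensorands the second.\<close>

lemma minimal_twist_group_twist:
  fixes J :: "'a \<times> 'a \<Rightarrow> 'k::alg_closed_field"
  assumes fin: "finite (carrier G)" and card: "of_nat (card (carrier G)) \<noteq> (0::'k)"
    and J: "minimal_twist (grp_alg G) J"
  defines "J' \<equiv> ainv (sq_alg (grp_alg G)) J"
  shows "group_twist G J J'" and "group_twist (opposite G) J' J"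
proof -
  have ainv: "is_ainv (sq_alg (grp_alg G)) J J'"
    unfolding J'_def by (rule minimal_twist_inverse[OF fin J])
  have unity: "unity (sq_alg (grp_alg G)) (b, c) = (if b = \<one> \<and> c = \<one> then 1 else (0::'k))" for b c
    by (auto simp: tens_alg_def grp_alg_simps kd_def)
  have JJ': "amul (sq_alg (grp_alg G)) J J' = unity (sq_alg (grp_alg G))"
    and J'J: "amul (sq_alg (grp_alg G)) J' J = unity (sq_alg (grp_alg G))"
    using ainv by (simp_all add: is_ainv_def)
  note ev = amul_sq_grp_alg_eval[OF fin]
  have tw: "is_twist (grp_alg G) J" using J by (simp add: minimal_twist_def)
  have coc: "amul (cube_alg (grp_alg G)) (comul_l (grp_alg G) J) (leg12 (grp_alg G) J) =
      amul (cube_alg (grp_alg G)) (comul_r (grp_alg G) J) (leg23 (grp_alg G) J)"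
    using tw by (simp add: is_twist_def)
  note coc' = inverse_cocycle[OF fin ainv coc]
  have cl: "(\<Sum>b\<in>carrier G. J (b, c)) = (if c = \<one> then 1 else 0)" for c
  proof -
    have "counit_l (grp_alg G) J = unity (grp_alg G)" using tw by (simp add: is_twist_def)
    from fun_cong[OF this, of c] show ?thesis by (simp add: counit_l_def grp_alg_simps kd_def)
  qed
  have cr: "(\<Sum>c\<in>carrier G. J (b, c)) = (if b = \<one> then 1 else 0)" for b
  proof -
    have "counit_r (grp_alg G) J = unity (grp_alg G)" using tw by (simp add: is_twist_def)
    from fun_cong[OF this, of b] show ?thesis by (simp add: counit_r_def grp_alg_simps kd_def)
  qed
  \<comment> \<open>The map \<epsilon> \<otimes> Id is multiplicative and sends J to 1, so it sends
    the inverse of J to 1.\<close>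
  have cl': "(\<Sum>b\<in>carrier G. J' (b, c)) = (if c = \<one> then 1 else 0)" if c: "c \<in> carrier G" for c
  proof -
    have "(if c = \<one> then 1 else 0) = (\<Sum>b\<in>carrier G. if b = \<one> then (if c = \<one> then 1 else 0 :: 'k) else 0)"
      using fin by simp
    also have "\<dots> = (\<Sum>b\<in>carrier G. amul (sq_alg (grp_alg G)) J J' (b, c))"
      by (intro sum.cong refl) (simp add: JJ' unity)
    also have "\<dots> = (\<Sum>b\<in>carrier G. \<Sum>p\<in>carrier G. \<Sum>q\<in>carrier G. J (p, q) * J' (inv p \<otimes> b, inv q \<otimes> c))"
      using c by (intro sum.cong refl) (simp add: ev(1))
    also have "\<dots> = (\<Sum>p\<in>carrier G. \<Sum>q\<in>carrier G. J (p, q) * (\<Sum>b\<in>carrier G. J' (inv p \<otimes> b, inv q \<otimes> c)))"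
      by (subst sum_sum_swap3) (simp add: sum_distrib_left)
    also have "\<dots> = (\<Sum>p\<in>carrier G. \<Sum>q\<in>carrier G. J (p, q) * (\<Sum>b\<in>carrier G. J' (b, inv q \<otimes> c)))"
    proof (rule sum.cong[OF refl], rule sum.cong[OF refl], rule arg_cong2[where f = times, OF refl])
      fix p q assume "p \<in> carrier G"
      then show "(\<Sum>b\<in>carrier G. J' (inv p \<otimes> b, inv q \<otimes> c)) = (\<Sum>b\<in>carrier G. J' (b, inv q \<otimes> c))"
        using sum_mult_left[of "inv p" "\<lambda>b. J' (b, inv q \<otimes> c)"] by simp
    qed
    also have "\<dots> = (\<Sum>q\<in>carrier G. (\<Sum>p\<in>carrier G. J (p, q)) * (\<Sum>b\<in>carrier G. J' (b, inv q \<otimes> c)))"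
      by (subst sum.swap) (simp add: sum_distrib_right)
    also have "\<dots> = (\<Sum>q\<in>carrier G. if q = \<one> then (\<Sum>b\<in>carrier G. J' (b, inv q \<otimes> c)) else 0)"
      by (intro sum.cong refl) (simp add: cl)
    also have "\<dots> = (\<Sum>b\<in>carrier G. J' (b, c))" using fin c by simp
    finally show ?thesis ..
  qed
  have cr': "(\<Sum>c\<in>carrier G. J' (b, c)) = (if b = \<one> then 1 else 0)" if b: "b \<in> carrier G" for b
  proof -
    have "(if b = \<one> then 1 else 0) = (\<Sum>c\<in>carrier G. if c = \<one> then (if b = \<one> then 1 else 0 :: 'k) else 0)"
      using fin by simp
    also have "\<dots> = (\<Sum>c\<in>carrier G. amul (sq_alg (grp_alg G)) J J' (b, c))"
      by (intro sum.cong refl) (simp add: JJ' unity)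
    also have "\<dots> = (\<Sum>c\<in>carrier G. \<Sum>p\<in>carrier G. \<Sum>q\<in>carrier G. J (p, q) * J' (inv p \<otimes> b, inv q \<otimes> c))"
      using b by (intro sum.cong refl) (simp add: ev(1))
    also have "\<dots> = (\<Sum>p\<in>carrier G. \<Sum>q\<in>carrier G. J (p, q) * (\<Sum>c\<in>carrier G. J' (inv p \<otimes> b, inv q \<otimes> c)))"
      by (subst sum_sum_swap3) (simp add: sum_distrib_left)
    also have "\<dots> = (\<Sum>p\<in>carrier G. \<Sum>q\<in>carrier G. J (p, q) * (\<Sum>c\<in>carrier G. J' (inv p \<otimes> b, c)))"
    proof (rule sum.cong[OF refl], rule sum.cong[OF refl], rule arg_cong2[where f = times, OF refl])
      fix p q assume "q \<in> carrier G"
      then show "(\<Sum>c\<in>carrier G. J' (inv p \<otimes> b, inv q \<otimes> c)) = (\<Sum>c\<in>carrier G. J' (inv p \<otimes> b, c))"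
        using sum_mult_left[of "inv q" "\<lambda>c. J' (inv p \<otimes> b, c)"] by simp
    qed
    also have "\<dots> = (\<Sum>p\<in>carrier G. (\<Sum>q\<in>carrier G. J (p, q)) * (\<Sum>c\<in>carrier G. J' (inv p \<otimes> b, c)))"
      by (simp add: sum_distrib_right)
    also have "\<dots> = (\<Sum>p\<in>carrier G. if p = \<one> then (\<Sum>c\<in>carrier G. J' (inv p \<otimes> b, c)) else 0)"
      by (intro sum.cong refl) (simp add: cr)
    also have "\<dots> = (\<Sum>c\<in>carrier G. J' (b, c))" using fin b by simp
    finally show ?thesis ..
  qed
  define R where "R a y = (\<Sum>p\<in>carrier G. \<Sum>q\<in>carrier G. J' (q, p) * J (inv p \<otimes> a, inv q \<otimes> y))" for a y
  have R: "twist_R (grp_alg G) J (a, y) = R a y" if "a \<in> carrier G" "y \<in> carrier G" for a y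
    unfolding twist_R_def R_def ainv_sq_grp_alg[OF fin is_ainv_flip[OF fin ainv]]
    using that by (simp add: ev(1) flip_def)
  \<comment> \<open>A row vector that annihilates the matrix R annihilates every combination of its
    columns, and by minimality each basis vector is such a combination.\<close>
  have nd: "\<phi> a = 0" if z: "\<And>y. y \<in> carrier G \<Longrightarrow> (\<Sum>a\<in>carrier G. \<phi> a * R a y) = 0" and a: "a \<in> carrier G"
    for \<phi> a
  proof -
    have "kd a \<in> left_tensorands (grp_alg G) (twist_R (grp_alg G) J)"
      using J a by (simp add: minimal_twist_def kd_elts grp_alg_simps)
    then obtain \<psi> where \<psi>: "kd a = (\<lambda>x. \<Sum>y\<in>carrier G. twist_R (grp_alg G) J (x, y) * \<psi> y)"
      by (auto simp: left_tensorands_def grp_alg_simps)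
    have "\<phi> a = (\<Sum>x\<in>carrier G. \<phi> x * (kd a x :: 'k))"
      using a sum_kd_mult(2)[OF fin, of a \<phi>] by (simp add: mult.commute)
    also have "\<dots> = (\<Sum>x\<in>carrier G. \<Sum>y\<in>carrier G. \<phi> x * R x y * \<psi> y)"
      unfolding \<psi> by (intro sum.cong refl) (simp add: R sum_distrib_left mult.assoc)
    also have "\<dots> = (\<Sum>y\<in>carrier G. (\<Sum>x\<in>carrier G. \<phi> x * R x y) * \<psi> y)"
      by (subst sum.swap) (simp add: sum_distrib_right)
    finally show ?thesis by (simp add: z)
  qed
  have nd': "\<phi> a = 0" if z: "\<And>y. y \<in> carrier G \<Longrightarrow> (\<Sum>a\<in>carrier G. \<phi> a * R y a) = 0" and a: "a \<in> carrier G"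
    for \<phi> a
  proof -
    have "kd a \<in> right_tensorands (grp_alg G) (twist_R (grp_alg G) J)"
      using J a by (simp add: minimal_twist_def kd_elts grp_alg_simps)
    then obtain \<psi> where \<psi>: "kd a = (\<lambda>x. \<Sum>y\<in>carrier G. \<psi> y * twist_R (grp_alg G) J (y, x))"
      by (auto simp: right_tensorands_def grp_alg_simps)
    have "\<phi> a = (\<Sum>x\<in>carrier G. \<phi> x * (kd a x :: 'k))"
      using a sum_kd_mult(2)[OF fin, of a \<phi>] by (simp add: mult.commute)
    also have "\<dots> = (\<Sum>x\<in>carrier G. \<Sum>y\<in>carrier G. \<phi> x * R y x * \<psi> y)"
      unfolding \<psi> by (intro sum.cong refl) (simp add: R sum_distrib_left mult_ac)
    also have "\<dots> = (\<Sum>y\<in>carrier G. (\<Sum>x\<in>carrier G. \<phi> x * R y x) * \<psi> y)"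
      by (subst sum.swap) (simp add: sum_distrib_right)
    finally show ?thesis by (simp add: z)
  qed
  show "group_twist G J J'"
  proof (intro group_twist.intro group_twist_axioms.intro)
    fix b c d assume bcd: "b \<in> carrier G" "c \<in> carrier G" "d \<in> carrier G"
    show "(\<Sum>a\<in>carrier G. J (a, d) * J (inv a \<otimes> b, inv a \<otimes> c)) =
      (\<Sum>a\<in>carrier G. J (b, a) * J (inv a \<otimes> c, inv a \<otimes> d))"
      using fun_cong[OF coc, of "(b, c, d)"]
      unfolding comul_l_leg12_eval(1)[OF fin bcd] comul_r_leg23_eval(1)[OF fin bcd] .
  next
    fix b c assume bc: "b \<in> carrier G" "c \<in> carrier G"
    show "(\<Sum>p\<in>carrier G. \<Sum>q\<in>carrier G. J (p, q) * J' (inv p \<otimes> b, inv q \<otimes> c)) =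
      (if b = \<one> \<and> c = \<one> then 1 else 0)"
      unfolding ev(1)[OF bc, symmetric] JJ' unity ..
    show "(\<Sum>p\<in>carrier G. \<Sum>q\<in>carrier G. J' (p, q) * J (inv p \<otimes> b, inv q \<otimes> c)) =
      (if b = \<one> \<and> c = \<one> then 1 else 0)"
      unfolding ev(1)[OF bc, symmetric] J'J unity ..
  next
    fix \<phi> :: "'a \<Rightarrow> 'k" and a
    assume "\<And>y. y \<in> carrier G \<Longrightarrow> (\<Sum>a\<in>carrier G. \<phi> a *
      (\<Sum>p\<in>carrier G. \<Sum>q\<in>carrier G. J' (q, p) * J (inv p \<otimes> a, inv q \<otimes> y))) = 0" "a \<in> carrier G"
    then show "\<phi> a = 0" unfolding R_def[symmetric] by (rule nd)
  qed (use fin card cl cr in \<open>auto intro: is_group\<close>)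
  show "group_twist (opposite G) J' J"
  proof (intro group_twist.intro group_twist_axioms.intro, unfold opposite_simps)
    fix b c d assume bcd: "b \<in> carrier G" "c \<in> carrier G" "d \<in> carrier G"
    show "(\<Sum>a\<in>carrier G. J' (a, d) * J' (b \<otimes> inv\<^bsub>opposite G\<^esub> a, c \<otimes> inv\<^bsub>opposite G\<^esub> a)) =
      (\<Sum>a\<in>carrier G. J' (b, a) * J' (c \<otimes> inv\<^bsub>opposite G\<^esub> a, d \<otimes> inv\<^bsub>opposite G\<^esub> a))"
      using fun_cong[OF coc', of "(b, c, d)"]
      unfolding comul_l_leg12_eval(2)[OF fin bcd] comul_r_leg23_eval(2)[OF fin bcd]
      by (simp add: inv_opposite)
  next
    fix b c assume bc: "b \<in> carrier G" "c \<in> carrier G"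
    show "(\<Sum>p\<in>carrier G. \<Sum>q\<in>carrier G. J' (p, q) * J (b \<otimes> inv\<^bsub>opposite G\<^esub> p, c \<otimes> inv\<^bsub>opposite G\<^esub> q)) =
      (if b = \<one> \<and> c = \<one> then 1 else 0)"
      using ev(2)[OF bc, of J J'] unfolding JJ' unity by (simp add: inv_opposite mult.commute)
    show "(\<Sum>p\<in>carrier G. \<Sum>q\<in>carrier G. J (p, q) * J' (b \<otimes> inv\<^bsub>opposite G\<^esub> p, c \<otimes> inv\<^bsub>opposite G\<^esub> q)) =
      (if b = \<one> \<and> c = \<one> then 1 else 0)"
      using ev(2)[OF bc, of J' J] unfolding J'J unity by (simp add: inv_opposite mult.commute)
  next
    fix \<phi> :: "'a \<Rightarrow> 'k" and a
    assume z: "\<And>y. y \<in> carrier G \<Longrightarrow> (\<Sum>a\<in>carrier G. \<phi> a *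
      (\<Sum>p\<in>carrier G. \<Sum>q\<in>carrier G. J (q, p) * J' (a \<otimes> inv\<^bsub>opposite G\<^esub> p, y \<otimes> inv\<^bsub>opposite G\<^esub> q))) = 0"
      and a: "a \<in> carrier G"
    have "(\<Sum>p\<in>carrier G. \<Sum>q\<in>carrier G. J (q, p) * J' (a \<otimes> inv\<^bsub>opposite G\<^esub> p, y \<otimes> inv\<^bsub>opposite G\<^esub> q)) = R y a"
      if ay: "a \<in> carrier G" "y \<in> carrier G" for a y
    proof -
      have "(\<Sum>p\<in>carrier G. \<Sum>q\<in>carrier G. J (q, p) * J' (a \<otimes> inv\<^bsub>opposite G\<^esub> p, y \<otimes> inv\<^bsub>opposite G\<^esub> q))
        = (\<Sum>p\<in>carrier G. \<Sum>q\<in>carrier G. J (q, p) * J' (a \<otimes> inv p, y \<otimes> inv q))"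
        by (simp add: inv_opposite)
      \<comment> \<open>Replacing q by \<open>inv q \<otimes> y\<close> and p by
        \<open>inv p \<otimes> a\<close> gives \<open>J'\<close> the arguments (p, q), as in
        \<open>R\<close> up to renaming.\<close>
      also have "\<dots> = (\<Sum>p\<in>carrier G. \<Sum>q\<in>carrier G. J (inv q \<otimes> y, p) * J' (a \<otimes> inv p, y \<otimes> inv (inv q \<otimes> y)))"
        using ay by (intro sum.cong refl sum_inv_mult_right[symmetric])
      also have "\<dots> = (\<Sum>p\<in>carrier G. \<Sum>q\<in>carrier G. J (inv q \<otimes> y, inv p \<otimes> a) *
          J' (a \<otimes> inv (inv p \<otimes> a), y \<otimes> inv (inv q \<otimes> y)))"
        using ay by (intro sum_inv_mult_right[symmetric])
      also have "\<dots> = (\<Sum>p\<in>carrier G. \<Sum>q\<in>carrier G. J' (p, q) * J (inv q \<otimes> y, inv p \<otimes> a))"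
        using ay by (intro sum.cong refl) (simp add: inv_mult_group cancel_inv_mult mult.commute)
      also have "\<dots> = R y a" unfolding R_def by (rule sum.swap)
      finally show ?thesis .
    qed
    then show "\<phi> a = 0" using nd'[OF _ a] z a by simp
  qed (use fin card cl' cr' in \<open>auto intro: opposite_group\<close>)
qed

end

section \<open>Representations of central extensions\<close>

text \<open>The zero matrix depends on the size, so a sum over a possibly empty set carries the size
  as a parameter and is formed entrywise.\<close>

definition msum :: "nat \<Rightarrow> nat \<Rightarrow> 'i set \<Rightarrow> ('i \<Rightarrow> 'k::field mat) \<Rightarrow> 'k mat" where
  "msum n m I F = mat n m (\<lambda>(i, j). \<Sum>x\<in>I. F x $$ (i, j))"

lemma msum_carrier [simp]: "msum n m I F \<in> carrier_mat n m"
  by (simp add: msum_def)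

lemma msum_index [simp]: "i < n \<Longrightarrow> j < m \<Longrightarrow> msum n m I F $$ (i, j) = (\<Sum>x\<in>I. F x $$ (i, j))"
  by (simp add: msum_def)

lemma mat_assoc:
  "dim_col A = dim_row B \<Longrightarrow> dim_col B = dim_row C \<Longrightarrow> A * B * C = A * (B * (C :: 'k::semiring_0 mat))"
  by (rule assoc_mult_mat[of A "dim_row A" "dim_row B" B "dim_row C" C "dim_col C"]) auto

lemma mult_msum:
  assumes A: "A \<in> carrier_mat r n" and F: "\<And>x. x \<in> I \<Longrightarrow> F x \<in> carrier_mat n m"
  shows "A * msum n m I F = msum r m I (\<lambda>x. A * F x)"
proof (rule eq_matI)
  fix i j assume "i < dim_row (msum r m I (\<lambda>x. A * F x))" "j < dim_col (msum r m I (\<lambda>x. A * F x))"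
  then have ij: "i < r" "j < m" by (auto simp: msum_def)
  have "(A * msum n m I F) $$ (i, j) = (\<Sum>c<n. \<Sum>x\<in>I. A $$ (i, c) * F x $$ (c, j))"
    using ij by (simp add: mat_mult_index[OF A msum_carrier] sum_distrib_left)
  also have "\<dots> = (\<Sum>x\<in>I. (A * F x) $$ (i, j))"
    using ij by (subst sum.swap) (simp add: mat_mult_index[OF A F])
  finally show "(A * msum n m I F) $$ (i, j) = msum r m I (\<lambda>x. A * F x) $$ (i, j)"
    using ij by simp
qed (use A in \<open>auto simp: msum_def\<close>)

lemma msum_mult:
  assumes A: "A \<in> carrier_mat m r" and F: "\<And>x. x \<in> I \<Longrightarrow> F x \<in> carrier_mat n m"
  shows "msum n m I F * A = msum n r I (\<lambda>x. F x * A)"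
proof (rule eq_matI)
  fix i j assume "i < dim_row (msum n r I (\<lambda>x. F x * A))" "j < dim_col (msum n r I (\<lambda>x. F x * A))"
  then have ij: "i < n" "j < r" by (auto simp: msum_def)
  have "(msum n m I F * A) $$ (i, j) = (\<Sum>c<m. \<Sum>x\<in>I. F x $$ (i, c) * A $$ (c, j))"
    using ij by (simp add: mat_mult_index[OF msum_carrier A] sum_distrib_right)
  also have "\<dots> = (\<Sum>x\<in>I. (F x * A) $$ (i, j))"
    using ij by (subst sum.swap) (simp add: mat_mult_index[OF F A])
  finally show "(msum n m I F * A) $$ (i, j) = msum n r I (\<lambda>x. F x * A) $$ (i, j)"
    using ij by simp
qed (use A in \<open>auto simp: msum_def\<close>)

lemma msum_cong: "(\<And>x. x \<in> I \<Longrightarrow> F x = F' x) \<Longrightarrow> msum n m I F = msum n m I F'"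
  by (simp add: msum_def)

section \<open>The general linear group and isomorphism of representations\<close>

lemma GLn_simps:
  "carrier (GLn n) = {A \<in> carrier_mat n n. \<exists>B\<in>carrier_mat n n. A * B = 1\<^sub>m n \<and> B * A = 1\<^sub>m n}"
  "A \<otimes>\<^bsub>GLn n\<^esub> B = A * B" "\<one>\<^bsub>GLn n\<^esub> = 1\<^sub>m n"
  by (auto simp: GLn_def units_of_def Units_def ring_mat_def)

lemma GLn_carrier_mat: "A \<in> carrier (GLn n) \<Longrightarrow> A \<in> carrier_mat n n"
  by (simp add: GLn_simps)

lemma GLn_group: "group (GLn n :: 'k::field mat monoid)"
proof -
  interpret R: ring "ring_mat TYPE('k) n ()" by (rule ring_mat)
  show ?thesis unfolding GLn_def by (rule R.units_group)
qed

lemma hom_GLnI: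
  assumes E: "group E" and X: "\<And>x. x \<in> carrier E \<Longrightarrow> X x \<in> carrier_mat n n"
    and one: "X \<one>\<^bsub>E\<^esub> = 1\<^sub>m n"
    and mult: "\<And>x y. x \<in> carrier E \<Longrightarrow> y \<in> carrier E \<Longrightarrow> X (x \<otimes>\<^bsub>E\<^esub> y) = X x * X y"
  shows "X \<in> hom E (GLn n)"
proof -
  interpret E: group E by fact
  have "X x * X (inv\<^bsub>E\<^esub> x) = 1\<^sub>m n" "X (inv\<^bsub>E\<^esub> x) * X x = 1\<^sub>m n" if "x \<in> carrier E" for x
    using that mult[of x "inv\<^bsub>E\<^esub> x"] mult[of "inv\<^bsub>E\<^esub> x" x] one by simp_all
  then show ?thesis using X mult E.inv_closed unfolding hom_def GLn_simps by blast
qed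

lemma rep_iso_refl:
  assumes "\<And>x. x \<in> S \<Longrightarrow> snd V x \<in> carrier_mat (fst V) (fst V)"
  shows "rep_iso S V V"
  unfolding rep_iso_def GLn_simps
  by (intro conjI refl bexI[of _ "1\<^sub>m (fst V)"] ballI CollectI)
    (auto simp: left_mult_one_mat[OF assms] right_mult_one_mat[OF assms] intro!: bexI[of _ "1\<^sub>m (fst V)"])

lemma rep_iso_sym:
  assumes iso: "rep_iso S V W"
    and V: "\<And>x. x \<in> S \<Longrightarrow> snd V x \<in> carrier_mat (fst V) (fst V)"
    and W: "\<And>x. x \<in> S \<Longrightarrow> snd W x \<in> carrier_mat (fst W) (fst W)"
  shows "rep_iso S W V"
proof -
  define n where "n = fst V"
  have n: "fst W = n" using iso by (simp add: rep_iso_def n_def)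
  obtain P Q where P: "P \<in> carrier_mat n n" and Q: "Q \<in> carrier_mat n n"
    and PQ: "P * Q = 1\<^sub>m n" "Q * P = 1\<^sub>m n" and int: "\<And>x. x \<in> S \<Longrightarrow> P * snd V x = snd W x * P"
    using iso by (auto simp: rep_iso_def GLn_simps n_def)
  have "Q * snd W x = snd V x * Q" if x: "x \<in> S" for x
  proof -
    have Vx: "snd V x \<in> carrier_mat n n" and Wx: "snd W x \<in> carrier_mat n n"
      using V[OF x] W[OF x] n by (simp_all add: n_def)
    have "Q * snd W x = Q * (snd W x * (P * Q))" using PQ Q Wx by simp
    also have "\<dots> = Q * (snd W x * P) * Q" using P Q Wx by (simp add: assoc_mult_mat[of _ n n _ n _ n])
    also have "\<dots> = (Q * P) * (snd V x * Q)"
      unfolding int[OF x, symmetric] using P Q Vx by (simp add: assoc_mult_mat[of _ n n _ n _ n])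
    also have "\<dots> = snd V x * Q" using PQ Q Vx by (simp add: mult_carrier_mat[of _ n n])
    finally show ?thesis .
  qed
  moreover have "Q \<in> carrier (GLn n)" using P Q PQ unfolding GLn_simps by blast
  ultimately show ?thesis using n unfolding rep_iso_def n_def[symmetric] by auto
qed

lemma rep_iso_trans:
  assumes iso: "rep_iso S V W" "rep_iso S W X"
    and V: "\<And>x. x \<in> S \<Longrightarrow> snd V x \<in> carrier_mat (fst V) (fst V)"
    and W: "\<And>x. x \<in> S \<Longrightarrow> snd W x \<in> carrier_mat (fst W) (fst W)"
    and X: "\<And>x. x \<in> S \<Longrightarrow> snd X x \<in> carrier_mat (fst X) (fst X)"
  shows "rep_iso S V X"
proof -
  define n where "n = fst V"
  have n: "fst W = n" "fst X = n" using iso by (simp_all add: rep_iso_def n_def)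
  obtain P where P: "P \<in> carrier (GLn n)" and Pi: "\<And>x. x \<in> S \<Longrightarrow> P * snd V x = snd W x * P"
    using iso(1) by (auto simp: rep_iso_def n_def)
  obtain Q where Q: "Q \<in> carrier (GLn n)" and Qi: "\<And>x. x \<in> S \<Longrightarrow> Q * snd W x = snd X x * Q"
    using iso(2) n by (auto simp: rep_iso_def)
  interpret GL: group "GLn n :: 'b mat monoid" by (rule GLn_group)
  have QP: "Q * P \<in> carrier (GLn n)" using GL.m_closed[OF Q P] by (simp add: GLn_simps(2))
  have "Q * P * snd V x = snd X x * (Q * P)" if x: "x \<in> S" for x
  proof -
    have c: "snd V x \<in> carrier_mat n n" "snd W x \<in> carrier_mat n n" "snd X x \<in> carrier_mat n n"
      "P \<in> carrier_mat n n" "Q \<in> carrier_mat n n"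
      using V[OF x] W[OF x] X[OF x] n P Q by (simp_all add: n_def GLn_carrier_mat)
    have "Q * P * snd V x = Q * (snd W x * P)"
      unfolding Pi[OF x, symmetric] using c by (simp add: assoc_mult_mat[of _ n n _ n _ n])
    also have "\<dots> = (snd X x * Q) * P"
      unfolding Qi[OF x, symmetric] using c by (simp add: assoc_mult_mat[of _ n n _ n _ n])
    also have "\<dots> = snd X x * (Q * P)" using c by (simp add: assoc_mult_mat[of _ n n _ n _ n])
    finally show ?thesis .
  qed
  then show ?thesis using QP n by (auto simp: rep_iso_def n_def)
qed

lemma rep_isoI_irreducible:
  fixes V W :: "('x, 'k::field) mrep"
  assumes irr: "irreducible_on S V" "irreducible_on S W"
    and V: "\<And>x. x \<in> S \<Longrightarrow> snd V x \<in> carrier_mat (fst V) (fst V)"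
    and W: "\<And>x. x \<in> S \<Longrightarrow> snd W x \<in> carrier_mat (fst W) (fst W)"
    and P: "P \<in> carrier_mat (fst W) (fst V)" "P \<noteq> 0\<^sub>m (fst W) (fst V)"
    and int: "\<And>x. x \<in> S \<Longrightarrow> P * snd V x = snd W x * P"
  shows "rep_iso S V W"
  using schur_intertwiner[of S "fst V" "snd V" "fst W" "snd W" P] irr V W P int
  by (auto simp: rep_iso_def GLn_simps)

text \<open>Averages are taken over the quotient K, which is finite with order invertible in the
  field. The function \<chi> is constrained only through \<open>chi_rep\<close>.\<close>

locale central_extension = E: group E + K: group K
  for E :: "('e, 'l) monoid_scheme" (structure) and K :: "('a, 'q) monoid_scheme" +
  fixes p :: "'e \<Rightarrow> 'a" and \<chi> :: "'e \<Rightarrow> 'k::alg_closed_field"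
  assumes finK: "finite (carrier K)" and card_ne: "of_nat (card (carrier K)) \<noteq> (0::'k)"
    and p: "p \<in> epi E K"
begin

definition chi_rep :: "nat \<Rightarrow> ('e \<Rightarrow> 'k mat) \<Rightarrow> bool" where
  "chi_rep n X \<longleftrightarrow> X \<in> hom E (GLn n) \<and> (\<forall>z\<in>kernel E K p. X z = \<chi> z \<cdot>\<^sub>m 1\<^sub>m n)"

abbreviation irreps :: "('e, 'k) mrep set" where
  "irreps \<equiv> grp_irreps E (kernel E K p) \<chi>"

lemma irreps_iff: "V \<in> irreps \<longleftrightarrow> chi_rep (fst V) (snd V) \<and> irreducible_on (carrier E) V"
  by (auto simp: grp_irreps_def chi_rep_def)

lemma p_hom: "p \<in> hom E K" using p by (simp add: epi_def)

lemma p_surj: "p ` carrier E = carrier K" using p by (simp add: epi_def)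

lemma p_closed [simp]: "x \<in> carrier E \<Longrightarrow> p x \<in> carrier K"
  using p_hom by (auto simp: hom_def)

lemma p_mult: "x \<in> carrier E \<Longrightarrow> y \<in> carrier E \<Longrightarrow> p (x \<otimes> y) = p x \<otimes>\<^bsub>K\<^esub> p y"
  using p_hom by (auto simp: hom_def)

text \<open>A set-theoretic section of the projection; \<open>conj_depends_on_p\<close> shows that
  the expressions averaged below do not depend on it.\<close>

definition lift :: "'a \<Rightarrow> 'e" where "lift a = (SOME x. x \<in> carrier E \<and> p x = a)"

lemma lift: assumes "a \<in> carrier K" shows "lift a \<in> carrier E" "p (lift a) = a"
proof -
  have "a \<in> p ` carrier E" using p_surj assms by simp
  then have "\<exists>x. x \<in> carrier E \<and> p x = a" by blast
  then have "lift a \<in> carrier E \<and> p (lift a) = a" unfolding lift_def by (rule someI_ex)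
  then show "lift a \<in> carrier E" "p (lift a) = a" by auto
qed

lemma chi_rep_mat: "chi_rep n X \<Longrightarrow> x \<in> carrier E \<Longrightarrow> X x \<in> carrier_mat n n"
  by (auto simp: chi_rep_def hom_def GLn_simps)

lemma chi_rep_mult: "chi_rep n X \<Longrightarrow> x \<in> carrier E \<Longrightarrow> y \<in> carrier E \<Longrightarrow> X (x \<otimes> y) = X x * X y"
  by (auto simp: chi_rep_def hom_def GLn_simps(2))

lemma chi_rep_one: "chi_rep n X \<Longrightarrow> X \<one> = 1\<^sub>m n"
  using hom_one[OF _ E.is_group GLn_group[of n, where 'k = 'k], of X] by (simp add: chi_rep_def GLn_simps(3))

lemma chi_rep_inv: assumes "chi_rep n X" "x \<in> carrier E"
  shows "X x * X (inv x) = 1\<^sub>m n" "X (inv x) * X x = 1\<^sub>m n"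
  using assms chi_rep_mult[of n X x "inv x"] chi_rep_mult[of n X "inv x" x] chi_rep_one[of n X] by simp_all

lemma irreps_mat: "V \<in> irreps \<Longrightarrow> x \<in> carrier E \<Longrightarrow> snd V x \<in> carrier_mat (fst V) (fst V)"
  using chi_rep_mat irreps_iff by blast

text \<open>Two preimages of the same element differ by some z in the kernel, which acts by
  \<chi>(z) on one side of M and by the inverse scalar on the other.\<close>

lemma conj_depends_on_p:
  assumes X: "chi_rep n X" and Y: "chi_rep m Y" and M: "M \<in> carrier_mat n m"
    and xy: "x \<in> carrier E" "y \<in> carrier E" "p x = p y"
  shows "X x * M * Y (inv x) = X y * M * Y (inv y)"
proof -
  define z where "z = x \<otimes> inv y"
  have z: "z \<in> carrier E" using xy by (simp add: z_def)
  have "p z = p y \<otimes>\<^bsub>K\<^esub> p (inv y)" using xy by (simp add: z_def p_mult)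
  also have "\<dots> = \<one>\<^bsub>K\<^esub>" using xy p_mult[of y "inv y"] hom_one[OF p_hom E.is_group K.is_group] by simp
  finally have zk: "z \<in> kernel E K p" using z by (simp add: kernel_def)
  have x: "x = z \<otimes> y" using xy by (simp add: z_def E.m_assoc)
  have c: "X y \<in> carrier_mat n n" "Y (inv y) \<in> carrier_mat m m" "Y (inv z) \<in> carrier_mat m m"
    using X Y xy z by (auto intro: chi_rep_mat)
  have Xz: "X z = \<chi> z \<cdot>\<^sub>m 1\<^sub>m n" and Yz: "Y z = \<chi> z \<cdot>\<^sub>m 1\<^sub>m m"
    using X Y zk by (auto simp: chi_rep_def)
  have "\<chi> z \<cdot>\<^sub>m Y (inv z) = 1\<^sub>m m"
    using chi_rep_inv(1)[OF Y z] c(3) unfolding Yz by (simp add: mult_smult_assoc_mat[of _ m m _ m])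
  have "X x * M * Y (inv x) = (X z * X y) * M * (Y (inv y) * Y (inv z))"
    unfolding x using xy z X Y by (simp add: chi_rep_mult E.inv_mult_group)
  also have "\<dots> = (\<chi> z \<cdot>\<^sub>m (X y * M)) * (Y (inv y) * Y (inv z))"
    unfolding Xz using c M by (simp add: mult_smult_assoc_mat[of _ n n _ n] mult_smult_assoc_mat[of _ n n _ m])
  also have "\<dots> = \<chi> z \<cdot>\<^sub>m ((X y * M * Y (inv y)) * Y (inv z))"
    using c M by (auto simp: mult_smult_assoc_mat[of _ n m _ m] mat_assoc)
  also have "\<dots> = (X y * M * Y (inv y)) * (\<chi> z \<cdot>\<^sub>m Y (inv z))"
    using c M by (intro mult_smult_distrib[of _ n m _ m, symmetric]) (auto simp: mult_carrier_mat[of _ n n])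
  also have "\<dots> = X y * M * Y (inv y)"
    unfolding \<open>\<chi> z \<cdot>\<^sub>m Y (inv z) = 1\<^sub>m m\<close> using c M by (intro right_mult_one_mat[of _ n m]) auto
  finally show ?thesis .
qed

definition average :: "nat \<Rightarrow> nat \<Rightarrow> ('e \<Rightarrow> 'k mat) \<Rightarrow> ('e \<Rightarrow> 'k mat) \<Rightarrow> 'k mat \<Rightarrow> 'k mat" where
  "average n m X Y M = msum n m (carrier K) (\<lambda>a. X (lift a) * M * Y (inv (lift a)))"

text \<open>Multiplication by \<open>X x\<close> permutes the summands: x times a preimage of a is a
  preimage of p(x) a, and any preimage gives the same summand.\<close>

lemma average_intertwines:
  assumes X: "chi_rep n X" and Y: "chi_rep m Y" and M: "M \<in> carrier_mat n m" and x: "x \<in> carrier E"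
  shows "X x * average n m X Y M = average n m X Y M * Y x"
proof -
  let ?f = "\<lambda>y. X y * M * Y (inv y)"
  have fc: "?f y \<in> carrier_mat n m" if "y \<in> carrier E" for y
    using chi_rep_mat[OF X that] chi_rep_mat[OF Y, of "inv y"] M that by auto
  have Xx: "X x \<in> carrier_mat n n" and Yx: "Y x \<in> carrier_mat m m" "Y (inv x) \<in> carrier_mat m m"
    using X Y x by (auto intro: chi_rep_mat)
  have "X x * ?f y = ?f (x \<otimes> y) * Y x" if y: "y \<in> carrier E" for y
  proof -
    have c: "X y \<in> carrier_mat n n" "Y (inv y) \<in> carrier_mat m m"
      using X Y y by (auto intro: chi_rep_mat)
    have "?f (x \<otimes> y) * Y x = X x * X y * M * (Y (inv y) * Y (inv x)) * Y x"
      using x y X Y by (simp add: chi_rep_mult E.inv_mult_group)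
    also have "\<dots> = X x * (X y * M * Y (inv y)) * (Y (inv x) * Y x)"
      using c M Xx Yx by (simp add: assoc_mult_mat[of _ n n _ n _ m] assoc_mult_mat[of _ n m _ m _ m]
          assoc_mult_mat[of _ n n _ m _ m] assoc_mult_mat[of _ m m _ m _ m] mult_carrier_mat[of _ n n]
          mult_carrier_mat[of _ n m] mult_carrier_mat[of _ m m])
    also have "\<dots> = X x * ?f y"
      unfolding chi_rep_inv(2)[OF Y x] using c M Xx
      by (intro right_mult_one_mat[of _ n m]) (auto simp: mult_carrier_mat[of _ n n])
    finally show ?thesis ..
  qed
  then have "X x * average n m X Y M = msum n m (carrier K) (\<lambda>a. ?f (x \<otimes> lift a) * Y x)"
    unfolding average_def using fc lift by (subst mult_msum[OF Xx]) (auto intro!: msum_cong)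
  also have "\<dots> = msum n m (carrier K) (\<lambda>a. ?f (x \<otimes> lift a)) * Y x"
    using fc lift x by (subst msum_mult[OF Yx(1)]) auto
  also have "msum n m (carrier K) (\<lambda>a. ?f (x \<otimes> lift a)) = msum n m (carrier K) (\<lambda>a. ?f (lift (p x \<otimes>\<^bsub>K\<^esub> a)))"
    using x lift by (intro msum_cong conj_depends_on_p[OF X Y M]) (auto simp: p_mult)
  also have "\<dots> = average n m X Y M"
    unfolding average_def msum_def
    using K.sum_mult_left[of "p x" "\<lambda>a. ?f (lift a) $$ _"] x by (simp add: K.sum_mult_left)
  finally show ?thesis .
qed

end

section \<open>Schur orthogonality over the finite quotient\<close>

lemma mat_eq_unit_vec:
  fixes A B :: "'k::field mat"
  assumes A: "A \<in> carrier_mat n m" and B: "B \<in> carrier_mat n m"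
    and eq: "\<And>j. j < m \<Longrightarrow> A *\<^sub>v unit_vec m j = B *\<^sub>v unit_vec m j"
  shows "A = B"
proof (rule eq_matI)
  fix i j assume "i < dim_row B" "j < dim_col B"
  then have ij: "i < n" "j < m" using B by auto
  show "A $$ (i, j) = B $$ (i, j)"
    using arg_cong[OF eq[OF ij(2)], of "\<lambda>v. v $ i"] unfolding mat_mult_unit_vec[OF A ij] mat_mult_unit_vec[OF B ij] .
qed (use A B in auto)

lemma mult_mat_unit_mult_index:
  fixes A B :: "'k::field mat"
  assumes A: "A \<in> carrier_mat r n" and B: "B \<in> carrier_mat m s"
    and ind: "i < r" "j < s" "u < n" "v < m"
  shows "(A * mat n m (\<lambda>(a, b). if a = u \<and> b = v then 1 else 0) * B) $$ (i, j) = A $$ (i, u) * B $$ (v, j)"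
proof -
  let ?U = "mat n m (\<lambda>(a, b). if a = u \<and> b = v then 1 else (0::'k))"
  have U: "?U \<in> carrier_mat n m" by simp
  have AU: "A * ?U \<in> carrier_mat r m" using A by simp
  have e: "(A * ?U) $$ (i, b) = (if b = v then A $$ (i, u) else 0)" if b: "b < m" for b
  proof -
    have "(A * ?U) $$ (i, b) = (\<Sum>c<n. if c = u then (if b = v then A $$ (i, u) else 0) else 0)"
      unfolding mat_mult_index[OF A U ind(1) b] using b by (intro sum.cong) auto
    then show ?thesis using ind by simp
  qed
  have "(A * ?U * B) $$ (i, j) = (\<Sum>b<m. if b = v then A $$ (i, u) * B $$ (b, j) else 0)"
    unfolding mat_mult_index[OF AU B ind(1,2)] by (intro sum.cong refl) (simp add: e)
  then show ?thesis using ind by simp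
qed

context central_extension
begin

text \<open>A pairing of matrix coefficients of X and Y over K. By \<open>average_unit_index\<close>
  it is the entry at (i, j) of the average of the matrix unit at (u, v).\<close>

definition inner :: "('e \<Rightarrow> 'k mat) \<Rightarrow> nat \<Rightarrow> nat \<Rightarrow> ('e \<Rightarrow> 'k mat) \<Rightarrow> nat \<Rightarrow> nat \<Rightarrow> 'k" where
  "inner X i u Y v j = (\<Sum>a\<in>carrier K. X (lift a) $$ (i, u) * Y (inv (lift a)) $$ (v, j))"

lemma average_unit_index:
  assumes X: "chi_rep n X" and Y: "chi_rep m Y"
    and ind: "i < n" "j < m" "u < n" "v < m"
  shows "average n m X Y (mat n m (\<lambda>(a, b). if a = u \<and> b = v then 1 else 0)) $$ (i, j) = inner X i u Y v j"
  unfolding average_def inner_def msum_index[OF ind(1,2)]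
proof (rule sum.cong[OF refl])
  fix a assume a: "a \<in> carrier K"
  have A: "X (lift a) \<in> carrier_mat n n" using X lift[OF a] by (auto intro: chi_rep_mat)
  have B: "Y (inv (lift a)) \<in> carrier_mat m m" using Y lift[OF a] by (auto intro: chi_rep_mat)
  show "(X (lift a) * mat n m (\<lambda>(a, b). if a = u \<and> b = v then 1 else 0) * Y (inv (lift a))) $$ (i, j) =
      X (lift a) $$ (i, u) * Y (inv (lift a)) $$ (v, j)"
    by (rule mult_mat_unit_mult_index[OF A B ind])
qed

lemma average_carrier [simp]: "average n m X Y M \<in> carrier_mat n m"
  by (simp add: average_def)

lemma schur_orthogonality_distinct:
  assumes X: "X \<in> irreps" and Y: "Y \<in> irreps" and ne: "\<not> rep_iso (carrier E) Y X"
    and ind: "i < fst X" "j < fst Y" "u < fst X" "v < fst Y"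
  shows "inner (snd X) i u (snd Y) v j = 0"
proof -
  have Xr: "chi_rep (fst X) (snd X)" and Yr: "chi_rep (fst Y) (snd Y)" using X Y by (auto simp: irreps_iff)
  let ?U = "mat (fst X) (fst Y) (\<lambda>(a, b). if a = u \<and> b = v then 1 else (0::'k))"
  let ?A = "average (fst X) (fst Y) (snd X) (snd Y) ?U"
  have "?A = 0\<^sub>m (fst X) (fst Y)"
  proof (rule ccontr)
    assume nz: "?A \<noteq> 0\<^sub>m (fst X) (fst Y)"
    have "rep_iso (carrier E) Y X"
    proof (rule rep_isoI_irreducible[OF _ _ irreps_mat[OF Y] irreps_mat[OF X] average_carrier nz])
      fix x assume "x \<in> carrier E"
      then show "?A * snd Y x = snd X x * ?A"
        by (intro average_intertwines[OF Xr Yr, symmetric]) auto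
    qed (use X Y in \<open>auto simp: irreps_iff\<close>)
    then show False using ne by simp
  qed
  then show ?thesis using average_unit_index[OF Xr Yr ind] ind by simp
qed

text \<open>The average of a matrix unit is a scalar c. Comparing traces, dim X times c is |K| for a
  diagonal matrix unit and 0 otherwise; as |K| is invertible in the field, so is dim X.\<close>

lemma schur_orthogonality_same:
  assumes X: "X \<in> irreps" and ind: "i < fst X" "j < fst X" "u < fst X" "v < fst X"
  shows "of_nat (fst X) * inner (snd X) i u (snd X) v j =
    (if i = j \<and> u = v then of_nat (card (carrier K)) else 0)"
    and "of_nat (fst X) \<noteq> (0 :: 'k)"
proof -
  define n where "n = fst X"
  have Xr: "chi_rep n (snd X)" and irr: "irreducible_on (carrier E) (n, snd X)"
    using X by (auto simp: irreps_iff n_def)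
  have *: "of_nat n * inner (snd X) i u (snd X) v j = (if i = j \<and> u = v then of_nat (card (carrier K)) else 0)"
    if ind: "i < n" "j < n" "u < n" "v < n" for i j u v
  proof -
    let ?U = "mat n n (\<lambda>(a, b). if a = u \<and> b = v then 1 else (0::'k))"
    have "\<exists>c. average n n (snd X) (snd X) ?U = c \<cdot>\<^sub>m 1\<^sub>m n"
      by (rule schur_scalar[OF irr chi_rep_mat[OF Xr] average_carrier])
        (auto intro: average_intertwines[OF Xr Xr, symmetric])
    then obtain c where c: "average n n (snd X) (snd X) ?U = c \<cdot>\<^sub>m 1\<^sub>m n" ..
    have in_c: "inner (snd X) i u (snd X) v j = (if i = j then c else 0)" if "i < n" "j < n" for i j
      using average_unit_index[OF Xr Xr that ind(3,4), symmetric] that unfolding c by simp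
    have "of_nat n * c = (\<Sum>i<n. inner (snd X) i u (snd X) v i)" by (simp add: in_c)
    also have "\<dots> = (\<Sum>a\<in>carrier K. \<Sum>i<n. snd X (inv (lift a)) $$ (v, i) * snd X (lift a) $$ (i, u))"
      unfolding inner_def by (subst sum.swap) (simp add: mult.commute)
    also have "\<dots> = (\<Sum>a\<in>carrier K. if u = v then 1 else 0)"
    proof (rule sum.cong[OF refl])
      fix a assume a: "a \<in> carrier K"
      have "(\<Sum>i<n. snd X (inv (lift a)) $$ (v, i) * snd X (lift a) $$ (i, u)) =
          (snd X (inv (lift a)) * snd X (lift a)) $$ (v, u)"
        using lift[OF a] ind chi_rep_mat[OF Xr] by (intro mat_mult_index[symmetric]) auto
      then show "(\<Sum>i<n. snd X (inv (lift a)) $$ (v, i) * snd X (lift a) $$ (i, u)) = (if u = v then 1 else 0)"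
        unfolding chi_rep_inv(2)[OF Xr lift(1)[OF a]] using ind by simp
    qed
    finally show ?thesis using in_c[OF ind(1,2)] by auto
  qed
  show "of_nat (fst X) * inner (snd X) i u (snd X) v j =
    (if i = j \<and> u = v then of_nat (card (carrier K)) else 0)"
    using * ind unfolding n_def by blast
  have "of_nat n \<noteq> (0::'k)" using *[of i i u u] ind card_ne unfolding n_def by auto
  then show "of_nat (fst X) \<noteq> (0 :: 'k)" by (simp add: n_def)
qed

text \<open>By orthogonality the matrix coefficients of inequivalent irreducibles, evaluated at the
  chosen preimages, are linearly independent functions on K.\<close>

lemma sum_of_squares_le:
  assumes fin: "finite D" and D: "D \<subseteq> irreps"
    and ne: "\<And>X Y. X \<in> D \<Longrightarrow> Y \<in> D \<Longrightarrow> rep_iso (carrier E) X Y \<Longrightarrow> X = Y"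
  shows "(\<Sum>X\<in>D. fst X * fst X) \<le> card (carrier K)"
proof -
  let ?I = "SIGMA X:D. {..<fst X} \<times> {..<fst X}"
  have "card ?I \<le> card (carrier K)"
  proof (rule card_le_of_dual_families[where s = "\<lambda>(X, j, v) a. of_nat (fst X) / of_nat (card (carrier K)) * snd X (inv (lift a)) $$ (v, j)"
        and t = "\<lambda>(X, i, u) a. snd X (lift a) $$ (i, u)"])
    fix x y assume xy: "x \<in> ?I" "y \<in> ?I"
    obtain Y j v where x: "x = (Y, j, v)" by (cases x) auto
    obtain X i u where y: "y = (X, i, u)" by (cases y) auto
    have XY: "X \<in> D" "Y \<in> D" and ind: "i < fst X" "j < fst Y" "u < fst X" "v < fst Y"
      using xy by (auto simp: x y)
    have *: "(\<Sum>z\<in>carrier K. of_nat (fst Y) / of_nat (card (carrier K)) * snd Y (inv (lift z)) $$ (v, j) * snd X (lift z) $$ (i, u))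
        = of_nat (fst Y) * inner (snd X) i u (snd Y) v j / of_nat (card (carrier K))"
      unfolding inner_def by (simp add: sum_distrib_left sum_divide_distrib mult_ac)
    have "of_nat (fst Y) * inner (snd X) i u (snd Y) v j = (if X = Y \<and> i = j \<and> u = v then of_nat (card (carrier K)) else 0)"
    proof (cases "X = Y")
      case True
      then show ?thesis using schur_orthogonality_same(1)[of X i j u v] D XY ind by auto
    next
      case False
      then show ?thesis using schur_orthogonality_distinct[of X Y i j u v] ne[of Y X] D XY ind by auto
    qed
    then have "(\<Sum>z\<in>carrier K. of_nat (fst Y) / of_nat (card (carrier K)) * snd Y (inv (lift z)) $$ (v, j) * snd X (lift z) $$ (i, u))
        = (if x = y then 1 else 0)"
      unfolding * using card_ne by (auto simp: x y)
    then show "(\<Sum>z\<in>carrier K. (case x of (X, j, v) \<Rightarrow> \<lambda>a. of_nat (fst X) / of_nat (card (carrier K)) * snd X (inv (lift a)) $$ (v, j)) z *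
        (case y of (X, i, u) \<Rightarrow> \<lambda>a. snd X (lift a) $$ (i, u)) z) = (if x = y then 1 else 0)"
      unfolding x y prod.case .
  qed (use fin finK in auto)
  then show ?thesis using fin by (simp add: card_SigmaI card_cartesian_product)
qed

text \<open>\<open>S0\<close> splits the embedding T only linearly. Its average over K is
  equivariant, and on the image of T each summand becomes Y(x) Y(x^{-1}) = 1, so dividing by |K|
  gives an equivariant retraction.\<close>

lemma maschke_retraction:
  assumes X: "chi_rep n X" and T: "T \<in> carrier_mat n d" and S0: "S0 \<in> carrier_mat d n"
    and S0T: "S0 * T = 1\<^sub>m d"
    and inv_range: "\<And>x. x \<in> carrier E \<Longrightarrow> T * (S0 * (X x * T)) = X x * T"
  defines "Y \<equiv> \<lambda>x. S0 * (X x * T)"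
  obtains S where "chi_rep d Y" "\<And>x. x \<in> carrier E \<Longrightarrow> X x * T = T * Y x"
    "S \<in> carrier_mat d n" "S * T = 1\<^sub>m d" "\<And>x. x \<in> carrier E \<Longrightarrow> S * X x = Y x * S"
proof -
  have Xc: "X x \<in> carrier_mat n n" if "x \<in> carrier E" for x using chi_rep_mat[OF X that] .
  have Yc: "Y x \<in> carrier_mat d d" if "x \<in> carrier E" for x
    using Xc[OF that] T S0 by (auto simp: Y_def)
  have XT: "X x * T = T * Y x" if "x \<in> carrier E" for x using inv_range[OF that] by (simp add: Y_def)
  have Y: "chi_rep d Y" unfolding chi_rep_def
  proof (intro conjI ballI hom_GLnI E.is_group Yc)
    show "Y \<one> = 1\<^sub>m d" using T S0 S0T by (simp add: Y_def chi_rep_one[OF X])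
    fix x y assume x: "x \<in> carrier E" and y: "y \<in> carrier E"
    have "Y (x \<otimes> y) = S0 * (X x * (X y * T))"
      using Xc[OF x] Xc[OF y] T S0 by (auto simp: Y_def chi_rep_mult[OF X x y] mat_assoc)
    also have "\<dots> = S0 * ((X x * T) * Y y)"
      unfolding XT[OF y] using Xc[OF x] Yc[OF y] T S0 by (auto simp: mat_assoc)
    also have "\<dots> = (S0 * (X x * T)) * Y y"
      using Xc[OF x] Yc[OF y] T S0 by (auto simp: mat_assoc)
    also have "\<dots> = Y x * Y y" by (simp add: Y_def)
    finally show "Y (x \<otimes> y) = Y x * Y y" .
  next
    fix z assume z: "z \<in> kernel E K p"
    have "X z = \<chi> z \<cdot>\<^sub>m 1\<^sub>m n" using X z by (simp add: chi_rep_def)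
    then have "Y z = S0 * (\<chi> z \<cdot>\<^sub>m T)"
      using T by (simp add: Y_def mult_smult_assoc_mat[of _ n n _ d])
    also have "\<dots> = \<chi> z \<cdot>\<^sub>m 1\<^sub>m d"
      using mult_smult_distrib[OF S0 T] S0T by simp
    finally show "Y z = \<chi> z \<cdot>\<^sub>m 1\<^sub>m d" .
  qed
  define S where "S = (1 / of_nat (card (carrier K))) \<cdot>\<^sub>m average d n Y X S0"
  have S: "S \<in> carrier_mat d n" by (simp add: S_def)
  have "average d n Y X S0 * T = of_nat (card (carrier K)) \<cdot>\<^sub>m 1\<^sub>m d"
  proof -
    have tm: "Y (lift a) * S0 * X (inv (lift a)) \<in> carrier_mat d n" if "a \<in> carrier K" for a
      using Yc[of "lift a"] Xc[of "inv (lift a)"] S0 lift[OF that] by auto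
    have "average d n Y X S0 * T = msum d d (carrier K) (\<lambda>a. Y (lift a) * S0 * X (inv (lift a)) * T)"
      unfolding average_def by (rule msum_mult[OF T tm])
    also have "\<dots> = msum d d (carrier K) (\<lambda>a. 1\<^sub>m d)"
    proof (rule msum_cong)
      fix a assume a: "a \<in> carrier K"
      have la: "lift a \<in> carrier E" "inv (lift a) \<in> carrier E" using lift[OF a] by auto
      have "Y (lift a) * S0 * X (inv (lift a)) * T = Y (lift a) * (S0 * (X (inv (lift a)) * T))"
        using Yc[OF la(1)] Xc[OF la(2)] S0 T by (auto simp: mat_assoc)
      also have "\<dots> = Y (lift a) * Y (inv (lift a))" by (simp add: Y_def)
      also have "\<dots> = 1\<^sub>m d" by (rule chi_rep_inv(1)[OF Y la(1)])
      finally show "Y (lift a) * S0 * X (inv (lift a)) * T = 1\<^sub>m d" .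
    qed
    also have "\<dots> = of_nat (card (carrier K)) \<cdot>\<^sub>m 1\<^sub>m d"
      by (rule eq_matI) (auto simp: msum_def)
    finally show ?thesis .
  qed
  then have ST: "S * T = 1\<^sub>m d"
    using T card_ne unfolding S_def
    by (subst mult_smult_assoc_mat[of _ d n _ d]) (auto intro!: eq_matI)
  have SX: "S * X x = Y x * S" if x: "x \<in> carrier E" for x
    unfolding S_def using average_intertwines[OF Y X S0 x] Xc[OF x] Yc[OF x]
    by (simp add: mult_smult_assoc_mat[of _ d n _ n] mult_smult_distrib[of _ d d _ n])
  show ?thesis using that[OF Y XT S ST SX] .
qed

text \<open>Among the nonzero invariant subspaces of the image of e, one of least dimension is
  irreducible. Averaging makes its retraction equivariant, and composing with e makes the retraction
  vanish on the kernel of e, so the constituent is orthogonal to whatever e annihilates.\<close>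

lemma irreducible_in_image:
  assumes X: "chi_rep n X" and e: "e \<in> carrier_mat n n" "e * e = e" "e \<noteq> 0\<^sub>m n n"
    and eX: "\<And>x. x \<in> carrier E \<Longrightarrow> e * X x = X x * e"
  obtains V T S where "V \<in> irreps" "T \<in> carrier_mat n (fst V)" "S \<in> carrier_mat (fst V) n"
    "S * T = 1\<^sub>m (fst V)" "e * T = T" "S * e = S"
    "\<And>x. x \<in> carrier E \<Longrightarrow> X x * T = T * snd V x" "\<And>x. x \<in> carrier E \<Longrightarrow> S * X x = snd V x * S"
proof -
  have Xc: "X x \<in> carrier_mat n n" if "x \<in> carrier E" for x using chi_rep_mat[OF X that] .
  \<comment> \<open>The range of T is an invariant subspace inside the image of e. Invariance is
    expressed by T S0 being the identity on the columns of \<open>X x * T\<close>, with S0 any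
    linear retraction.\<close>
  define good where "good d T S0 \<longleftrightarrow> 0 < d \<and> T \<in> carrier_mat n d \<and> S0 \<in> carrier_mat d n \<and>
    S0 * T = 1\<^sub>m d \<and> e * T = T \<and> (\<forall>x\<in>carrier E. T * (S0 * (X x * T)) = X x * T)" for d T S0
  have range_eq: "T * (S0 * A) = A"
    if T: "T \<in> carrier_mat n d" "S0 \<in> carrier_mat d n" "S0 * T = 1\<^sub>m d" and A: "A \<in> carrier_mat n m"
      and rng: "\<And>j. j < m \<Longrightarrow> \<exists>v\<in>carrier_vec d. A *\<^sub>v unit_vec m j = T *\<^sub>v v"
    for T S0 A :: "'k mat" and d m n :: nat
  proof (rule mat_eq_unit_vec[where n = n and m = m])
    show "T * (S0 * A) \<in> carrier_mat n m" using T A by auto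
    fix j assume j: "j < m"
    obtain v where v: "v \<in> carrier_vec d" "A *\<^sub>v unit_vec m j = T *\<^sub>v v" using rng[OF j] by blast
    have "(T * (S0 * A)) *\<^sub>v unit_vec m j = T *\<^sub>v (S0 *\<^sub>v (A *\<^sub>v unit_vec m j))"
      using T A by (simp add: assoc_mult_mat_vec[of _ n d _ m] assoc_mult_mat_vec[of _ d n _ m])
    also have "\<dots> = T *\<^sub>v ((S0 * T) *\<^sub>v v)" unfolding v(2) assoc_mult_mat_vec[OF T(2,1) v(1)] ..
    also have "\<dots> = T *\<^sub>v v" unfolding T(3) using v(1) by simp
    also have "\<dots> = A *\<^sub>v unit_vec m j" using v(2) by simp
    finally show "(T * (S0 * A)) *\<^sub>v unit_vec m j = A *\<^sub>v unit_vec m j" .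
  qed (rule A)
  have "\<exists>d T S0. good d T S0"
  proof -
    let ?U = "{v \<in> carrier_vec n. e *\<^sub>v v = v}"
    obtain d T S0 where T: "T \<in> carrier_mat n d" and S0: "S0 \<in> carrier_mat d n" and ST: "S0 * T = 1\<^sub>m d"
      and U: "?U = {T *\<^sub>v v | v. v \<in> carrier_vec d}"
    proof (rule subspace_split[of ?U n])
      show "0\<^sub>v n \<in> ?U" using e by (auto intro!: eq_vecI)
      fix v w assume "v \<in> ?U" "w \<in> ?U"
      then show "v + w \<in> ?U" by (simp add: mult_add_distrib_mat_vec[OF e(1)])
    next
      fix c v assume "v \<in> ?U"
      then show "c \<cdot>\<^sub>v v \<in> ?U" using e by (simp add: mult_mat_vec[of _ n n])
    qed auto
    have eT: "e * T = T"
    proof (rule mat_eq_unit_vec[where n = n and m = d])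
      fix j assume "j < d"
      have "T *\<^sub>v unit_vec d j \<in> ?U" unfolding U by auto
      then show "(e * T) *\<^sub>v unit_vec d j = T *\<^sub>v unit_vec d j"
        using assoc_mult_mat_vec[OF e(1) T, of "unit_vec d j"] by simp
    qed (use e T in auto)
    have inv: "T * (S0 * (X x * T)) = X x * T" if x: "x \<in> carrier E" for x
    proof (rule range_eq[OF T S0 ST])
      show "X x * T \<in> carrier_mat n d" using Xc[OF x] T by simp
      fix j assume j: "j < d"
      let ?w = "(X x * T) *\<^sub>v unit_vec d j"
      have XTc: "X x * T \<in> carrier_mat n d" using Xc[OF x] T by simp
      have "e * (X x * T) = X x * T"
      proof -
        have "e * (X x * T) = (e * X x) * T" using e Xc[OF x] T by (auto simp: mat_assoc)
        also have "\<dots> = X x * (e * T)" unfolding eX[OF x] using e Xc[OF x] T by (auto simp: mat_assoc)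
        finally show ?thesis by (simp add: eT)
      qed
      then have "e *\<^sub>v ?w = ?w"
        using assoc_mult_mat_vec[OF e(1) XTc, of "unit_vec d j"] by simp
      then have "?w \<in> ?U" using mult_mat_vec_carrier[OF XTc] by simp
      then show "\<exists>v\<in>carrier_vec d. ?w = T *\<^sub>v v" unfolding U by blast
    qed
    have "0 < d"
    proof (rule ccontr)
      assume "\<not> 0 < d"
      then have U0: "?U = {T *\<^sub>v v | v. v \<in> carrier_vec 0}" and T0: "T \<in> carrier_mat n 0" using U T by auto
      have "e = 0\<^sub>m n n"
      proof (rule mat_eq_unit_vec[where n = n and m = n])
        fix j assume j: "j < n"
        have "e *\<^sub>v (e *\<^sub>v unit_vec n j) = e *\<^sub>v unit_vec n j"
          using assoc_mult_mat_vec[OF e(1) e(1), of "unit_vec n j"] e(2) by simp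
        then have "e *\<^sub>v unit_vec n j \<in> ?U" using mult_mat_vec_carrier[OF e(1)] by simp
        then obtain v where v: "v \<in> carrier_vec 0" "e *\<^sub>v unit_vec n j = T *\<^sub>v v" unfolding U0 by blast
        show "e *\<^sub>v unit_vec n j = 0\<^sub>m n n *\<^sub>v unit_vec n j"
          unfolding v(2) using T0 v(1) by (intro eq_vecI) (auto simp: scalar_prod_def)
      qed (use e in auto)
      then show False using e by simp
    qed
    then show ?thesis using T S0 ST eT inv unfolding good_def by blast
  qed
  then have ex: "\<exists>d. \<exists>T S0. good d T S0" .
  define d where "d = (LEAST d. \<exists>T S0. good d T S0)"
  have "\<exists>T S0. good d T S0" unfolding d_def by (rule LeastI_ex[OF ex])
  then obtain T S0 where gd: "good d T S0" by (elim exE) (rule that)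
  have least: "d \<le> d'" if "good d' T' S'" for d' T' S'
    unfolding d_def using that by (intro Least_le) blast
  have d0: "0 < d" and T: "T \<in> carrier_mat n d" and S0: "S0 \<in> carrier_mat d n" and ST0: "S0 * T = 1\<^sub>m d"
    and eT: "e * T = T" and inv: "\<And>x. x \<in> carrier E \<Longrightarrow> T * (S0 * (X x * T)) = X x * T"
    using gd by (auto simp: good_def)
  define Y where "Y = (\<lambda>x. S0 * (X x * T))"
  obtain S where Y: "chi_rep d Y" and XT: "\<And>x. x \<in> carrier E \<Longrightarrow> X x * T = T * Y x"
    and S: "S \<in> carrier_mat d n" and ST: "S * T = 1\<^sub>m d" and SX: "\<And>x. x \<in> carrier E \<Longrightarrow> S * X x = Y x * S"
    using maschke_retraction[OF X T S0 ST0 inv] unfolding Y_def by blast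
  have Yc: "Y x \<in> carrier_mat d d" if "x \<in> carrier E" for x using chi_rep_mat[OF Y that] .
  have irr: "irreducible_on (carrier E) (d, Y)"
    unfolding irreducible_on_def fst_conv snd_conv
  proof (intro conjI allI impI d0)
    fix U assume sub: "VectorSpace.subspace class_ring U (module_vec TYPE('k) d)"
      and U_inv: "\<forall>x\<in>carrier E. \<forall>v\<in>U. Y x *\<^sub>v v \<in> U"
    note U = subspace_vecD[OF sub]
    obtain d' T' S' where T': "T' \<in> carrier_mat d d'" and S': "S' \<in> carrier_mat d' d" and ST': "S' * T' = 1\<^sub>m d'"
      and U_eq: "U = {T' *\<^sub>v v | v. v \<in> carrier_vec d'}"
      by (rule subspace_split[OF U])
    show "U = {0\<^sub>v d} \<or> U = carrier_vec d"
    proof (cases "d' = 0")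
      case True
      have "T' *\<^sub>v v = 0\<^sub>v d" if "v \<in> carrier_vec d'" for v
        using T' that True by (intro eq_vecI) (auto simp: scalar_prod_def)
      then have "U \<subseteq> {0\<^sub>v d}" using U_eq by auto
      then show ?thesis using U(2) by auto
    next
      case False
      have YT': "T' * (S' * (Y x * T')) = Y x * T'" if x: "x \<in> carrier E" for x
      proof (rule range_eq[OF T' S' ST'])
        show "Y x * T' \<in> carrier_mat d d'" using Yc[OF x] T' by simp
        fix j assume "j < d'"
        have "T' *\<^sub>v unit_vec d' j \<in> U" unfolding U_eq by auto
        then have "Y x *\<^sub>v (T' *\<^sub>v unit_vec d' j) \<in> U" using U_inv x by blast
        then have "(Y x * T') *\<^sub>v unit_vec d' j \<in> U"
          using assoc_mult_mat_vec[OF Yc[OF x] T', of "unit_vec d' j"] by simp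
        then show "\<exists>v\<in>carrier_vec d'. (Y x * T') *\<^sub>v unit_vec d' j = T' *\<^sub>v v" unfolding U_eq by blast
      qed
      \<comment> \<open>A nonzero invariant subspace of the minimal one is itself a candidate, so
        its dimension is again d and its embedding T' is invertible.\<close>
      have "good d' (T * T') (S' * S0)" unfolding good_def
      proof (intro conjI ballI)
        show "0 < d'" using False by simp
        show "T * T' \<in> carrier_mat n d'" "S' * S0 \<in> carrier_mat d' n" using T T' S0 S' by auto
        have "S' * S0 * (T * T') = S' * ((S0 * T) * T')" using T T' S0 S' by (auto simp: mat_assoc)
        then show "S' * S0 * (T * T') = 1\<^sub>m d'" using ST0 ST' T' by simp
        have "e * (T * T') = (e * T) * T'" using e T T' by (auto simp: mat_assoc)
        then show "e * (T * T') = T * T'" by (simp add: eT)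
        fix x assume x: "x \<in> carrier E"
        have XTT': "X x * (T * T') = T * (Y x * T')"
        proof -
          have "X x * (T * T') = (X x * T) * T'" using Xc[OF x] T T' by (auto simp: mat_assoc)
          then show ?thesis unfolding XT[OF x] using Yc[OF x] T T' by (auto simp: mat_assoc)
        qed
        have "T * T' * (S' * S0 * (X x * (T * T'))) = T * (T' * (S' * ((S0 * T) * (Y x * T'))))"
          unfolding XTT' using Yc[OF x] T T' S0 S' by (auto simp: mat_assoc)
        also have "\<dots> = T * (Y x * T')"
          unfolding ST0 using YT'[OF x] Yc[OF x] T' by (simp add: left_mult_one_mat[of _ d d'])
        finally show "T * T' * (S' * S0 * (X x * (T * T'))) = X x * (T * T')" by (simp add: XTT')
      qed
      then have "d \<le> d'" by (rule least)
      moreover have "d' \<le> d" by (rule mat_left_inverse_le[OF S' T' ST'])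
      ultimately have dd: "d' = d" by simp
      have TS': "T' * S' = 1\<^sub>m d" using mat_mult_left_right_inverse[of S' d T'] S' T' ST' dd by simp
      have "w \<in> U" if w: "w \<in> carrier_vec d" for w
      proof -
        have "w = T' *\<^sub>v (S' *\<^sub>v w)"
          using assoc_mult_mat_vec[OF T' S' w] TS' w by simp
        moreover have "S' *\<^sub>v w \<in> carrier_vec d'" using S' w by simp
        ultimately show ?thesis unfolding U_eq by blast
      qed
      then show ?thesis using U(1) by auto
    qed
  qed
  have V: "(d, Y) \<in> irreps" using Y irr by (simp add: irreps_iff)
  \<comment> \<open>The retraction handed out is S e; on the image of T it agrees with S because e T
    = T.\<close>
  have Se: "S * e \<in> carrier_mat d n" using S e by simp
  show ?thesis
  proof (rule that[OF V])
    have "S * e * T = S * (e * T)" using S e T by (auto simp: mat_assoc)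
    then show "S * e * T = 1\<^sub>m (fst (d, Y))" by (simp add: eT ST)
    have "S * e * e = S * (e * e)" using S e by (auto simp: mat_assoc)
    then show "S * e * e = S * e" by (simp add: e)
    fix x assume x: "x \<in> carrier E"
    have "S * e * X x = S * (e * X x)" using S e Xc[OF x] by (auto simp: mat_assoc)
    also have "\<dots> = (S * X x) * e" unfolding eX[OF x] using S e Xc[OF x] by (auto simp: mat_assoc)
    also have "\<dots> = Y x * (S * e)" unfolding SX[OF x] using S e Yc[OF x] by (auto simp: mat_assoc)
    finally show "S * e * X x = snd (d, Y) x * (S * e)" by simp
  qed (use T Se eT XT in auto)
qed

end

text \<open>D indexes a complete set of representatives on both sides at once, and this identifies
  the two quotients. The last conjunct records which classes are matched, so that dimensions can be
  compared.\<close>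

lemma quotient_bij_betw:
  assumes r: "equiv A r" and s: "equiv B s"
    and f: "\<And>d. d \<in> D \<Longrightarrow> f d \<in> A" and g: "\<And>d. d \<in> D \<Longrightarrow> g d \<in> B"
    and fu: "\<And>d d'. d \<in> D \<Longrightarrow> d' \<in> D \<Longrightarrow> (f d, f d') \<in> r \<Longrightarrow> d = d'"
    and gu: "\<And>d d'. d \<in> D \<Longrightarrow> d' \<in> D \<Longrightarrow> (g d, g d') \<in> s \<Longrightarrow> d = d'"
    and fe: "\<And>a. a \<in> A \<Longrightarrow> \<exists>d\<in>D. (f d, a) \<in> r" and ge: "\<And>b. b \<in> B \<Longrightarrow> \<exists>d\<in>D. (g d, b) \<in> s"
  shows "\<exists>\<Phi>. bij_betw \<Phi> (A // r) (B // s) \<and>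
    (\<forall>C\<in>A // r. \<exists>d\<in>D. C = r `` {f d} \<and> \<Phi> C = s `` {g d})"
proof -
  have bij: "bij_betw (\<lambda>d. q `` {h d}) D (M // q)"
    if q: "equiv M q" and h: "\<And>d. d \<in> D \<Longrightarrow> h d \<in> M"
      and hu: "\<And>d d'. d \<in> D \<Longrightarrow> d' \<in> D \<Longrightarrow> (h d, h d') \<in> q \<Longrightarrow> d = d'"
      and he: "\<And>a. a \<in> M \<Longrightarrow> \<exists>d\<in>D. (h d, a) \<in> q" for M q and h :: "_ \<Rightarrow> 'z"
    unfolding bij_betw_def
  proof (intro conjI inj_onI subset_antisym subsetI)
    fix d d' assume "d \<in> D" "d' \<in> D" "q `` {h d} = q `` {h d'}"
    then show "d = d'" using hu h eq_equiv_class_iff[OF q] by auto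
  next
    fix C assume "C \<in> (\<lambda>d. q `` {h d}) ` D"
    then show "C \<in> M // q" using h by (auto intro: quotientI)
  next
    fix C assume "C \<in> M // q"
    then obtain a where a: "a \<in> M" "C = q `` {a}" by (auto elim: quotientE)
    obtain d where "d \<in> D" "(h d, a) \<in> q" using he a by blast
    then show "C \<in> (\<lambda>d. q `` {h d}) ` D" using a equiv_class_eq[OF q] by auto
  qed
  define F where "F d = r `` {f d}" for d
  define \<Phi> where "\<Phi> C = s `` {g (inv_into D F C)}" for C
  have F: "bij_betw F D (A // r)" unfolding F_def by (rule bij[OF r f fu fe])
  have G: "bij_betw (\<lambda>d. s `` {g d}) D (B // s)" by (rule bij[OF s g gu ge])
  have "bij_betw ((\<lambda>d. s `` {g d}) \<circ> inv_into D F) (A // r) (B // s)"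
    by (rule bij_betw_trans[OF bij_betw_inv_into[OF F] G])
  moreover have "(\<lambda>d. s `` {g d}) \<circ> inv_into D F = \<Phi>" by (auto simp: \<Phi>_def)
  ultimately have 1: "bij_betw \<Phi> (A // r) (B // s)" by simp
  have 2: "\<exists>d\<in>D. C = r `` {f d} \<and> \<Phi> C = s `` {g d}" if "C \<in> A // r" for C
  proof (intro bexI conjI)
    show "inv_into D F C \<in> D" using F that by (auto simp: bij_betw_def intro: inv_into_into)
    show "C = r `` {f (inv_into D F C)}"
      using F that f_inv_into_f[of C F D] by (auto simp: bij_betw_def F_def)
  qed (simp add: \<Phi>_def)
  show ?thesis using 1 2 by blast
qed

section \<open>Decomposition into irreducible constituents\<close>

context central_extension
begin

text \<open>Biorthogonal embeddings and retractions of irreducible constituents. The last condition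
  makes isomorphic constituents equal, so that maps between them are scalars and no isomorphisms
  have to be chosen later.\<close>

definition family :: "nat \<Rightarrow> ('e \<Rightarrow> 'k mat) \<Rightarrow> nat \<Rightarrow> (nat \<Rightarrow> ('e, 'k) mrep) \<Rightarrow>
    (nat \<Rightarrow> 'k mat) \<Rightarrow> (nat \<Rightarrow> 'k mat) \<Rightarrow> bool" where
  "family n X N V T S \<longleftrightarrow>
     (\<forall>j<N. V j \<in> irreps \<and> T j \<in> carrier_mat n (fst (V j)) \<and> S j \<in> carrier_mat (fst (V j)) n \<and>
        (\<forall>x\<in>carrier E. X x * T j = T j * snd (V j) x \<and> S j * X x = snd (V j) x * S j)) \<and>
     (\<forall>j<N. \<forall>k<N. S j * T k = (if j = k then 1\<^sub>m (fst (V j)) else 0\<^sub>m (fst (V j)) (fst (V k)))) \<and>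
     (\<forall>j<N. \<forall>k<N. rep_iso (carrier E) (V j) (V k) \<longrightarrow> V j = V k)"

text \<open>One column of each T j and one row of each S j already form dual families in dimension
  n.\<close>

lemma family_bound:
  assumes "family n X N V T S"
  shows "N \<le> n"
proof -
  have "card {..<N} \<le> card {..<n}"
  proof (rule card_le_of_dual_families[where s = "\<lambda>j c. S j $$ (0, c)" and t = "\<lambda>k c. T k $$ (c, 0)"])
    fix j k assume "j \<in> {..<N}" "k \<in> {..<N}"
    then have jk: "j < N" "k < N" by auto
    have c: "S j \<in> carrier_mat (fst (V j)) n" "T k \<in> carrier_mat n (fst (V k))"
      and V: "V j \<in> irreps" "V k \<in> irreps"
      and ST: "S j * T k = (if j = k then 1\<^sub>m (fst (V j)) else 0\<^sub>m (fst (V j)) (fst (V k)))"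
      using assms jk unfolding family_def by blast+
    have pos: "0 < fst (V j)" "0 < fst (V k)"
      using V by (auto simp: irreps_iff irreducible_on_def)
    have "(\<Sum>c<n. S j $$ (0, c) * T k $$ (c, 0)) = (S j * T k) $$ (0, 0)"
      using mat_mult_index[OF c pos] by simp
    then show "(\<Sum>c<n. S j $$ (0, c) * T k $$ (c, 0)) = (if j = k then 1 else 0)"
      using pos by (simp add: ST)
  qed auto
  then show ?thesis by simp
qed

text \<open>The complement e of the projection q onto the constituents found so far is a nonzero
  equivariant idempotent. A constituent of its image is orthogonal to the old ones on both sides
  because e T = T and S e = S.\<close>

lemma family_extend:
  assumes X: "chi_rep n X" and fam: "family n X N V T S"
    and ne: "msum n n {..<N} (\<lambda>j. T j * S j) \<noteq> 1\<^sub>m n"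
  shows "\<exists>V T S. family n X (Suc N) V T S"
proof -
  have V: "V j \<in> irreps" and T: "T j \<in> carrier_mat n (fst (V j))" and S: "S j \<in> carrier_mat (fst (V j)) n"
    and XT: "\<And>x. x \<in> carrier E \<Longrightarrow> X x * T j = T j * snd (V j) x"
    and SX: "\<And>x. x \<in> carrier E \<Longrightarrow> S j * X x = snd (V j) x * S j" if "j < N" for j
    using fam that unfolding family_def by blast+
  have ST: "S j * T k = (if j = k then 1\<^sub>m (fst (V j)) else 0\<^sub>m (fst (V j)) (fst (V k)))"
    and Viso: "rep_iso (carrier E) (V j) (V k) \<Longrightarrow> V j = V k" if "j < N" "k < N" for j k
    using fam that unfolding family_def by blast+
  have Xc: "X x \<in> carrier_mat n n" if "x \<in> carrier E" for x using chi_rep_mat[OF X that] .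
  define q where "q = msum n n {..<N} (\<lambda>j. T j * S j)"
  have TSc: "T j * S j \<in> carrier_mat n n" if "j < N" for j using T[OF that] S[OF that] by simp
  have qc: "q \<in> carrier_mat n n" by (simp add: q_def)
  have Sq: "S k * q = S k" if k: "k < N" for k
  proof -
    have "S k * q = msum (fst (V k)) n {..<N} (\<lambda>j. S k * (T j * S j))"
      unfolding q_def using TSc by (intro mult_msum[OF S[OF k]]) auto
    also have "\<dots> = msum (fst (V k)) n {..<N} (\<lambda>j. if j = k then S k else 0\<^sub>m (fst (V k)) n)"
    proof (rule msum_cong)
      fix j assume "j \<in> {..<N}"
      then have j: "j < N" by simp
      have "S k * (T j * S j) = (S k * T j) * S j" using S[OF k] T[OF j] S[OF j] by (auto simp: mat_assoc)
      then show "S k * (T j * S j) = (if j = k then S k else 0\<^sub>m (fst (V k)) n)"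
        using S[OF j] by (auto simp: ST[OF k j])
    qed
    also have "\<dots> = S k"
    proof (rule eq_matI)
      fix a b assume "a < dim_row (S k)" "b < dim_col (S k)"
      then have ab: "a < fst (V k)" "b < n" using S[OF k] by auto
      have "(\<Sum>j<N. (if j = k then S k else 0\<^sub>m (fst (V k)) n) $$ (a, b)) = (\<Sum>j<N. if j = k then S k $$ (a, b) else 0)"
        using ab by (intro sum.cong) auto
      then show "msum (fst (V k)) n {..<N} (\<lambda>j. if j = k then S k else 0\<^sub>m (fst (V k)) n) $$ (a, b) = S k $$ (a, b)"
        using ab k by simp
    qed (use S[OF k] in \<open>auto simp: msum_def\<close>)
    finally show ?thesis .
  qed
  have qT: "q * T k = T k" if k: "k < N" for k
  proof -
    have "q * T k = msum n (fst (V k)) {..<N} (\<lambda>j. T j * S j * T k)"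
      unfolding q_def using TSc by (intro msum_mult[OF T[OF k]]) auto
    also have "\<dots> = msum n (fst (V k)) {..<N} (\<lambda>j. if j = k then T k else 0\<^sub>m n (fst (V k)))"
    proof (rule msum_cong)
      fix j assume "j \<in> {..<N}"
      then have j: "j < N" by simp
      have "T j * S j * T k = T j * (S j * T k)" using T[OF k] T[OF j] S[OF j] by (auto simp: mat_assoc)
      then show "T j * S j * T k = (if j = k then T k else 0\<^sub>m n (fst (V k)))"
        using T[OF j] by (auto simp: ST[OF j k])
    qed
    also have "\<dots> = T k"
    proof (rule eq_matI)
      fix a b assume "a < dim_row (T k)" "b < dim_col (T k)"
      then have ab: "a < n" "b < fst (V k)" using T[OF k] by auto
      have "(\<Sum>j<N. (if j = k then T k else 0\<^sub>m n (fst (V k))) $$ (a, b)) = (\<Sum>j<N. if j = k then T k $$ (a, b) else 0)"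
        using ab by (intro sum.cong) auto
      then show "msum n (fst (V k)) {..<N} (\<lambda>j. if j = k then T k else 0\<^sub>m n (fst (V k))) $$ (a, b) = T k $$ (a, b)"
        using ab k by simp
    qed (use T[OF k] in \<open>auto simp: msum_def\<close>)
    finally show ?thesis .
  qed
  have qq: "q * q = q"
  proof -
    have "q * q = msum n n {..<N} (\<lambda>j. q * (T j * S j))"
      using mult_msum[OF qc, of "{..<N}" "\<lambda>j. T j * S j" n] TSc by (simp flip: q_def)
    also have "\<dots> = q" unfolding q_def
    proof (rule msum_cong)
      fix j assume "j \<in> {..<N}"
      then have j: "j < N" by simp
      have "q * (T j * S j) = (q * T j) * S j" using qc T[OF j] S[OF j] by (auto simp: mat_assoc)
      then show "msum n n {..<N} (\<lambda>j. T j * S j) * (T j * S j) = T j * S j" by (simp add: qT[OF j] flip: q_def)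
    qed
    finally show ?thesis .
  qed
  have qX: "q * X x = X x * q" if x: "x \<in> carrier E" for x
  proof -
    have "q * X x = msum n n {..<N} (\<lambda>j. T j * S j * X x)"
      unfolding q_def using TSc by (intro msum_mult[OF Xc[OF x]]) auto
    also have "\<dots> = msum n n {..<N} (\<lambda>j. X x * (T j * S j))"
    proof (rule msum_cong)
      fix j assume "j \<in> {..<N}"
      then have j: "j < N" by simp
      have Vc: "snd (V j) x \<in> carrier_mat (fst (V j)) (fst (V j))" using irreps_mat[OF V[OF j] x] .
      have "T j * S j * X x = T j * (S j * X x)" using T[OF j] S[OF j] Xc[OF x] by (auto simp: mat_assoc)
      also have "\<dots> = (T j * snd (V j) x) * S j"
        unfolding SX[OF j x] using T[OF j] S[OF j] Vc by (auto simp: mat_assoc)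
      also have "\<dots> = X x * (T j * S j)"
        unfolding XT[OF j x, symmetric] using T[OF j] S[OF j] Xc[OF x] by (auto simp: mat_assoc)
      finally show "T j * S j * X x = X x * (T j * S j)" .
    qed
    also have "\<dots> = X x * q"
      unfolding q_def using TSc by (intro mult_msum[OF Xc[OF x], symmetric]) auto
    finally show ?thesis .
  qed
  define e where "e = 1\<^sub>m n - q"
  have ec: "e \<in> carrier_mat n n" by (simp add: e_def qc minus_carrier_mat)
  have eM: "e * M = M - q * M" if "M \<in> carrier_mat n m" for M m
    unfolding e_def using minus_mult_distrib_mat[OF one_carrier_mat qc that] that by simp
  have Me: "M * e = M - M * q" if "M \<in> carrier_mat m n" for M m
    unfolding e_def using mult_minus_distrib_mat[OF that one_carrier_mat qc] that by simp
  have ee: "e * e = e"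
  proof -
    have "q * e = 0\<^sub>m n n" using Me[OF qc] qc by (simp add: qq)
    then show ?thesis using eM[OF ec] ec by (auto intro!: eq_matI)
  qed
  have e0: "e \<noteq> 0\<^sub>m n n"
  proof
    assume e: "e = 0\<^sub>m n n"
    have "q = 1\<^sub>m n"
    proof (rule eq_matI)
      fix i j assume "i < dim_row (1\<^sub>m n)" "j < dim_col (1\<^sub>m n)"
      then have ij: "i < n" "j < n" by auto
      have "(1\<^sub>m n - q) $$ (i, j) = 0" using e ij unfolding e_def by simp
      then show "q $$ (i, j) = 1\<^sub>m n $$ (i, j)" using ij qc by auto
    qed (use qc in auto)
    then show False using ne by (simp add: q_def)
  qed
  have eX: "e * X x = X x * e" if "x \<in> carrier E" for x
    by (simp add: eM[OF Xc[OF that]] Me[OF Xc[OF that]] qX[OF that])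
  obtain V' T' S' where V': "V' \<in> irreps" and T': "T' \<in> carrier_mat n (fst V')" and S': "S' \<in> carrier_mat (fst V') n"
    and ST': "S' * T' = 1\<^sub>m (fst V')" and eT': "e * T' = T'" and Se': "S' * e = S'"
    and XT': "\<And>x. x \<in> carrier E \<Longrightarrow> X x * T' = T' * snd V' x"
    and SX': "\<And>x. x \<in> carrier E \<Longrightarrow> S' * X x = snd V' x * S'"
    by (rule irreducible_in_image[OF X ec ee e0]) (use eX that in blast)+
  \<comment> \<open>To keep isomorphic constituents equal, a new constituent isomorphic to some V j
    is transported to V j along the isomorphism P.\<close>
  have "\<exists>V' T' S'. V' \<in> irreps \<and> T' \<in> carrier_mat n (fst V') \<and> S' \<in> carrier_mat (fst V') n \<and>
    S' * T' = 1\<^sub>m (fst V') \<and> e * T' = T' \<and> S' * e = S' \<and>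
    (\<forall>x\<in>carrier E. X x * T' = T' * snd V' x \<and> S' * X x = snd V' x * S') \<and>
    (\<forall>j<N. rep_iso (carrier E) V' (V j) \<longrightarrow> V' = V j)"
  proof (cases "\<exists>j<N. rep_iso (carrier E) V' (V j)")
    case False
    then show ?thesis using V' T' S' ST' eT' Se' XT' SX' by blast
  next
    case True
    then obtain j where j: "j < N" and iso: "rep_iso (carrier E) V' (V j)" by blast
    define d where "d = fst V'"
    have d: "fst (V j) = d" using iso by (simp add: rep_iso_def d_def)
    obtain P Q where P: "P \<in> carrier_mat d d" and Q: "Q \<in> carrier_mat d d"
      and PQ: "P * Q = 1\<^sub>m d" "Q * P = 1\<^sub>m d"
      and int: "\<And>x. x \<in> carrier E \<Longrightarrow> P * snd V' x = snd (V j) x * P"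
      using iso by (auto simp: rep_iso_def GLn_simps d_def)
    have c: "T' \<in> carrier_mat n d" "S' \<in> carrier_mat d n" using T' S' by (simp_all add: d_def)
    show ?thesis
    proof (intro exI conjI ballI allI impI)
      show "V j \<in> irreps" by (rule V[OF j])
      show "T' * Q \<in> carrier_mat n (fst (V j))" "P * S' \<in> carrier_mat (fst (V j)) n"
        using c P Q d by auto
      have "P * S' * (T' * Q) = P * ((S' * T') * Q)" using c P Q by (auto simp: mat_assoc)
      then show "P * S' * (T' * Q) = 1\<^sub>m (fst (V j))" using ST' PQ Q d by (simp add: d_def)
      have "e * (T' * Q) = (e * T') * Q" using c Q ec by (auto simp: mat_assoc)
      then show "e * (T' * Q) = T' * Q" by (simp add: eT')
      have "P * S' * e = P * (S' * e)" using c P ec by (auto simp: mat_assoc)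
      then show "P * S' * e = P * S'" by (simp add: Se')
    next
      fix x assume x: "x \<in> carrier E"
      have Vc: "snd V' x \<in> carrier_mat d d" using irreps_mat[OF V' x] by (simp add: d_def)
      have Vjc: "snd (V j) x \<in> carrier_mat d d" using irreps_mat[OF V[OF j] x] d by simp
      have "P * S' * X x = P * (S' * X x)" using c P Xc[OF x] by (auto simp: mat_assoc)
      also have "\<dots> = (P * snd V' x) * S'" unfolding SX'[OF x] using c P Vc by (auto simp: mat_assoc)
      also have "\<dots> = snd (V j) x * (P * S')" unfolding int[OF x] using c P Vjc by (auto simp: mat_assoc)
      finally show "P * S' * X x = snd (V j) x * (P * S')" .
      have VQ: "snd V' x * Q = Q * snd (V j) x"
      proof -
        have "snd V' x * Q = (Q * P) * (snd V' x * Q)" using PQ Vc Q by simp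
        also have "\<dots> = Q * ((P * snd V' x) * Q)" using P Q Vc by (auto simp: mat_assoc)
        also have "\<dots> = Q * snd (V j) x * (P * Q)" unfolding int[OF x] using P Q Vjc by (auto simp: mat_assoc)
        also have "\<dots> = Q * snd (V j) x" using PQ Q Vjc by simp
        finally show ?thesis .
      qed
      have "X x * (T' * Q) = (X x * T') * Q" using c Q Xc[OF x] by (auto simp: mat_assoc)
      also have "\<dots> = T' * (snd V' x * Q)" unfolding XT'[OF x] using c Q Vc by (auto simp: mat_assoc)
      also have "\<dots> = T' * Q * snd (V j) x" unfolding VQ using c Q Vjc by (auto simp: mat_assoc)
      finally show "X x * (T' * Q) = T' * Q * snd (V j) x" .
    next
      fix k assume "k < N" "rep_iso (carrier E) (V j) (V k)"
      then show "V j = V k" using Viso[OF j] by blast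
    qed
  qed
  then obtain V' T' S' where V': "V' \<in> irreps" and T': "T' \<in> carrier_mat n (fst V')" and S': "S' \<in> carrier_mat (fst V') n"
    and ST': "S' * T' = 1\<^sub>m (fst V')" and eT': "e * T' = T'" and Se': "S' * e = S'"
    and XT': "\<And>x. x \<in> carrier E \<Longrightarrow> X x * T' = T' * snd V' x"
    and SX': "\<And>x. x \<in> carrier E \<Longrightarrow> S' * X x = snd V' x * S'"
    and iso': "\<And>j. j < N \<Longrightarrow> rep_iso (carrier E) V' (V j) \<Longrightarrow> V' = V j"
    by (elim exE conjE) (rule that; blast)
  have S'T: "S' * T k = 0\<^sub>m (fst V') (fst (V k))" if k: "k < N" for k
  proof -
    have "S' * T k = S' * (e * T k)" using S' ec T[OF k] by (subst Se'[symmetric]) (auto simp: mat_assoc)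
    also have "e * T k = 0\<^sub>m n (fst (V k))" using eM[OF T[OF k]] qT[OF k] T[OF k] by simp
    finally show ?thesis using S' by simp
  qed
  have ST'0: "S k * T' = 0\<^sub>m (fst (V k)) (fst V')" if k: "k < N" for k
  proof -
    have "S k * T' = (S k * e) * T'" using T' ec S[OF k] by (subst eT'[symmetric]) (auto simp: mat_assoc)
    also have "S k * e = 0\<^sub>m (fst (V k)) n" using Me[OF S[OF k]] Sq[OF k] S[OF k] by simp
    finally show ?thesis using T' by simp
  qed
  have iso'': "V j = V'" if "j < N" "rep_iso (carrier E) (V j) V'" for j
    using iso'[OF that(1) rep_iso_sym[OF that(2)]] irreps_mat V[OF that(1)] V' by blast
  have "family n X (Suc N) (V(N := V')) (T(N := T')) (S(N := S'))"
    unfolding family_def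
  proof (rule conjI[OF _ conjI]; rule allI; rule impI)
    fix j assume j: "j < Suc N"
    show "(V(N := V')) j \<in> irreps \<and> (T(N := T')) j \<in> carrier_mat n (fst ((V(N := V')) j)) \<and>
      (S(N := S')) j \<in> carrier_mat (fst ((V(N := V')) j)) n \<and>
      (\<forall>x\<in>carrier E. X x * (T(N := T')) j = (T(N := T')) j * snd ((V(N := V')) j) x \<and>
        (S(N := S')) j * X x = snd ((V(N := V')) j) x * (S(N := S')) j)"
      using V[of j] T[of j] S[of j] XT[of j] SX[of j] V' T' S' XT' SX' j by (cases "j = N") auto
    show "\<forall>k<Suc N. (S(N := S')) j * (T(N := T')) k =
      (if j = k then 1\<^sub>m (fst ((V(N := V')) j)) else 0\<^sub>m (fst ((V(N := V')) j)) (fst ((V(N := V')) k)))"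
    proof (intro allI impI)
      fix k assume k: "k < Suc N"
      show "(S(N := S')) j * (T(N := T')) k =
        (if j = k then 1\<^sub>m (fst ((V(N := V')) j)) else 0\<^sub>m (fst ((V(N := V')) j)) (fst ((V(N := V')) k)))"
        using ST[of j k] ST' S'T[of k] ST'0[of j] j k by (cases "j = N"; cases "k = N") auto
    qed
    show "\<forall>k<Suc N. rep_iso (carrier E) ((V(N := V')) j) ((V(N := V')) k) \<longrightarrow>
      (V(N := V')) j = (V(N := V')) k"
    proof (intro allI impI)
      fix k assume k: "k < Suc N" and iso: "rep_iso (carrier E) ((V(N := V')) j) ((V(N := V')) k)"
      show "(V(N := V')) j = (V(N := V')) k"
        using iso Viso[of j k] iso'[of k] iso''[of j] j k by (cases "j = N"; cases "k = N") auto
    qed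
  qed
  then show ?thesis by blast
qed

text \<open>A longest family exists by \<open>family_bound\<close>, and \<open>family_extend\<close>
  shows that it exhausts the representation.\<close>

lemma decomposition:
  assumes X: "chi_rep n X"
  obtains N V T S where "family n X N V T S" "msum n n {..<N} (\<lambda>j. T j * S j) = 1\<^sub>m n"
proof -
  have ex0: "\<exists>V T S. family n X 0 V T S" by (simp add: family_def)
  have bd: "N \<le> n" if "\<exists>V T S. family n X N V T S" for N using that family_bound by blast
  define N where "N = (GREATEST N. \<exists>V T S. family n X N V T S)"
  have "\<exists>V T S. family n X N V T S"
    unfolding N_def using GreatestI_nat[of "\<lambda>N. \<exists>V T S. family n X N V T S" 0 n] ex0 bd by blast
  then obtain V T S where fam: "family n X N V T S" by blast
  have "\<not> (\<exists>V T S. family n X (Suc N) V T S)"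
    using Greatest_le_nat[of "\<lambda>N. \<exists>V T S. family n X N V T S" "Suc N" n] bd unfolding N_def[symmetric] by auto
  then have "msum n n {..<N} (\<lambda>j. T j * S j) = 1\<^sub>m n" using family_extend[OF X fam] by blast
  then show ?thesis using that fam by blast
qed

end

section \<open>The commutant of a representation\<close>

lemma mat_mult3_index:
  assumes A: "A \<in> carrier_mat r n" and B: "B \<in> carrier_mat n m" and C: "C \<in> carrier_mat m s"
    and ij: "i < r" "j < s"
  shows "(A * B * C) $$ (i, j) = (\<Sum>b<n. \<Sum>c<m. A $$ (i, b) * B $$ (b, c) * (C $$ (c, j) :: 'k::field))"
proof -
  have AB: "A * B \<in> carrier_mat r m" using A B by simp
  have "(A * B * C) $$ (i, j) = (\<Sum>c<m. \<Sum>b<n. A $$ (i, b) * B $$ (b, c) * C $$ (c, j))"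
    unfolding mat_mult_index[OF AB C ij] using ij(1)
    by (intro sum.cong refl) (simp add: mat_mult_index[OF A B] sum_distrib_right del: index_mult_mat)
  then show ?thesis by (subst sum.swap) simp
qed

lemma elts_lincomb: "(\<And>i. i \<in> I \<Longrightarrow> f i \<in> elts D) \<Longrightarrow> (\<lambda>z. \<Sum>i\<in>I. c i * f i z) \<in> elts D"
  by (simp add: elts_def)

lemma alg_rep_carrier: "alg_rep D V \<Longrightarrow> f \<in> elts D \<Longrightarrow> snd V f \<in> carrier_mat (fst V) (fst V)"
  by (simp add: alg_rep_def Let_def)

lemma alg_rep_lincomb:
  assumes V: "alg_rep D V" and I: "finite I" and f: "\<And>i. i \<in> I \<Longrightarrow> f i \<in> elts D"
    and ab: "a < fst V" "b < fst V"
  shows "snd V (\<lambda>z. \<Sum>i\<in>I. c i * f i z) $$ (a, b) = (\<Sum>i\<in>I. c i * snd V (f i) $$ (a, b))"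
  using I f
proof (induction I rule: finite_induct)
  case empty
  have z: "(\<lambda>z. 0) \<in> elts D" by (simp add: elts_def)
  have "snd V (\<lambda>x. c * f x) = c \<cdot>\<^sub>m snd V f" if "f \<in> elts D" for f c
    using V that by (simp add: alg_rep_def Let_def)
  from this[OF z, of 0] have "snd V (\<lambda>z. 0) = 0 \<cdot>\<^sub>m snd V (\<lambda>z. 0)" by simp
  then have "snd V (\<lambda>z. 0) $$ (a, b) = (0 \<cdot>\<^sub>m snd V (\<lambda>z. 0)) $$ (a, b)" by simp
  also have "\<dots> = 0" using alg_rep_carrier[OF V z] ab by simp
  finally show ?case by simp
next
  case (insert i I)
  have g: "(\<lambda>z. \<Sum>i\<in>I. c i * f i z) \<in> elts D" using insert by (intro elts_lincomb) auto
  have fi: "f i \<in> elts D" using insert by simp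
  have cf: "(\<lambda>z. c i * f i z) \<in> elts D" using fi by (simp add: elts_def)
  have "snd V (\<lambda>z. \<Sum>i\<in>insert i I. c i * f i z) = snd V (\<lambda>z. c i * f i z + (\<Sum>i\<in>I. c i * f i z))"
    using insert by simp
  also have "\<dots> = snd V (\<lambda>z. c i * f i z) + snd V (\<lambda>z. \<Sum>i\<in>I. c i * f i z)"
    using V cf g by (simp add: alg_rep_def Let_def)
  also have "snd V (\<lambda>z. c i * f i z) = c i \<cdot>\<^sub>m snd V (f i)"
    using V fi by (simp add: alg_rep_def Let_def)
  finally show ?case
    using insert alg_rep_carrier[OF V fi] alg_rep_carrier[OF V g] ab by simp
qed

text \<open>Through \<open>Pi\<close> the algebra D is the full commutant of X. The equality
  \<open>card_D\<close>, which says dim D times |K| = n^2, is the numerical input that forces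
  equality in the estimates for multiplicities and dimensions. \<open>Pi_lin\<close> expresses
  linearity through the values on the basis.\<close>

locale commutant = central_extension E K p \<chi>
  for E :: "('e, 'l) monoid_scheme" (structure) and K :: "('a, 'q) monoid_scheme"
    and p :: "'e \<Rightarrow> 'a" and \<chi> :: "'e \<Rightarrow> 'k::alg_closed_field" +
  fixes n :: nat and X :: "'e \<Rightarrow> 'k mat" and D :: "('b, 'k) algd" and Pi :: "('b \<Rightarrow> 'k) \<Rightarrow> 'k mat"
  assumes X: "chi_rep n X" and n_pos: "0 < n" and finD: "finite (bas D)"
    and Pi_mat: "\<And>f. f \<in> elts D \<Longrightarrow> Pi f \<in> carrier_mat n n"
    and Pi_lin: "\<And>f i j. f \<in> elts D \<Longrightarrow> i < n \<Longrightarrow> j < n \<Longrightarrow>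
      Pi f $$ (i, j) = (\<Sum>z\<in>bas D. f z * Pi (kd z) $$ (i, j))"
    and D_mult: "\<And>f h. f \<in> elts D \<Longrightarrow> h \<in> elts D \<Longrightarrow> amul D f h \<in> elts D"
    and D_one: "unity D \<in> elts D"
    and Pi_mult: "\<And>f h. f \<in> elts D \<Longrightarrow> h \<in> elts D \<Longrightarrow> Pi (amul D f h) = Pi f * Pi h"
    and Pi_one: "Pi (unity D) = 1\<^sub>m n"
    and Pi_comm: "\<And>f x. f \<in> elts D \<Longrightarrow> x \<in> carrier E \<Longrightarrow> Pi f * X x = X x * Pi f"
    and Pi_surj: "\<And>M. M \<in> carrier_mat n n \<Longrightarrow> (\<And>x. x \<in> carrier E \<Longrightarrow> M * X x = X x * M) \<Longrightarrow>
      \<exists>f\<in>elts D. Pi f = M"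
    and Pi_inj: "\<And>f h. f \<in> elts D \<Longrightarrow> h \<in> elts D \<Longrightarrow> Pi f = Pi h \<Longrightarrow> f = h"
    and card_D: "card (bas D) * card (carrier K) = n * n"

locale decomposed_commutant = commutant E K p \<chi> n X D Pi
  for E :: "('e, 'l) monoid_scheme" (structure) and K :: "('a, 'q) monoid_scheme"
    and p :: "'e \<Rightarrow> 'a" and \<chi> :: "'e \<Rightarrow> 'k::alg_closed_field"
    and n :: nat and X :: "'e \<Rightarrow> 'k mat" and D :: "('b, 'k) algd" and Pi :: "('b \<Rightarrow> 'k) \<Rightarrow> 'k mat" +
  fixes N :: nat and V :: "nat \<Rightarrow> ('e, 'k) mrep" and T S :: "nat \<Rightarrow> 'k mat"
  assumes family: "family n X N V T S" and total: "msum n n {..<N} (\<lambda>j. T j * S j) = 1\<^sub>m n"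
begin

lemma V: "j < N \<Longrightarrow> V j \<in> irreps" and T: "j < N \<Longrightarrow> T j \<in> carrier_mat n (fst (V j))"
  and S: "j < N \<Longrightarrow> S j \<in> carrier_mat (fst (V j)) n"
  and XT: "j < N \<Longrightarrow> x \<in> carrier E \<Longrightarrow> X x * T j = T j * snd (V j) x"
  and SX: "j < N \<Longrightarrow> x \<in> carrier E \<Longrightarrow> S j * X x = snd (V j) x * S j"
  and ST: "j < N \<Longrightarrow> k < N \<Longrightarrow> S j * T k = (if j = k then 1\<^sub>m (fst (V j)) else 0\<^sub>m (fst (V j)) (fst (V k)))"
  and V_iso: "j < N \<Longrightarrow> k < N \<Longrightarrow> rep_iso (carrier E) (V j) (V k) \<Longrightarrow> V j = V k"
  using family unfolding family_def by blast+

lemma V_pos: "j < N \<Longrightarrow> 0 < fst (V j)"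
  using V[of j] by (auto simp: irreps_iff irreducible_on_def)

lemma X_mat: "x \<in> carrier E \<Longrightarrow> X x \<in> carrier_mat n n"
  using chi_rep_mat[OF X] .

text \<open>\<open>coef j k f\<close> is the scalar by which \<open>f\<close> maps the \<open>k\<close>-th constituent to an isomorphic \<open>j\<close>-th
  one, and \<open>munit j k\<close> below is the matrix unit for this pair.\<close>

definition coef :: "nat \<Rightarrow> nat \<Rightarrow> ('b \<Rightarrow> 'k) \<Rightarrow> 'k" where
  "coef j k f = (S j * Pi f * T k) $$ (0, 0)"

definition index :: "('e, 'k) mrep \<Rightarrow> nat set" where
  "index Y = {j. j < N \<and> V j = Y}"

lemma index_finite [simp]: "finite (index Y)" by (simp add: index_def)

text \<open>\<open>Pi f\<close> commutes with X, so this block intertwines V k with V j and Schur's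
  lemma applies.\<close>

lemma block_scalar:
  assumes jk: "j < N" "k < N" and f: "f \<in> elts D"
  shows "S j * Pi f * T k = (if V j = V k then coef j k f \<cdot>\<^sub>m 1\<^sub>m (fst (V j)) else 0\<^sub>m (fst (V j)) (fst (V k)))"
proof -
  let ?A = "S j * Pi f * T k"
  have c: "S j \<in> carrier_mat (fst (V j)) n" "Pi f \<in> carrier_mat n n" "T k \<in> carrier_mat n (fst (V k))"
    using S[OF jk(1)] T[OF jk(2)] Pi_mat[OF f] by auto
  have Ac: "?A \<in> carrier_mat (fst (V j)) (fst (V k))" using c by auto
  have int: "?A * snd (V k) x = snd (V j) x * ?A" if x: "x \<in> carrier E" for x
  proof -
    have Vc: "snd (V j) x \<in> carrier_mat (fst (V j)) (fst (V j))" "snd (V k) x \<in> carrier_mat (fst (V k)) (fst (V k))"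
      using irreps_mat[OF V x] jk by auto
    have "?A * snd (V k) x = S j * Pi f * (T k * snd (V k) x)" using c Vc by (auto simp: mat_assoc)
    also have "\<dots> = S j * (Pi f * X x) * T k"
      unfolding XT[OF jk(2) x, symmetric] using c X_mat[OF x] by (auto simp: mat_assoc)
    also have "\<dots> = (S j * X x) * Pi f * T k"
      unfolding Pi_comm[OF f x] using c X_mat[OF x] by (auto simp: mat_assoc)
    also have "\<dots> = snd (V j) x * ?A" unfolding SX[OF jk(1) x] using c Vc by (auto simp: mat_assoc)
    finally show ?thesis .
  qed
  have irr: "irreducible_on (carrier E) (fst (V i), snd (V i))" if "i < N" for i
    using V[OF that] by (simp add: irreps_iff)
  show ?thesis
  proof (cases "V j = V k")
    case True
    have "\<exists>c. ?A = c \<cdot>\<^sub>m 1\<^sub>m (fst (V j))"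
    proof (rule schur_scalar[OF irr[OF jk(1)] irreps_mat[OF V[OF jk(1)]]])
      show "?A \<in> carrier_mat (fst (V j)) (fst (V j))" using Ac True by simp
      show "?A * snd (V j) x = snd (V j) x * ?A" if "x \<in> carrier E" for x using int[OF that] True by simp
    qed
    then obtain a where a: "?A = a \<cdot>\<^sub>m 1\<^sub>m (fst (V j))" ..
    have "coef j k f = a" unfolding coef_def a using V_pos[OF jk(1)] by simp
    then show ?thesis using a True by simp
  next
    case False
    have "?A = 0\<^sub>m (fst (V j)) (fst (V k))"
    proof (rule ccontr)
      assume "?A \<noteq> 0\<^sub>m (fst (V j)) (fst (V k))"
      then have "rep_iso (carrier E) (V k) (V j)"
        using V[OF jk(1)] V[OF jk(2)]
        by (intro rep_isoI_irreducible[OF _ _ _ _ Ac _ int]) (auto simp: irreps_iff irreps_mat)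
      then show False using V_iso[OF jk(2,1)] False by simp
    qed
    then show ?thesis using False by simp
  qed
qed

lemma coef_lin:
  assumes jk: "j < N" "k < N" and f: "f \<in> elts D"
  shows "coef j k f = (\<Sum>z\<in>bas D. f z * coef j k (kd z))"
proof -
  note idx = V_pos[OF jk(1)] V_pos[OF jk(2)]
  have kd: "kd z \<in> elts D" if "z \<in> bas D" for z using that by (rule kd_elts)
  have "coef j k f = (\<Sum>b<n. \<Sum>c<n. \<Sum>z\<in>bas D. f z * (S j $$ (0, b) * Pi (kd z) $$ (b, c) * T k $$ (c, 0)))"
    unfolding coef_def mat_mult3_index[OF S[OF jk(1)] Pi_mat[OF f] T[OF jk(2)] idx]
    by (intro sum.cong refl) (simp add: Pi_lin[OF f] sum_distrib_left sum_distrib_right mult_ac)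
  also have "\<dots> = (\<Sum>z\<in>bas D. \<Sum>b<n. \<Sum>c<n. f z * (S j $$ (0, b) * Pi (kd z) $$ (b, c) * T k $$ (c, 0)))"
    by (rule sum_sum_swap3[symmetric])
  also have "\<dots> = (\<Sum>z\<in>bas D. f z * coef j k (kd z))"
    unfolding coef_def using kd
    by (intro sum.cong refl) (simp add: mat_mult3_index[OF S[OF jk(1)] Pi_mat T[OF jk(2)] idx] sum_distrib_left)
  finally show ?thesis .
qed

definition munit :: "nat \<Rightarrow> nat \<Rightarrow> 'b \<Rightarrow> 'k" where
  "munit j k = (SOME f. f \<in> elts D \<and> Pi f = T j * S k)"

text \<open>When the constituents j and k are equal, the product of T j and S k commutes with X and
  so lies in the image of \<open>Pi\<close>.\<close>

lemma munit:
  assumes jk: "j < N" "k < N" "V j = V k"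
  shows "munit j k \<in> elts D" "Pi (munit j k) = T j * S k"
proof -
  have c: "T j \<in> carrier_mat n (fst (V j))" "S k \<in> carrier_mat (fst (V j)) n"
    using T[OF jk(1)] S[OF jk(2)] jk(3) by auto
  have "\<exists>f\<in>elts D. Pi f = T j * S k"
  proof (rule Pi_surj)
    fix x assume x: "x \<in> carrier E"
    have Vc: "snd (V j) x \<in> carrier_mat (fst (V j)) (fst (V j))" using irreps_mat[OF V[OF jk(1)] x] .
    have "T j * S k * X x = T j * (S k * X x)" using c X_mat[OF x] by (auto simp: mat_assoc)
    also have "\<dots> = (T j * snd (V j) x) * S k"
      unfolding SX[OF jk(2) x] jk(3)[symmetric] using c Vc by (auto simp: mat_assoc)
    also have "\<dots> = X x * (T j * S k)"
      unfolding XT[OF jk(1) x, symmetric] using c X_mat[OF x] by (auto simp: mat_assoc)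
    finally show "T j * S k * X x = X x * (T j * S k)" .
  qed (use c in auto)
  then have "\<exists>f. f \<in> elts D \<and> Pi f = T j * S k" by blast
  then have "munit j k \<in> elts D \<and> Pi (munit j k) = T j * S k" unfolding munit_def by (rule someI_ex)
  then show "munit j k \<in> elts D" "Pi (munit j k) = T j * S k" by auto
qed

lemma coef_munit:
  assumes jk: "j < N" "k < N" "V j = V k" and ab: "a < N" "b < N"
  shows "coef a b (munit j k) = (if a = j \<and> b = k then 1 else 0)"
proof -
  have c: "T j \<in> carrier_mat n (fst (V j))" "S k \<in> carrier_mat (fst (V j)) n"
    "S a \<in> carrier_mat (fst (V a)) n" "T b \<in> carrier_mat n (fst (V b))"
    using T[OF jk(1)] S[OF jk(2)] S[OF ab(1)] T[OF ab(2)] jk(3) by simp_all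
  have "S a * Pi (munit j k) * T b = (S a * T j) * (S k * T b)"
    unfolding munit(2)[OF jk] using c by (auto simp: mat_assoc)
  also have "\<dots> = (if a = j \<and> b = k then 1\<^sub>m (fst (V a)) else 0\<^sub>m (fst (V a)) (fst (V b)))"
    unfolding ST[OF ab(1) jk(1)] ST[OF jk(2) ab(2)] using jk(3) by auto
  finally show ?thesis unfolding coef_def using V_pos ab by simp
qed

text \<open>Inserting the resolution of the identity, the sum of the products of T l and S l, leaves
  only the blocks between equal constituents. So D acts on the span of these T l by the coefficients
  \<open>coef l k\<close>.\<close>

lemma Pi_T:
  assumes k: "k < N" and f: "f \<in> elts D"
  shows "Pi f * T k = msum n (fst (V k)) (index (V k)) (\<lambda>l. coef l k f \<cdot>\<^sub>m T l)"
proof -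
  have c: "Pi f \<in> carrier_mat n n" "T k \<in> carrier_mat n (fst (V k))" using Pi_mat[OF f] T[OF k] by auto
  have PT: "Pi f * T k \<in> carrier_mat n (fst (V k))" using c by simp
  have TSc: "T l * S l \<in> carrier_mat n n" if "l < N" for l using T[OF that] S[OF that] by simp
  have "Pi f * T k = 1\<^sub>m n * (Pi f * T k)" by (rule left_mult_one_mat[OF PT, symmetric])
  also have "\<dots> = msum n (fst (V k)) {..<N} (\<lambda>l. T l * S l * (Pi f * T k))"
    unfolding total[symmetric] using TSc by (intro msum_mult[OF PT]) auto
  also have "\<dots> = msum n (fst (V k)) (index (V k)) (\<lambda>l. coef l k f \<cdot>\<^sub>m T l)"
  proof (rule eq_matI)
    fix i j assume "i < dim_row (msum n (fst (V k)) (index (V k)) (\<lambda>l. coef l k f \<cdot>\<^sub>m T l))"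
      "j < dim_col (msum n (fst (V k)) (index (V k)) (\<lambda>l. coef l k f \<cdot>\<^sub>m T l))"
    then have ij: "i < n" "j < fst (V k)" by (auto simp: msum_def)
    have e: "(T l * S l * (Pi f * T k)) $$ (i, j) = (if V l = V k then (coef l k f \<cdot>\<^sub>m T l) $$ (i, j) else 0)"
      if l: "l < N" for l
    proof -
      have "T l * S l * (Pi f * T k) = T l * (S l * Pi f * T k)"
        using c T[OF l] S[OF l] by (auto simp: mat_assoc)
      also have "\<dots> = (if V l = V k then coef l k f \<cdot>\<^sub>m T l else 0\<^sub>m n (fst (V k)))"
        unfolding block_scalar[OF l k f] using T[OF l]
        by (auto simp: mult_smult_distrib[OF T[OF l] one_carrier_mat])
      finally show ?thesis using ij by auto
    qed
    have "(\<Sum>l<N. (T l * S l * (Pi f * T k)) $$ (i, j)) = (\<Sum>l\<in>index (V k). (coef l k f \<cdot>\<^sub>m T l) $$ (i, j))"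
    proof (rule sum.mono_neutral_cong_right)
      show "index (V k) \<subseteq> {..<N}" by (auto simp: index_def)
      show "\<forall>l\<in>{..<N} - index (V k). (T l * S l * (Pi f * T k)) $$ (i, j) = 0"
        using e by (auto simp: index_def simp del: index_mult_mat)
      show "\<And>l. l \<in> index (V k) \<Longrightarrow> (T l * S l * (Pi f * T k)) $$ (i, j) = (coef l k f \<cdot>\<^sub>m T l) $$ (i, j)"
        using e by (auto simp: index_def simp del: index_mult_mat index_smult_mat)
    qed auto
    then show "msum n (fst (V k)) {..<N} (\<lambda>l. T l * S l * (Pi f * T k)) $$ (i, j) =
        msum n (fst (V k)) (index (V k)) (\<lambda>l. coef l k f \<cdot>\<^sub>m T l) $$ (i, j)"
      using ij by (simp del: index_mult_mat index_smult_mat)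
  qed (auto simp: msum_def)
  finally show ?thesis .
qed

lemma coef_mult:
  assumes jk: "j < N" "k < N" and f: "f \<in> elts D" and h: "h \<in> elts D"
  shows "coef j k (amul D f h) = (\<Sum>l\<in>index (V k). coef j l f * coef l k h)"
proof -
  have c: "Pi f \<in> carrier_mat n n" "Pi h \<in> carrier_mat n n" "S j \<in> carrier_mat (fst (V j)) n"
    "T k \<in> carrier_mat n (fst (V k))"
    using Pi_mat f h S T jk by auto
  have SPf: "S j * Pi f \<in> carrier_mat (fst (V j)) n" using c by simp
  have Tl: "T l \<in> carrier_mat n (fst (V k))" if "l \<in> index (V k)" for l
    using T[of l] that by (auto simp: index_def)
  have "S j * Pi (amul D f h) * T k = S j * Pi f * (Pi h * T k)"
    unfolding Pi_mult[OF f h] using c by (auto simp: mat_assoc)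
  also have "\<dots> = msum (fst (V j)) (fst (V k)) (index (V k)) (\<lambda>l. S j * Pi f * (coef l k h \<cdot>\<^sub>m T l))"
    unfolding Pi_T[OF jk(2) h] using Tl by (intro mult_msum[OF SPf]) auto
  also have "\<dots> = msum (fst (V j)) (fst (V k)) (index (V k)) (\<lambda>l. coef l k h \<cdot>\<^sub>m (S j * Pi f * T l))"
    using Tl by (intro msum_cong mult_smult_distrib[OF SPf])
  finally have e: "S j * Pi (amul D f h) * T k =
      msum (fst (V j)) (fst (V k)) (index (V k)) (\<lambda>l. coef l k h \<cdot>\<^sub>m (S j * Pi f * T l))" .
  have "(coef l k h \<cdot>\<^sub>m (S j * Pi f * T l)) $$ (0, 0) = coef j l f * coef l k h" if l: "l \<in> index (V k)" for l
    using Tl[OF l] c V_pos[OF jk(1)] V_pos[OF jk(2)] unfolding coef_def[of j l]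
    by (simp add: mult.commute del: index_mult_mat(1))
  then show ?thesis
    unfolding coef_def[of j k] e using V_pos[OF jk(1)] V_pos[OF jk(2)] by simp
qed

lemma coef_one:
  assumes jk: "j < N" "k < N"
  shows "coef j k (unity D) = (if j = k then 1 else 0)"
proof -
  have "S j * Pi (unity D) * T k = S j * T k" using S[OF jk(1)] by (simp add: Pi_one)
  then show ?thesis unfolding coef_def ST[OF jk] using V_pos jk by simp
qed

section \<open>Multiplicity spaces as irreducible representations of the commutant\<close>

definition enum :: "('e, 'k) mrep \<Rightarrow> nat \<Rightarrow> nat" where
  "enum Y = (SOME h. bij_betw h {..<card (index Y)} (index Y))"

lemma enum: "bij_betw (enum Y) {..<card (index Y)} (index Y)"
proof -
  have "\<exists>h. bij_betw h {..<card (index Y)} (index Y)"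
    using ex_bij_betw_nat_finite[OF index_finite, of Y] by (simp add: atLeast0LessThan)
  then show ?thesis unfolding enum_def by (rule someI_ex)
qed

lemma enum_index: "a < card (index Y) \<Longrightarrow> enum Y a < N \<and> V (enum Y a) = Y"
  using enum[of Y] by (auto simp: bij_betw_def index_def)

lemma enum_eq_iff: "a < card (index Y) \<Longrightarrow> b < card (index Y) \<Longrightarrow> enum Y a = enum Y b \<longleftrightarrow> a = b"
  using enum[of Y] by (auto simp: bij_betw_def inj_on_def)

lemma sum_enum: "(\<Sum>a<card (index Y). g (enum Y a)) = (\<Sum>l\<in>index Y. g l)"
  using sum.reindex_bij_betw[OF enum] .

text \<open>The action of D on the multiplicity space of Y, that is, on the intertwiners from Y to
  X, in the basis of the T l with l in \<open>index Y\<close>; compare \<open>Pi_T\<close>.\<close>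

definition mult_rep :: "('e, 'k) mrep \<Rightarrow> ('b \<Rightarrow> 'k, 'k) mrep" where
  "mult_rep Y = (card (index Y), \<lambda>f. mat (card (index Y)) (card (index Y)) (\<lambda>(a, b). coef (enum Y a) (enum Y b) f))"

lemma mult_rep_simps [simp]:
  "fst (mult_rep Y) = card (index Y)"
  "snd (mult_rep Y) f \<in> carrier_mat (card (index Y)) (card (index Y))"
  "a < card (index Y) \<Longrightarrow> b < card (index Y) \<Longrightarrow> snd (mult_rep Y) f $$ (a, b) = coef (enum Y a) (enum Y b) f"
  by (simp_all add: mult_rep_def)

lemma mult_rep_dims [simp]:
  "dim_row (snd (mult_rep Y) f) = card (index Y)" "dim_col (snd (mult_rep Y) f) = card (index Y)"
  by (simp_all add: mult_rep_def)

lemma mult_rep_alg_rep: "alg_rep D (mult_rep Y)"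
  unfolding alg_rep_def Let_def
proof (intro conjI ballI allI)
  let ?m = "card (index Y)"
  fix f assume f: "f \<in> elts D"
  show "snd (mult_rep Y) f \<in> carrier_mat (fst (mult_rep Y)) (fst (mult_rep Y))" by simp
  show "snd (mult_rep Y) (\<lambda>x. c * f x) = c \<cdot>\<^sub>m snd (mult_rep Y) f" for c
  proof (rule eq_matI)
    fix a b assume "a < dim_row (c \<cdot>\<^sub>m snd (mult_rep Y) f)" "b < dim_col (c \<cdot>\<^sub>m snd (mult_rep Y) f)"
    then have ab: "a < ?m" "b < ?m" by auto
    have cf: "(\<lambda>x. c * f x) \<in> elts D" using f by (simp add: elts_def)
    show "snd (mult_rep Y) (\<lambda>x. c * f x) $$ (a, b) = (c \<cdot>\<^sub>m snd (mult_rep Y) f) $$ (a, b)"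
      using ab enum_index[OF ab(1)] enum_index[OF ab(2)]
      by (simp add: coef_lin[OF _ _ cf] coef_lin[OF _ _ f] sum_distrib_left mult.assoc)
  qed auto
  fix h assume h: "h \<in> elts D"
  show "snd (mult_rep Y) (\<lambda>x. f x + h x) = snd (mult_rep Y) f + snd (mult_rep Y) h"
  proof (rule eq_matI)
    fix a b assume "a < dim_row (snd (mult_rep Y) f + snd (mult_rep Y) h)"
      "b < dim_col (snd (mult_rep Y) f + snd (mult_rep Y) h)"
    then have ab: "a < ?m" "b < ?m" by auto
    have fh: "(\<lambda>x. f x + h x) \<in> elts D" using f h by (simp add: elts_def)
    show "snd (mult_rep Y) (\<lambda>x. f x + h x) $$ (a, b) = (snd (mult_rep Y) f + snd (mult_rep Y) h) $$ (a, b)"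
      using ab enum_index[OF ab(1)] enum_index[OF ab(2)]
      by (simp add: coef_lin[OF _ _ fh] coef_lin[OF _ _ f] coef_lin[OF _ _ h] distrib_right sum.distrib)
  qed auto
  show "snd (mult_rep Y) (amul D f h) = snd (mult_rep Y) f * snd (mult_rep Y) h"
  proof (rule eq_matI)
    fix a b assume "a < dim_row (snd (mult_rep Y) f * snd (mult_rep Y) h)"
      "b < dim_col (snd (mult_rep Y) f * snd (mult_rep Y) h)"
    then have ab: "a < ?m" "b < ?m" by auto
    have "(snd (mult_rep Y) f * snd (mult_rep Y) h) $$ (a, b) =
        (\<Sum>c<?m. coef (enum Y a) (enum Y c) f * coef (enum Y c) (enum Y b) h)"
      using ab mat_mult_index[OF mult_rep_simps(2)[of Y f] mult_rep_simps(2)[of Y h] ab] by simp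
    also have "\<dots> = (\<Sum>l\<in>index Y. coef (enum Y a) l f * coef l (enum Y b) h)" by (rule sum_enum)
    also have "\<dots> = coef (enum Y a) (enum Y b) (amul D f h)"
      using coef_mult[OF _ _ f h, of "enum Y a" "enum Y b"] enum_index[OF ab(1)] enum_index[OF ab(2)] by simp
    finally show "snd (mult_rep Y) (amul D f h) $$ (a, b) = (snd (mult_rep Y) f * snd (mult_rep Y) h) $$ (a, b)"
      using ab by simp
  qed auto
next
  show "snd (mult_rep Y) (unity D) = 1\<^sub>m (fst (mult_rep Y))"
  proof (rule eq_matI)
    fix a b assume "a < dim_row (1\<^sub>m (fst (mult_rep Y)))" "b < dim_col (1\<^sub>m (fst (mult_rep Y)))"
    then have ab: "a < card (index Y)" "b < card (index Y)" by auto
    show "snd (mult_rep Y) (unity D) $$ (a, b) = 1\<^sub>m (fst (mult_rep Y)) $$ (a, b)"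
      using ab enum_index[OF ab(1)] enum_index[OF ab(2)] by (simp add: coef_one enum_eq_iff)
  qed auto
qed

lemma mult_rep_munit:
  assumes ab: "a < card (index Y)" "b < card (index Y)"
    and cd: "c < card (index Y')" "d < card (index Y')"
  shows "snd (mult_rep Y) (munit (enum Y' c) (enum Y' d)) $$ (a, b) =
    (if Y = Y' \<and> a = c \<and> b = d then 1 else 0)"
  using enum_index[OF ab(1)] enum_index[OF ab(2)] enum_index[OF cd(1)] enum_index[OF cd(2)] ab cd
  by (auto simp: coef_munit enum_eq_iff)

text \<open>From a vector with nonzero entry at b, the matrix unit (a, b) produces a nonzero
  multiple of the unit vector at a, for every a.\<close>

lemma mult_rep_irreducible:
  assumes Y: "index Y \<noteq> {}"
  shows "irreducible_on (elts D) (mult_rep Y)"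
proof -
  let ?m = "card (index Y)"
  have m: "?m > 0" using Y by (simp add: card_gt_0_iff)
  show ?thesis
    unfolding irreducible_on_def
  proof (intro conjI allI impI)
    show "0 < fst (mult_rep Y)" using m by simp
    fix U assume sub: "VectorSpace.subspace class_ring U (module_vec TYPE('k) (fst (mult_rep Y)))"
      and inv: "\<forall>x\<in>elts D. \<forall>v\<in>U. snd (mult_rep Y) x *\<^sub>v v \<in> U"
    have U: "U \<subseteq> carrier_vec ?m" "0\<^sub>v ?m \<in> U" "\<And>v w. v \<in> U \<Longrightarrow> w \<in> U \<Longrightarrow> v + w \<in> U"
      "\<And>c v. v \<in> U \<Longrightarrow> c \<cdot>\<^sub>v v \<in> U"
      using subspace_vecD[OF sub] by simp_all
    show "U = {0\<^sub>v (fst (mult_rep Y))} \<or> U = carrier_vec (fst (mult_rep Y))"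
    proof (cases "U = {0\<^sub>v ?m}")
      case False
      then obtain u where u: "u \<in> U" "u \<noteq> 0\<^sub>v ?m" using U(2) by blast
      have um: "u \<in> carrier_vec ?m" using u U(1) by auto
      have "\<exists>b<?m. u $ b \<noteq> 0"
      proof (rule ccontr)
        assume "\<not> ?thesis"
        then have "u = 0\<^sub>v ?m" using um by (intro eq_vecI) auto
        then show False using u by simp
      qed
      then obtain b where b: "b < ?m" "u $ b \<noteq> 0" by blast
      have unit: "unit_vec ?m a \<in> U" if a: "a < ?m" for a
      proof -
        let ?e = "snd (mult_rep Y) (munit (enum Y a) (enum Y b))"
        have "munit (enum Y a) (enum Y b) \<in> elts D"
          using munit(1) enum_index[OF a] enum_index[OF b(1)] by simp
        then have "?e *\<^sub>v u \<in> U" using inv u by blast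
        then have "inverse (u $ b) \<cdot>\<^sub>v (?e *\<^sub>v u) \<in> U" by (rule U(4))
        also have "inverse (u $ b) \<cdot>\<^sub>v (?e *\<^sub>v u) = unit_vec ?m a"
        proof (rule eq_vecI)
          fix c assume "c < dim_vec (unit_vec ?m a :: 'k vec)"
          then have c: "c < ?m" by simp
          have "(?e *\<^sub>v u) $ c = (\<Sum>d<?m. ?e $$ (c, d) * u $ d)"
            using c um by (simp add: scalar_prod_def atLeast0LessThan row_def)
          also have "\<dots> = (\<Sum>d<?m. if d = b then (if c = a then u $ b else 0) else 0)"
          proof (rule sum.cong[OF refl])
            fix d assume "d \<in> {..<?m}"
            then have d: "d < ?m" by simp
            show "?e $$ (c, d) * u $ d = (if d = b then (if c = a then u $ b else 0) else 0)"
              unfolding mult_rep_munit[OF c d a b(1)] by simp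
          qed
          also have "\<dots> = (if c = a then u $ b else 0)" using b by simp
          finally show "(inverse (u $ b) \<cdot>\<^sub>v (?e *\<^sub>v u)) $ c = unit_vec ?m a $ c"
            using c a b by simp
        qed simp
        finally show ?thesis .
      qed
      have "v \<in> U" if v: "v \<in> carrier_vec ?m" for v
      proof -
        have "vec ?m (\<lambda>c. \<Sum>i<?m. v $ i * unit_vec ?m i $ c) \<in> U"
          using unit by (intro closed_sum_vec[OF U]) auto
        also have "vec ?m (\<lambda>c. \<Sum>i<?m. v $ i * unit_vec ?m i $ c) = v"
        proof (rule eq_vecI)
          fix c assume "c < dim_vec v"
          then have c: "c < ?m" using v by simp
          have "(\<Sum>i<?m. v $ i * unit_vec ?m i $ c) = (\<Sum>i<?m. if i = c then v $ c else 0)"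
            using c by (intro sum.cong) auto
          then show "vec ?m (\<lambda>c. \<Sum>i<?m. v $ i * unit_vec ?m i $ c) $ c = v $ c" using c by simp
        qed (use v in simp)
        finally show ?thesis .
      qed
      then show ?thesis using U(1) by auto
    qed simp
  qed
qed

text \<open>A diagonal matrix unit for Y acts nontrivially on the multiplicity space of Y and by
  zero on that of any other constituent.\<close>

lemma mult_rep_distinct:
  assumes Y: "index Y \<noteq> {}" and iso: "rep_iso (elts D) (mult_rep Y) (mult_rep Y')"
  shows "Y = Y'"
proof (rule ccontr)
  assume ne: "Y \<noteq> Y'"
  let ?m = "card (index Y)"
  have m: "?m > 0" using Y by (simp add: card_gt_0_iff)
  have m': "card (index Y') = ?m" using iso by (simp add: rep_iso_def)
  obtain P Q where P: "P \<in> carrier_mat ?m ?m" and Q: "Q \<in> carrier_mat ?m ?m" and QP: "Q * P = 1\<^sub>m ?m"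
    and int: "\<And>f. f \<in> elts D \<Longrightarrow> P * snd (mult_rep Y) f = snd (mult_rep Y') f * P"
    using iso by (auto simp: rep_iso_def GLn_simps)
  let ?f = "munit (enum Y 0) (enum Y 0)"
  have f: "?f \<in> elts D" using munit(1) enum_index[OF m] by simp
  have "snd (mult_rep Y') ?f = 0\<^sub>m ?m ?m"
    using mult_rep_munit[of _ Y' _ 0 Y 0] m m' ne by (intro eq_matI) (auto simp del: mult_rep_simps(3))
  then have "P * snd (mult_rep Y) ?f = 0\<^sub>m ?m ?m" using int[OF f] P by simp
  then have "Q * (P * snd (mult_rep Y) ?f) = 0\<^sub>m ?m ?m" using Q by simp
  moreover have "Q * (P * snd (mult_rep Y) ?f) = (Q * P) * snd (mult_rep Y) ?f"
    using P Q by (auto simp: mat_assoc)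
  ultimately have z: "snd (mult_rep Y) ?f = 0\<^sub>m ?m ?m"
    using QP left_mult_one_mat[OF mult_rep_simps(2)[of Y ?f]] by simp
  have "snd (mult_rep Y) ?f $$ (0, 0) = 1" unfolding mult_rep_munit[OF m m m m] by simp
  then show False unfolding z using m by simp
qed

lemma unity_decomposition: "unity D = (\<lambda>z. \<Sum>j<N. 1 * munit j j z)"
proof (rule Pi_inj[OF D_one])
  have mu: "munit j j \<in> elts D" if "j < N" for j using munit(1)[OF that that] by simp
  show el: "(\<lambda>z. \<Sum>j<N. 1 * munit j j z) \<in> elts D" using mu by (intro elts_lincomb) auto
  have "Pi (\<lambda>z. \<Sum>j<N. 1 * munit j j z) = msum n n {..<N} (\<lambda>j. T j * S j)"
  proof (rule eq_matI)
    fix i k assume "i < dim_row (msum n n {..<N} (\<lambda>j. T j * S j))" "k < dim_col (msum n n {..<N} (\<lambda>j. T j * S j))"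
    then have ik: "i < n" "k < n" by (auto simp: msum_def)
    have "Pi (\<lambda>z. \<Sum>j<N. 1 * munit j j z) $$ (i, k) = (\<Sum>j<N. \<Sum>z\<in>bas D. munit j j z * Pi (kd z) $$ (i, k))"
      unfolding Pi_lin[OF el ik] by (subst sum.swap) (simp add: sum_distrib_right)
    also have "\<dots> = (\<Sum>j<N. (T j * S j) $$ (i, k))"
      using munit(2) by (intro sum.cong refl) (simp add: Pi_lin[OF mu ik, symmetric] del: index_mult_mat)
    finally show "Pi (\<lambda>z. \<Sum>j<N. 1 * munit j j z) $$ (i, k) = msum n n {..<N} (\<lambda>j. T j * S j) $$ (i, k)"
      using ik by simp
  qed (use Pi_mat[OF el] in \<open>auto simp: msum_def\<close>)
  then show "Pi (unity D) = Pi (\<lambda>z. \<Sum>j<N. 1 * munit j j z)" by (simp add: Pi_one total)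
qed

text \<open>For fixed j the elements \<open>munit l j\<close> with l in \<open>index (V j)\<close>
  span a left ideal, and the formula says that D acts on it as on the multiplicity space of V
  j.\<close>

lemma mult_munit:
  assumes f: "f \<in> elts D" and kj: "k < N" "j < N" "V k = V j"
  shows "amul D f (munit k j) = (\<lambda>z. \<Sum>l\<in>index (V j). coef l k f * munit l j z)"
proof (rule Pi_inj)
  have l: "l < N" "V l = V j" if "l \<in> index (V j)" for l using that by (auto simp: index_def)
  have mu: "munit l j \<in> elts D" if "l \<in> index (V j)" for l using munit(1) l[OF that] kj by simp
  show el: "(\<lambda>z. \<Sum>l\<in>index (V j). coef l k f * munit l j z) \<in> elts D" using mu by (rule elts_lincomb)
  show "amul D f (munit k j) \<in> elts D" using D_mult[OF f munit(1)[OF kj]] .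
  have c: "Pi f \<in> carrier_mat n n" "T k \<in> carrier_mat n (fst (V j))" "S j \<in> carrier_mat (fst (V j)) n"
    using Pi_mat[OF f] T[of k] S[of j] kj by auto
  have Tl: "T l \<in> carrier_mat n (fst (V j))" if "l \<in> index (V j)" for l using T[of l] l[OF that] by simp
  have "Pi (amul D f (munit k j)) = (Pi f * T k) * S j"
    unfolding Pi_mult[OF f munit(1)[OF kj]] munit(2)[OF kj] using c by (auto simp: mat_assoc)
  also have "\<dots> = msum n n (index (V j)) (\<lambda>l. (coef l k f \<cdot>\<^sub>m T l) * S j)"
    unfolding Pi_T[OF kj(1) f] kj(3) using Tl by (intro msum_mult[OF c(3)]) auto
  also have "\<dots> = Pi (\<lambda>z. \<Sum>l\<in>index (V j). coef l k f * munit l j z)"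
  proof (rule eq_matI)
    fix a b assume "a < dim_row (Pi (\<lambda>z. \<Sum>l\<in>index (V j). coef l k f * munit l j z))"
      "b < dim_col (Pi (\<lambda>z. \<Sum>l\<in>index (V j). coef l k f * munit l j z))"
    then have ab: "a < n" "b < n" using Pi_mat[OF el] by auto
    have "Pi (\<lambda>z. \<Sum>l\<in>index (V j). coef l k f * munit l j z) $$ (a, b) =
        (\<Sum>l\<in>index (V j). \<Sum>z\<in>bas D. coef l k f * (munit l j z * Pi (kd z) $$ (a, b)))"
      unfolding Pi_lin[OF el ab] by (subst sum.swap) (simp add: sum_distrib_right mult.assoc)
    also have "\<dots> = (\<Sum>l\<in>index (V j). ((coef l k f \<cdot>\<^sub>m T l) * S j) $$ (a, b))"
    proof (rule sum.cong[OF refl])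
      fix l assume li: "l \<in> index (V j)"
      have "(\<Sum>z\<in>bas D. coef l k f * (munit l j z * Pi (kd z) $$ (a, b))) = coef l k f * Pi (munit l j) $$ (a, b)"
        by (simp add: Pi_lin[OF mu[OF li] ab] sum_distrib_left)
      also have "\<dots> = (coef l k f \<cdot>\<^sub>m (T l * S j)) $$ (a, b)"
        using munit(2)[of l j] l[OF li] kj Tl[OF li] c ab by simp
      also have "coef l k f \<cdot>\<^sub>m (T l * S j) = (coef l k f \<cdot>\<^sub>m T l) * S j"
        by (rule mult_smult_assoc_mat[OF Tl[OF li] c(3), symmetric])
      finally show "(\<Sum>z\<in>bas D. coef l k f * (munit l j z * Pi (kd z) $$ (a, b))) =
          ((coef l k f \<cdot>\<^sub>m T l) * S j) $$ (a, b)" .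
    qed
    finally show "msum n n (index (V j)) (\<lambda>l. (coef l k f \<cdot>\<^sub>m T l) * S j) $$ (a, b) =
        Pi (\<lambda>z. \<Sum>l\<in>index (V j). coef l k f * munit l j z) $$ (a, b)"
      using ab by (simp del: index_mult_mat)
  qed (use Pi_mat[OF el] in \<open>auto simp: msum_def\<close>)
  finally show "Pi (amul D f (munit k j)) = Pi (\<lambda>z. \<Sum>l\<in>index (V j). coef l k f * munit l j z)" .
qed

text \<open>The unit is the sum of the diagonal matrix units, so some \<open>munit j j\<close> acts
  on W by a nonzero matrix. Applying the left ideal of \<open>mult_munit\<close> to a suitable
  vector of W then gives a nonzero intertwiner from the multiplicity space of V j.\<close>

lemma alg_irrep_iso_mult_rep:
  assumes W: "W \<in> alg_irreps D"
  shows "\<exists>j<N. rep_iso (elts D) (mult_rep (V j)) W"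
proof -
  define m where "m = fst W"
  define r where "r = snd W"
  have rep: "alg_rep D W" and irr: "irreducible_on (elts D) W" using W by (auto simp: alg_irreps_def)
  have m: "m > 0" using irr by (simp add: irreducible_on_def m_def)
  have rc: "r f \<in> carrier_mat m m" if "f \<in> elts D" for f
    using alg_rep_carrier[OF rep that] by (simp add: r_def m_def)
  have r_mult: "r (amul D f h) = r f * r h" if "f \<in> elts D" "h \<in> elts D" for f h
    using rep that by (simp add: alg_rep_def Let_def r_def)
  have r_one: "r (unity D) = 1\<^sub>m m" using rep by (simp add: alg_rep_def Let_def r_def m_def)
  have mu: "munit j j \<in> elts D" if "j < N" for j using munit(1)[OF that that] by simp
  \<comment> \<open>The identity matrix has the entry 1 at (0, 0), so some summand is nonzero
    already in row 0.\<close>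
  have "\<exists>j<N. \<exists>b<m. r (munit j j) $$ (0, b) \<noteq> 0"
  proof (rule ccontr)
    assume z: "\<not> ?thesis"
    have "1 = r (unity D) $$ (0, 0)" using m by (simp add: r_one)
    also have "\<dots> = (\<Sum>j<N. 1 * r (munit j j) $$ (0, 0))"
      unfolding unity_decomposition r_def
      by (rule alg_rep_lincomb[OF rep]) (use mu m in \<open>auto simp: m_def\<close>)
    also have "\<dots> = 0" using z m by simp
    finally show False by simp
  qed
  then obtain j b where j: "j < N" and b: "b < m" and jb: "r (munit j j) $$ (0, b) \<noteq> 0" by blast
  let ?Y = "V j"
  let ?c = "card (index ?Y)"
  have j_in: "j \<in> index ?Y" using j by (simp add: index_def)
  have muk: "munit (enum ?Y a) j \<in> elts D" if "a < ?c" for a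
    using munit(1) enum_index[OF that] j by simp
  \<comment> \<open>The intertwiner sends the basis vector a of the multiplicity space to
    \<open>munit (enum ?Y a) j\<close> applied to the unit vector of W at b.\<close>
  define P where "P = mat m ?c (\<lambda>(i, a). r (munit (enum ?Y a) j) $$ (i, b))"
  have Pc: "P \<in> carrier_mat m ?c" by (simp add: P_def)
  have "j \<in> enum ?Y ` {..<?c}" using enum[of ?Y] j_in by (simp add: bij_betw_def)
  then obtain a where a_eq: "j = enum ?Y a" and a_in: "a \<in> {..<?c}" by (rule imageE)
  note a = lessThan_iff[THEN iffD1, OF a_in] a_eq[symmetric]
  have P0: "P \<noteq> 0\<^sub>m m ?c"
  proof
    assume "P = 0\<^sub>m m ?c"
    then have "P $$ (0, a) = 0" using a m by simp
    then show False using jb a m by (simp add: P_def)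
  qed
  have int: "P * snd (mult_rep ?Y) f = r f * P" if f: "f \<in> elts D" for f
  proof (rule eq_matI)
    fix i d assume "i < dim_row (r f * P)" "d < dim_col (r f * P)"
    then have id: "i < m" "d < ?c" using rc[OF f] Pc by auto
    have ed: "enum ?Y d < N" "V (enum ?Y d) = ?Y" using enum_index[OF id(2)] by auto
    have "(r f * P) $$ (i, d) = (\<Sum>q<m. r f $$ (i, q) * r (munit (enum ?Y d) j) $$ (q, b))"
      unfolding mat_mult_index[OF rc[OF f] Pc id] using id by (simp add: P_def)
    also have "\<dots> = (r f * r (munit (enum ?Y d) j)) $$ (i, b)"
      by (rule mat_mult_index[OF rc[OF f] rc[OF muk[OF id(2)]] id(1) b, symmetric])
    also have "\<dots> = r (\<lambda>z. \<Sum>l\<in>index ?Y. coef l (enum ?Y d) f * munit l j z) $$ (i, b)"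
      unfolding r_mult[OF f muk[OF id(2)], symmetric] mult_munit[OF f ed(1) j ed(2)] ..
    also have "\<dots> = (\<Sum>l\<in>index ?Y. coef l (enum ?Y d) f * r (munit l j) $$ (i, b))"
      unfolding r_def
    proof (rule alg_rep_lincomb[OF rep index_finite])
      fix l assume "l \<in> index ?Y"
      then show "munit l j \<in> elts D" using munit(1)[of l j] j by (simp add: index_def)
    qed (use id b in \<open>auto simp: m_def\<close>)
    also have "\<dots> = (\<Sum>q<?c. coef (enum ?Y q) (enum ?Y d) f * r (munit (enum ?Y q) j) $$ (i, b))"
      by (rule sum_enum[symmetric])
    also have "\<dots> = (P * snd (mult_rep ?Y) f) $$ (i, d)"
      unfolding mat_mult_index[OF Pc mult_rep_simps(2) id] using id by (simp add: P_def mult.commute)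
    finally show "(P * snd (mult_rep ?Y) f) $$ (i, d) = (r f * P) $$ (i, d)" ..
  qed (use rc[OF f] Pc in auto)
  have "rep_iso (elts D) (mult_rep ?Y) W"
  proof (rule rep_isoI_irreducible[OF mult_rep_irreducible irr])
    show "index ?Y \<noteq> {}" using j_in by blast
    show "P \<in> carrier_mat (fst W) (fst (mult_rep ?Y))" using Pc by (simp add: m_def)
    show "P \<noteq> 0\<^sub>m (fst W) (fst (mult_rep ?Y))" using P0 by (simp add: m_def)
    show "\<And>f. f \<in> elts D \<Longrightarrow> P * snd (mult_rep ?Y) f = snd W f * P" using int by (simp add: r_def)
    show "\<And>f. f \<in> elts D \<Longrightarrow> snd W f \<in> carrier_mat (fst W) (fst W)" using alg_rep_carrier[OF rep] .
  qed simp
  then show ?thesis using j by blast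
qed

section \<open>Counting dimensions and multiplicities\<close>

lemma dim_le_sum: "n \<le> (\<Sum>j<N. fst (V j))"
proof -
  let ?Z = "SIGMA j:{..<N}. {..<fst (V j)}"
  \<comment> \<open>The duality of the two families, summed over the pairs (j, c), is the resolution
    of the identity \<open>total\<close> read entrywise.\<close>
  have "card {..<n} \<le> card ?Z"
  proof (rule card_le_of_dual_families[where s = "\<lambda>i (j, c). T j $$ (i, c)" and t = "\<lambda>i (j, c). S j $$ (c, i)"])
    fix i k assume "i \<in> {..<n}" "k \<in> {..<n}"
    then have ik: "i < n" "k < n" by auto
    have "(\<Sum>z\<in>?Z. (case z of (j, c) \<Rightarrow> T j $$ (i, c)) * (case z of (j, c) \<Rightarrow> S j $$ (c, k))) =
        (\<Sum>j<N. \<Sum>c<fst (V j). T j $$ (i, c) * S j $$ (c, k))"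
      by (simp add: sum.Sigma split_beta)
    also have "\<dots> = (\<Sum>j<N. (T j * S j) $$ (i, k))"
      using ik by (intro sum.cong refl mat_mult_index[OF T S, symmetric]) auto
    also have "\<dots> = msum n n {..<N} (\<lambda>j. T j * S j) $$ (i, k)" using ik by simp
    also have "\<dots> = (if i = k then 1 else 0)" unfolding total using ik by simp
    finally show "(\<Sum>z\<in>?Z. (case z of (j, c) \<Rightarrow> T j $$ (i, c)) * (case z of (j, c) \<Rightarrow> S j $$ (c, k))) =
        (if i = k then 1 else 0)" .
  qed auto
  then show ?thesis by (simp add: card_SigmaI)
qed

text \<open>The matrix units are linearly independent in D, with the linear forms
  \<open>coef j k\<close> as dual functionals.\<close>

lemma mult_squares_le: "card {(j, k). j < N \<and> k < N \<and> V j = V k} \<le> card (bas D)"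
proof (rule card_le_of_dual_families[where s = "\<lambda>(j, k) z. coef j k (kd z)" and t = "\<lambda>(j, k) z. munit j k z"])
  have "{(j, k). j < N \<and> k < N \<and> V j = V k} \<subseteq> {..<N} \<times> {..<N}" by auto
  then show "finite {(j, k). j < N \<and> k < N \<and> V j = V k}" by (rule finite_subset) simp
next
  fix x y assume "x \<in> {(j, k). j < N \<and> k < N \<and> V j = V k}" "y \<in> {(j, k). j < N \<and> k < N \<and> V j = V k}"
  then obtain a b j k where xy: "x = (a, b)" "y = (j, k)" and ab: "a < N" "b < N" and jk: "j < N" "k < N" "V j = V k"
    by auto
  have "(\<Sum>z\<in>bas D. coef a b (kd z) * munit j k z) = coef a b (munit j k)"
    unfolding coef_lin[OF ab munit(1)[OF jk]] by (simp add: mult.commute)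
  then show "(\<Sum>z\<in>bas D. (case x of (j, k) \<Rightarrow> \<lambda>z. coef j k (kd z)) z * (case y of (j, k) \<Rightarrow> \<lambda>z. munit j k z) z) =
      (if x = y then 1 else 0)"
    by (simp add: xy coef_munit[OF jk ab])
qed (rule finD)

text \<open>Equality in the Cauchy-Schwarz inequality: the multiplicities \<open>m\<close> and the dimensions \<open>d\<close>
  satisfy \<open>(\<Sum>m\<^sup>2) (\<Sum>d\<^sup>2) \<le> n\<^sup>2 \<le> (\<Sum>m d)\<^sup>2\<close>, hence \<open>m\<close> is proportional to \<open>d\<close>.\<close>

lemma multiplicity:
  assumes fin: "finite I" and I: "I \<subseteq> irreps" "V ` {..<N} \<subseteq> I"
    and ne: "\<And>Y Z. Y \<in> I \<Longrightarrow> Z \<in> I \<Longrightarrow> rep_iso (carrier E) Y Z \<Longrightarrow> Y = Z"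
    and Y: "Y \<in> I"
  shows "real (card (index Y)) = real n / real (card (carrier K)) * real (fst Y)"
proof -
  define c where "c = real n / real (card (carrier K))"
  have K: "card (carrier K) > 0" using finK K.one_closed card_gt_0_iff by blast
  have c: "c \<ge> 0" by (simp add: c_def)
  have group: "(\<Sum>Y\<in>I. \<Sum>j\<in>index Y. g j) = (\<Sum>j<N. g j :: nat)" for g
    using sum.group[of "{..<N}" I V g] fin I(2) by (simp add: index_def)
  have "(\<Sum>Y\<in>I. card (index Y) * card (index Y)) = (\<Sum>Y\<in>I. \<Sum>j\<in>index Y. card (index (V j)))"
    by (intro sum.cong refl) (simp add: index_def)
  also have "\<dots> = (\<Sum>j<N. card (index (V j)))" by (rule group)
  also have "\<dots> = card (SIGMA j:{..<N}. index (V j))" by (simp add: card_SigmaI)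
  also have "(SIGMA j:{..<N}. index (V j)) = {(j, k). j < N \<and> k < N \<and> V j = V k}" by (auto simp: index_def)
  finally have "(\<Sum>Y\<in>I. card (index Y) * card (index Y)) \<le> card (bas D)" using mult_squares_le by simp
  then have m2: "(\<Sum>Y\<in>I. (real (card (index Y)))\<^sup>2) \<le> real (card (bas D))"
    by (simp add: power2_eq_square flip: of_nat_mult of_nat_sum)
  have "(\<Sum>Y\<in>I. card (index Y) * fst Y) = (\<Sum>Y\<in>I. \<Sum>j\<in>index Y. fst (V j))"
    by (intro sum.cong refl) (simp add: index_def)
  also have "\<dots> = (\<Sum>j<N. fst (V j))" by (rule group)
  finally have "n \<le> (\<Sum>Y\<in>I. card (index Y) * fst Y)" using dim_le_sum by simp
  then have md: "real n \<le> (\<Sum>Y\<in>I. real (card (index Y)) * real (fst Y))"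
    by (simp flip: of_nat_mult of_nat_sum)
  have d2: "(\<Sum>Y\<in>I. (real (fst Y))\<^sup>2) \<le> real (card (carrier K))"
    using sum_of_squares_le[OF fin I(1) ne] by (simp add: power2_eq_square flip: of_nat_mult of_nat_sum)
  \<comment> \<open>For this c the three estimates bound the sum of squares by dim D - 2 c n + c^2
    |K|, which is zero, so every square vanishes.\<close>
  have "(\<Sum>Y\<in>I. (real (card (index Y)) - c * real (fst Y))\<^sup>2) =
      (\<Sum>Y\<in>I. (real (card (index Y)))\<^sup>2) - 2 * c * (\<Sum>Y\<in>I. real (card (index Y)) * real (fst Y)) +
      c\<^sup>2 * (\<Sum>Y\<in>I. (real (fst Y))\<^sup>2)"
    by (simp add: power2_diff power_mult_distrib sum.distrib sum_subtractf sum_distrib_left mult_ac)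
  also have "\<dots> \<le> real (card (bas D)) - 2 * c * real n + c\<^sup>2 * real (card (carrier K))"
    using m2 mult_left_mono[OF md, of "2 * c"] mult_left_mono[OF d2, of "c\<^sup>2"] c by simp
  also have "\<dots> = 0"
  proof -
    have "real (card (bas D)) * real (card (carrier K)) = real n * real n"
      using card_D by (simp flip: of_nat_mult)
    then show ?thesis using K by (simp add: c_def field_simps power2_eq_square)
  qed
  finally have "(\<Sum>Y\<in>I. (real (card (index Y)) - c * real (fst Y))\<^sup>2) \<le> 0" .
  then have "(\<Sum>Y\<in>I. (real (card (index Y)) - c * real (fst Y))\<^sup>2) = 0"
    by (intro antisym sum_nonneg) auto
  then have "(real (card (index Y)) - c * real (fst Y))\<^sup>2 = 0"
    using sum_nonneg_eq_0_iff[OF fin, of "\<lambda>Y. (real (card (index Y)) - c * real (fst Y))\<^sup>2"] Y by simp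
  then show ?thesis by (simp add: c_def)
qed

end

section \<open>The correspondence of isomorphism classes\<close>

lemma rep_iso_equiv:
  assumes "\<And>V x. V \<in> C \<Longrightarrow> x \<in> S \<Longrightarrow> snd V x \<in> carrier_mat (fst V) (fst V)"
  shows "equiv C {(V, W). V \<in> C \<and> W \<in> C \<and> rep_iso S V W}"
proof (rule equivI)
  show "refl_on C {(V, W). V \<in> C \<and> W \<in> C \<and> rep_iso S V W}"
    using assms by (auto simp: refl_on_def intro: rep_iso_refl)
  show "sym {(V, W). V \<in> C \<and> W \<in> C \<and> rep_iso S V W}"
    using assms by (auto simp: sym_def intro: rep_iso_sym)
  show "trans {(V, W). V \<in> C \<and> W \<in> C \<and> rep_iso S V W}"
  proof (rule transI, clarify)
    fix V n X m Y W
    assume "V \<in> C" "(n, X) \<in> C" "(m, Y) \<in> C" "rep_iso S V (n, X)" "rep_iso S (n, X) (m, Y)"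
    then show "rep_iso S V (m, Y)" using assms rep_iso_trans[of S V "(n, X)" "(m, Y)"] by blast
  qed
qed auto

text \<open>The constituents of X index both sides, through \<open>mult_rep\<close> on the algebra
  side and through themselves on the group side. The latter list is complete because any irreducible
  that could be adjoined to it would have multiplicity proportional to its dimension, hence
  positive.\<close>

lemma (in commutant) correspondence:
  "\<exists>\<Phi>. bij_betw \<Phi> (iso_classes (elts D) (alg_irreps D)) (iso_classes (carrier E) irreps) \<and>
     (\<forall>C\<in>iso_classes (elts D) (alg_irreps D). \<forall>Y\<in>C. \<forall>X'\<in>\<Phi> C.
        real (fst Y) = real n / real (card (carrier K)) * real (fst X'))"
proof -
  obtain N V T S where fam: "family n X N V T S" and tot: "msum n n {..<N} (\<lambda>j. T j * S j) = 1\<^sub>m n"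
    by (rule decomposition[OF X])
  interpret decomposed_commutant E K p \<chi> n X D Pi N V T S
    by unfold_locales (fact fam tot)+
  let ?I = "V ` {..<N}"
  have I: "?I \<subseteq> irreps" using V by auto
  have I_ne: "Y = Z" if "Y \<in> ?I" "Z \<in> ?I" "rep_iso (carrier E) Y Z" for Y Z
    using that V_iso by auto
  have idx: "index Y \<noteq> {}" if "Y \<in> ?I" for Y using that by (auto simp: index_def)
  have Kpos: "card (carrier K) > 0" using finK K.one_closed card_gt_0_iff by blast
  have eqA: "equiv (alg_irreps D) {(V, W). V \<in> alg_irreps D \<and> W \<in> alg_irreps D \<and> rep_iso (elts D) V W}"
    by (rule rep_iso_equiv) (auto simp: alg_irreps_def intro: alg_rep_carrier)
  have eqB: "equiv irreps {(V, W). V \<in> irreps \<and> W \<in> irreps \<and> rep_iso (carrier E) V W}"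
    by (rule rep_iso_equiv) (rule irreps_mat)
  have mA: "mult_rep Y \<in> alg_irreps D" if "Y \<in> ?I" for Y
    using mult_rep_alg_rep mult_rep_irreducible[OF idx[OF that]] by (simp add: alg_irreps_def)
  have complete: "\<exists>Y\<in>?I. rep_iso (carrier E) Y W" if W: "W \<in> irreps" for W
  proof (rule ccontr)
    assume no: "\<not> ?thesis"
    have no': "\<not> rep_iso (carrier E) W Y" if "Y \<in> ?I" for Y
      using no that rep_iso_sym[of "carrier E" W Y] irreps_mat W I by blast
    have "rep_iso (carrier E) W W" using irreps_mat[OF W] by (rule rep_iso_refl)
    then have "W \<notin> ?I" using no by blast
    then have "index W = {}" by (auto simp: index_def)
    \<comment> \<open>\<open>multiplicity\<close> is applied to the list of constituents enlarged by
      W, although W has multiplicity 0; this is the contradiction.\<close>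
    moreover have "real (card (index W)) = real n / real (card (carrier K)) * real (fst W)"
    proof (rule multiplicity[of "insert W ?I"])
      show "Y = Z" if "Y \<in> insert W ?I" "Z \<in> insert W ?I" "rep_iso (carrier E) Y Z" for Y Z
        using that I_ne no no' by blast
    qed (use W I in auto)
    moreover have "fst W > 0" using W by (auto simp: irreps_iff irreducible_on_def)
    ultimately show False using Kpos n_pos by simp
  qed
  let ?r = "{(V, W). V \<in> alg_irreps D \<and> W \<in> alg_irreps D \<and> rep_iso (elts D) V W}"
  let ?s = "{(V, W). V \<in> irreps \<and> W \<in> irreps \<and> rep_iso (carrier E) V W}"
  have "\<exists>\<Phi>. bij_betw \<Phi> (alg_irreps D // ?r) (irreps // ?s) \<and>
      (\<forall>C\<in>alg_irreps D // ?r. \<exists>Y\<in>?I. C = ?r `` {mult_rep Y} \<and> \<Phi> C = ?s `` {Y})"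
  proof (rule quotient_bij_betw[OF eqA eqB, where f = mult_rep and g = "\<lambda>Y. Y" and D = ?I])
    show "\<exists>Y\<in>?I. (mult_rep Y, W) \<in> ?r" if W: "W \<in> alg_irreps D" for W
      using alg_irrep_iso_mult_rep[OF W] W mA by auto
    show "\<exists>Y\<in>?I. (Y, W) \<in> ?s" if "W \<in> irreps" for W using complete[OF that] that I by auto
    show "Y = Z" if "Y \<in> ?I" "Z \<in> ?I" "(mult_rep Y, mult_rep Z) \<in> ?r" for Y Z
      using mult_rep_distinct[OF idx[OF that(1)]] that(3) by auto
    show "Y = Z" if "Y \<in> ?I" "Z \<in> ?I" "(Y, Z) \<in> ?s" for Y Z using I_ne that by auto
    show "mult_rep Y \<in> alg_irreps D" if "Y \<in> ?I" for Y by (rule mA[OF that])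
    show "Y \<in> irreps" if "Y \<in> ?I" for Y using that I by auto
  qed
  then obtain \<Phi> where bij: "bij_betw \<Phi> (alg_irreps D // ?r) (irreps // ?s)"
    and \<Phi>: "\<And>C. C \<in> alg_irreps D // ?r \<Longrightarrow> \<exists>Y\<in>?I. C = ?r `` {mult_rep Y} \<and> \<Phi> C = ?s `` {Y}"
    by blast
  have "real (fst Y) = real n / real (card (carrier K)) * real (fst X')"
    if C: "C \<in> alg_irreps D // ?r" and Y: "Y \<in> C" and X': "X' \<in> \<Phi> C" for C Y X'
  proof -
    obtain Z where Z: "Z \<in> ?I" "C = ?r `` {mult_rep Z}" "\<Phi> C = ?s `` {Z}" using \<Phi>[OF C] by blast
    have "fst Y = card (index Z)" "fst X' = fst Z" using Y X' Z by (auto simp: rep_iso_def)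
    then show ?thesis using multiplicity[OF _ I subset_refl I_ne Z(1)] by simp
  qed
  then show ?thesis using bij unfolding iso_classes_def by blast
qed

section \<open>Modules over an algebra through the action of its basis\<close>

lemma elts_expand:
  assumes "finite (bas D)" "f \<in> elts D"
  shows "f = (\<lambda>z. \<Sum>b\<in>bas D. f b * kd b z)"
  using assms by (auto simp: sum_kd_mult elts_def)

lemma alg_rep_expand:
  assumes V: "alg_rep D V" and fin: "finite (bas D)" and f: "f \<in> elts D" and ij: "i < fst V" "j < fst V"
  shows "snd V f $$ (i, j) = (\<Sum>b\<in>bas D. f b * snd V (kd b) $$ (i, j))"
proof -
  have "snd V (\<lambda>z. \<Sum>b\<in>bas D. f b * kd b z) $$ (i, j) = (\<Sum>b\<in>bas D. f b * snd V (kd b) $$ (i, j))"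
    by (rule alg_rep_lincomb[OF V fin kd_elts ij])
  then show ?thesis using elts_expand[OF fin f] by simp
qed

text \<open>A subspace invariant under the basis vectors is invariant under their linear
  combinations, hence under the whole algebra.\<close>

lemma irreducible_on_basis:
  fixes D :: "('b, 'k::field) algd"
  assumes V: "alg_rep D V" and fin: "finite (bas D)" and irr: "irreducible_on (elts D) V"
  shows "irreducible_on (bas D) (fst V, \<lambda>b. snd V (kd b))"
proof -
  let ?n = "fst V"
  show ?thesis unfolding irreducible_on_def fst_conv snd_conv
  proof (intro conjI allI impI)
    show "0 < ?n" using irr by (simp add: irreducible_on_def)
    fix U assume sub: "VectorSpace.subspace class_ring U (module_vec TYPE('k) ?n)"
      and inv: "\<forall>b\<in>bas D. \<forall>v\<in>U. snd V (kd b) *\<^sub>v v \<in> U"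
    note U = subspace_vecD[OF sub]
    have "snd V f *\<^sub>v v \<in> U" if f: "f \<in> elts D" and v: "v \<in> U" for f v
    proof -
      have vc: "v \<in> carrier_vec ?n" using v U(1) by auto
      have "vec ?n (\<lambda>c. \<Sum>b\<in>bas D. f b * (snd V (kd b) *\<^sub>v v) $ c) \<in> U"
        using inv v by (intro closed_sum_vec[OF U fin]) auto
      also have "vec ?n (\<lambda>c. \<Sum>b\<in>bas D. f b * (snd V (kd b) *\<^sub>v v) $ c) = snd V f *\<^sub>v v"
      proof (rule eq_vecI)
        have mv: "(snd V h *\<^sub>v v) $ c = (\<Sum>j<?n. snd V h $$ (c, j) * v $ j)" if "h \<in> elts D" "c < ?n" for h c
          using alg_rep_carrier[OF V that(1)] vc that(2) by (simp add: scalar_prod_def atLeast0LessThan)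
        fix c assume "c < dim_vec (snd V f *\<^sub>v v)"
        then have c: "c < ?n" using alg_rep_carrier[OF V f] by simp
        have "(\<Sum>b\<in>bas D. f b * (snd V (kd b) *\<^sub>v v) $ c) =
            (\<Sum>b\<in>bas D. \<Sum>j<?n. f b * snd V (kd b) $$ (c, j) * v $ j)"
          using c by (intro sum.cong refl) (simp add: mv kd_elts sum_distrib_left mult.assoc)
        also have "\<dots> = (\<Sum>j<?n. snd V f $$ (c, j) * v $ j)"
          using c by (subst sum.swap) (simp add: alg_rep_expand[OF V fin f] sum_distrib_right)
        also have "\<dots> = (snd V f *\<^sub>v v) $ c" by (rule mv[OF f c, symmetric])
        finally show "vec ?n (\<lambda>c. \<Sum>b\<in>bas D. f b * (snd V (kd b) *\<^sub>v v) $ c) $ c = (snd V f *\<^sub>v v) $ c"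
          using c by simp
      qed (use alg_rep_carrier[OF V f] in simp)
      finally show ?thesis .
    qed
    then show "U = {0\<^sub>v ?n} \<or> U = carrier_vec ?n"
      using irr sub unfolding irreducible_on_def by blast
  qed
qed

lemma amul_kd:
  assumes "finite (bas D)" "b \<in> bas D" "c \<in> bas D"
  shows "amul D (kd b) (kd c) x = mcoeff D b c x"
proof -
  have "amul D (kd b) (kd c) x = (\<Sum>b'\<in>bas D. kd b b' * (\<Sum>c'\<in>bas D. kd c c' * mcoeff D b' c' x))"
    by (simp add: amul_def sum_distrib_left mult.assoc)
  then show ?thesis using assms by (simp add: sum_kd_mult)
qed

text \<open>Transfers \<open>irreducible_dual_basis\<close> to an algebra record whose structure
  constants are those of the locale; the operator of the basis vector b is the value of the
  representation at \<open>kd b\<close>.\<close>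

lemma (in frobenius_algebra) alg_irrep_dual_basis:
  fixes D :: "('b, 'k) algd"
  assumes bas: "bas D = B"
    and mc: "\<And>b c x. b \<in> B \<Longrightarrow> c \<in> B \<Longrightarrow> mcoeff D b c x = (if x \<in> B then m b c x else 0)"
    and one: "unity D = (\<lambda>x. if x \<in> B then 1 else 0)"
    and W: "W \<in> alg_irreps D"
  defines "n \<equiv> fst W" and "P \<equiv> \<lambda>b. snd W (kd b)"
  shows "n * n = card B" "0 < n"
    and "\<And>b. b \<in> B \<Longrightarrow> P b \<in> carrier_mat n n"
    and "\<And>b c i j. b \<in> B \<Longrightarrow> c \<in> B \<Longrightarrow> i < n \<Longrightarrow> j < n \<Longrightarrow>
      (P b * P c) $$ (i, j) = (\<Sum>x\<in>B. m b c x * P x $$ (i, j))"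
    and "\<And>i j. i < n \<Longrightarrow> j < n \<Longrightarrow> (\<Sum>b\<in>B. P b $$ (i, j)) = (if i = j then 1 else 0)"
    and "\<exists>Q. (\<forall>s\<in>B. \<forall>s'\<in>B. (\<Sum>(i, j)\<in>{..<n} \<times> {..<n}. P s $$ (i, j) * Q s' i j) = (if s = s' then 1 else 0)) \<and>
      (\<forall>i<n. \<forall>j<n. \<forall>i'<n. \<forall>j'<n. (\<Sum>s\<in>B. P s $$ (i, j) * Q s i' j') = (if i = i' \<and> j = j' then 1 else 0))"
proof -
  have rep: "alg_rep D W" and irr: "irreducible_on (elts D) W" using W by (auto simp: alg_irreps_def)
  have finD: "finite (bas D)" using fin bas by simp
  have kd: "kd b \<in> elts D" if "b \<in> B" for b using that bas by (simp add: kd_elts)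
  show n: "0 < n" using irr by (simp add: irreducible_on_def n_def)
  show Pc: "P b \<in> carrier_mat n n" if "b \<in> B" for b
    using alg_rep_carrier[OF rep kd[OF that]] by (simp add: P_def n_def)
  show mult: "(P b * P c) $$ (i, j) = (\<Sum>x\<in>B. m b c x * P x $$ (i, j))"
    if b: "b \<in> B" and c: "c \<in> B" and ij: "i < n" "j < n" for b c i j
  proof -
    have e: "amul D (kd b) (kd c) \<in> elts D"
      using b c bas finD by (simp add: elts_def amul_kd mc)
    have "P b * P c = snd W (amul D (kd b) (kd c))"
      using rep kd[OF b] kd[OF c] by (simp add: alg_rep_def Let_def P_def)
    then show ?thesis
      using alg_rep_expand[OF rep finD e] ij b c finD bas by (simp add: n_def P_def amul_kd mc)
  qed
  show on: "(\<Sum>b\<in>B. P b $$ (i, j)) = (if i = j then 1 else 0)" if ij: "i < n" "j < n" for i j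
  proof -
    have u: "unity D \<in> elts D" by (simp add: one elts_def bas)
    have "snd W (unity D) = 1\<^sub>m n" using rep by (simp add: alg_rep_def Let_def n_def)
    then have "snd W (unity D) $$ (i, j) = (if i = j then 1 else 0)" using ij by simp
    then show ?thesis using alg_rep_expand[OF rep finD u] ij by (simp add: n_def P_def bas one)
  qed
  have irrB: "irreducible_on B (n, P)"
    using irreducible_on_basis[OF rep finD irr] by (simp add: bas n_def P_def)
  show "n * n = card B"
    by (rule irreducible_dual_basis(1)[OF Pc mult on irrB])
  show "\<exists>Q. (\<forall>s\<in>B. \<forall>s'\<in>B. (\<Sum>(i, j)\<in>{..<n} \<times> {..<n}. P s $$ (i, j) * Q s' i j) = (if s = s' then 1 else 0)) \<and>
      (\<forall>i<n. \<forall>j<n. \<forall>i'<n. \<forall>j'<n. (\<Sum>s\<in>B. P s $$ (i, j) * Q s i' j') = (if i = i' \<and> j = j' then 1 else 0))"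
    by (rule irreducible_dual_basis(2)[OF Pc mult on irrB])
qed

section \<open>Functions on a double coset\<close>

text \<open>A row or column index of a Kronecker product encodes the pair (k div n2, k mod n2); this
  is how sums over such indices split.\<close>

lemma sum_div_mod:
  fixes F :: "nat \<Rightarrow> nat \<Rightarrow> 'k::comm_monoid_add"
  shows "(\<Sum>k<n1 * n2. F (k div n2) (k mod n2)) = (\<Sum>a<n1. \<Sum>b<n2. F a b)"
proof -
  have "(\<Sum>k<n1 * n2. F (k div n2) (k mod n2)) = (\<Sum>(a, b)\<in>{..<n1} \<times> {..<n2}. F a b)"
  proof (rule sum.reindex_bij_witness[where i = "\<lambda>(a, b). a * n2 + b" and j = "\<lambda>k. (k div n2, k mod n2)"])
    fix k assume "k \<in> {..<n1 * n2}"
    then have k: "k < n1 * n2" by simp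
    then have n2: "n2 > 0" by (cases n2) auto
    show "(\<lambda>k. (k div n2, k mod n2)) k \<in> {..<n1} \<times> {..<n2}"
      using k n2 by (auto simp: less_mult_imp_div_less)
  next
    fix z assume "z \<in> {..<n1} \<times> {..<n2}"
    then obtain a b where z: "z = (a, b)" "a < n1" "b < n2" by auto
    have "a * n2 + b < Suc a * n2" using z by simp
    also have "\<dots> \<le> n1 * n2" using z by (intro mult_le_mono1) simp
    finally show "(\<lambda>(a, b). a * n2 + b) z \<in> {..<n1 * n2}" using z by simp
  qed auto
  then show ?thesis by (simp add: sum.cartesian_product)
qed

lemma kron_carrier: "S \<in> carrier_mat a b \<Longrightarrow> T \<in> carrier_mat c d \<Longrightarrow> kron S T \<in> carrier_mat (a * c) (b * d)"
  by (auto simp: kron_def)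

lemma kron_index:
  assumes "S \<in> carrier_mat n1 n1" "T \<in> carrier_mat n2 n2" "i < n1 * n2" "j < n1 * n2"
  shows "kron S T $$ (i, j) = S $$ (i div n2, j div n2) * T $$ (i mod n2, j mod n2)"
  using assms by (auto simp: kron_def)

lemma div_mod_less:
  assumes "i < n1 * (n2::nat)" shows "i div n2 < n1" "i mod n2 < n2"
proof -
  have "n2 > 0" using assms by (cases n2) auto
  then show "i div n2 < n1" "i mod n2 < n2" using assms by (auto simp: less_mult_imp_div_less)
qed

lemma div_mod_eq_iff: "(i div n2 = j div n2 \<and> i mod n2 = j mod n2) \<longleftrightarrow> i = (j::nat)"
  by (metis div_mult_mod_eq)

lemma kron_mult:
  fixes S S' T T' :: "'k::field mat"
  assumes S: "S \<in> carrier_mat n1 n1" "S' \<in> carrier_mat n1 n1" and T: "T \<in> carrier_mat n2 n2" "T' \<in> carrier_mat n2 n2"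
  shows "kron S T * kron S' T' = kron (S * S') (T * T')"
proof (rule eq_matI)
  have k: "kron S T \<in> carrier_mat (n1 * n2) (n1 * n2)" "kron S' T' \<in> carrier_mat (n1 * n2) (n1 * n2)"
    "kron (S * S') (T * T') \<in> carrier_mat (n1 * n2) (n1 * n2)"
    using S T by (auto intro!: kron_carrier)
  show "dim_row (kron S T * kron S' T') = dim_row (kron (S * S') (T * T'))"
    "dim_col (kron S T * kron S' T') = dim_col (kron (S * S') (T * T'))" using k by auto
  fix i j assume "i < dim_row (kron (S * S') (T * T'))" "j < dim_col (kron (S * S') (T * T'))"
  then have ij: "i < n1 * n2" "j < n1 * n2" using k by auto
  note i = div_mod_less[OF ij(1)] and j = div_mod_less[OF ij(2)]
  have "(kron S T * kron S' T') $$ (i, j) = (\<Sum>k<n1 * n2.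
      (S $$ (i div n2, k div n2) * T $$ (i mod n2, k mod n2)) * (S' $$ (k div n2, j div n2) * T' $$ (k mod n2, j mod n2)))"
    unfolding mat_mult_index[OF k(1,2) ij] using ij S T by (intro sum.cong refl) (simp add: kron_index)
  also have "\<dots> = (\<Sum>a<n1. \<Sum>b<n2.
      (S $$ (i div n2, a) * T $$ (i mod n2, b)) * (S' $$ (a, j div n2) * T' $$ (b, j mod n2)))"
    by (rule sum_div_mod)
  also have "\<dots> = (\<Sum>a<n1. S $$ (i div n2, a) * S' $$ (a, j div n2)) * (\<Sum>b<n2. T $$ (i mod n2, b) * T' $$ (b, j mod n2))"
    by (simp add: sum_product mult_ac)
  also have "\<dots> = kron (S * S') (T * T') $$ (i, j)"
    using S T ij i j by (simp add: kron_index[of _ n1 _ n2] mat_mult_index[of _ n1 n1 _ n1] mat_mult_index[of _ n2 n2 _ n2] del: index_mult_mat(1))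
  finally show "(kron S T * kron S' T') $$ (i, j) = kron (S * S') (T * T') $$ (i, j)" .
qed

text \<open>\<open>P s\<close> and \<open>Q t\<close> are the actions of \<open>\<delta>\<^sub>s\<close> on \<open>V\<^sub>1\<close> and of \<open>\<delta>\<^sub>t\<close> on \<open>V\<^sub>2\<close>; \<open>P'\<close> and \<open>Q'\<close> are
  dual bases for them.\<close>

locale double_coset_rep = group G for G :: "('g, 'm) monoid_scheme" (structure) +
  fixes H :: "'g set" and g :: 'g and J J' :: "'g \<times> 'g \<Rightarrow> 'k::field"
    and n1 n2 :: nat and P Q :: "'g \<Rightarrow> 'k mat" and P' Q' :: "'g \<Rightarrow> nat \<Rightarrow> nat \<Rightarrow> 'k"
  assumes finG: "finite (carrier G)" and subH: "subgroup H G" and gG: "g \<in> carrier G"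
    and P_mat: "\<And>s. s \<in> H \<Longrightarrow> P s \<in> carrier_mat n1 n1"
    and Q_mat: "\<And>s. s \<in> H \<Longrightarrow> Q s \<in> carrier_mat n2 n2"
    and P_mult: "\<And>s s' i j. s \<in> H \<Longrightarrow> s' \<in> H \<Longrightarrow> i < n1 \<Longrightarrow> j < n1 \<Longrightarrow>
      (P s * P s') $$ (i, j) = (\<Sum>x\<in>H. J (inv x \<otimes> s, inv x \<otimes> s') * P x $$ (i, j))"
    and Q_mult: "\<And>t t' i j. t \<in> H \<Longrightarrow> t' \<in> H \<Longrightarrow> i < n2 \<Longrightarrow> j < n2 \<Longrightarrow>
      (Q t * Q t') $$ (i, j) = (\<Sum>y\<in>H. J' (t \<otimes> inv y, t' \<otimes> inv y) * Q y $$ (i, j))"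
    and P_one: "\<And>i j. i < n1 \<Longrightarrow> j < n1 \<Longrightarrow> (\<Sum>s\<in>H. P s $$ (i, j)) = (if i = j then 1 else 0)"
    and Q_one: "\<And>i j. i < n2 \<Longrightarrow> j < n2 \<Longrightarrow> (\<Sum>s\<in>H. Q s $$ (i, j)) = (if i = j then 1 else 0)"
    and P_dual: "\<And>s s'. s \<in> H \<Longrightarrow> s' \<in> H \<Longrightarrow>
      (\<Sum>(i, j)\<in>{..<n1} \<times> {..<n1}. P s $$ (i, j) * P' s' i j) = (if s = s' then 1 else 0)"
    and P_dual': "\<And>i j i' j'. i < n1 \<Longrightarrow> j < n1 \<Longrightarrow> i' < n1 \<Longrightarrow> j' < n1 \<Longrightarrow>
      (\<Sum>s\<in>H. P s $$ (i, j) * P' s i' j') = (if i = i' \<and> j = j' then 1 else 0)"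
    and Q_dual: "\<And>s s'. s \<in> H \<Longrightarrow> s' \<in> H \<Longrightarrow>
      (\<Sum>(i, j)\<in>{..<n2} \<times> {..<n2}. Q s $$ (i, j) * Q' s' i j) = (if s = s' then 1 else 0)"
    and Q_dual': "\<And>i j i' j'. i < n2 \<Longrightarrow> j < n2 \<Longrightarrow> i' < n2 \<Longrightarrow> j' < n2 \<Longrightarrow>
      (\<Sum>s\<in>H. Q s $$ (i, j) * Q' s i' j') = (if i = i' \<and> j = j' then 1 else 0)"
begin

lemma H_mem [simp]: "s \<in> H \<Longrightarrow> s \<in> carrier G"
  using subgroup.mem_carrier[OF subH] .

lemma H_mult [simp]: "s \<in> H \<Longrightarrow> t \<in> H \<Longrightarrow> s \<otimes> t \<in> H"
  using subgroup.m_closed[OF subH] .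

lemma H_inv [simp]: "s \<in> H \<Longrightarrow> inv s \<in> H"
  using subgroup.m_inv_closed[OF subH] .

lemma finH [simp]: "finite H"
  using finite_subset[OF subgroup.subset[OF subH] finG] .

text \<open>F is read as an element of the tensor product of the two dual algebras, with \<delta>_s
  \<otimes> \<delta>_t acting on V_1 \<otimes> V_2 by the Kronecker product of P s and Q t.\<close>

definition tens :: "('g \<Rightarrow> 'g \<Rightarrow> 'k) \<Rightarrow> 'k mat" where
  "tens F = msum (n1 * n2) (n1 * n2) (H \<times> H) (\<lambda>(s, t). F s t \<cdot>\<^sub>m kron (P s) (Q t))"

lemma tens_mat [simp]: "tens F \<in> carrier_mat (n1 * n2) (n1 * n2)"
  by (simp add: tens_def)

lemma tens_dim [simp]: "dim_row (tens F) = n1 * n2" "dim_col (tens F) = n1 * n2"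
  by (simp_all add: tens_def msum_def)

lemma kron_PQ_mat: "s \<in> H \<Longrightarrow> t \<in> H \<Longrightarrow> kron (P s) (Q t) \<in> carrier_mat (n1 * n2) (n1 * n2)"
  by (intro kron_carrier P_mat Q_mat)

lemma tens_index:
  assumes ij: "i < n1 * n2" "j < n1 * n2"
  shows "tens F $$ (i, j) = (\<Sum>(s, t)\<in>H \<times> H. F s t * (P s $$ (i div n2, j div n2) * Q t $$ (i mod n2, j mod n2)))"
  unfolding tens_def msum_index[OF ij]
proof (rule sum.cong[OF refl])
  fix z assume "z \<in> H \<times> H"
  then obtain s t where z: "z = (s, t)" "s \<in> H" "t \<in> H" by auto
  show "(case z of (s, t) \<Rightarrow> F s t \<cdot>\<^sub>m kron (P s) (Q t)) $$ (i, j) =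
      (case z of (s, t) \<Rightarrow> F s t * (P s $$ (i div n2, j div n2) * Q t $$ (i mod n2, j mod n2)))"
    using z ij kron_PQ_mat[OF z(2,3)] kron_index[OF P_mat Q_mat ij, OF z(2,3)] by simp
qed

lemma tens_cong: "(\<And>s t. s \<in> H \<Longrightarrow> t \<in> H \<Longrightarrow> F s t = F' s t) \<Longrightarrow> tens F = tens F'"
  unfolding tens_def by (rule msum_cong) auto

text \<open>Products of the two dual bases are dual to the Kronecker products of the P s and Q
  t.\<close>

lemma tens_dual:
  assumes st: "s \<in> H" "t \<in> H"
  shows "(\<Sum>i<n1 * n2. \<Sum>j<n1 * n2. tens F $$ (i, j) * (P' s (i div n2) (j div n2) * Q' t (i mod n2) (j mod n2))) = F s t"
proof -
  have "(\<Sum>i<n1 * n2. \<Sum>j<n1 * n2. tens F $$ (i, j) * (P' s (i div n2) (j div n2) * Q' t (i mod n2) (j mod n2))) =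
      (\<Sum>i<n1 * n2. \<Sum>j<n1 * n2. \<Sum>z\<in>H \<times> H. F (fst z) (snd z) *
        ((P (fst z) $$ (i div n2, j div n2) * P' s (i div n2) (j div n2)) *
         (Q (snd z) $$ (i mod n2, j mod n2) * Q' t (i mod n2) (j mod n2))))"
    by (intro sum.cong refl) (simp add: tens_index sum_distrib_left sum_distrib_right split_beta mult_ac)
  also have "\<dots> = (\<Sum>z\<in>H \<times> H. F (fst z) (snd z) * (\<Sum>i<n1 * n2. \<Sum>j<n1 * n2.
        (P (fst z) $$ (i div n2, j div n2) * P' s (i div n2) (j div n2)) *
         (Q (snd z) $$ (i mod n2, j mod n2) * Q' t (i mod n2) (j mod n2))))"
    by (subst sum_sum_swap3[symmetric]) (simp add: sum_distrib_left)
  also have "\<dots> = (\<Sum>z\<in>H \<times> H. if z = (s, t) then F s t else 0)"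
  proof (rule sum.cong[OF refl])
    fix z assume "z \<in> H \<times> H"
    then obtain s' t' where z: "z = (s', t')" "s' \<in> H" "t' \<in> H" by auto
    have "(\<Sum>i<n1 * n2. \<Sum>j<n1 * n2. (P s' $$ (i div n2, j div n2) * P' s (i div n2) (j div n2)) *
         (Q t' $$ (i mod n2, j mod n2) * Q' t (i mod n2) (j mod n2))) =
       (\<Sum>i<n1 * n2. \<Sum>b<n1. \<Sum>d<n2. (P s' $$ (i div n2, b) * P' s (i div n2) b) *
         (Q t' $$ (i mod n2, d) * Q' t (i mod n2) d))"
      by (rule sum.cong[OF refl], rule sum_div_mod)
    also have "\<dots> = (\<Sum>a<n1. \<Sum>c<n2. \<Sum>b<n1. \<Sum>d<n2. (P s' $$ (a, b) * P' s a b) * (Q t' $$ (c, d) * Q' t c d))"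
      by (rule sum_div_mod)
    also have "\<dots> = (\<Sum>a<n1. \<Sum>c<n2. (\<Sum>b<n1. P s' $$ (a, b) * P' s a b) * (\<Sum>d<n2. Q t' $$ (c, d) * Q' t c d))"
      by (simp add: sum_product)
    also have "\<dots> = (\<Sum>a<n1. \<Sum>b<n1. P s' $$ (a, b) * P' s a b) * (\<Sum>c<n2. \<Sum>d<n2. Q t' $$ (c, d) * Q' t c d)"
      by (rule sum_product[symmetric])
    also have "\<dots> = (if s' = s then 1 else 0) * (if t' = t then 1 else 0)"
      using P_dual[OF z(2) st(1)] Q_dual[OF z(3) st(2)] by (simp add: sum.cartesian_product)
    finally show "F (fst z) (snd z) * (\<Sum>i<n1 * n2. \<Sum>j<n1 * n2.
        (P (fst z) $$ (i div n2, j div n2) * P' s (i div n2) (j div n2)) *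
         (Q (snd z) $$ (i mod n2, j mod n2) * Q' t (i mod n2) (j mod n2))) = (if z = (s, t) then F s t else 0)"
      by (simp add: z)
  qed
  also have "\<dots> = F s t" using st by simp
  finally show ?thesis .
qed

lemma tens_inj: "tens F = tens F' \<Longrightarrow> s \<in> H \<Longrightarrow> t \<in> H \<Longrightarrow> F s t = F' s t"
  using tens_dual[of s t F] tens_dual[of s t F'] by simp

lemma tens_surj:
  assumes M: "M \<in> carrier_mat (n1 * n2) (n1 * n2)"
  shows "\<exists>F. tens F = M"
proof -
  \<comment> \<open>The coefficients are forced by \<open>tens_dual\<close>: F is the pairing of M
    with the products of the dual bases.\<close>
  define F where "F s t = (\<Sum>i'<n1 * n2. \<Sum>j'<n1 * n2. M $$ (i', j') * (P' s (i' div n2) (j' div n2) * Q' t (i' mod n2) (j' mod n2)))" for s t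
  have "tens F = M"
  proof (rule eq_matI)
    fix i j assume "i < dim_row M" "j < dim_col M"
    then have ij: "i < n1 * n2" "j < n1 * n2" using M by auto
    note i = div_mod_less[OF ij(1)] and j = div_mod_less[OF ij(2)]
    have "tens F $$ (i, j) = (\<Sum>s\<in>H. \<Sum>t\<in>H. \<Sum>i'<n1 * n2. \<Sum>j'<n1 * n2. M $$ (i', j') *
       ((P s $$ (i div n2, j div n2) * P' s (i' div n2) (j' div n2)) *
        (Q t $$ (i mod n2, j mod n2) * Q' t (i' mod n2) (j' mod n2))))"
      unfolding tens_index[OF ij] sum.cartesian_product[symmetric] F_def
      by (simp add: sum_distrib_left sum_distrib_right mult_ac)
    also have "\<dots> = (\<Sum>i'<n1 * n2. \<Sum>s\<in>H. \<Sum>t\<in>H. \<Sum>j'<n1 * n2. M $$ (i', j') *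
       ((P s $$ (i div n2, j div n2) * P' s (i' div n2) (j' div n2)) *
        (Q t $$ (i mod n2, j mod n2) * Q' t (i' mod n2) (j' mod n2))))"
      by (rule sum_sum_swap3[symmetric])
    also have "\<dots> = (\<Sum>i'<n1 * n2. \<Sum>j'<n1 * n2. \<Sum>s\<in>H. \<Sum>t\<in>H. M $$ (i', j') *
       ((P s $$ (i div n2, j div n2) * P' s (i' div n2) (j' div n2)) *
        (Q t $$ (i mod n2, j mod n2) * Q' t (i' mod n2) (j' mod n2))))"
      by (rule sum.cong[OF refl], rule sum_sum_swap3[symmetric])
    also have "\<dots> = (\<Sum>i'<n1 * n2. \<Sum>j'<n1 * n2. if j' = j then (if i' = i then M $$ (i, j) else 0) else 0)"
    proof (rule sum.cong[OF refl], rule sum.cong[OF refl])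
      fix i' j' assume "i' \<in> {..<n1 * n2}" "j' \<in> {..<n1 * n2}"
      then have ij': "i' < n1 * n2" "j' < n1 * n2" by auto
      note i' = div_mod_less[OF ij'(1)] and j' = div_mod_less[OF ij'(2)]
      have "(\<Sum>s\<in>H. \<Sum>t\<in>H. M $$ (i', j') * ((P s $$ (i div n2, j div n2) * P' s (i' div n2) (j' div n2)) *
          (Q t $$ (i mod n2, j mod n2) * Q' t (i' mod n2) (j' mod n2)))) =
        M $$ (i', j') * ((\<Sum>s\<in>H. P s $$ (i div n2, j div n2) * P' s (i' div n2) (j' div n2)) *
          (\<Sum>t\<in>H. Q t $$ (i mod n2, j mod n2) * Q' t (i' mod n2) (j' mod n2)))"
        unfolding sum_product by (simp add: sum_distrib_left)
      also have "\<dots> = M $$ (i', j') * ((if i div n2 = i' div n2 \<and> j div n2 = j' div n2 then 1 else 0) *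
          (if i mod n2 = i' mod n2 \<and> j mod n2 = j' mod n2 then 1 else 0))"
        using i j i' j' by (simp add: P_dual' Q_dual')
      also have "\<dots> = (if j' = j then (if i' = i then M $$ (i, j) else 0) else 0)"
        using div_mod_eq_iff[of i n2 i'] div_mod_eq_iff[of j n2 j'] by auto
      finally show "(\<Sum>s\<in>H. \<Sum>t\<in>H. M $$ (i', j') * ((P s $$ (i div n2, j div n2) * P' s (i' div n2) (j' div n2)) *
          (Q t $$ (i mod n2, j mod n2) * Q' t (i' mod n2) (j' mod n2)))) =
        (if j' = j then (if i' = i then M $$ (i, j) else 0) else 0)" .
    qed
    also have "\<dots> = M $$ (i, j)" using ij by simp
    finally show "tens F $$ (i, j) = M $$ (i, j)" .
  qed (use M tens_mat[of F] in auto)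
  then show ?thesis by blast
qed

lemma tens_one: "tens (\<lambda>s t. 1) = 1\<^sub>m (n1 * n2)"
proof (rule eq_matI)
  fix i j assume "i < dim_row (1\<^sub>m (n1 * n2))" "j < dim_col (1\<^sub>m (n1 * n2))"
  then have ij: "i < n1 * n2" "j < n1 * n2" by auto
  note i = div_mod_less[OF ij(1)] and j = div_mod_less[OF ij(2)]
  have "tens (\<lambda>s t. 1) $$ (i, j) = (\<Sum>s\<in>H. P s $$ (i div n2, j div n2)) * (\<Sum>t\<in>H. Q t $$ (i mod n2, j mod n2))"
    unfolding tens_index[OF ij] sum.cartesian_product[symmetric] sum_product by simp
  also have "\<dots> = (if i div n2 = j div n2 then 1 else 0) * (if i mod n2 = j mod n2 then 1 else 0)"
    using P_one[OF i(1) j(1)] Q_one[OF i(2) j(2)] by simp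
  also have "\<dots> = (if i = j then 1 else 0)" using div_mod_eq_iff[of i n2 j] by auto
  finally show "tens (\<lambda>s t. 1) $$ (i, j) = 1\<^sub>m (n1 * n2) $$ (i, j)" using ij by simp
qed (use tens_mat in \<open>auto simp: tens_def msum_def\<close>)

text \<open>The right side is the product in the tensor product of the two dual algebras, whose
  structure constants are J(x^{-1} s, x^{-1} s') and J'(t y^{-1}, t' y^{-1}).\<close>

lemma tens_mult:
  "tens F * tens F' = tens (\<lambda>x y. \<Sum>(s, t)\<in>H \<times> H. \<Sum>(s', t')\<in>H \<times> H.
     F s t * F' s' t' * (J (inv x \<otimes> s, inv x \<otimes> s') * J' (t \<otimes> inv y, t' \<otimes> inv y)))"
  (is "_ = tens ?F")
proof (rule eq_matI)
  let ?n = "n1 * n2"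
  let ?R = "\<lambda>z. kron (P (fst z)) (Q (snd z))"
  fix i j assume "i < dim_row (tens ?F)" "j < dim_col (tens ?F)"
  then have ij: "i < ?n" "j < ?n" using tens_mat[of ?F] by auto
  note i = div_mod_less[OF ij(1)] and j = div_mod_less[OF ij(2)]
  have Rc: "?R z \<in> carrier_mat ?n ?n" if "z \<in> H \<times> H" for z using kron_PQ_mat that by auto
  have ti: "tens F $$ (i, k) = (\<Sum>z\<in>H \<times> H. F (fst z) (snd z) * ?R z $$ (i, k))" if "i < ?n" "k < ?n" for F i k
    unfolding tens_def msum_index[OF that]
  proof (rule sum.cong[OF refl])
    fix z assume "z \<in> H \<times> H"
    then show "(case z of (s, t) \<Rightarrow> F s t \<cdot>\<^sub>m kron (P s) (Q t)) $$ (i, k) = F (fst z) (snd z) * ?R z $$ (i, k)"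
      using Rc[of z] that by (simp add: split_beta)
  qed
  have "(tens F * tens F') $$ (i, j) = (\<Sum>k<?n. \<Sum>z\<in>H \<times> H. \<Sum>w\<in>H \<times> H.
      (F (fst z) (snd z) * F' (fst w) (snd w)) * (?R z $$ (i, k) * ?R w $$ (k, j)))"
    unfolding mat_mult_index[OF tens_mat tens_mat ij]
    using ij by (intro sum.cong refl) (simp add: ti sum_product mult_ac)
  also have "\<dots> = (\<Sum>z\<in>H \<times> H. \<Sum>w\<in>H \<times> H. (F (fst z) (snd z) * F' (fst w) (snd w)) *
      (\<Sum>k<?n. ?R z $$ (i, k) * ?R w $$ (k, j)))"
    by (subst sum_sum_swap3) (simp add: sum_distrib_left)
  also have "\<dots> = (\<Sum>z\<in>H \<times> H. \<Sum>w\<in>H \<times> H. (F (fst z) (snd z) * F' (fst w) (snd w)) *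
      (\<Sum>u\<in>H \<times> H. (J (inv (fst u) \<otimes> fst z, inv (fst u) \<otimes> fst w) * J' (snd z \<otimes> inv (snd u), snd w \<otimes> inv (snd u))) *
        (P (fst u) $$ (i div n2, j div n2) * Q (snd u) $$ (i mod n2, j mod n2))))"
  proof (rule sum.cong[OF refl], rule sum.cong[OF refl], rule arg_cong2[where f = times, OF refl])
    fix z w assume z: "z \<in> H \<times> H" and w: "w \<in> H \<times> H"
    have zw: "fst z \<in> H" "snd z \<in> H" "fst w \<in> H" "snd w \<in> H" using z w by auto
    have "(\<Sum>k<?n. ?R z $$ (i, k) * ?R w $$ (k, j)) = (?R z * ?R w) $$ (i, j)"
      by (rule mat_mult_index[OF Rc[OF z] Rc[OF w] ij, symmetric])
    also have "\<dots> = kron (P (fst z) * P (fst w)) (Q (snd z) * Q (snd w)) $$ (i, j)"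
      by (simp add: kron_mult[OF P_mat P_mat Q_mat Q_mat] zw)
    also have "\<dots> = (P (fst z) * P (fst w)) $$ (i div n2, j div n2) * (Q (snd z) * Q (snd w)) $$ (i mod n2, j mod n2)"
      using P_mat[OF zw(1)] P_mat[OF zw(3)] Q_mat[OF zw(2)] Q_mat[OF zw(4)]
      by (intro kron_index[OF _ _ ij]) auto
    also have "\<dots> = (\<Sum>x\<in>H. J (inv x \<otimes> fst z, inv x \<otimes> fst w) * P x $$ (i div n2, j div n2)) *
        (\<Sum>y\<in>H. J' (snd z \<otimes> inv y, snd w \<otimes> inv y) * Q y $$ (i mod n2, j mod n2))"
      using zw i j by (simp add: P_mult Q_mult del: index_mult_mat)
    also have "\<dots> = (\<Sum>u\<in>H \<times> H. (J (inv (fst u) \<otimes> fst z, inv (fst u) \<otimes> fst w) * J' (snd z \<otimes> inv (snd u), snd w \<otimes> inv (snd u))) *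
        (P (fst u) $$ (i div n2, j div n2) * Q (snd u) $$ (i mod n2, j mod n2)))"
      by (simp add: sum_product sum.cartesian_product split_beta mult_ac)
    finally show "(\<Sum>k<?n. ?R z $$ (i, k) * ?R w $$ (k, j)) =
      (\<Sum>u\<in>H \<times> H. (J (inv (fst u) \<otimes> fst z, inv (fst u) \<otimes> fst w) * J' (snd z \<otimes> inv (snd u), snd w \<otimes> inv (snd u))) *
        (P (fst u) $$ (i div n2, j div n2) * Q (snd u) $$ (i mod n2, j mod n2)))" .
  qed
  also have "\<dots> = (\<Sum>z\<in>H \<times> H. \<Sum>w\<in>H \<times> H. \<Sum>u\<in>H \<times> H. (F (fst z) (snd z) * F' (fst w) (snd w)) *
      (J (inv (fst u) \<otimes> fst z, inv (fst u) \<otimes> fst w) * J' (snd z \<otimes> inv (snd u), snd w \<otimes> inv (snd u))) *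
        (P (fst u) $$ (i div n2, j div n2) * Q (snd u) $$ (i mod n2, j mod n2)))"
    by (simp add: sum_distrib_left mult.assoc)
  also have "\<dots> = (\<Sum>u\<in>H \<times> H. ?F (fst u) (snd u) * (P (fst u) $$ (i div n2, j div n2) * Q (snd u) $$ (i mod n2, j mod n2)))"
    by (subst sum_sum_swap3[symmetric]) (simp add: sum_distrib_right split_beta)
  also have "\<dots> = tens ?F $$ (i, j)"
    unfolding tens_index[OF ij] by (simp add: split_beta)
  finally show "(tens F * tens F') $$ (i, j) = tens ?F $$ (i, j)" .
qed (auto simp: tens_def msum_def)

text \<open>Lifts of the two projective actions permute the P s and the Q t by translation, so
  conjugation by their Kronecker product moves F by the inverse translations of its
  arguments.\<close>

lemma tens_conj:
  assumes S0: "S0 \<in> carrier_mat n1 n1" and T0: "T0 \<in> carrier_mat n2 n2"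
    and SP: "\<And>s. s \<in> H \<Longrightarrow> S0 * P s = P (h \<otimes> s) * S0"
    and TQ: "\<And>t. t \<in> H \<Longrightarrow> T0 * Q t = Q (t \<otimes> inv a) * T0"
    and ha: "h \<in> H" "a \<in> H"
  shows "kron S0 T0 * tens F = tens (\<lambda>s t. F (inv h \<otimes> s) (t \<otimes> a)) * kron S0 T0"
proof -
  let ?n = "n1 * n2"
  have k: "kron S0 T0 \<in> carrier_mat ?n ?n" by (rule kron_carrier[OF S0 T0])
  have Rc: "F s t \<cdot>\<^sub>m kron (P s') (Q t') \<in> carrier_mat ?n ?n" if "s' \<in> H" "t' \<in> H" for F :: "'g \<Rightarrow> 'g \<Rightarrow> 'k" and s t s' t'
    using kron_PQ_mat[OF that] by simp
  have "kron S0 T0 * tens F = msum ?n ?n (H \<times> H) (\<lambda>z. kron S0 T0 * (case z of (s, t) \<Rightarrow> F s t \<cdot>\<^sub>m kron (P s) (Q t)))"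
    unfolding tens_def using Rc by (intro mult_msum[OF k]) auto
  also have "\<dots> = msum ?n ?n (H \<times> H) (\<lambda>z. (case z of (s, t) \<Rightarrow> F s t \<cdot>\<^sub>m kron (P (h \<otimes> s)) (Q (t \<otimes> inv a))) * kron S0 T0)"
  proof (rule msum_cong, clarify)
    fix s t assume st: "s \<in> H" "t \<in> H"
    have hs: "h \<otimes> s \<in> H" "t \<otimes> inv a \<in> H" using st ha by auto
    have "kron S0 T0 * kron (P s) (Q t) = kron (S0 * P s) (T0 * Q t)"
      by (rule kron_mult[OF S0 P_mat[OF st(1)] T0 Q_mat[OF st(2)]])
    also have "\<dots> = kron (P (h \<otimes> s)) (Q (t \<otimes> inv a)) * kron S0 T0"
      unfolding SP[OF st(1)] TQ[OF st(2)]
      by (rule kron_mult[OF P_mat[OF hs(1)] S0 Q_mat[OF hs(2)] T0, symmetric])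
    finally show "kron S0 T0 * (F s t \<cdot>\<^sub>m kron (P s) (Q t)) =
        F s t \<cdot>\<^sub>m kron (P (h \<otimes> s)) (Q (t \<otimes> inv a)) * kron S0 T0"
      using mult_smult_distrib[OF k kron_PQ_mat[OF st]] mult_smult_assoc_mat[OF kron_PQ_mat[OF hs] k] by simp
  qed
  also have "\<dots> = msum ?n ?n (H \<times> H) (\<lambda>(s, t). F s t \<cdot>\<^sub>m kron (P (h \<otimes> s)) (Q (t \<otimes> inv a))) * kron S0 T0"
    using Rc ha by (intro msum_mult[OF k, symmetric]) auto
  also have "msum ?n ?n (H \<times> H) (\<lambda>(s, t). F s t \<cdot>\<^sub>m kron (P (h \<otimes> s)) (Q (t \<otimes> inv a))) =
      tens (\<lambda>s t. F (inv h \<otimes> s) (t \<otimes> a))"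
  proof (rule eq_matI)
    fix i j assume "i < dim_row (tens (\<lambda>s t. F (inv h \<otimes> s) (t \<otimes> a)))" "j < dim_col (tens (\<lambda>s t. F (inv h \<otimes> s) (t \<otimes> a)))"
    then have ij: "i < ?n" "j < ?n" using tens_mat[of "\<lambda>s t. F (inv h \<otimes> s) (t \<otimes> a)"] by auto
    have hG: "h \<in> carrier G" "a \<in> carrier G" using ha by auto
    have "(\<Sum>z\<in>H \<times> H. (case z of (s, t) \<Rightarrow> F s t \<cdot>\<^sub>m kron (P (h \<otimes> s)) (Q (t \<otimes> inv a))) $$ (i, j)) =
        (\<Sum>z\<in>H \<times> H. (case z of (s, t) \<Rightarrow> F (inv h \<otimes> s) (t \<otimes> a) \<cdot>\<^sub>m kron (P s) (Q t)) $$ (i, j))"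
      by (rule sum.reindex_bij_witness[where j = "\<lambda>(s, t). (h \<otimes> s, t \<otimes> inv a)" and i = "\<lambda>(s, t). (inv h \<otimes> s, t \<otimes> a)"])
        (use ha hG in \<open>auto simp: cancel_inv_mult m_assoc\<close>)
    then show "msum ?n ?n (H \<times> H) (\<lambda>(s, t). F s t \<cdot>\<^sub>m kron (P (h \<otimes> s)) (Q (t \<otimes> inv a))) $$ (i, j) =
        tens (\<lambda>s t. F (inv h \<otimes> s) (t \<otimes> a)) $$ (i, j)"
      unfolding tens_def msum_index[OF ij] .
  qed (auto simp: tens_def msum_def)
  finally show ?thesis .
qed

section \<open>The double coset as an orbit space of the stabilizer\<close>

definition coset :: "'g set" where "coset = {t \<otimes> g \<otimes> s | t s. t \<in> H \<and> s \<in> H}"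

definition stab :: "'g set" where "stab = {a \<in> H. inv g \<otimes> a \<otimes> g \<in> H}"

text \<open>Each fibre of (s, t) \<mapsto> t g s is a single orbit of \<open>stab\<close>, where a
  sends s to (g^{-1} a g)^{-1} s and t to t a. That this action preserves t g s is the converse,
  \<open>stab_move\<close>.\<close>

lemma coset_eqD:
  assumes st: "s \<in> H" "t \<in> H" "s' \<in> H" "t' \<in> H" and eq: "t \<otimes> g \<otimes> s = t' \<otimes> g \<otimes> s'"
  shows "inv t \<otimes> t' \<in> stab" "s' = inv (inv g \<otimes> (inv t \<otimes> t') \<otimes> g) \<otimes> s"
proof -
  define a where "a = inv t \<otimes> t'"
  have c: "s \<in> carrier G" "t \<in> carrier G" "s' \<in> carrier G" "t' \<in> carrier G" "a \<in> carrier G"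
    using st by (simp_all add: a_def)
  have "g \<otimes> s = inv t \<otimes> (t \<otimes> g \<otimes> s)" using c gG by (simp add: m_assoc cancel_inv_mult)
  also have "\<dots> = a \<otimes> (g \<otimes> s')" unfolding eq using c gG by (simp add: a_def m_assoc)
  finally have e: "g \<otimes> s = a \<otimes> (g \<otimes> s')" .
  have "(inv g \<otimes> a \<otimes> g) \<otimes> s' = inv g \<otimes> (g \<otimes> s)" unfolding e using c gG by (simp add: m_assoc)
  then have e2: "(inv g \<otimes> a \<otimes> g) \<otimes> s' = s" using c gG by (simp add: cancel_inv_mult)
  then have "inv g \<otimes> a \<otimes> g = s \<otimes> inv s'" using c gG by (metis inv_closed inv_solve_right m_closed)
  then show "inv t \<otimes> t' \<in> stab" using st by (simp add: stab_def a_def)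
  have gag: "inv g \<otimes> a \<otimes> g \<in> carrier G" using c gG by simp
  show "s' = inv (inv g \<otimes> (inv t \<otimes> t') \<otimes> g) \<otimes> s"
    unfolding a_def[symmetric] e2[symmetric] using cancel_inv_mult(1)[OF gag c(3)] by simp
qed

lemma stab_move:
  assumes a: "a \<in> stab" and st: "s \<in> H" "t \<in> H"
  shows "(t \<otimes> a) \<otimes> g \<otimes> (inv (inv g \<otimes> a \<otimes> g) \<otimes> s) = t \<otimes> g \<otimes> s"
proof -
  have c: "a \<in> carrier G" "s \<in> carrier G" "t \<in> carrier G" using a st by (auto simp: stab_def)
  define h where "h = inv g \<otimes> a \<otimes> g"
  have h: "h \<in> carrier G" using c gG by (simp add: h_def)
  have ag: "a \<otimes> g = g \<otimes> h" using c gG by (simp add: h_def m_assoc cancel_inv_mult)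
  have "(t \<otimes> a) \<otimes> g \<otimes> (inv h \<otimes> s) = t \<otimes> (a \<otimes> g) \<otimes> (inv h \<otimes> s)"
    using c gG h by (simp add: m_assoc)
  also have "\<dots> = t \<otimes> g \<otimes> (h \<otimes> (inv h \<otimes> s))" unfolding ag using c gG h by (simp add: m_assoc)
  also have "\<dots> = t \<otimes> g \<otimes> s" unfolding cancel_inv_mult(2)[OF h c(2)] ..
  finally show ?thesis unfolding h_def .
qed

text \<open>By \<open>coset_eqD\<close> an invariant function is constant on the fibres of (s, t)
  \<mapsto> t g s, so its value at any chosen point of a fibre defines f.\<close>

lemma descend:
  assumes inv: "\<And>a s t. a \<in> stab \<Longrightarrow> s \<in> H \<Longrightarrow> t \<in> H \<Longrightarrow>
    F s t = (F (inv (inv g \<otimes> a \<otimes> g) \<otimes> s) (t \<otimes> a) :: 'k)"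
  shows "\<exists>f. (\<forall>x. x \<notin> coset \<longrightarrow> f x = 0) \<and> (\<forall>s\<in>H. \<forall>t\<in>H. F s t = f (t \<otimes> g \<otimes> s))"
proof -
  define f where "f x = (if x \<in> coset then (case (SOME (s, t). s \<in> H \<and> t \<in> H \<and> x = t \<otimes> g \<otimes> s) of (s, t) \<Rightarrow> F s t) else 0)" for x
  have "F s t = f (t \<otimes> g \<otimes> s)" if st: "s \<in> H" "t \<in> H" for s t
  proof -
    have in_c: "t \<otimes> g \<otimes> s \<in> coset" using st by (auto simp: coset_def)
    obtain s' t' where some: "(SOME (s', t'). s' \<in> H \<and> t' \<in> H \<and> t \<otimes> g \<otimes> s = t' \<otimes> g \<otimes> s') = (s', t')"
      by (cases "SOME (s', t'). s' \<in> H \<and> t' \<in> H \<and> t \<otimes> g \<otimes> s = t' \<otimes> g \<otimes> s'") auto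
    have "\<exists>z. case z of (s', t') \<Rightarrow> s' \<in> H \<and> t' \<in> H \<and> t \<otimes> g \<otimes> s = t' \<otimes> g \<otimes> s'" using st by auto
    then have "case (SOME (s', t'). s' \<in> H \<and> t' \<in> H \<and> t \<otimes> g \<otimes> s = t' \<otimes> g \<otimes> s') of
        (s', t') \<Rightarrow> s' \<in> H \<and> t' \<in> H \<and> t \<otimes> g \<otimes> s = t' \<otimes> g \<otimes> s'" by (rule someI_ex)
    then have st': "s' \<in> H" "t' \<in> H" "t \<otimes> g \<otimes> s = t' \<otimes> g \<otimes> s'" unfolding some by auto
    have tt: "t \<otimes> (inv t \<otimes> t') = t'" using st st' by (simp add: cancel_inv_mult)
    have "F s t = F (inv (inv g \<otimes> (inv t \<otimes> t') \<otimes> g) \<otimes> s) (t \<otimes> (inv t \<otimes> t'))"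
      by (rule inv[OF coset_eqD(1)[OF st st'] st])
    also have "\<dots> = F s' t'" unfolding coset_eqD(2)[OF st st', symmetric] tt ..
    also have "\<dots> = f (t \<otimes> g \<otimes> s)" using in_c by (simp add: f_def some)
    finally show ?thesis .
  qed
  moreover have "f x = 0" if "x \<notin> coset" for x using that by (simp add: f_def)
  ultimately show ?thesis by blast
qed

text \<open>The stabilizer acts freely on H \<times> H, since a can be recovered from t a. A choice
  r of one point in each fibre therefore identifies H \<times> H with the product of the double
  coset and the stabilizer.\<close>

lemma card_coset: "card coset * card stab = card H * card H"
proof -
  have "\<exists>z. z \<in> H \<times> H \<and> x = snd z \<otimes> g \<otimes> fst z" if "x \<in> coset" for x
    using that by (force simp: coset_def)
  then obtain r where r: "\<And>x. x \<in> coset \<Longrightarrow> r x \<in> H \<times> H \<and> x = snd (r x) \<otimes> g \<otimes> fst (r x)" by metis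
  let ?h = "\<lambda>(x, a). (inv (inv g \<otimes> a \<otimes> g) \<otimes> fst (r x), snd (r x) \<otimes> a)"
  have rH: "fst (r x) \<in> H" "snd (r x) \<in> H" "x = snd (r x) \<otimes> g \<otimes> fst (r x)" if "x \<in> coset" for x
    using r[OF that] by (auto simp: mem_Times_iff)
  have aH: "a \<in> H" "inv g \<otimes> a \<otimes> g \<in> H" if "a \<in> stab" for a using that by (auto simp: stab_def)
  have "bij_betw ?h (coset \<times> stab) (H \<times> H)"
    unfolding bij_betw_def
  proof (intro conjI inj_onI subset_antisym subsetI)
    fix z w assume "z \<in> coset \<times> stab" "w \<in> coset \<times> stab" and eq: "?h z = ?h w"
    then obtain x a y b where z: "z = (x, a)" "x \<in> coset" "a \<in> stab" and w: "w = (y, b)" "y \<in> coset" "b \<in> stab"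
      by auto
    have e: "inv (inv g \<otimes> a \<otimes> g) \<otimes> fst (r x) = inv (inv g \<otimes> b \<otimes> g) \<otimes> fst (r y)"
      "snd (r x) \<otimes> a = snd (r y) \<otimes> b" using eq by (auto simp: z w)
    have "x = (snd (r x) \<otimes> a) \<otimes> g \<otimes> (inv (inv g \<otimes> a \<otimes> g) \<otimes> fst (r x))"
      using stab_move[OF z(3) rH(1,2)[OF z(2)]] rH(3)[OF z(2)] by simp
    also have "\<dots> = y" unfolding e using stab_move[OF w(3) rH(1,2)[OF w(2)]] rH(3)[OF w(2)] by simp
    finally have xy: "x = y" .
    then have "a = b" using e(2) rH(2)[OF w(2)] aH(1)[OF z(3)] aH(1)[OF w(3)] by simp
    then show "z = w" using xy by (simp add: z w)
  next
    fix z assume "z \<in> ?h ` (coset \<times> stab)"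
    then show "z \<in> H \<times> H" using rH aH by auto
  next
    fix z assume "z \<in> H \<times> H"
    then obtain s t where z: "z = (s, t)" and st: "s \<in> H" "t \<in> H" by auto
    let ?x = "t \<otimes> g \<otimes> s"
    have x: "?x \<in> coset" using st by (auto simp: coset_def)
    let ?a = "inv (snd (r ?x)) \<otimes> t"
    have eq: "snd (r ?x) \<otimes> g \<otimes> fst (r ?x) = t \<otimes> g \<otimes> s" using rH(3)[OF x] by simp
    note d = coset_eqD[OF rH(1,2)[OF x] st eq]
    have "snd (r ?x) \<otimes> ?a = t" using rH(2)[OF x] st by (simp add: cancel_inv_mult)
    then have "?h (?x, ?a) = z" using d(2) by (simp add: z)
    then show "z \<in> ?h ` (coset \<times> stab)" using x d(1) by (intro image_eqI[of z ?h "(?x, ?a)"]) auto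
  qed
  then have "card (coset \<times> stab) = card (H \<times> H)" by (rule bij_betw_same_card)
  then show ?thesis by (simp add: card_cartesian_product)
qed

lemma stab_subgroup: "subgroup stab G"
proof (rule subgroupI)
  show "stab \<subseteq> carrier G" by (auto simp: stab_def)
  have "\<one> \<in> stab" using subgroup.one_closed[OF subH] gG by (simp add: stab_def)
  then show "stab \<noteq> {}" by blast
  fix a assume a: "a \<in> stab"
  have ac: "a \<in> carrier G" using a by (auto simp: stab_def)
  have "inv (inv g \<otimes> a \<otimes> g) = inv g \<otimes> inv a \<otimes> g" using ac gG by (simp add: inv_mult_group m_assoc)
  then show "inv a \<in> stab" using a H_inv[of "inv g \<otimes> a \<otimes> g"] by (simp add: stab_def)
  fix b assume b: "b \<in> stab"
  have bc: "b \<in> carrier G" using b by (auto simp: stab_def)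
  have "inv g \<otimes> (a \<otimes> b) \<otimes> g = (inv g \<otimes> a \<otimes> g) \<otimes> (inv g \<otimes> b \<otimes> g)"
    using ac bc gG by (simp add: m_assoc cancel_inv_mult)
  then show "a \<otimes> b \<in> stab" using a b by (simp add: stab_def)
qed

end

text \<open>J has its coefficients in k[H], while A is formed with products in k[G]; on elements
  supported on the smaller basis the two multiplications agree.\<close>

lemma amul_restrict:
  assumes fin: "finite (bas B)" and sub: "bas A \<subseteq> bas B" and mc: "mcoeff A = mcoeff B"
    and el: "u \<in> elts A" "v \<in> elts A"
  shows "amul B u v = amul A u v"
proof
  fix x
  have "amul B u v x = (\<Sum>b\<in>bas A. \<Sum>c\<in>bas B. u b * v c * mcoeff B b c x)"
    unfolding amul_def using el by (intro sum.mono_neutral_right fin sub) (auto simp: elts_def)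
  also have "\<dots> = (\<Sum>b\<in>bas A. \<Sum>c\<in>bas A. u b * v c * mcoeff B b c x)"
    using el by (intro sum.cong refl sum.mono_neutral_right fin sub) (auto simp: elts_def)
  finally show "amul B u v x = amul A u v x" by (simp add: amul_def mc)
qed

lemma sq_alg_simps: "bas (sq_alg A) = bas A \<times> bas A"
  "unity (sq_alg A) = (\<lambda>(x, y). unity A x * unity A y)"
  by (simp_all add: tens_alg_def)

section \<open>Structure constants of the dual algebras\<close>

context group
begin

lemma coalg1_dual_mcoeff:
  fixes J :: "'a \<times> 'a \<Rightarrow> 'k::field"
  assumes fin: "finite (carrier G)" and bc: "b \<in> carrier G" "c \<in> carrier G"
  shows "mcoeff (dual_alg (coalg1 (grp_alg G) J)) b c x =
    (if x \<in> carrier G then J (inv x \<otimes> b, inv x \<otimes> c) else 0)"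
proof (cases "x \<in> carrier G")
  case True
  have "amul (sq_alg (grp_alg G)) (kd (x, x)) J (b, c) =
      (\<Sum>p\<in>carrier G. kd x p * (\<Sum>q\<in>carrier G. kd x q * J (inv p \<otimes> b, inv q \<otimes> c)))"
    unfolding amul_sq_grp_alg_eval(1)[OF fin bc] by (simp add: kd_pair sum_distrib_left mult.assoc)
  then show ?thesis using True by (simp add: dual_alg_def coalg1_def grp_alg_simps sum_kd_mult[OF fin])
qed (simp add: dual_alg_def coalg1_def grp_alg_simps)

lemma coalg2_dual_mcoeff:
  fixes J :: "'a \<times> 'a \<Rightarrow> 'k::field"
  assumes fin: "finite (carrier G)" and bc: "b \<in> carrier G" "c \<in> carrier G"
  shows "mcoeff (dual_alg (coalg2 (grp_alg G) J)) b c x =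
    (if x \<in> carrier G then ainv (sq_alg (grp_alg G)) J (b \<otimes> inv x, c \<otimes> inv x) else 0)"
proof (cases "x \<in> carrier G")
  case True
  have "amul (sq_alg (grp_alg G)) (ainv (sq_alg (grp_alg G)) J) (kd (x, x)) (b, c) =
      (\<Sum>p\<in>carrier G. kd x p * (\<Sum>q\<in>carrier G. kd x q * ainv (sq_alg (grp_alg G)) J (b \<otimes> inv p, c \<otimes> inv q)))"
    unfolding amul_sq_grp_alg_eval(2)[OF fin bc] by (simp add: kd_pair sum_distrib_left mult_ac)
  then show ?thesis using True by (simp add: dual_alg_def coalg2_def grp_alg_simps sum_kd_mult[OF fin])
qed (simp add: dual_alg_def coalg2_def grp_alg_simps)

text \<open>The inverse of J formed over H remains an inverse over G, so a single J' serves the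
  coalgebras on k[H] and the twisted coproduct on k[G].\<close>

lemma is_ainv_subgroup:
  fixes J J' :: "'a \<times> 'a \<Rightarrow> 'k::field"
  assumes fin: "finite (carrier G)" and H: "subgroup H G"
    and ainv: "is_ainv (sq_alg (grp_alg (G\<lparr>carrier := H\<rparr>))) J J'"
  shows "is_ainv (sq_alg (grp_alg G)) J J'"
proof -
  let ?A = "sq_alg (grp_alg (G\<lparr>carrier := H\<rparr>)) :: ('a \<times> 'a, 'k) algd"
  let ?B = "sq_alg (grp_alg G) :: ('a \<times> 'a, 'k) algd"
  have HG: "H \<subseteq> carrier G" using subgroup.subset[OF H] .
  have sub: "bas ?A \<subseteq> bas ?B" using HG by (auto simp: sq_alg_simps grp_alg_simps)
  have finB: "finite (bas ?B)" using fin by (simp add: sq_alg_simps grp_alg_simps)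
  have mc: "mcoeff ?A = mcoeff ?B" by (simp add: tens_alg_def grp_alg_def)
  have un: "unity ?A = unity ?B" by (simp add: sq_alg_simps grp_alg_simps)
  have el: "J \<in> elts ?A" "J' \<in> elts ?A" using ainv by (simp_all add: is_ainv_def)
  have el': "J \<in> elts ?B" "J' \<in> elts ?B" using el sub unfolding elts_def by blast+
  show ?thesis
    using ainv el' unfolding is_ainv_def
    by (simp add: amul_restrict[OF finB sub mc el] amul_restrict[OF finB sub mc el(2,1)] un)
qed

text \<open>This is the coefficient at (b, c) of J^{-1} \<Delta>(x) J, with the sums cut down to H,
  where J and its inverse are supported.\<close>

lemma twisted_ccoeff:
  fixes J J' :: "'a \<times> 'a \<Rightarrow> 'k::field"
  assumes fin: "finite (carrier G)" and H: "subgroup H G"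
    and ainv: "is_ainv (sq_alg (grp_alg (G\<lparr>carrier := H\<rparr>))) J J'"
    and x: "x \<in> carrier G" and bc: "b \<in> carrier G" "c \<in> carrier G"
  shows "ccoeff (twisted (grp_alg G) J) x (b, c) =
    (\<Sum>w\<in>H \<times> H. \<Sum>z\<in>H \<times> H. J' z * J w *
      (kd (fst z \<otimes> x \<otimes> fst w) b * kd (snd z \<otimes> x \<otimes> snd w) c))"
proof -
  have HG: "H \<subseteq> carrier G" using subgroup.subset[OF H] .
  have ainvG: "ainv (sq_alg (grp_alg G)) J = J'"
    by (rule ainv_sq_grp_alg[OF fin is_ainv_subgroup[OF fin H ainv]])
  have J0: "J w = 0" "J' w = 0" if "w \<notin> H \<times> H" for w
    using ainv that by (cases w; auto simp: is_ainv_def elts_def sq_alg_simps grp_alg_simps)+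
  have kd: "kd x (inv a \<otimes> b \<otimes> inv e) = (kd (a \<otimes> x \<otimes> e) b :: 'k)"
    if "a \<in> carrier G" "e \<in> carrier G" "b \<in> carrier G" for a b e
  proof -
    have "inv a \<otimes> b \<otimes> inv e = x \<longleftrightarrow> b = a \<otimes> x \<otimes> e"
    proof
      assume "inv a \<otimes> b \<otimes> inv e = x"
      then have "a \<otimes> x \<otimes> e = a \<otimes> (inv a \<otimes> b \<otimes> inv e) \<otimes> e" by simp
      also have "\<dots> = b" using that by (simp add: m_assoc cancel_inv_mult)
      finally show "b = a \<otimes> x \<otimes> e" ..
    next
      assume "b = a \<otimes> x \<otimes> e"
      then show "inv a \<otimes> b \<otimes> inv e = x" using that x by (simp add: m_assoc cancel_inv_mult)
    qed
    then show ?thesis by (simp add: kd_def)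
  qed
  let ?w = "amul (sq_alg (grp_alg G)) J' (kd (x, x))"
  have "ccoeff (twisted (grp_alg G) J) x (b, c) = amul (sq_alg (grp_alg G)) ?w J (b, c)"
    by (simp add: twisted_def ainvG grp_alg_simps)
  also have "\<dots> = (\<Sum>w\<in>carrier G \<times> carrier G. ?w (b \<otimes> inv (fst w), c \<otimes> inv (snd w)) * J w)"
    unfolding amul_sq_grp_alg_eval(2)[OF fin bc] by (simp add: sum.cartesian_product split_beta)
  also have "\<dots> = (\<Sum>w\<in>H \<times> H. ?w (b \<otimes> inv (fst w), c \<otimes> inv (snd w)) * J w)"
    using HG fin by (intro sum.mono_neutral_right) (auto simp: J0)
  also have "\<dots> = (\<Sum>w\<in>H \<times> H. \<Sum>z\<in>H \<times> H. J' z * J w *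
      (kd (fst z \<otimes> x \<otimes> fst w) b * kd (snd z \<otimes> x \<otimes> snd w) c))"
  proof (rule sum.cong[OF refl])
    fix w assume "w \<in> H \<times> H"
    then have w: "fst w \<in> carrier G" "snd w \<in> carrier G" using HG by auto
    have bw: "b \<otimes> inv (fst w) \<in> carrier G" "c \<otimes> inv (snd w) \<in> carrier G" using w bc by auto
    have "?w (b \<otimes> inv (fst w), c \<otimes> inv (snd w)) =
        (\<Sum>z\<in>carrier G \<times> carrier G. J' z * kd (x, x) (inv (fst z) \<otimes> (b \<otimes> inv (fst w)), inv (snd z) \<otimes> (c \<otimes> inv (snd w))))"
      unfolding amul_sq_grp_alg_eval(1)[OF fin bw] by (simp add: sum.cartesian_product split_beta)
    also have "\<dots> = (\<Sum>z\<in>H \<times> H. J' z * kd (x, x) (inv (fst z) \<otimes> (b \<otimes> inv (fst w)), inv (snd z) \<otimes> (c \<otimes> inv (snd w))))"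
      using HG fin by (intro sum.mono_neutral_right) (auto simp: J0)
    also have "\<dots> = (\<Sum>z\<in>H \<times> H. J' z * (kd (fst z \<otimes> x \<otimes> fst w) b * kd (snd z \<otimes> x \<otimes> snd w) c))"
    proof (rule sum.cong[OF refl])
      fix z assume "z \<in> H \<times> H"
      then have z: "fst z \<in> carrier G" "snd z \<in> carrier G" using HG by auto
      show "J' z * kd (x, x) (inv (fst z) \<otimes> (b \<otimes> inv (fst w)), inv (snd z) \<otimes> (c \<otimes> inv (snd w))) =
          J' z * (kd (fst z \<otimes> x \<otimes> fst w) b * kd (snd z \<otimes> x \<otimes> snd w) c)"
        using kd[OF z(1) w(1) bc(1)] kd[OF z(2) w(2) bc(2)] z w bc by (simp add: kd_pair m_assoc)
    qed
    finally show "?w (b \<otimes> inv (fst w), c \<otimes> inv (snd w)) * J w = (\<Sum>z\<in>H \<times> H. J' z * J w *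
        (kd (fst z \<otimes> x \<otimes> fst w) b * kd (snd z \<otimes> x \<otimes> snd w) c))"
      by (simp add: sum_distrib_left sum_distrib_right mult_ac)
  qed
  finally show ?thesis .
qed

text \<open>The product of f and h at x is f \<otimes> h evaluated on J^{-1} \<Delta>(x) J. Since z
  and w have components in H, all arguments of f and h stay in the double coset of x.\<close>

lemma factor_alg_product:
  fixes J J' :: "'a \<times> 'a \<Rightarrow> 'k::field"
  assumes fin: "finite (carrier G)" and H: "subgroup H G"
    and ainv: "is_ainv (sq_alg (grp_alg (G\<lparr>carrier := H\<rparr>))) J J'"
    and Z: "Z \<subseteq> carrier G"
    and fh: "\<And>x. x \<notin> Z \<Longrightarrow> f x = 0" "\<And>x. x \<notin> Z \<Longrightarrow> h x = 0"
  shows "amul (factor_alg (dual_alg (twisted (grp_alg G) J)) Z) f h x =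
    (if x \<in> carrier G then (\<Sum>w\<in>H \<times> H. \<Sum>z\<in>H \<times> H. J' z * J w *
      (f (fst z \<otimes> x \<otimes> fst w) * h (snd z \<otimes> x \<otimes> snd w))) else 0)"
proof (cases "x \<in> carrier G")
  case x: True
  have finZ: "finite Z" using finite_subset[OF Z fin] .
  have "amul (factor_alg (dual_alg (twisted (grp_alg G) J)) Z) f h x =
      (\<Sum>b\<in>Z. \<Sum>c\<in>Z. f b * h c * ccoeff (twisted (grp_alg G) J) x (b, c))"
    using x by (simp add: amul_def factor_alg_def dual_alg_def twisted_def grp_alg_simps)
  also have "\<dots> = (\<Sum>b\<in>Z. \<Sum>c\<in>Z. \<Sum>w\<in>H \<times> H. \<Sum>z\<in>H \<times> H. J' z * J w *
      ((kd (fst z \<otimes> x \<otimes> fst w) b * f b) * (kd (snd z \<otimes> x \<otimes> snd w) c * h c)))"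
    using Z by (intro sum.cong refl)
      (simp add: twisted_ccoeff[OF fin H ainv x] subset_iff sum_distrib_left mult_ac)
  also have "\<dots> = (\<Sum>w\<in>H \<times> H. \<Sum>b\<in>Z. \<Sum>c\<in>Z. \<Sum>z\<in>H \<times> H. J' z * J w *
      ((kd (fst z \<otimes> x \<otimes> fst w) b * f b) * (kd (snd z \<otimes> x \<otimes> snd w) c * h c)))"
    by (rule sum_sum_swap3[symmetric])
  also have "\<dots> = (\<Sum>w\<in>H \<times> H. \<Sum>z\<in>H \<times> H. \<Sum>b\<in>Z. \<Sum>c\<in>Z. J' z * J w *
      ((kd (fst z \<otimes> x \<otimes> fst w) b * f b) * (kd (snd z \<otimes> x \<otimes> snd w) c * h c)))"
    by (rule sum.cong[OF refl], rule sum_sum_swap3[symmetric])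
  also have "\<dots> = (\<Sum>w\<in>H \<times> H. \<Sum>z\<in>H \<times> H. J' z * J w *
      ((\<Sum>b\<in>Z. kd (fst z \<otimes> x \<otimes> fst w) b * f b) * (\<Sum>c\<in>Z. kd (snd z \<otimes> x \<otimes> snd w) c * h c)))"
    unfolding sum_product by (simp add: sum_distrib_left)
  also have "\<dots> = (\<Sum>w\<in>H \<times> H. \<Sum>z\<in>H \<times> H. J' z * J w *
      (f (fst z \<otimes> x \<otimes> fst w) * h (snd z \<otimes> x \<otimes> snd w)))"
  proof -
    have "(\<Sum>b\<in>Z. kd y b * f b) = f y" "(\<Sum>b\<in>Z. kd y b * h b) = h y" for y
      using fh by (simp_all add: sum_kd_mult[OF finZ])
    then show ?thesis by simp
  qed
  finally show ?thesis using x by simp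
qed (simp add: amul_def factor_alg_def dual_alg_def twisted_def grp_alg_simps)

end

text \<open>The substitution s = x b, s' = x b', t = a y, t' = a' y turns the structure constants of
  the two dual algebras into J(b, b') and J'(a, a'), which is the formula of
  \<open>factor_alg_product\<close> at y g x. So f \<mapsto> f(t g s) is multiplicative.\<close>

lemma (in double_coset_rep) tens_product:
  shows "tens (\<lambda>s t. f (t \<otimes> g \<otimes> s)) * tens (\<lambda>s t. h (t \<otimes> g \<otimes> s)) =
    tens (\<lambda>s t. \<Sum>w\<in>H \<times> H. \<Sum>z\<in>H \<times> H. J' z * J w *
      (f (fst z \<otimes> (t \<otimes> g \<otimes> s) \<otimes> fst w) * h (snd z \<otimes> (t \<otimes> g \<otimes> s) \<otimes> snd w)))"
  unfolding tens_mult
proof (rule tens_cong)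
  fix x y assume x: "x \<in> H" and y: "y \<in> H"
  have c: "x \<in> carrier G" "y \<in> carrier G" "inv x \<in> H" "inv y \<in> H" using x y by auto
  have "(\<Sum>(s, t)\<in>H \<times> H. \<Sum>(s', t')\<in>H \<times> H. f (t \<otimes> g \<otimes> s) * h (t' \<otimes> g \<otimes> s') *
        (J (inv x \<otimes> s, inv x \<otimes> s') * J' (t \<otimes> inv y, t' \<otimes> inv y))) =
      (\<Sum>((s, t), s', t')\<in>(H \<times> H) \<times> (H \<times> H). f (t \<otimes> g \<otimes> s) * h (t' \<otimes> g \<otimes> s') *
        (J (inv x \<otimes> s, inv x \<otimes> s') * J' (t \<otimes> inv y, t' \<otimes> inv y)))"
    by (simp add: sum.cartesian_product split_beta)
  also have "\<dots> = (\<Sum>((b, b'), a, a')\<in>(H \<times> H) \<times> (H \<times> H). J' (a, a') * J (b, b') *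
      (f (a \<otimes> (y \<otimes> g \<otimes> x) \<otimes> b) * h (a' \<otimes> (y \<otimes> g \<otimes> x) \<otimes> b')))"
    by (rule sum.reindex_bij_witness[where j = "\<lambda>((s, t), s', t'). ((inv x \<otimes> s, inv x \<otimes> s'), t \<otimes> inv y, t' \<otimes> inv y)"
          and i = "\<lambda>((b, b'), a, a'). ((x \<otimes> b, a \<otimes> y), x \<otimes> b', a' \<otimes> y)"])
      (use c x y gG in \<open>auto simp: m_assoc cancel_inv_mult mult_ac\<close>)
  also have "\<dots> = (\<Sum>w\<in>H \<times> H. \<Sum>z\<in>H \<times> H. J' z * J w *
      (f (fst z \<otimes> (y \<otimes> g \<otimes> x) \<otimes> fst w) * h (snd z \<otimes> (y \<otimes> g \<otimes> x) \<otimes> snd w)))"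
    by (simp add: sum.cartesian_product split_beta)
  finally show "(\<Sum>(s, t)\<in>H \<times> H. \<Sum>(s', t')\<in>H \<times> H. f (t \<otimes> g \<otimes> s) * h (t' \<otimes> g \<otimes> s') *
        (J (inv x \<otimes> s, inv x \<otimes> s') * J' (t \<otimes> inv y, t' \<otimes> inv y))) =
    (\<Sum>w\<in>H \<times> H. \<Sum>z\<in>H \<times> H. J' z * J w *
      (f (fst z \<otimes> (y \<otimes> g \<otimes> x) \<otimes> fst w) * h (snd z \<otimes> (y \<otimes> g \<otimes> x) \<otimes> snd w)))" .
qed

text \<open>The conjugation formula multiplied by T0 on the right; as a commutation relation it can
  be used without inverses.\<close>

lemma induced_projD:
  fixes V :: "('b \<Rightarrow> 'k, 'k::field) mrep"
  assumes T: "T0 \<in> induced_proj D \<rho> V h" and f: "f \<in> elts D" and V: "alg_rep D V"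
  shows "T0 \<in> carrier_mat (fst V) (fst V)" "T0 * snd V f = snd V (\<rho> h f) * T0"
proof -
  let ?G = "GLn (fst V) :: 'k mat monoid"
  interpret GL: group ?G by (rule GLn_group)
  have TG: "T0 \<in> carrier ?G" and conj: "T0 * snd V f * inv\<^bsub>?G\<^esub> T0 = snd V (\<rho> h f)"
    using T f by (auto simp: induced_proj_def)
  have c: "T0 \<in> carrier_mat (fst V) (fst V)" "inv\<^bsub>?G\<^esub> T0 \<in> carrier_mat (fst V) (fst V)"
    "snd V f \<in> carrier_mat (fst V) (fst V)"
    using TG GL.inv_closed[OF TG] alg_rep_carrier[OF V f] by (auto intro: GLn_carrier_mat)
  have i: "inv\<^bsub>?G\<^esub> T0 * T0 = 1\<^sub>m (fst V)" using GL.l_inv[OF TG] by (simp add: GLn_simps(2,3))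
  show "T0 \<in> carrier_mat (fst V) (fst V)" by (rule c)
  have "snd V (\<rho> h f) * T0 = T0 * snd V f * (inv\<^bsub>?G\<^esub> T0 * T0)"
    unfolding conj[symmetric] using c by (auto simp: mat_assoc)
  then show "T0 * snd V f = snd V (\<rho> h f) * T0" using c by (simp add: i)
qed

lemma rho_kd:
  assumes fin: "finite (carrier M)" and s: "s \<in> carrier M"
  shows "rho1 M h (kd s) = kd (h \<otimes>\<^bsub>M\<^esub> s)" "rho2 M h (kd s) = kd (s \<otimes>\<^bsub>M\<^esub> inv\<^bsub>M\<^esub> h)"
  using s by (auto simp: rho1_def rho2_def sum_kd_mult[OF fin])

section \<open>The algebra of the double coset as the commutant of W\<close>

theorem theorem5p2p2:
  fixes G :: "('g, 'm) monoid_scheme" (structure)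
    and J R :: "'g \<times> 'g \<Rightarrow> 'k::alg_closed_field"
    and A kH :: "('g, 'k) bialgd"
    and V1 V2 :: "('g \<Rightarrow> 'k, 'k) mrep"
    and W1 W2 :: "'g \<Rightarrow> 'k mat set"
    and E :: "('e, 'l) monoid_scheme"
    and p :: "'e \<Rightarrow> 'g"
    and \<pi>W :: "'e \<Rightarrow> 'k mat"
    and \<chi> :: "'e \<Rightarrow> 'k"
  assumes G: "group G" "finite (carrier G)" "\<not> CHAR('k) dvd card (carrier G)"
    and H: "subgroup H G"
    and kH: "kH = grp_alg (G\<lparr>carrier := H\<rparr>)"
    and J: "minimal_twist kH J"
    and A: "A = twisted (grp_alg G) J"
    and R: "R = twist_R (grp_alg G) J"
    and AR: "hopf_algebra A" "triangular A R" "semisimple_alg A" "cosemisimple A"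
      "drinfeld_element A R = unity A"
    and Z: "\<exists>x\<in>carrier G. Z = H <#> (x <# H)"
    and g: "g \<in> Z"
    and Kg: "Kg = H \<inter> (g <# H #> inv g)"
    and V1: "V1 \<in> alg_irreps (dual_alg (coalg1 kH J))"
    and V2: "V2 \<in> alg_irreps (dual_alg (coalg2 kH J))"
    and W1: "W1 = (\<lambda>a. induced_proj (dual_alg (coalg1 kH J)) (rho1 (G\<lparr>carrier := H\<rparr>)) V1
                         (inv g \<otimes> a \<otimes> g))"
    and W2: "W2 = (\<lambda>a. induced_proj (dual_alg (coalg2 kH J)) (rho2 (G\<lparr>carrier := H\<rparr>)) V2 a)"
    and lin: "linearization (G\<lparr>carrier := Kg\<rparr>) (fst V1 * fst V2) (proj_tensor W1 W2) E p \<pi>W"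
    and \<zeta>: "\<zeta> = kernel E (G\<lparr>carrier := Kg\<rparr>) p"
    and \<chi>: "\<forall>z\<in>\<zeta>. \<pi>W z = \<chi> z \<cdot>\<^sub>m 1\<^sub>m (fst V1 * fst V2)"
  shows "\<exists>\<Phi>. bij_betw \<Phi>
                (iso_classes (elts (factor_alg (dual_alg A) Z))
                             (alg_irreps (factor_alg (dual_alg A) Z)))
                (iso_classes (carrier E) (grp_irreps E \<zeta> \<chi>)) \<and>
              (\<forall>C\<in>iso_classes (elts (factor_alg (dual_alg A) Z))
                              (alg_irreps (factor_alg (dual_alg A) Z)).
                 \<forall>Y\<in>C. \<forall>X'\<in>\<Phi> C.
                   real (fst Y) = real (card H) / real (card Kg) * real (fst X'))"
proof -
  interpret G: group G by (rule G(1))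
  define M where "M = G\<lparr>carrier := H\<rparr>"
  have HG: "H \<subseteq> carrier G" using subgroup.subset[OF H] .
  have M_simps [simp]: "carrier M = H" "x \<otimes>\<^bsub>M\<^esub> y = x \<otimes> y" "\<one>\<^bsub>M\<^esub> = \<one>" for x y
    by (simp_all add: M_def)
  interpret M: group M unfolding M_def by (rule G.subgroup_imp_group[OF H])
  have M_inv [simp]: "inv\<^bsub>M\<^esub> x = inv x" if "x \<in> H" for x
    unfolding M_def using that by (rule G.m_inv_consistent[OF H])
  have finH: "finite H" using finite_subset[OF HG G(2)] .
  have finM: "finite (carrier M)" using finH by simp
  have nz: "of_nat (card (carrier G)) \<noteq> (0::'k)" using G(3) by (simp add: of_nat_eq_0_iff_char_dvd)
  \<comment> \<open>The order of a subgroup divides |G|, so it is nonzero in the field too; this is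
    used for H and for K_g.\<close>
  have nz_sub: "of_nat (card S) \<noteq> (0::'k)" if "subgroup S G" for S
  proof
    assume "of_nat (card S) = (0::'k)"
    moreover have "card (rcosets S) * card S = card (carrier G)"
      using G.lagrange[OF that] by (simp add: Coset.order_def)
    ultimately show False using nz by (metis mult_zero_right of_nat_mult)
  qed
  have nzM: "of_nat (card (carrier M)) \<noteq> (0::'k)" using nz_sub[OF H] by simp
  define J' where "J' = ainv (sq_alg (grp_alg M)) J"
  have J': "minimal_twist (grp_alg M) J" using J by (simp add: kH M_def)
  have ainv: "is_ainv (sq_alg (grp_alg M)) J J'"
    unfolding J'_def by (rule M.minimal_twist_inverse[OF finM J'])
  have twists: "group_twist M J J'" "group_twist (opposite M) J' J"
    unfolding J'_def by (rule M.minimal_twist_group_twist[OF finM nzM J'])+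
  interpret T1: group_twist M J J' by (rule twists)
  interpret T2: group_twist "opposite M" J' J by (rule twists)
  define D1 where "D1 = dual_alg (coalg1 (grp_alg M) J)"
  define D2 where "D2 = dual_alg (coalg2 (grp_alg M) J)"
  have bas12 [simp]: "bas D1 = H" "bas D2 = H"
    by (simp_all add: D1_def D2_def dual_alg_def coalg1_def coalg2_def grp_alg_simps)
  have one12: "unity D1 = (\<lambda>x. if x \<in> carrier M then 1 else 0)"
    "unity D2 = (\<lambda>x. if x \<in> carrier (opposite M) then 1 else 0)"
    by (auto simp: D1_def D2_def dual_alg_def coalg1_def coalg2_def grp_alg_def)
  have mc1: "mcoeff D1 b c x = (if x \<in> carrier M then T1.tmult b c x else 0)"
    if "b \<in> carrier M" "c \<in> carrier M" for b c x
    using M.coalg1_dual_mcoeff[OF finM that, of J x] by (simp add: D1_def T1.tmult_def)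
  have mc2: "mcoeff D2 b c x = (if x \<in> carrier (opposite M) then T2.tmult b c x else 0)"
    if "b \<in> carrier (opposite M)" "c \<in> carrier (opposite M)" for b c x
    using M.coalg2_dual_mcoeff[OF finM, of b c J x] that
    by (auto simp: D2_def T2.tmult_def M.inv_opposite simp flip: J'_def)
  have V1': "V1 \<in> alg_irreps D1" and V2': "V2 \<in> alg_irreps D2"
    using V1 V2 by (simp_all add: D1_def D2_def kH M_def)
  have rep1: "alg_rep D1 V1" and rep2: "alg_rep D2 V2" using V1' V2' by (auto simp: alg_irreps_def)
  have b1: "bas D1 = carrier M" and b2: "bas D2 = carrier (opposite M)" by simp_all
  note irr1 = T1.twisted.alg_irrep_dual_basis[OF b1 mc1 one12(1) V1']
  note irr2 = T2.twisted.alg_irrep_dual_basis[OF b2 mc2 one12(2) V2']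
  define n1 n2 where "n1 = fst V1" and "n2 = fst V2"
  define P Q where "P b = snd V1 (kd b)" and "Q b = snd V2 (kd b)" for b
  obtain P' where P': "\<And>s s'. s \<in> H \<Longrightarrow> s' \<in> H \<Longrightarrow>
      (\<Sum>(i, j)\<in>{..<n1} \<times> {..<n1}. P s $$ (i, j) * P' s' i j) = (if s = s' then 1 else 0)"
    "\<And>i j i' j'. i < n1 \<Longrightarrow> j < n1 \<Longrightarrow> i' < n1 \<Longrightarrow> j' < n1 \<Longrightarrow>
      (\<Sum>s\<in>H. P s $$ (i, j) * P' s i' j') = (if i = i' \<and> j = j' then 1 else 0)"
    using irr1(6) unfolding P_def n1_def M_simps by blast
  obtain Q' where Q': "\<And>s s'. s \<in> H \<Longrightarrow> s' \<in> H \<Longrightarrow>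
      (\<Sum>(i, j)\<in>{..<n2} \<times> {..<n2}. Q s $$ (i, j) * Q' s' i j) = (if s = s' then 1 else 0)"
    "\<And>i j i' j'. i < n2 \<Longrightarrow> j < n2 \<Longrightarrow> i' < n2 \<Longrightarrow> j' < n2 \<Longrightarrow>
      (\<Sum>s\<in>H. Q s $$ (i, j) * Q' s i' j') = (if i = i' \<and> j = j' then 1 else 0)"
    using irr2(6) unfolding Q_def n2_def opposite_simps M_simps by blast
  obtain x0 where x0: "x0 \<in> carrier G" "Z = H <#> (x0 <# H)" using Z by blast
  have Z_x0: "Z = {t \<otimes> x0 \<otimes> s | t s. t \<in> H \<and> s \<in> H}"
  proof -
    have Z1: "Z = {t \<otimes> (x0 \<otimes> s) | t s. t \<in> H \<and> s \<in> H}"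
      unfolding x0(2) by (auto simp: set_mult_def l_coset_def)
    have assoc: "t \<otimes> (x0 \<otimes> s) = t \<otimes> x0 \<otimes> s" if "t \<in> H" "s \<in> H" for t s
      using that HG x0(1) by (simp add: G.m_assoc subset_iff)
    show ?thesis
      unfolding Z1 by (rule Collect_cong, rule iff_exI, rule iff_exI) (auto simp: assoc)
  qed
  obtain t0 s0 where ts0: "t0 \<in> H" "s0 \<in> H" "g = t0 \<otimes> x0 \<otimes> s0" using g Z_x0 by blast
  have gG: "g \<in> carrier G" using ts0 x0 HG by auto
  interpret DC: double_coset_rep G H g J J' n1 n2 P Q P' Q'
  proof (intro double_coset_rep.intro double_coset_rep_axioms.intro)
    show "group G" by (rule G(1))
    show "finite (carrier G)" "subgroup H G" "g \<in> carrier G" by fact+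
    show "P s \<in> carrier_mat n1 n1" if "s \<in> H" for s
      using irr1(3) that by (simp add: P_def n1_def)
    show "Q s \<in> carrier_mat n2 n2" if "s \<in> H" for s
      using irr2(3) that by (simp add: Q_def n2_def)
    show "(P s * P s') $$ (i, j) = (\<Sum>x\<in>H. J (inv x \<otimes> s, inv x \<otimes> s') * P x $$ (i, j))"
      if "s \<in> H" "s' \<in> H" "i < n1" "j < n1" for s s' i j
      using irr1(4)[of s s' i j] that by (simp add: P_def n1_def T1.tmult_def)
    show "(Q t * Q t') $$ (i, j) = (\<Sum>y\<in>H. J' (t \<otimes> inv y, t' \<otimes> inv y) * Q y $$ (i, j))"
      if "t \<in> H" "t' \<in> H" "i < n2" "j < n2" for t t' i j
      using irr2(4)[of t t' i j] that by (simp add: Q_def n2_def T2.tmult_def M.inv_opposite)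
    show "(\<Sum>s\<in>H. P s $$ (i, j)) = (if i = j then 1 else 0)" if "i < n1" "j < n1" for i j
      using irr1(5)[of i j] that by (simp add: P_def n1_def)
    show "(\<Sum>s\<in>H. Q s $$ (i, j)) = (if i = j then 1 else 0)" if "i < n2" "j < n2" for i j
      using irr2(5)[of i j] that by (simp add: Q_def n2_def)
  qed (use P' Q' in auto)
  \<comment> \<open>The base point of the double coset is moved from the given x0 to g.\<close>
  have Z_coset: "Z = DC.coset"
  proof -
    have "t \<otimes> x0 \<otimes> s \<in> DC.coset" if ts: "t \<in> H" "s \<in> H" for t s
    proof -
      have "t \<otimes> x0 \<otimes> s = (t \<otimes> inv t0) \<otimes> g \<otimes> (inv s0 \<otimes> s)"
        using ts ts0 x0(1) by (simp add: G.m_assoc G.cancel_inv_mult)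
      moreover have "t \<otimes> inv t0 \<in> H" "inv s0 \<otimes> s \<in> H" using ts ts0 by auto
      ultimately show ?thesis unfolding DC.coset_def by blast
    qed
    moreover have "t \<otimes> g \<otimes> s \<in> Z" if ts: "t \<in> H" "s \<in> H" for t s
    proof -
      have "t \<otimes> g \<otimes> s = (t \<otimes> t0) \<otimes> x0 \<otimes> (s0 \<otimes> s)" using ts ts0 x0(1) by (simp add: G.m_assoc)
      moreover have "t \<otimes> t0 \<in> H" "s0 \<otimes> s \<in> H" using ts ts0 by auto
      ultimately show ?thesis unfolding Z_x0 by blast
    qed
    ultimately show ?thesis unfolding Z_x0 DC.coset_def by blast
  qed
  have Kg_stab: "Kg = DC.stab"
  proof -
    have "a \<in> g <# H #> inv g \<longleftrightarrow> inv g \<otimes> a \<otimes> g \<in> H" if a: "a \<in> H" for a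
    proof
      assume "a \<in> g <# H #> inv g"
      then obtain h where "h \<in> H" "a = g \<otimes> h \<otimes> inv g" by (auto simp: l_coset_def r_coset_def)
      then show "inv g \<otimes> a \<otimes> g \<in> H" using gG by (simp add: G.m_assoc G.cancel_inv_mult)
    next
      assume h: "inv g \<otimes> a \<otimes> g \<in> H"
      have "a = g \<otimes> (inv g \<otimes> a \<otimes> g) \<otimes> inv g" using gG a by (simp add: G.m_assoc G.cancel_inv_mult)
      then show "a \<in> g <# H #> inv g" using h by (auto simp: l_coset_def r_coset_def)
    qed
    then show ?thesis unfolding Kg DC.stab_def by blast
  qed
  have Kg_sub: "subgroup Kg G" unfolding Kg_stab by (rule DC.stab_subgroup)
  have KgH: "Kg \<subseteq> H" unfolding Kg by blast
  define K where "K = G\<lparr>carrier := Kg\<rparr>"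
  define n where "n = n1 * n2"
  have n: "fst V1 * fst V2 = n" by (simp add: n_def n1_def n2_def)
  have carK: "carrier K = Kg" by (simp add: K_def)
  have linK: "proj_rep K n (proj_tensor W1 W2)" "group E" "p \<in> epi E K" "\<pi>W \<in> hom E (GLn n)"
    "\<And>x. x \<in> carrier E \<Longrightarrow> scalars n #>\<^bsub>GLn n\<^esub> \<pi>W x = proj_tensor W1 W2 (p x)"
    using lin unfolding linearization_def n K_def by blast+
  interpret CE: central_extension E K p \<chi>
  proof (intro central_extension.intro central_extension_axioms.intro linK(2,3))
    show "group K" unfolding K_def by (rule G.subgroup_imp_group[OF Kg_sub])
    show "finite (carrier K)" using finite_subset[OF KgH finH] by (simp add: carK)
    show "of_nat (card (carrier K)) \<noteq> (0::'k)" using nz_sub[OF Kg_sub] by (simp add: carK)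
  qed
  have chi: "CE.chi_rep n \<pi>W"
  proof -
    have "\<forall>z\<in>kernel E K p. \<pi>W z = \<chi> z \<cdot>\<^sub>m 1\<^sub>m n" using \<chi> unfolding \<zeta> n K_def .
    then show ?thesis using linK(4) unfolding CE.chi_rep_def by blast
  qed
  define D where "D = factor_alg (dual_alg A) Z"
  have basD: "bas D = Z" by (simp add: D_def factor_alg_def)
  have ZG: "Z \<subseteq> carrier G" unfolding Z_coset DC.coset_def using gG by auto
  have finZ: "finite Z" using finite_subset[OF ZG G(2)] .
  have in_Z: "t \<otimes> g \<otimes> s \<in> Z" if "s \<in> H" "t \<in> H" for s t
    unfolding Z_coset DC.coset_def using that by blast
  have Z_move: "a \<otimes> x \<otimes> b \<in> Z \<longleftrightarrow> x \<in> Z" if ab: "a \<in> H" "b \<in> H" and x: "x \<in> carrier G" for a b x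
  proof -
    have *: "a \<otimes> x \<otimes> b \<in> Z" if ab: "a \<in> H" "b \<in> H" and x: "x \<in> Z" for a b x
    proof -
      obtain t s where ts: "t \<in> H" "s \<in> H" "x = t \<otimes> g \<otimes> s" using x unfolding Z_coset DC.coset_def by blast
      have "a \<otimes> x \<otimes> b = (a \<otimes> t) \<otimes> g \<otimes> (s \<otimes> b)" using ts ab gG by (simp add: G.m_assoc)
      then show ?thesis using in_Z[of "s \<otimes> b" "a \<otimes> t"] ts ab by simp
    qed
    have "x = inv a \<otimes> (a \<otimes> x \<otimes> b) \<otimes> inv b" using ab x by (simp add: G.m_assoc G.cancel_inv_mult)
    then show ?thesis using *[OF ab] *[of "inv a" "inv b" "a \<otimes> x \<otimes> b"] ab by auto
  qed
  have ainv': "is_ainv (sq_alg (grp_alg (G\<lparr>carrier := H\<rparr>))) J J'" using ainv by (simp add: M_def)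
  have eltsD: "f \<in> elts D \<longleftrightarrow> (\<forall>x. x \<notin> Z \<longrightarrow> f x = 0)" for f by (simp add: elts_def basD)
  have prod: "amul D f h x = (if x \<in> carrier G then (\<Sum>w\<in>H \<times> H. \<Sum>z\<in>H \<times> H. J' z * J w *
      (f (fst z \<otimes> x \<otimes> fst w) * h (snd z \<otimes> x \<otimes> snd w))) else 0)"
    if "f \<in> elts D" "h \<in> elts D" for f h x
    unfolding D_def A using that by (intro G.factor_alg_product[OF G(2) H ainv' ZG]) (auto simp: eltsD)
  define Pi where "Pi f = DC.tens (\<lambda>s t. f (t \<otimes> g \<otimes> s))" for f :: "'g \<Rightarrow> 'k"
  \<comment> \<open>\<open>\<pi>W x\<close> lies in its own coset of scalars, and that coset is the
    set of Kronecker products of lifts. So \<open>\<pi>W x\<close> is itself such a product, and the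
    relations with P and Q hold exactly and not only up to scalars.\<close>
  have \<pi>_kron: "\<exists>S0 T0. \<pi>W x = kron S0 T0 \<and> S0 \<in> carrier_mat n1 n1 \<and> T0 \<in> carrier_mat n2 n2 \<and>
      (\<forall>s\<in>H. S0 * P s = P ((inv g \<otimes> p x \<otimes> g) \<otimes> s) * S0) \<and> (\<forall>t\<in>H. T0 * Q t = Q (t \<otimes> inv (p x)) * T0)"
    if x: "x \<in> carrier E" for x
  proof -
    have px: "p x \<in> DC.stab" using CE.p_closed[OF x] by (simp add: carK Kg_stab)
    have pH: "p x \<in> H" "inv g \<otimes> p x \<otimes> g \<in> H" using px by (auto simp: DC.stab_def)
    have "\<pi>W x \<in> scalars n #>\<^bsub>GLn n\<^esub> \<pi>W x"
    proof -
      have "1\<^sub>m n \<in> (scalars n :: 'k mat set)" unfolding scalars_def by (intro CollectI exI[of _ 1]) auto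
      moreover have "\<pi>W x = 1\<^sub>m n * \<pi>W x" using CE.chi_rep_mat[OF chi x] by simp
      ultimately show ?thesis unfolding r_coset_def GLn_simps(2) by blast
    qed
    then have "\<pi>W x \<in> proj_tensor W1 W2 (p x)" using linK(5)[OF x] by simp
    then obtain S0 T0 where ST: "\<pi>W x = kron S0 T0" "S0 \<in> W1 (p x)" "T0 \<in> W2 (p x)"
      by (auto simp: proj_tensor_def)
    have S0: "S0 \<in> induced_proj D1 (rho1 M) V1 (inv g \<otimes> p x \<otimes> g)"
      and T0: "T0 \<in> induced_proj D2 (rho2 M) V2 (p x)"
      using ST(2,3) by (simp_all add: W1 W2 D1_def D2_def kH M_def)
    have kdS: "kd s \<in> elts D1" "kd s \<in> elts D2" if "s \<in> H" for s using that by (auto intro: kd_elts)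
    have S: "S0 \<in> carrier_mat n1 n1" "S0 * P s = P ((inv g \<otimes> p x \<otimes> g) \<otimes> s) * S0" if s: "s \<in> H" for s
    proof -
      have e: "rho1 M (inv g \<otimes> p x \<otimes> g) (kd s) = (kd ((inv g \<otimes> p x \<otimes> g) \<otimes> s) :: 'g \<Rightarrow> 'k)"
        using rho_kd(1)[OF finM, of s] s by simp
      from induced_projD[OF S0 kdS(1)[OF s] rep1] e
      show "S0 \<in> carrier_mat n1 n1" "S0 * P s = P ((inv g \<otimes> p x \<otimes> g) \<otimes> s) * S0"
        by (simp_all add: P_def n1_def)
    qed
    have T: "T0 \<in> carrier_mat n2 n2" "T0 * Q t = Q (t \<otimes> inv (p x)) * T0" if t: "t \<in> H" for t
    proof -
      have e: "rho2 M (p x) (kd t) = (kd (t \<otimes> inv (p x)) :: 'g \<Rightarrow> 'k)"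
        using rho_kd(2)[OF finM, of t "p x"] t pH by simp
      from induced_projD[OF T0 kdS(2)[OF t] rep2] e
      show "T0 \<in> carrier_mat n2 n2" "T0 * Q t = Q (t \<otimes> inv (p x)) * T0"
        by (simp_all add: Q_def n2_def)
    qed
    show ?thesis using ST(1) S T pH(1) by blast
  qed
  have conj: "\<pi>W x * DC.tens F = DC.tens (\<lambda>s t. F (inv (inv g \<otimes> p x \<otimes> g) \<otimes> s) (t \<otimes> p x)) * \<pi>W x"
    if x: "x \<in> carrier E" for x F
  proof -
    have "p x \<in> DC.stab" using CE.p_closed[OF x] by (simp add: carK Kg_stab)
    then have pH: "p x \<in> H" "inv g \<otimes> p x \<otimes> g \<in> H" by (auto simp: DC.stab_def)
    obtain S0 T0 where *: "\<pi>W x = kron S0 T0" "S0 \<in> carrier_mat n1 n1" "T0 \<in> carrier_mat n2 n2"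
      "\<And>s. s \<in> H \<Longrightarrow> S0 * P s = P ((inv g \<otimes> p x \<otimes> g) \<otimes> s) * S0"
      "\<And>t. t \<in> H \<Longrightarrow> T0 * Q t = Q (t \<otimes> inv (p x)) * T0"
      using \<pi>_kron[OF x] by blast
    show ?thesis unfolding *(1) by (rule DC.tens_conj[OF *(2-5) pH(2,1)])
  qed
  interpret C: commutant E K p \<chi> n \<pi>W D Pi
  proof unfold_locales
    show "CE.chi_rep n \<pi>W" by (rule chi)
    show "0 < n" using irr1(2) irr2(2) by (simp add: n_def n1_def n2_def)
    show "finite (bas D)" using finZ by (simp add: basD)
    fix f h :: "'g \<Rightarrow> 'k"
    show Pc: "Pi f \<in> carrier_mat n n" by (simp add: Pi_def n_def)
    assume f: "f \<in> elts D"
    show "Pi f $$ (i, j) = (\<Sum>z\<in>bas D. f z * Pi (kd z) $$ (i, j))" if ij: "i < n" "j < n" for i j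
    proof -
      note ti = DC.tens_index[OF ij[unfolded n_def]]
      let ?k = "\<lambda>w. P (fst w) $$ (i div n2, j div n2) * Q (snd w) $$ (i mod n2, j mod n2)"
      have "(\<Sum>z\<in>bas D. f z * Pi (kd z) $$ (i, j)) =
          (\<Sum>w\<in>H \<times> H. \<Sum>z\<in>Z. f z * kd z (snd w \<otimes> g \<otimes> fst w) * ?k w)"
        unfolding Pi_def ti basD by (subst sum.swap) (simp add: sum_distrib_left split_beta mult.assoc)
      also have "\<dots> = (\<Sum>w\<in>H \<times> H. f (snd w \<otimes> g \<otimes> fst w) * ?k w)"
        using in_Z by (intro sum.cong refl) (auto simp: sum_kd_mult[OF finZ] simp flip: sum_distrib_right)
      also have "\<dots> = Pi f $$ (i, j)" unfolding Pi_def ti by (simp add: split_beta)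
      finally show ?thesis ..
    qed
    \<comment> \<open>Conjugation by \<open>\<pi>W x\<close> moves (s, t) by the stabilizer element
      \<open>p x\<close>, which leaves t g s and hence f(t g s) unchanged.\<close>
    show "Pi f * \<pi>W x = \<pi>W x * Pi f" if x: "x \<in> carrier E" for x
    proof -
      have px: "p x \<in> DC.stab" using CE.p_closed[OF x] by (simp add: carK Kg_stab)
      have "DC.tens (\<lambda>s t. f ((t \<otimes> p x) \<otimes> g \<otimes> (inv (inv g \<otimes> p x \<otimes> g) \<otimes> s))) = Pi f"
        unfolding Pi_def by (rule DC.tens_cong) (simp only: DC.stab_move[OF px])
      then show ?thesis unfolding Pi_def conj[OF x] by (simp add: Pi_def)
    qed
    assume h: "h \<in> elts D"
    show fh: "amul D f h \<in> elts D"
      unfolding eltsD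
    proof (intro allI impI)
      fix x assume x: "x \<notin> Z"
      \<comment> \<open>Multiplication by elements of H keeps x outside Z, so every term of the
        product vanishes.\<close>
      have "f (fst z \<otimes> x \<otimes> fst w) = 0" if "w \<in> H \<times> H" "z \<in> H \<times> H" "x \<in> carrier G" for w z
        using f x Z_move[of "fst z" "fst w" x] that by (auto simp: eltsD)
      then show "amul D f h x = 0" unfolding prod[OF f h] by simp
    qed
    show "Pi (amul D f h) = Pi f * Pi h"
      unfolding Pi_def DC.tens_product
    proof (rule DC.tens_cong)
      fix s t assume "s \<in> H" "t \<in> H"
      then have "t \<otimes> g \<otimes> s \<in> carrier G" using gG by simp
      then show "amul D f h (t \<otimes> g \<otimes> s) = (\<Sum>w\<in>H \<times> H. \<Sum>z\<in>H \<times> H. J' z * J w *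
          (f (fst z \<otimes> (t \<otimes> g \<otimes> s) \<otimes> fst w) * h (snd z \<otimes> (t \<otimes> g \<otimes> s) \<otimes> snd w)))"
        unfolding prod[OF f h] by simp
    qed
    show "f = h" if "Pi f = Pi h"
    proof
      fix x show "f x = h x"
      proof (cases "x \<in> Z")
        case True
        then obtain t s where "t \<in> H" "s \<in> H" "x = t \<otimes> g \<otimes> s" unfolding Z_coset DC.coset_def by blast
        then show ?thesis using DC.tens_inj[OF that[unfolded Pi_def], of s t] by simp
      qed (use f h in \<open>auto simp: eltsD\<close>)
    qed
  next
    have un: "unity D x = (if x \<in> Z then 1 else 0)" for x
      using ZG by (auto simp: D_def factor_alg_def dual_alg_def A twisted_def grp_alg_def)
    show "unity D \<in> elts D" by (simp add: eltsD un)
    have "Pi (unity D) = DC.tens (\<lambda>s t. 1)"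
      unfolding Pi_def by (rule DC.tens_cong) (simp add: un in_Z)
    then show "Pi (unity D) = 1\<^sub>m n" by (simp add: DC.tens_one n_def)
    \<comment> \<open>V_1 and V_2 both have dimension squared equal to |H|, so n^2 = |H|^2, and
      \<open>card_coset\<close> counts the orbits of the stabilizer.\<close>
    show "card (bas D) * card (carrier K) = n * n"
    proof -
      have "n * n = (n1 * n1) * (n2 * n2)" by (simp add: n_def)
      also have "\<dots> = card H * card H" using irr1(1) irr2(1) by (simp add: n1_def n2_def)
      finally show ?thesis using DC.card_coset by (simp add: basD carK Kg_stab Z_coset)
    qed
  next
    fix M0 assume M0: "M0 \<in> carrier_mat n n" and comm: "\<And>x. x \<in> carrier E \<Longrightarrow> M0 * \<pi>W x = \<pi>W x * M0"
    obtain F where F: "DC.tens F = M0" using DC.tens_surj M0 unfolding n_def by blast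
    \<comment> \<open>Commuting with the invertible matrix \<open>\<pi>W x\<close> means that F and
      its translate have the same image under \<open>DC.tens\<close>, so they agree by
      \<open>tens_inj\<close>; an invariant F then descends to Z.\<close>
    have "F s t = F (inv (inv g \<otimes> a \<otimes> g) \<otimes> s) (t \<otimes> a)"
      if a: "a \<in> DC.stab" and st: "s \<in> H" "t \<in> H" for a s t
    proof -
      obtain x where x: "x \<in> carrier E" "p x = a"
        using CE.lift[of a] a by (auto simp: carK Kg_stab)
      let ?F = "\<lambda>s t. F (inv (inv g \<otimes> a \<otimes> g) \<otimes> s) (t \<otimes> a)"
      have c: "\<pi>W x \<in> carrier_mat n n" "\<pi>W (inv\<^bsub>E\<^esub> x) \<in> carrier_mat n n"
        "DC.tens F \<in> carrier_mat n n" "DC.tens ?F \<in> carrier_mat n n"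
        using CE.chi_rep_mat[OF chi] x DC.tens_mat by (auto simp: n_def)
      have "DC.tens F * \<pi>W x = DC.tens ?F * \<pi>W x"
        using comm[OF x(1)] conj[OF x(1), of F] by (simp add: F x(2))
      then have "DC.tens F * \<pi>W x * \<pi>W (inv\<^bsub>E\<^esub> x) = DC.tens ?F * \<pi>W x * \<pi>W (inv\<^bsub>E\<^esub> x)" by simp
      moreover have "T * \<pi>W x * \<pi>W (inv\<^bsub>E\<^esub> x) = T" if "T \<in> carrier_mat n n" for T
      proof -
        have "T * \<pi>W x * \<pi>W (inv\<^bsub>E\<^esub> x) = T * (\<pi>W x * \<pi>W (inv\<^bsub>E\<^esub> x))" using that c by (auto simp: mat_assoc)
        then show ?thesis using CE.chi_rep_inv(1)[OF chi x(1)] that by simp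
      qed
      ultimately have "DC.tens F = DC.tens ?F" using c by simp
      then show ?thesis using DC.tens_inj[of F ?F s t] st by simp
    qed
    then obtain f where f: "\<forall>x. x \<notin> DC.coset \<longrightarrow> f x = 0" "\<forall>s\<in>H. \<forall>t\<in>H. F s t = f (t \<otimes> g \<otimes> s)"
      using DC.descend[of F] by blast
    have "Pi f = M0" unfolding Pi_def F[symmetric] using f(2) by (intro DC.tens_cong) simp
    then show "\<exists>f\<in>elts D. Pi f = M0" using f(1) by (intro bexI[of _ f]) (simp_all add: eltsD Z_coset)
  qed
  \<comment> \<open>From n1^2 = n2^2 = |H| follows n = n1 n2 = |H|, so the ratio n/|K| in
    \<open>correspondence\<close> is |H|/|K_g|.\<close>
  have "n1 * n1 = n2 * n2" "n1 * n1 = card H"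
    using irr1(1) irr2(1) by (simp_all add: n1_def n2_def)
  moreover from this have "n1 = n2" by (metis power2_eq_square power2_eq_imp_eq zero_le)
  ultimately have "n = card H" by (simp add: n_def)
  then show ?thesis using C.correspondence unfolding D_def carK \<zeta> K_def[symmetric] by simp
qed

end
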